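(* Let $\{A_{\mathbf n}\}_n$ be a $d$-level $(r,s)$-block GLT sequence with symbol $\kappa:[0,1]^d\times[-\pi,\pi]^d\to\mathbb C^{r\times s}$. If $\kappa$ has full rank a.e., then $\{A_{\mathbf n}^\dagger\}_n\sim_{\rm GLT}\kappa^\dagger$, where $\dagger$ denotes the Moore–Penrose pseudoinverse (taken pointwise for $\kappa$).
   Context: Conventions. A $d$-index is a vector in $\mathbb Z^d$. For $\mathbf n\in\mathbb N^d$ ($\mathbb N=\{1,2,\dots\}$) put $N(\mathbf n)=\prod_{i=1}^d n_i$; $\mathbf n\to\infty$ means $\min_i n_i\to\infty$. Operations and inequalities between $d$-indices are componentwise, $\mathbf 1=(1,\dots,1)$, and $\mathbf i=\mathbf 1,\dots,\mathbf n$ means that $\mathbf i$ ranges over $\{\mathbf i\in\mathbb Z^d:\mathbf 1\le\mathbf i\le\mathbf n\}$ in lexicographic order. A $d$-level $(r,s)$-block matrix with level orders $\mathbf n$ is a matrix $X=[x_{\mathbf i\mathbf j}]_{\mathbf i,\mathbf j=\mathbf 1}^{\mathbf n}$ of size $N(\mathbf n)r\times N(\mathbf n)s$ whose entries $x_{\mathbf i\mathbf j}$ are $r\times s$ complex blocks. A $d$-level $(r,s)$-block matrix-sequence is a sequence $\{A_{\mathbf n}\}_n$ where $n$ varies in an infinite subset of $\mathbb N$, $\mathbf n=\mathbf n(n)\in\mathbb N^d$ satisfies $\mathbf n\to\infty$ as $n\to\infty$, and $A_{\mathbf n}$ is an $N(\mathbf n)r\times N(\mathbf n)s$ matrix (regarded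 as a $d$-level $(r,s)$-block matrix); "$s$-block" means "$(s,s)$-block". Matrix-valued functions are measurable, continuous a.e., convergent in measure, etc. if their components are (Lebesgue measure); $I_s$ is the $s\times s$ identity. Toeplitz and sampling matrices. For $f:[-\pi,\pi]^d\to\mathbb C^{r\times s}$ in $L^1$, with Fourier coefficients $f_{\mathbf k}=(2\pi)^{-d}\int_{[-\pi,\pi]^d}f(\boldsymbol\theta)e^{-\mathrm i\mathbf k\cdot\boldsymbol\theta}d\boldsymbol\theta$, let $T_{\mathbf n}(f)=[f_{\mathbf i-\mathbf j}]_{\mathbf i,\mathbf j=\mathbf 1}^{\mathbf n}$. For $a:[0,1]^d\to\mathbb C^{r\times s}$ let $D_{\mathbf n}(a)$ be the block diagonal matrix $\mathrm{diag}_{\mathbf i=\mathbf 1,\dots,\mathbf n}\,a(\mathbf i/\mathbf n)$. A.c.s. If $A_n$ and $B_{n,m}$ are $d_n\times e_n$ matrices, $\{B_{n,m}\}_n\xrightarrow{\rm a.c.s.}\{A_n\}_n$ (as $m\to\infty$) means: for every $m$ there is $n_m$ such that for $n\ge n_m$, $A_n=B_{n,m}+R_{n,m}+N_{n,m}$ with $\mathrm{rank}(R_{n,m})\le c(m)\min(d_n,e_n)$ and $\|N_{n,m}\|\le\omega(m)$ (spectral norm), where $n_m,c(m),\omega(m)$ depend only on $m$ and $c(m),\omega(m)\to0$ as $m\to\infty$. Square GLT sequences. For a $d$-level $s$-block matrix-sequence $\{A_{\mathbf n}\}_n$ and a measurable $\kappa:[0,1]^d\times[-\pi,\pi]^d\to\mathbb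 C^{s\times s}$, one writes $\{A_{\mathbf n}\}_n\sim_{\rm GLT}\kappa$ ("$\{A_{\mathbf n}\}_n$ is a $d$-level $s$-block GLT sequence with symbol $\kappa$") if (this characterization is equivalent to the original definition) for every $m$ there are finitely many functions $a_{i,m}\in C^\infty([0,1]^d)$ (complex-valued) and trigonometric monomials $f_{i,m}\in\{e^{\mathrm i\mathbf j\cdot\boldsymbol\theta}E_{\alpha\beta}^{(s)}:\mathbf j\in\mathbb Z^d,1\le\alpha,\beta\le s\}$, $i=1,\dots,N_m$, where $E^{(s)}_{\alpha\beta}$ is the $s\times s$ matrix with $1$ in position $(\alpha,\beta)$ and $0$ elsewhere, such that $\sum_{i=1}^{N_m}a_{i,m}(\mathbf x)f_{i,m}(\boldsymbol\theta)\to\kappa(\mathbf x,\boldsymbol\theta)$ a.e. as $m\to\infty$ and $\{\sum_{i=1}^{N_m}D_{\mathbf n}(a_{i,m}I_s)T_{\mathbf n}(f_{i,m})\}_n\xrightarrow{\rm a.c.s.}\{A_{\mathbf n}\}_n$. Extension operator. For $t\ge\max(r,s)$ and $x\in\mathbb C^{r\times s}$, $E_{r,s}^t(x)=\begin{bmatrix}x&O\\O&O\end{bmatrix}\in\mathbb C^{t\times t}$; for a $d$-level $(r,s)$-block matrix $X=[x_{\mathbf i\mathbf j}]$, $E_{r,s}^t(X)=[E_{r,s}^t(x_{\mathbf i\mathbf j})]_{\mathbf i,\mathbf j=\mathbf 1}^{\mathbf n}$ (a $d$-level $t$-block matrix). Rectangular GLT sequences. For a $d$-level $(r,s)$-block matrix-sequence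 $\{A_{\mathbf n}\}_n$ and a measurable $\kappa:[0,1]^d\times[-\pi,\pi]^d\to\mathbb C^{r\times s}$, one writes $\{A_{\mathbf n}\}_n\sim_{\rm GLT}\kappa$ ("$\{A_{\mathbf n}\}_n$ is a $d$-level $(r,s)$-block GLT sequence with symbol $\kappa$") if $\{E_{r,s}^t(A_{\mathbf n})\}_n\sim_{\rm GLT}E_{r,s}^t(\kappa)$ in the square sense for all $t\ge\max(r,s)$; equivalently, for some $t\ge\max(r,s)$. For $r=s$ this agrees with the square notion. *)

theory Defs
  imports
    "HOL-Analysis.Analysis"
    "Jordan_Normal_Form.Schur_Decomposition"
    "Jordan_Normal_Form.DL_Rank"
begin

no_notation Matrix.vec_index (infixl "$" 100)

section \<open>Multi-indices and multilevel block matrices\<close>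

text \<open>
  The dimension \<open>d\<close> is the cardinality of the index type \<open>'d\<close>, whose linear order says which
  component of a \<open>d\<close>-index comes first; \<open>d\<close>-indices have type \<open>int ^ 'd\<close>. The order \<open>\<le>\<close> on that
  type is componentwise, so \<open>{1..n}\<close> is the range of the multi-index \<open>i = 1, ..., n\<close>.
\<close>

type_synonym 'd dindex = "(int, 'd) Finite_Cartesian_Product.vec"
type_synonym 'd point = "(real, 'd) Finite_Cartesian_Product.vec"

definition level_size :: "('d::finite) dindex \<Rightarrow> nat" where
  "level_size n = nat (\<Prod>k\<in>UNIV. n $ k)"

definition lex_less :: "('d::{finite,linorder}) dindex \<Rightarrow> 'd dindex \<Rightarrow> bool" where
  "lex_less i j \<longleftrightarrow> (\<exists>k. i $ k < j $ k \<and> (\<forall>l<k. i $ l = j $ l))"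

definition lex_pos :: "('d::{finite,linorder}) dindex \<Rightarrow> 'd dindex \<Rightarrow> nat" where
  "lex_pos n i = card {j \<in> {1..n}. lex_less j i}"

definition lex_index :: "('d::{finite,linorder}) dindex \<Rightarrow> nat \<Rightarrow> 'd dindex" where
  "lex_index n = the_inv_into {1..n} (lex_pos n)"

text \<open>Matrix rows and columns, hence also the positions of the blocks, are counted from \<open>0\<close>.\<close>

definition block_mat ::
  "('d::{finite,linorder}) dindex \<Rightarrow> nat \<Rightarrow> nat \<Rightarrow> ('d dindex \<Rightarrow> 'd dindex \<Rightarrow> complex mat) \<Rightarrow> complex mat"
where
  "block_mat n r s x = Matrix.mat (level_size n * r) (level_size n * s)
     (\<lambda>(p, q). x (lex_index n (p div r)) (lex_index n (q div s)) $$ (p mod r, q mod s))"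

definition block_of ::
  "('d::{finite,linorder}) dindex \<Rightarrow> nat \<Rightarrow> nat \<Rightarrow> complex mat \<Rightarrow> 'd dindex \<Rightarrow> 'd dindex \<Rightarrow> complex mat"
where
  "block_of n r s X i j =
     Matrix.mat r s (\<lambda>(\<alpha>, \<beta>). X $$ (lex_pos n i * r + \<alpha>, lex_pos n j * s + \<beta>))"

text \<open>
  A matrix-sequence is indexed by an infinite set \<open>J\<close> of natural numbers, \<open>\<nu> n\<close> being the level
  orders of its \<open>n\<close>-th member; what happens outside \<open>J\<close> is irrelevant.
\<close>

definition block_mat_seq ::
  "nat set \<Rightarrow> (nat \<Rightarrow> ('d::finite) dindex) \<Rightarrow> nat \<Rightarrow> nat \<Rightarrow> (nat \<Rightarrow> complex mat) \<Rightarrow> bool"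
where
  "block_mat_seq J \<nu> r s A \<longleftrightarrow>
     infinite J \<and>
     (\<forall>n\<in>J. 1 \<le> \<nu> n) \<and>
     (\<forall>K. \<exists>n0. \<forall>n\<in>J. n0 \<le> n \<longrightarrow> (\<forall>k. K \<le> \<nu> n $ k)) \<and>
     (\<forall>n\<in>J. A n \<in> carrier_mat (level_size (\<nu> n) * r) (level_size (\<nu> n) * s))"

section \<open>Toeplitz and diagonal sampling matrices\<close>

definition torus :: "('d::finite) point set" where
  "torus = cbox (\<chi> k. - pi) (\<chi> k. pi)"

definition phase :: "('d::finite) dindex \<Rightarrow> 'd point \<Rightarrow> real" where
  "phase j \<theta> = (\<Sum>k\<in>UNIV. of_int (j $ k) * \<theta> $ k)"

definition fourier_coeff ::
  "nat \<Rightarrow> nat \<Rightarrow> (('d::finite) point \<Rightarrow> complex mat) \<Rightarrow> 'd dindex \<Rightarrow> complex mat"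
where
  "fourier_coeff r s f k = Matrix.mat r s (\<lambda>(\<alpha>, \<beta>).
     (LINT \<theta>|lebesgue_on torus. f \<theta> $$ (\<alpha>, \<beta>) * exp (- \<i> * complex_of_real (phase k \<theta>)))
       / complex_of_real ((2 * pi) ^ CARD('d)))"

definition toeplitz ::
  "nat \<Rightarrow> nat \<Rightarrow> ('d::{finite,linorder}) dindex \<Rightarrow> ('d point \<Rightarrow> complex mat) \<Rightarrow> complex mat"
where
  "toeplitz r s n f = block_mat n r s (\<lambda>i j. fourier_coeff r s f (i - j))"

definition diag_sampling ::
  "nat \<Rightarrow> nat \<Rightarrow> ('d::{finite,linorder}) dindex \<Rightarrow> ('d point \<Rightarrow> complex mat) \<Rightarrow> complex mat"
where
  "diag_sampling r s n a = block_mat n r s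
     (\<lambda>i j. if i = j then a (\<chi> k. of_int (i $ k) / of_int (n $ k)) else 0\<^sub>m r s)"

section \<open>Approximating classes of sequences\<close>

abbreviation mat_rank :: "complex mat \<Rightarrow> nat" where
  "mat_rank A \<equiv> vec_space.rank (dim_row A) A"

definition l2_norm_vec :: "complex Matrix.vec \<Rightarrow> real" where
  "l2_norm_vec v = L2_set (\<lambda>i. cmod (vec_index v i)) {..<dim_vec v}"

definition spectral_norm :: "complex mat \<Rightarrow> real" where
  "spectral_norm A =
     Sup {l2_norm_vec (A *\<^sub>v v) | v. v \<in> carrier_vec (dim_col A) \<and> l2_norm_vec v \<le> 1}"

definition acs_convergent ::
  "nat set \<Rightarrow> (nat \<Rightarrow> nat \<Rightarrow> complex mat) \<Rightarrow> (nat \<Rightarrow> complex mat) \<Rightarrow> bool"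
where
  "acs_convergent J B A \<longleftrightarrow>
     (\<exists>(n0 :: nat \<Rightarrow> nat) (c :: nat \<Rightarrow> real) (\<omega> :: nat \<Rightarrow> real).
        c \<longlonglongrightarrow> 0 \<and> \<omega> \<longlonglongrightarrow> 0 \<and>
        (\<forall>m. \<forall>n\<in>J. n0 m \<le> n \<longrightarrow>
          B m n \<in> carrier_mat (dim_row (A n)) (dim_col (A n)) \<and>
          (\<exists>R N. R \<in> carrier_mat (dim_row (A n)) (dim_col (A n)) \<and>
                 N \<in> carrier_mat (dim_row (A n)) (dim_col (A n)) \<and>
                 A n = B m n + R + N \<and>
                 real (mat_rank R) \<le> c m * real (min (dim_row (A n)) (dim_col (A n))) \<and>
                 spectral_norm N \<le> \<omega> m)))"

section \<open>GLT sequences\<close>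

text \<open>
  \<open>a \<in> C\<^sup>\<infinity>([0,1]\<^sup>d)\<close> is read as: \<open>a\<close> is the restriction of a \<open>C\<^sup>\<infinity>\<close> function on the
  whole space.
\<close>

primrec Ck :: "nat \<Rightarrow> (('d::finite) point \<Rightarrow> complex) \<Rightarrow> bool" where
  "Ck 0 f \<longleftrightarrow> continuous_on UNIV f"
| "Ck (Suc m) f \<longleftrightarrow>
     (\<forall>x. f differentiable (at x)) \<and> (\<forall>k. Ck m (\<lambda>x. frechet_derivative f (at x) (axis k 1)))"

definition smooth_on_unit_cube :: "(('d::finite) point \<Rightarrow> complex) \<Rightarrow> bool" where
  "smooth_on_unit_cube a \<longleftrightarrow> (\<exists>g. (\<forall>m. Ck m g) \<and> (\<forall>x\<in>cbox 0 1. a x = g x))"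

definition unit_mat_entry :: "nat \<Rightarrow> nat \<Rightarrow> nat \<Rightarrow> complex mat" where
  "unit_mat_entry s \<alpha> \<beta> = Matrix.mat s s (\<lambda>(p, q). if p = \<alpha> \<and> q = \<beta> then 1 else 0)"

definition trig_monomials :: "nat \<Rightarrow> (('d::finite) point \<Rightarrow> complex mat) set" where
  "trig_monomials s =
     {\<lambda>\<theta>. exp (\<i> * complex_of_real (phase j \<theta>)) \<cdot>\<^sub>m unit_mat_entry s \<alpha> \<beta> | j \<alpha> \<beta>. \<alpha> < s \<and> \<beta> < s}"

definition glt_domain :: "(('d::finite) point \<times> 'd point) set" where
  "glt_domain = cbox 0 1 \<times> torus"

definition measurable_symbol ::
  "nat \<Rightarrow> nat \<Rightarrow> (('d::finite) point \<times> 'd point \<Rightarrow> complex mat) \<Rightarrow> bool"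
where
  "measurable_symbol r s \<kappa> \<longleftrightarrow>
     (\<forall>z\<in>glt_domain. \<kappa> z \<in> carrier_mat r s) \<and>
     (\<forall>\<alpha><r. \<forall>\<beta><s. (\<lambda>z. \<kappa> z $$ (\<alpha>, \<beta>)) \<in> borel_measurable (lebesgue_on glt_domain))"

text \<open>Since matrices of unspecified size have no zero, a finite sum needs its size as a parameter.\<close>

definition mat_sum :: "nat \<Rightarrow> nat \<Rightarrow> (nat \<Rightarrow> complex mat) \<Rightarrow> nat \<Rightarrow> complex mat" where
  "mat_sum r s X N = Matrix.mat r s (\<lambda>(p, q). \<Sum>i<N. X i $$ (p, q))"

definition glt_square ::
  "nat set \<Rightarrow> (nat \<Rightarrow> ('d::{finite,linorder}) dindex) \<Rightarrow> nat \<Rightarrow> (nat \<Rightarrow> complex mat) \<Rightarrow>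
   ('d point \<times> 'd point \<Rightarrow> complex mat) \<Rightarrow> bool"
where
  "glt_square J \<nu> s A \<kappa> \<longleftrightarrow>
     block_mat_seq J \<nu> s s A \<and>
     measurable_symbol s s \<kappa> \<and>
     (\<exists>(N :: nat \<Rightarrow> nat) (a :: nat \<Rightarrow> nat \<Rightarrow> 'd point \<Rightarrow> complex)
         (f :: nat \<Rightarrow> nat \<Rightarrow> 'd point \<Rightarrow> complex mat).
        (\<forall>m. \<forall>i<N m. smooth_on_unit_cube (a i m) \<and> f i m \<in> trig_monomials s) \<and>
        (AE z in lebesgue_on glt_domain. \<forall>\<alpha><s. \<forall>\<beta><s.
           (\<lambda>m. mat_sum s s (\<lambda>i. a i m (fst z) \<cdot>\<^sub>m f i m (snd z)) (N m) $$ (\<alpha>, \<beta>))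
             \<longlonglongrightarrow> \<kappa> z $$ (\<alpha>, \<beta>)) \<and>
        acs_convergent J
          (\<lambda>m n. mat_sum (level_size (\<nu> n) * s) (level_size (\<nu> n) * s)
             (\<lambda>i. diag_sampling s s (\<nu> n) (\<lambda>x. a i m x \<cdot>\<^sub>m 1\<^sub>m s) * toeplitz s s (\<nu> n) (f i m)) (N m))
          A)"

definition ext_mat :: "nat \<Rightarrow> complex mat \<Rightarrow> complex mat" where
  "ext_mat t x = Matrix.mat t t
     (\<lambda>(p, q). if p < dim_row x \<and> q < dim_col x then x $$ (p, q) else 0)"

definition ext_block_mat ::
  "('d::{finite,linorder}) dindex \<Rightarrow> nat \<Rightarrow> nat \<Rightarrow> nat \<Rightarrow> complex mat \<Rightarrow> complex mat"
where
  "ext_block_mat n r s t X = block_mat n t t (\<lambda>i j. ext_mat t (block_of n r s X i j))"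

definition glt ::
  "nat set \<Rightarrow> (nat \<Rightarrow> ('d::{finite,linorder}) dindex) \<Rightarrow> nat \<Rightarrow> nat \<Rightarrow> (nat \<Rightarrow> complex mat) \<Rightarrow>
   ('d point \<times> 'd point \<Rightarrow> complex mat) \<Rightarrow> bool"
where
  "glt J \<nu> r s A \<kappa> \<longleftrightarrow>
     block_mat_seq J \<nu> r s A \<and>
     measurable_symbol r s \<kappa> \<and>
     (\<forall>t \<ge> max r s. glt_square J \<nu> t (\<lambda>n. ext_block_mat (\<nu> n) r s t (A n)) (\<lambda>z. ext_mat t (\<kappa> z)))"

section \<open>Moore--Penrose pseudoinverse\<close>

definition pinv :: "complex mat \<Rightarrow> complex mat" where
  "pinv A = (THE B. B \<in> carrier_mat (dim_col A) (dim_row A) \<and>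
     A * B * A = A \<and> B * A * B = B \<and>
     mat_adjoint (A * B) = A * B \<and> mat_adjoint (B * A) = B * A)"

end

theory Submission
  imports Defs
begin

text \<open>
  Call a family of matrices negligible if it is of small rank up to small norm. Modulo negligible
  families the sums of matrices \<open>D\<^sub>n(a I) T\<^sub>n(f)\<close> form a \<open>*\<close>-algebra, since products and
  adjoints of such sums are again of this form up to a small Frobenius norm. If the symbols of such sums tend to \<open>0\<close> in
  measure, a polynomial cutoff of the symbol and a Riemann sum for the Frobenius norm show that the
  sums are negligible. So GLT sequences form a \<open>*\<close>-algebra in which the symbol \<open>0\<close> means negligible.

  Smooth trigonometric polynomials are dense in the measurable symbols, so there are sums \<open>Q\<close>
  with symbol \<open>\<kappa>\<^sup>\<dagger>\<close>. If \<open>\<kappa>\<close> has full row rank, \<open>A Q - I\<close> and \<open>Q A - (Q A)\<^sup>*\<close> have symbol \<open>0\<close>.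
  Hence \<open>A\<^sup>\<dagger>\<close> is bounded up to small rank, \<open>Q\<close> almost equals \<open>A\<^sup>* Q\<^sup>* Q\<close>, which the projection
  \<open>A\<^sup>\<dagger> A\<close> fixes, and therefore \<open>Q \<approx> A\<^sup>\<dagger> A Q \<approx> A\<^sup>\<dagger>\<close>. The case of full column rank follows by
  passing to adjoints. No control of the small singular values of \<open>A\<close> is needed.
\<close>

section \<open>Finitely supported matrices\<close>

text \<open>A pseudoinverse can be arbitrarily large, so a bound for \<open>B\<close>, the
  pseudoinverse of \<open>A\<close>, has to come out of an identity and not out of \<open>A\<close>
  alone. The identity has the form \<open>X = Y + X * Z\<close> with \<open>Y\<close> bounded and
  \<open>Z\<close> negligible. Inserting it into itself confines the unknown \<open>X\<close> to
  low-rank terms, bounded terms built from \<open>Y\<close>, and a remainder that can be made small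
  for each single matrix, however large \<open>X\<close> is. This device serves twice. For
  \<open>X = B\<close> it needs \<open>A Q\<close> close to an identity, which is where full rank
  enters. For a matrix \<open>X\<close> whose symbol is small off a small set it stands in for a
  theorem on the distribution of singular values: only second moments have to be computed, which
  explains the Frobenius norm. Everything is phrased for families in \<open>m\<close>
  (approximation) and \<open>n\<close> (matrix order), with "eventually in \<open>m\<close>,
  eventually in \<open>n\<close>"; the given sequence and its pseudoinverse are families constant in
  \<open>m\<close> and so live in the same algebra as the approximants. Ranks are measured against
  the number \<open>level_size n\<close> of grid points, so the block size affects constants
  only.\<close>

text \<open>
  Matrices of all sizes live in one normed algebra, so that extending a block matrix by zeros does
  not change the corresponding element. The algebra has no unit; \<open>idm S\<close> below plays that role.
\<close>

typedef 'i fmat = "{f :: 'i \<Rightarrow> 'i \<Rightarrow> complex. finite {(i, j). f i j \<noteq> 0}}"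
  morphisms entry Abs_fmat
  by (rule exI[of _ "\<lambda>_ _. 0"]) simp

setup_lifting type_definition_fmat

lemma fmat_eqI: "(\<And>i j. entry X i j = entry Y i j) \<Longrightarrow> X = Y"
  by (metis entry_inject ext)

text \<open>Row and column indices are put into one finite set, so that products, inner products and
  norms can all be summed over a square \<open>S \<times> S\<close>.\<close>

definition fsupp :: "'i fmat \<Rightarrow> 'i set" where
  "fsupp X = {i. \<exists>j. entry X i j \<noteq> 0 \<or> entry X j i \<noteq> 0}"

lemma finite_fsupp [simp]: "finite (fsupp X)"
proof -
  let ?P = "{(i, j). entry X i j \<noteq> 0}"
  have "finite ?P" using entry[of X] by simp
  moreover have "fsupp X = fst ` ?P \<union> snd ` ?P"
    unfolding fsupp_def by force
  ultimately show ?thesis by simp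
qed

lemma entry_nonzero_fsupp:
  "i \<notin> fsupp X \<Longrightarrow> entry X i j = 0" "j \<notin> fsupp X \<Longrightarrow> entry X i j = 0"
  by (auto simp: fsupp_def)

text \<open>The test \<open>finite S\<close> keeps the function total: for infinite \<open>S\<close>
  the value is the zero matrix.\<close>

definition fmat_on :: "'i set \<Rightarrow> ('i \<Rightarrow> 'i \<Rightarrow> complex) \<Rightarrow> 'i fmat" where
  "fmat_on S f = Abs_fmat (\<lambda>i j. if i \<in> S \<and> j \<in> S \<and> finite S then f i j else 0)"

lemma entry_fmat_on:
  assumes "finite S"
  shows "entry (fmat_on S f) i j = (if i \<in> S \<and> j \<in> S then f i j else 0)"
proof -
  have "finite {(i, j). (if i \<in> S \<and> j \<in> S \<and> finite S then f i j else 0) \<noteq> 0}"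
    by (rule finite_subset[of _ "S \<times> S"]) (use assms in \<open>auto split: if_splits\<close>)
  then show ?thesis
    unfolding fmat_on_def using assms by (simp add: Abs_fmat_inverse)
qed

lemma fsupp_fmat_on: "finite S \<Longrightarrow> fsupp (fmat_on S f) \<subseteq> S"
  by (auto simp: fsupp_def entry_fmat_on split: if_splits)

text \<open>This is the real part of the trace of \<open>adj X * Y\<close>. It precedes the class
  instances because the norm is defined from it.\<close>

definition frob_inner :: "'a fmat \<Rightarrow> 'a fmat \<Rightarrow> real" where
  "frob_inner X Y = (\<Sum>i\<in>fsupp X \<union> fsupp Y. \<Sum>j\<in>fsupp X \<union> fsupp Y. entry X i j \<bullet> entry Y i j)"

instantiation fmat :: (type) "{plus, minus, uminus, zero, scaleR, times}"
begin

lift_definition zero_fmat :: "'a fmat" is "\<lambda>_ _. 0" by simp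

lift_definition plus_fmat :: "'a fmat \<Rightarrow> 'a fmat \<Rightarrow> 'a fmat" is "\<lambda>f g i j. f i j + g i j"
proof -
  fix f g :: "'a \<Rightarrow> 'a \<Rightarrow> complex"
  assume "finite {(i, j). f i j \<noteq> 0}" "finite {(i, j). g i j \<noteq> 0}"
  then show "finite {(i, j). f i j + g i j \<noteq> 0}"
    by (rule finite_subset[rotated, OF finite_UnI]) auto
qed

lift_definition uminus_fmat :: "'a fmat \<Rightarrow> 'a fmat" is "\<lambda>f i j. - f i j" by simp

definition minus_fmat :: "'a fmat \<Rightarrow> 'a fmat \<Rightarrow> 'a fmat" where
  "minus_fmat X Y = X + - Y"

lift_definition scaleR_fmat :: "real \<Rightarrow> 'a fmat \<Rightarrow> 'a fmat" is "\<lambda>c f i j. complex_of_real c * f i j"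
proof -
  fix c and f :: "'a \<Rightarrow> 'a \<Rightarrow> complex"
  assume "finite {(i, j). f i j \<noteq> 0}"
  then show "finite {(i, j). complex_of_real c * f i j \<noteq> 0}"
    by (rule finite_subset[rotated]) auto
qed

definition times_fmat :: "'a fmat \<Rightarrow> 'a fmat \<Rightarrow> 'a fmat" where
  "times_fmat X Y = fmat_on (fsupp X \<union> fsupp Y) (\<lambda>i j. \<Sum>k\<in>fsupp X \<union> fsupp Y. entry X i k * entry Y k j)"

instance ..
end

lemma entry_zero [simp]: "entry 0 i j = 0" by transfer simp
lemma entry_plus [simp]: "entry (X + Y) i j = entry X i j + entry Y i j" by transfer simp
lemma entry_uminus [simp]: "entry (- X) i j = - entry X i j" by transfer simp
lemma entry_minus [simp]: "entry (X - Y) i j = entry X i j - entry Y i j"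
  by (simp add: minus_fmat_def)
lemma entry_scaleR [simp]: "entry (scaleR c X) i j = complex_of_real c * entry X i j"
  by transfer simp

text \<open>A summand vanishes as soon as \<open>k\<close> leaves the support of one of the factors,
  so a set containing either support will do and the other factor stays arbitrary.\<close>

lemma entry_times:
  assumes "finite S" "fsupp X \<subseteq> S \<or> fsupp Y \<subseteq> S"
  shows "entry (X * Y) i j = (\<Sum>k\<in>S. entry X i k * entry Y k j)"
proof -
  let ?T = "fsupp X \<union> fsupp Y"
  have z: "entry X i k * entry Y k j = 0" if "k \<notin> fsupp X \<inter> fsupp Y" for k
    using that by (metis IntI entry_nonzero_fsupp mult_zero_left mult_zero_right)
  have "entry (X * Y) i j = (\<Sum>k\<in>?T. entry X i k * entry Y k j)"
  proof (cases "i \<in> ?T \<and> j \<in> ?T")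
    case False
    then have "entry X i k * entry Y k j = 0" for k
      by (metis UnI1 UnI2 entry_nonzero_fsupp mult_zero_left mult_zero_right)
    then have "(\<Sum>k\<in>?T. entry X i k * entry Y k j) = 0" by (simp only: sum.neutral_const)
    with False show ?thesis unfolding times_fmat_def by (simp add: entry_fmat_on)
  qed (simp add: times_fmat_def entry_fmat_on)
  also have "\<dots> = (\<Sum>k\<in>fsupp X \<inter> fsupp Y. entry X i k * entry Y k j)"
    by (rule sum.mono_neutral_right) (auto simp: z)
  also have "\<dots> = (\<Sum>k\<in>S. entry X i k * entry Y k j)"
    by (rule sum.mono_neutral_left) (use assms z in auto)
  finally show ?thesis .
qed

lemma frob_inner_eq:
  assumes "finite S" "finite T"
    and "\<And>i j. i \<notin> S \<or> j \<notin> T \<Longrightarrow> entry X i j \<bullet> entry Y i j = 0"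
  shows "frob_inner X Y = (\<Sum>i\<in>S. \<Sum>j\<in>T. entry X i j \<bullet> entry Y i j)"
proof -
  let ?U = "fsupp X \<union> fsupp Y"
  let ?f = "\<lambda>(i, j). entry X i j \<bullet> entry Y i j"
  have z: "?f p = 0" if "p \<notin> S \<times> T" for p
    using that assms(3)[of "fst p" "snd p"] by (cases p) auto
  have "frob_inner X Y = sum ?f (?U \<times> ?U)"
    unfolding frob_inner_def by (simp add: sum.cartesian_product)
  also have "\<dots> = sum ?f ((?U \<inter> S) \<times> (?U \<inter> T))"
    by (rule sum.mono_neutral_right) (use z in auto)
  also have "\<dots> = sum ?f (S \<times> T)"
    by (rule sum.mono_neutral_left) (use assms in \<open>auto simp: entry_nonzero_fsupp\<close>)
  finally show ?thesis by (simp add: sum.cartesian_product)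
qed

lemma frob_inner_eq_square:
  assumes "finite S" "fsupp X \<subseteq> S \<or> fsupp Y \<subseteq> S"
  shows "frob_inner X Y = (\<Sum>i\<in>S. \<Sum>j\<in>S. entry X i j \<bullet> entry Y i j)"
proof (rule frob_inner_eq)
  show "entry X i j \<bullet> entry Y i j = 0" if "i \<notin> S \<or> j \<notin> S" for i j
    using assms(2) that by (metis entry_nonzero_fsupp inner_zero_left inner_zero_right subsetD)
qed (use assms in auto)

instance fmat :: (type) real_algebra
proof
  fix X Y Z :: "'a fmat" and c d :: real
  let ?S = "fsupp X \<union> fsupp Y \<union> fsupp Z"
  show "X + Y + Z = X + (Y + Z)" "X + Y = Y + X" "0 + X = X" "- X + X = 0" "X - Y = X + - Y"
    "scaleR c (X + Y) = scaleR c X + scaleR c Y" "scaleR (c + d) X = scaleR c X + scaleR d X"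
    "scaleR c (scaleR d X) = scaleR (c * d) X" "scaleR 1 X = X"
    by (rule fmat_eqI; simp add: algebra_simps)+
  show "X * Y * Z = X * (Y * Z)"
  proof (rule fmat_eqI)
    fix i j
    have "entry (X * Y * Z) i j = (\<Sum>k\<in>?S. (\<Sum>l\<in>?S. entry X i l * entry Y l k) * entry Z k j)"
      by (simp add: entry_times[of ?S "X * Y" Z] entry_times[of ?S X Y] Un_assoc sup.coboundedI1 sup.coboundedI2)
    also have "\<dots> = (\<Sum>k\<in>?S. \<Sum>l\<in>?S. entry X i l * (entry Y l k * entry Z k j))"
      by (simp add: sum_distrib_right mult.assoc)
    also have "\<dots> = (\<Sum>l\<in>?S. \<Sum>k\<in>?S. entry X i l * (entry Y l k * entry Z k j))"
      by (rule sum.swap)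
    also have "\<dots> = (\<Sum>l\<in>?S. entry X i l * entry (Y * Z) l j)"
      by (simp add: entry_times[of ?S Y Z] sum_distrib_left)
    also have "\<dots> = entry (X * (Y * Z)) i j"
      by (subst entry_times[of ?S X "Y * Z"]) auto
    finally show "entry (X * Y * Z) i j = entry (X * (Y * Z)) i j" .
  qed
  show "(X + Y) * Z = X * Z + Y * Z"
    by (rule fmat_eqI) (simp add: entry_times[of "fsupp Z"] sum.distrib algebra_simps)
  show "X * (Y + Z) = X * Y + X * Z"
    by (rule fmat_eqI) (simp add: entry_times[of "fsupp X"] sum.distrib algebra_simps)
  show "scaleR c X * Y = scaleR c (X * Y)"
    by (rule fmat_eqI) (simp add: entry_times[of "fsupp Y"] sum_distrib_left algebra_simps)
  show "X * scaleR c Y = scaleR c (X * Y)"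
    by (rule fmat_eqI) (simp add: entry_times[of "fsupp X"] sum_distrib_left algebra_simps)
qed

lemma sqrt_frob_inner_eq_L2_set:
  assumes "finite S" "fsupp X \<subseteq> S"
  shows "sqrt (frob_inner X X) = L2_set (\<lambda>(i, j). cmod (entry X i j)) (S \<times> S)"
  using assms
  by (simp add: frob_inner_eq_square[of S] L2_set_def sum.cartesian_product
      power2_norm_eq_inner case_prod_unfold)

instantiation fmat :: (type) real_normed_vector
begin

definition norm_fmat :: "'a fmat \<Rightarrow> real" where
  "norm_fmat X = sqrt (frob_inner X X)"

definition sgn_fmat :: "'a fmat \<Rightarrow> 'a fmat" where
  "sgn_fmat X = scaleR (inverse (norm X)) X"

definition dist_fmat :: "'a fmat \<Rightarrow> 'a fmat \<Rightarrow> real" where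
  "dist_fmat X Y = norm (X - Y)"

definition uniformity_fmat :: "('a fmat \<times> 'a fmat) filter" where
  "uniformity_fmat = (INF e\<in>{0<..}. principal {(X, Y). dist X Y < e})"

definition open_fmat :: "'a fmat set \<Rightarrow> bool" where
  "open_fmat U \<longleftrightarrow> (\<forall>X\<in>U. eventually (\<lambda>(X', Y). X' = X \<longrightarrow> Y \<in> U) uniformity)"

lemma norm_fmat_eq_L2_set:
  "finite S \<Longrightarrow> fsupp X \<subseteq> S \<Longrightarrow> norm X = L2_set (\<lambda>(i, j). cmod (entry X i j)) (S \<times> S)"
  by (simp add: norm_fmat_def sqrt_frob_inner_eq_L2_set)

instance
proof
  fix X Y :: "'a fmat" and c :: real and U :: "'a fmat set"
  let ?S = "fsupp X \<union> fsupp Y"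
  show "dist X Y = norm (X - Y)" "sgn X = inverse (norm X) *\<^sub>R X"
    "uniformity = (INF e\<in>{0<..}. principal {(X, Y :: 'a fmat). dist X Y < e})"
    "open U = (\<forall>X\<in>U. \<forall>\<^sub>F (X', Y) in uniformity. X' = X \<longrightarrow> Y \<in> U)"
    by (simp_all add: dist_fmat_def sgn_fmat_def uniformity_fmat_def open_fmat_def norm_fmat_def)
  have XY: "fsupp (X + Y) \<subseteq> ?S" by (auto simp: fsupp_def)
  have "norm (X + Y) = L2_set (\<lambda>(i, j). cmod (entry X i j + entry Y i j)) (?S \<times> ?S)"
    using norm_fmat_eq_L2_set[OF _ XY] by simp
  also have "\<dots> \<le> L2_set (\<lambda>p. (\<lambda>(i, j). cmod (entry X i j)) p + (\<lambda>(i, j). cmod (entry Y i j)) p) (?S \<times> ?S)"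
    by (rule L2_set_mono) (auto simp: norm_triangle_ineq)
  also have "\<dots> \<le> L2_set (\<lambda>(i, j). cmod (entry X i j)) (?S \<times> ?S) + L2_set (\<lambda>(i, j). cmod (entry Y i j)) (?S \<times> ?S)"
    by (rule L2_set_triangle_ineq)
  also have "\<dots> = norm X + norm Y"
    by (simp add: norm_fmat_eq_L2_set[of ?S])
  finally show "norm (X + Y) \<le> norm X + norm Y" .
  have "fsupp (scaleR c X) \<subseteq> ?S" by (auto simp: fsupp_def)
  then have "norm (scaleR c X) = L2_set (\<lambda>p. \<bar>c\<bar> * (\<lambda>(i, j). cmod (entry X i j)) p) (?S \<times> ?S)"
    by (simp add: norm_fmat_eq_L2_set[of ?S] norm_mult case_prod_unfold)
  also have "\<dots> = \<bar>c\<bar> * norm X"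
    by (simp add: norm_fmat_eq_L2_set[of ?S] L2_set_right_distrib)
  finally show "norm (scaleR c X) = \<bar>c\<bar> * norm X" .
  show "norm X = 0 \<longleftrightarrow> X = 0"
  proof
    assume "norm X = 0"
    then have *: "entry X i j = 0" if "i \<in> fsupp X" "j \<in> fsupp X" for i j
      using that by (simp add: norm_fmat_eq_L2_set[of "fsupp X"] L2_set_eq_0_iff)
    show "X = 0"
      by (rule fmat_eqI) (metis "*" entry_nonzero_fsupp(1) entry_nonzero_fsupp(2) entry_zero)
  qed (simp add: norm_fmat_def frob_inner_def)
qed

end

instantiation fmat :: (type) real_inner
begin

definition inner_fmat :: "'a fmat \<Rightarrow> 'a fmat \<Rightarrow> real" where "inner_fmat = frob_inner"

instance
proof
  fix X Y Z :: "'a fmat" and c :: real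
  let ?S = "fsupp X \<union> fsupp Y \<union> fsupp Z"
  have eq: "inner A B = (\<Sum>i\<in>?S. \<Sum>j\<in>?S. entry A i j \<bullet> entry B i j)"
    if "fsupp A \<subseteq> ?S \<or> fsupp B \<subseteq> ?S" for A B
    unfolding inner_fmat_def using that by (intro frob_inner_eq_square) auto
  show n: "norm X = sqrt (inner X X)" for X :: "'a fmat"
    by (simp add: norm_fmat_def inner_fmat_def)
  have s: "fsupp X \<subseteq> ?S" "fsupp Y \<subseteq> ?S" "fsupp Z \<subseteq> ?S" by auto
  show "inner X Y = inner Y X"
    using s by (simp add: eq inner_commute)
  show "inner (X + Y) Z = inner X Z + inner Y Z"
    using s by (simp add: eq sum.distrib inner_add_left)
  show "inner (scaleR c X) Y = c * inner X Y"
    using s by (simp add: eq sum_distrib_left scaleR_conv_of_real[symmetric])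
  have "inner X X = (\<Sum>i\<in>?S. \<Sum>j\<in>?S. (cmod (entry X i j))\<^sup>2)"
    using s by (simp add: eq power2_norm_eq_inner)
  then show "0 \<le> inner X X" by (simp add: sum_nonneg)
  show "inner X X = 0 \<longleftrightarrow> X = 0"
    using n[of X] by (metis norm_eq_zero real_sqrt_eq_zero_cancel_iff)
qed

end

lemmas inner_fmat_eq = frob_inner_eq[folded inner_fmat_def]
lemmas inner_fmat_eq_square = frob_inner_eq_square[folded inner_fmat_def]

lemma norm_fmat_sq:
  assumes "finite S" "finite T" "\<And>i j. i \<notin> S \<or> j \<notin> T \<Longrightarrow> entry X i j = 0"
  shows "(norm X)\<^sup>2 = (\<Sum>i\<in>S. \<Sum>j\<in>T. (cmod (entry X i j))\<^sup>2)"
  unfolding power2_norm_eq_inner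
  by (subst inner_fmat_eq[of S T])
    (use assms in \<open>auto intro!: sum.cong simp: power2_norm_eq_inner\<close>)

lemma cmod_entry_le_norm: "cmod (entry X i j) \<le> norm X"
proof -
  have "(cmod (entry X i j))\<^sup>2 \<le> (\<Sum>j'\<in>insert j (fsupp X). (cmod (entry X i j'))\<^sup>2)"
    by (rule member_le_sum) auto
  also have "\<dots> \<le> (\<Sum>i'\<in>insert i (fsupp X). \<Sum>j'\<in>insert j (fsupp X). (cmod (entry X i' j'))\<^sup>2)"
    by (rule member_le_sum) (auto intro: sum_nonneg)
  also have "\<dots> = (norm X)\<^sup>2"
    by (rule norm_fmat_sq[symmetric]) (auto simp: entry_nonzero_fsupp)
  finally show ?thesis by (simp add: power2_le_iff_abs_le)
qed

lemma entry_sum [simp]: "entry (\<Sum>x\<in>A. f x) i j = (\<Sum>x\<in>A. entry (f x) i j)"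
  by (induction A rule: infinite_finite_induct) auto

lemma entry_sum_list: "entry (sum_list Xs) i j = (\<Sum>X\<leftarrow>Xs. entry X i j)"
  by (induction Xs) auto

subsection \<open>The adjoint\<close>

lift_definition adj :: "'i fmat \<Rightarrow> 'i fmat" is "\<lambda>f i j. cnj (f j i)"
proof -
  fix f :: "'i \<Rightarrow> 'i \<Rightarrow> complex"
  assume "finite {(i, j). f i j \<noteq> 0}"
  then have "finite (prod.swap ` {(i, j). f i j \<noteq> 0})" by simp
  then show "finite {(i, j). cnj (f j i) \<noteq> 0}"
    by (rule finite_subset[rotated]) force
qed

lemma entry_adj [simp]: "entry (adj X) i j = cnj (entry X j i)" by transfer simp

lemma fsupp_adj [simp]: "fsupp (adj X) = fsupp X" by (auto simp: fsupp_def)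

lemma adj_simps [simp]:
  "adj (adj X) = X" "adj 0 = 0" "adj (X + Y) = adj X + adj Y" "adj (X - Y) = adj X - adj Y"
  "adj (- X) = - adj X" "adj (scaleR c X) = scaleR c (adj X)"
  by (rule fmat_eqI; simp)+

lemma adj_mult [simp]: "adj (X * Y) = adj Y * adj X"
  by (rule fmat_eqI)
    (simp add: entry_times[of "fsupp X \<union> fsupp Y"] algebra_simps)

lemma inner_adj: "inner (adj X) (adj Y) = inner X Y"
  by (simp add: inner_fmat_eq_square[of "fsupp X \<union> fsupp Y"])
    (subst sum.swap, simp add: inner_complex_def)

lemma norm_adj [simp]: "norm (adj X) = norm X"
  by (simp add: norm_eq_sqrt_inner inner_adj)

lemma inner_mult_left: "inner (X * Y) Z = inner Y (adj X * Z)"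
proof -
  let ?S = "fsupp X \<union> fsupp Y \<union> fsupp Z"
  have ip: "(a * b) \<bullet> c = b \<bullet> (cnj a * c)" for a b c :: complex
    by (simp add: inner_complex_def algebra_simps)
  have XY: "entry (X * Y) i j = (\<Sum>k\<in>?S. entry X i k * entry Y k j)" for i j
    by (rule entry_times) auto
  have "inner (X * Y) Z = (\<Sum>i\<in>?S. \<Sum>j\<in>?S. (\<Sum>k\<in>?S. entry X i k * entry Y k j) \<bullet> entry Z i j)"
    by (subst inner_fmat_eq_square[of ?S])
      (simp_all add: XY)
  also have "\<dots> = (\<Sum>i\<in>?S. \<Sum>j\<in>?S. \<Sum>k\<in>?S. entry Y k j \<bullet> (cnj (entry X i k) * entry Z i j))"
    by (simp only: inner_sum_left ip)
  also have "\<dots> = (\<Sum>j\<in>?S. \<Sum>i\<in>?S. \<Sum>k\<in>?S. entry Y k j \<bullet> (cnj (entry X i k) * entry Z i j))"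
    by (rule sum.swap)
  also have "\<dots> = (\<Sum>j\<in>?S. \<Sum>k\<in>?S. \<Sum>i\<in>?S. entry Y k j \<bullet> (cnj (entry X i k) * entry Z i j))"
    by (intro sum.cong refl sum.swap)
  also have "\<dots> = (\<Sum>k\<in>?S. \<Sum>j\<in>?S. \<Sum>i\<in>?S. entry Y k j \<bullet> (cnj (entry X i k) * entry Z i j))"
    by (rule sum.swap)
  also have "\<dots> = (\<Sum>k\<in>?S. \<Sum>j\<in>?S. entry Y k j \<bullet> entry (adj X * Z) k j)"
    by (intro sum.cong refl)
      (subst entry_times[of ?S "adj X" Z]; auto simp: inner_sum_right)
  also have "\<dots> = inner Y (adj X * Z)"
    by (subst inner_fmat_eq_square[of ?S]) auto
  finally show ?thesis .
qed

lemma inner_mult_right: "inner (X * Y) Z = inner X (Z * adj Y)"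
proof -
  have "inner (X * Y) Z = inner (adj (X * Y)) (adj Z)" by (simp only: inner_adj)
  also have "\<dots> = inner (adj Y * adj X) (adj Z)" by simp
  also have "\<dots> = inner (adj X) (Y * adj Z)" by (simp add: inner_mult_left)
  also have "\<dots> = inner (adj X) (adj (Z * adj Y))" by simp
  also have "\<dots> = inner X (Z * adj Y)" by (simp only: inner_adj)
  finally show ?thesis .
qed

section \<open>Local units\<close>

definition idm :: "'i set \<Rightarrow> 'i fmat" where
  "idm S = fmat_on S (\<lambda>i j. if i = j then 1 else 0)"

lemma entry_idm: "finite S \<Longrightarrow> entry (idm S) i j = (if i = j \<and> i \<in> S then 1 else 0)"
  by (auto simp: idm_def entry_fmat_on)

lemma fsupp_idm: "finite S \<Longrightarrow> fsupp (idm S) \<subseteq> S"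
  unfolding idm_def by (rule fsupp_fmat_on)

lemma adj_idm [simp]: "finite S \<Longrightarrow> adj (idm S) = idm S"
  by (rule fmat_eqI) (auto simp: entry_idm)

lemma entry_mult_idm:
  assumes "finite S"
  shows "entry (X * idm S) i j = (if j \<in> S then entry X i j else 0)"
    and "entry (idm S * X) i j = (if i \<in> S then entry X i j else 0)"
proof -
  have "entry (X * idm S) i j = (\<Sum>k\<in>S. entry X i k * (if k = j \<and> k \<in> S then 1 else 0))"
    using assms fsupp_idm by (subst entry_times[of S]) (auto simp: entry_idm)
  also have "\<dots> = (\<Sum>k\<in>S. if k = j then entry X i k else 0)"
    by (rule sum.cong) auto
  finally show "entry (X * idm S) i j = (if j \<in> S then entry X i j else 0)"
    using assms by simp
  have "entry (idm S * X) i j = (\<Sum>k\<in>S. (if i = k \<and> i \<in> S then 1 else 0) * entry X k j)"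
    using assms fsupp_idm by (subst entry_times[of S]) (auto simp: entry_idm)
  also have "\<dots> = (\<Sum>k\<in>S. if i = k then entry X k j else 0)"
    by (rule sum.cong) auto
  finally show "entry (idm S * X) i j = (if i \<in> S then entry X i j else 0)"
    using assms by simp
qed

lemma mult_idm:
  assumes "finite S" "fsupp X \<subseteq> S"
  shows "X * idm S = X" "idm S * X = X"
proof -
  have "entry X i j = 0" if "i \<notin> S \<or> j \<notin> S" for i j
    using that assms(2) entry_nonzero_fsupp by (metis subsetD)
  then show "X * idm S = X" "idm S * X = X"
    by (auto intro!: fmat_eqI simp: entry_mult_idm[OF assms(1)])
qed

lemma fsupp_mult: "fsupp X \<subseteq> S \<Longrightarrow> fsupp Y \<subseteq> S \<Longrightarrow> fsupp (X * Y) \<subseteq> S"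
  unfolding times_fmat_def by (rule order_trans[OF fsupp_fmat_on]) auto

text \<open>The squared Frobenius norm is the trace of \<open>adj X * X\<close>; the local unit
  \<open>idm (fsupp X)\<close> allows \<open>inner_mult_left\<close> to express this without a
  trace.\<close>

lemma adj_mult_eq_0:
  assumes "adj X * X = 0"
  shows "X = 0"
proof -
  have "X = X * idm (fsupp X)" by (simp add: mult_idm)
  then have "inner X X = inner (X * idm (fsupp X)) X" by simp
  also have "\<dots> = 0" using assms by (simp add: inner_mult_left)
  finally show ?thesis by simp
qed

lemma norm_mult_le: "norm (X * Y) \<le> norm X * norm (Y :: 'i fmat)"
proof -
  let ?S = "fsupp X \<union> fsupp Y"
  have "(norm (X * Y))\<^sup>2 = (\<Sum>i\<in>?S. \<Sum>j\<in>?S. (cmod (\<Sum>k\<in>?S. entry X i k * entry Y k j))\<^sup>2)"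
    by (subst norm_fmat_sq[of ?S ?S])
      (auto simp: entry_times[of ?S X Y] entry_nonzero_fsupp)
  also have "\<dots> \<le> (\<Sum>i\<in>?S. \<Sum>j\<in>?S. (\<Sum>k\<in>?S. (cmod (entry X i k))\<^sup>2) * (\<Sum>k\<in>?S. (cmod (entry Y k j))\<^sup>2))"
  proof (intro sum_mono)
    fix i j
    have "cmod (\<Sum>k\<in>?S. entry X i k * entry Y k j) \<le> (\<Sum>k\<in>?S. \<bar>cmod (entry X i k)\<bar> * \<bar>cmod (entry Y k j)\<bar>)"
      by (rule order_trans[OF norm_sum]) (simp add: norm_mult)
    also have "\<dots> \<le> L2_set (\<lambda>k. cmod (entry X i k)) ?S * L2_set (\<lambda>k. cmod (entry Y k j)) ?S"
      by (rule L2_set_mult_ineq)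
    finally have "(cmod (\<Sum>k\<in>?S. entry X i k * entry Y k j))\<^sup>2 \<le>
      (L2_set (\<lambda>k. cmod (entry X i k)) ?S * L2_set (\<lambda>k. cmod (entry Y k j)) ?S)\<^sup>2"
      by (rule power_mono) simp
    then show "(cmod (\<Sum>k\<in>?S. entry X i k * entry Y k j))\<^sup>2 \<le>
      (\<Sum>k\<in>?S. (cmod (entry X i k))\<^sup>2) * (\<Sum>k\<in>?S. (cmod (entry Y k j))\<^sup>2)"
      by (simp add: L2_set_def power_mult_distrib sum_nonneg)
  qed
  also have "\<dots> = (\<Sum>i\<in>?S. \<Sum>k\<in>?S. (cmod (entry X i k))\<^sup>2) * (\<Sum>j\<in>?S. \<Sum>k\<in>?S. (cmod (entry Y k j))\<^sup>2)"
    by (simp add: sum_product)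
  also have "(\<Sum>j\<in>?S. \<Sum>k\<in>?S. (cmod (entry Y k j))\<^sup>2) = (norm Y)\<^sup>2"
    by (subst sum.swap, rule norm_fmat_sq[symmetric]) (auto simp: entry_nonzero_fsupp)
  also have "(\<Sum>i\<in>?S. \<Sum>k\<in>?S. (cmod (entry X i k))\<^sup>2) = (norm X)\<^sup>2"
    by (rule norm_fmat_sq[symmetric]) (auto simp: entry_nonzero_fsupp)
  finally show ?thesis
    by (metis power_mult_distrib power2_le_imp_le norm_ge_zero mult_nonneg_nonneg)
qed

instance fmat :: (type) real_normed_algebra
  by standard (rule norm_mult_le)

section \<open>Matrices that are a low-rank plus a small-norm matrix\<close>

text \<open>
  The norm of \<open>'i fmat\<close> is the Frobenius norm; the operator norm only enters through its upper
  bounds \<open>M\<close>. Likewise \<open>lr k X\<close> below means that the rank of \<open>X\<close> is at most \<open>k\<close>.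
\<close>

definition opb :: "real \<Rightarrow> 'i fmat \<Rightarrow> bool" where
  "opb M X \<longleftrightarrow> 0 \<le> M \<and> (\<forall>Y. norm (X * Y) \<le> M * norm Y)"

lemma opb_nonneg: "opb M X \<Longrightarrow> 0 \<le> M" by (simp add: opb_def)

lemma opb_normD: "opb M X \<Longrightarrow> norm (X * Y) \<le> M * norm Y" by (simp add: opb_def)

lemma opb_norm: "norm X \<le> M \<Longrightarrow> opb M X"
  unfolding opb_def
  by (meson dual_order.trans mult_right_mono norm_ge_zero norm_mult_le)

lemma opb_mono: "opb M X \<Longrightarrow> M \<le> K \<Longrightarrow> opb K X"
  unfolding opb_def by (meson dual_order.trans mult_right_mono norm_ge_zero)

lemma opb_zero [simp]: "0 \<le> M \<Longrightarrow> opb M 0" by (simp add: opb_def)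

lemma opb_uminus: "opb M X \<Longrightarrow> opb M (- X)" by (simp add: opb_def)

lemma opb_add:
  assumes "opb M X" "opb K Y" shows "opb (M + K) (X + Y)"
  unfolding opb_def
proof safe
  fix Z :: "'a fmat"
  have "norm ((X + Y) * Z) \<le> norm (X * Z) + norm (Y * Z)"
    by (simp add: distrib_right norm_triangle_ineq)
  also have "\<dots> \<le> M * norm Z + K * norm Z"
    by (intro add_mono opb_normD assms)
  finally show "norm ((X + Y) * Z) \<le> (M + K) * norm Z" by (simp add: distrib_right)
qed (use assms[THEN opb_nonneg] in simp)

lemma opb_mult:
  assumes "opb M X" "opb K Y" shows "opb (M * K) (X * Y)"
  unfolding opb_def
proof safe
  fix Z :: "'a fmat"
  have "norm (X * Y * Z) \<le> M * norm (Y * Z)"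
    using opb_normD[OF assms(1)] by (simp add: mult.assoc)
  also have "\<dots> \<le> M * (K * norm Z)"
    by (intro mult_left_mono opb_normD opb_nonneg[OF assms(1)] assms)
  finally show "norm (X * Y * Z) \<le> M * K * norm Z" by (simp add: mult.assoc)
qed (use assms[THEN opb_nonneg] in simp)

text \<open>In \<open>|adj X Y|\<^sup>2 = \<langle>Y, X (adj X Y)\<rangle> \<le> |Y| M |adj X
  Y|\<close> one factor cancels.\<close>

lemma opb_adj:
  assumes "opb M X" shows "opb M (adj X)"
  unfolding opb_def
proof safe
  fix Y :: "'a fmat"
  have "(norm (adj X * Y))\<^sup>2 = inner Y (X * (adj X * Y))"
    by (simp add: power2_norm_eq_inner inner_mult_left)
  also have "\<dots> \<le> norm Y * norm (X * (adj X * Y))" by (rule norm_cauchy_schwarz)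
  also have "\<dots> \<le> norm Y * (M * norm (adj X * Y))"
    by (intro mult_left_mono opb_normD assms) simp
  finally have "norm (adj X * Y) * norm (adj X * Y) \<le> (M * norm Y) * norm (adj X * Y)"
    by (simp add: power2_eq_square mult_ac)
  then show "norm (adj X * Y) \<le> M * norm Y"
    using opb_nonneg[OF assms] by (cases "norm (adj X * Y) = 0") (auto simp: mult_le_cancel_right)
qed (rule opb_nonneg[OF assms])

text \<open>The rank is bounded by counting rank-one summands: in \<open>U * idm {i} * V\<close>
  only column \<open>i\<close> of \<open>U\<close> and row \<open>i\<close> of \<open>V\<close>
  matter. Subadditivity and the ideal properties then follow by induction, without linear
  algebra.\<close>

inductive lr :: "nat \<Rightarrow> 'i fmat \<Rightarrow> bool" where
  lr_0: "lr 0 0"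
| lr_Suc: "lr k X \<Longrightarrow> lr (Suc k) (X + U * idm {i} * V)"

lemma lr_add: "lr k X \<Longrightarrow> lr l Y \<Longrightarrow> lr (k + l) (X + Y)"
  by (rotate_tac 1, induction rule: lr.induct) (auto simp: add.assoc[symmetric] intro: lr_Suc)

lemma lr_Suc_same: "lr k X \<Longrightarrow> lr (Suc k) X"
  using lr_Suc[of k X 0] by simp

lemma lr_mono: "lr k X \<Longrightarrow> k \<le> l \<Longrightarrow> lr l X"
  by (rotate_tac 1, induction l rule: dec_induct) (auto intro: lr_Suc_same)

lemma lr_mult_left: "lr k X \<Longrightarrow> lr k (Y * X)"
proof (induction rule: lr.induct)
  case (lr_Suc k X U i V)
  then show ?case
    using lr.lr_Suc[of k "Y * X" "Y * U" i V] by (simp add: distrib_left mult.assoc)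
qed (simp add: lr_0)

lemma lr_mult_right: "lr k X \<Longrightarrow> lr k (X * Y)"
proof (induction rule: lr.induct)
  case (lr_Suc k X U i V)
  then show ?case
    using lr.lr_Suc[of k "X * Y" U i "V * Y"] by (simp add: distrib_right mult.assoc)
qed (simp add: lr_0)

text \<open>This is \<open>X (1 + Y)\<close> in an algebra that has no \<open>1\<close>; treating it
  as one product avoids doubling the rank.\<close>

lemma lr_add_mult_right: "lr k X \<Longrightarrow> lr k (X + X * Y)"
proof (induction rule: lr.induct)
  case (lr_Suc k X U i V)
  then show ?case
    using lr.lr_Suc[of k "X + X * Y" U i "V + V * Y"] by (simp add: algebra_simps)
qed (simp add: lr_0)

lemma lr_adj: "lr k X \<Longrightarrow> lr k (adj X)"
proof (induction rule: lr.induct)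
  case (lr_Suc k X U i V)
  then show ?case
    using lr.lr_Suc[of k "adj X" "adj V" i "adj U"] by (simp add: mult.assoc)
qed (simp add: lr_0)

lemma lr_uminus: "lr k X \<Longrightarrow> lr k (- X)"
proof (induction rule: lr.induct)
  case (lr_Suc k X U i V)
  then show ?case
    using lr.lr_Suc[of k "- X" "- U" i V] by simp
qed (simp add: lr_0)

lemma lr_idm: "finite S \<Longrightarrow> lr (card S) (idm S)"
proof (induction S rule: finite_induct)
  case empty
  have "idm {} = (0 :: 'a fmat)" by (rule fmat_eqI) (simp add: entry_idm)
  then show ?case by (simp add: lr_0)
next
  case (insert i S)
  have "idm (insert i S) = idm S + idm {i} * idm {i} * idm {i}"
    by (rule fmat_eqI) (use insert.hyps in \<open>auto simp: entry_mult_idm entry_idm\<close>)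
  then show ?case using insert lr_Suc by simp
qed

text \<open>The bound \<open>x\<close> on the rank is real because it will be a fraction of
  \<open>level_size n\<close>.\<close>

definition dcmp :: "real \<Rightarrow> real \<Rightarrow> 'i fmat \<Rightarrow> bool" where
  "dcmp x M X \<longleftrightarrow> (\<exists>k L N. X = L + N \<and> lr k L \<and> real k \<le> x \<and> opb M N)"

lemma dcmpE:
  assumes "dcmp x M X"
  obtains k L N where "X = L + N" "lr k L" "real k \<le> x" "opb M N"
  using assms by (auto simp: dcmp_def)

lemma dcmpI: "X = L + N \<Longrightarrow> lr k L \<Longrightarrow> real k \<le> x \<Longrightarrow> opb M N \<Longrightarrow> dcmp x M X"
  by (auto simp: dcmp_def)

lemma dcmp_mono: "dcmp x M X \<Longrightarrow> x \<le> y \<Longrightarrow> M \<le> K \<Longrightarrow> dcmp y K X"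
  by (elim dcmpE, rule dcmpI[of _ L N k for L N k]) (auto intro: opb_mono)

lemma dcmp_opb: "opb M X \<Longrightarrow> 0 \<le> x \<Longrightarrow> dcmp x M X"
  by (rule dcmpI[of X 0 X 0]) (auto intro: lr_0)

lemma dcmp_lr: "lr k X \<Longrightarrow> real k \<le> x \<Longrightarrow> dcmp x 0 X"
  by (rule dcmpI[of X X 0 k]) auto

lemma dcmp_add:
  assumes "dcmp x M X" "dcmp y K Y" shows "dcmp (x + y) (M + K) (X + Y)"
proof -
  obtain k L N where 1: "X = L + N" "lr k L" "real k \<le> x" "opb M N" using assms(1) by (rule dcmpE)
  obtain l L' N' where 2: "Y = L' + N'" "lr l L'" "real l \<le> y" "opb K N'" using assms(2) by (rule dcmpE)
  show ?thesis
    by (rule dcmpI[of _ "L + L'" "N + N'" "k + l"]) (use 1 2 in \<open>auto intro: lr_add opb_add\<close>)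
qed

lemma dcmp_uminus: "dcmp x M X \<Longrightarrow> dcmp x M (- X)"
  by (elim dcmpE, rule dcmpI[of _ "- L" "- N" k for L N k]) (auto intro: lr_uminus opb_uminus)

lemma dcmp_adj: "dcmp x M X \<Longrightarrow> dcmp x M (adj X)"
  by (elim dcmpE, rule dcmpI[of _ "adj L" "adj N" k for L N k]) (auto intro: lr_adj opb_adj)

text \<open>In \<open>X * Y = (L * Y + N * L') + N * N'\<close> the bracket has rank at most
  \<open>k + l\<close>, since rank bounds ignore the size of the other factor.\<close>

lemma dcmp_mult:
  assumes "dcmp x M X" "dcmp y K Y" shows "dcmp (x + y) (M * K) (X * Y)"
proof -
  obtain k L N where 1: "X = L + N" "lr k L" "real k \<le> x" "opb M N" using assms(1) by (rule dcmpE)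
  obtain l L' N' where 2: "Y = L' + N'" "lr l L'" "real l \<le> y" "opb K N'" using assms(2) by (rule dcmpE)
  have "lr (k + l) (L * Y + N * L')"
    by (intro lr_add lr_mult_left lr_mult_right 1 2)
  then show ?thesis
    using 1 2 by (intro dcmpI[OF _ _ _ opb_mult[OF 1(4) 2(4)]]) (auto simp: algebra_simps)
qed

section \<open>The Frobenius norm controls rank and operator norm\<close>

lemma norm_sq_columns:
  assumes "finite S" "fsupp X \<subseteq> S"
  shows "(norm X)\<^sup>2 = (\<Sum>j\<in>S. (norm (X * idm {j}))\<^sup>2)"
proof -
  have 0: "entry X i j = 0" if "i \<notin> S \<or> j \<notin> S" for i j
    using that assms(2) entry_nonzero_fsupp by (metis subsetD)
  have "(norm (X * idm {j}))\<^sup>2 = (\<Sum>i\<in>S. (cmod (entry X i j))\<^sup>2)" for j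
    by (subst norm_fmat_sq[of S "{j}"]) (auto simp: entry_mult_idm assms(1) 0)
  then have "(\<Sum>j\<in>S. (norm (X * idm {j}))\<^sup>2) = (\<Sum>j\<in>S. \<Sum>i\<in>S. (cmod (entry X i j))\<^sup>2)"
    by simp
  also have "\<dots> = (\<Sum>i\<in>S. \<Sum>j\<in>S. (cmod (entry X i j))\<^sup>2)"
    by (rule sum.swap)
  also have "\<dots> = (norm X)\<^sup>2"
    by (rule norm_fmat_sq[symmetric]) (auto simp: assms(1) 0)
  finally show ?thesis by simp
qed

text \<open>
  As long as \<open>X\<close> is not bounded by \<open>M\<close>, some unit vector \<open>v\<close> has \<open>|X v| > M\<close>; subtracting
  \<open>X v v\<^sup>*\<close> has rank one and lowers the squared Frobenius norm by more than \<open>M\<^sup>2\<close>.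
\<close>

lemma frobenius_peel:
  assumes "0 < M" "\<not> opb M X"
  obtains U V :: "'i fmat" and i where
    "(norm (X - U * idm {i} * V))\<^sup>2 \<le> (norm X)\<^sup>2 - M\<^sup>2"
proof -
  obtain Y where Y: "M * norm Y < norm (X * Y)"
    using assms by (auto simp: opb_def not_le)
  let ?S = "fsupp X \<union> fsupp Y"
  \<comment> \<open>Some single column already violates the bound: otherwise summing the squares
    over all columns would give it for \<open>Y\<close>.\<close>
  have "\<exists>j\<in>?S. M * norm (Y * idm {j}) < norm (X * (Y * idm {j}))"
  proof (rule ccontr)
    assume "\<not> ?thesis"
    then have *: "norm (X * (Y * idm {j})) \<le> M * norm (Y * idm {j})" if "j \<in> ?S" for j
      using that by (auto simp: not_less)
    have "(norm (X * Y))\<^sup>2 = (\<Sum>j\<in>?S. (norm (X * (Y * idm {j})))\<^sup>2)"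
      by (subst norm_sq_columns[OF _ fsupp_mult, of ?S]) (auto simp: mult.assoc)
    also have "\<dots> \<le> (\<Sum>j\<in>?S. (M * norm (Y * idm {j}))\<^sup>2)"
      by (intro sum_mono power_mono * norm_ge_zero)
    also have "\<dots> = (M * norm Y)\<^sup>2"
      by (simp add: norm_sq_columns[of ?S Y] power_mult_distrib sum_distrib_left)
    finally show False
      using Y assms(1) power2_le_imp_le[of "norm (X * Y)" "M * norm Y"] by simp
  qed
  then obtain j where j: "M * norm (Y * idm {j}) < norm (X * (Y * idm {j}))" by blast
  then have pos: "0 < norm (Y * idm {j})"
    by (metis mult_zero_right norm_zero order_less_irrefl zero_less_norm_iff)
  define v where "v = (inverse (norm (Y * idm {j}))) *\<^sub>R (Y * idm {j})"
  have v1: "norm v = 1" using pos by (simp add: v_def)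
  have "M < norm (X * (Y * idm {j})) / norm (Y * idm {j})"
    using j pos by (simp add: field_simps)
  then have vM: "M < norm (X * v)"
    using pos by (simp add: v_def divide_inverse mult.commute)
  \<comment> \<open>Since \<open>v\<close> has only column \<open>j\<close>, inserting
    \<open>idm {j}\<close> changes nothing but displays the rank-one form required by
    \<open>lr\<close>.\<close>
  have vj: "v * idm {j} = v"
    by (rule fmat_eqI) (auto simp: v_def entry_mult_idm)
  have "X * v * idm {j} = X * v" by (simp only: mult.assoc vj)
  then have "(norm (X - X * v * idm {j} * adj v))\<^sup>2 = (norm (X - X * v * adj v))\<^sup>2"
    by simp
  also have "\<dots> = (norm X)\<^sup>2 - 2 * inner X (X * v * adj v) + (norm (X * v * adj v))\<^sup>2"
    by (simp add: power2_norm_eq_inner inner_diff_left inner_diff_right inner_commute)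
  also have "inner X (X * v * adj v) = (norm (X * v))\<^sup>2"
    using inner_mult_right[of "X * v" "adj v" X]
    by (simp add: power2_norm_eq_inner inner_commute)
  also have "(norm (X * v * adj v))\<^sup>2 \<le> (norm (X * v))\<^sup>2"
    by (rule power_mono) (use norm_mult_le[of "X * v" "adj v"] v1 in auto)
  finally have "(norm (X - X * v * idm {j} * adj v))\<^sup>2 \<le> (norm X)\<^sup>2 - (norm (X * v))\<^sup>2" by simp
  also have "\<dots> \<le> (norm X)\<^sup>2 - M\<^sup>2"
    using vM assms(1) by (simp add: power_mono)
  finally show thesis by (rule that)
qed

text \<open>Each peeling costs one unit of rank and removes at least \<open>M\<^sup>2\<close> from
  the squared norm, so about \<open>|X|\<^sup>2 / M\<^sup>2\<close> peelings suffice. This replaces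
  counting the singular values above \<open>M\<close>.\<close>

lemma dcmp_frobenius:
  assumes "0 < M" "(norm X)\<^sup>2 \<le> x * M\<^sup>2"
  shows "dcmp x M X"
proof -
  \<comment> \<open>The strict inequality with \<open>Suc k\<close> lets \<open>k\<close> peelings
    suffice: for \<open>k = 0\<close> it says \<open>|X| < M\<close>, so \<open>X\<close> is already
    bounded.\<close>
  have *: "(norm X)\<^sup>2 < real (Suc k) * M\<^sup>2 \<Longrightarrow> \<exists>L N. X = L + N \<and> lr k L \<and> opb M N" for k and X :: "'a fmat"
  proof (induction k arbitrary: X)
    case 0
    then have "norm X \<le> M"
      using assms(1) power2_less_imp_less[of "norm X" M] by simp
    then show ?case by (intro exI[of _ 0] exI[of _ X]) (auto intro: lr_0 opb_norm)
  next
    case (Suc k)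
    show ?case
    proof (cases "opb M X")
      case True
      have "lr (Suc k) (0 :: 'a fmat)" by (rule lr_mono[OF lr_0]) simp
      with True show ?thesis by (intro exI[of _ 0] exI[of _ X]) auto
    next
      case False
      then obtain U V :: "'a fmat" and i where
        le: "(norm (X - U * idm {i} * V))\<^sup>2 \<le> (norm X)\<^sup>2 - M\<^sup>2"
        using frobenius_peel[OF assms(1)] by blast
      have "(norm (X - U * idm {i} * V))\<^sup>2 < real (Suc k) * M\<^sup>2"
        using le Suc.prems by (simp add: algebra_simps)
      from Suc.IH[OF this] obtain L N where
        LN: "X - U * idm {i} * V = L + N" "lr k L" "opb M N" by blast
      then have "X = (L + U * idm {i} * V) + N" by (simp add: algebra_simps)
      with LN lr_Suc[of k L U i V] show ?thesis by blast
    qed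
  qed
  have x: "0 \<le> x"
    using assms by (meson not_le mult_neg_pos order.strict_trans1 zero_le_power2 zero_less_power)
  \<comment> \<open>Rounding down gives both \<open>k \<le> x\<close>, the admissible rank, and
    \<open>x < k + 1\<close>, the strict inequality above.\<close>
  define k where "k = nat \<lfloor>x\<rfloor>"
  have "x < real (Suc k)" "real k \<le> x" using x unfolding k_def by linarith+
  then have "(norm X)\<^sup>2 < real (Suc k) * M\<^sup>2"
    using assms by (meson order.strict_trans1 mult_strict_right_mono zero_less_power)
  from *[OF this] \<open>real k \<le> x\<close> show ?thesis by (auto intro: dcmpI)
qed

text \<open>
  With \<open>Z = L + N\<close>, iterate \<open>X = (Y + X L) + X N\<close>. The number of iterations may depend on \<open>X\<close>,
  since only the remainder \<open>X N^j\<close> involves the norm of \<open>X\<close>.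
\<close>

lemma dcmp_neumann:
  assumes X: "X = Y + X * Z" and Y: "dcmp x M Y" and Z: "dcmp z (1/2) Z" and "0 < \<eta>"
  shows "dcmp (x + z) (2 * M + \<eta>) X"
proof -
  obtain k L N where 1: "Z = L + N" "lr k L" "real k \<le> z" "opb (1/2) N" using Z by (rule dcmpE)
  obtain l L' N' where 2: "Y = L' + N'" "lr l L'" "real l \<le> x" "opb M N'" using Y by (rule dcmpE)
  define W where "W = Y + X * L"
  have W: "X = W + X * N" unfolding W_def using X 1(1) by (simp add: distrib_left add.assoc)
  \<comment> \<open>\<open>S\<close> stands for \<open>N + N^2 + ... + N^j\<close> and
    \<open>P\<close> for \<open>N^(j+1)\<close>; the bounds are those of the geometric series with
    ratio 1/2.\<close>
  have "\<exists>S P. X = W + W * S + X * P \<and> opb (1 - (1/2)^j) S \<and> opb ((1/2)^Suc j) P" for j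
  proof (induction j)
    case 0
    show ?case by (rule exI[of _ 0], rule exI[of _ N]) (use W 1 in auto)
  next
    case (Suc j)
    then obtain S P where S: "X = W + W * S + X * P" "opb (1 - (1/2)^j) S" "opb ((1/2)^Suc j) P"
      by blast
    have "X * P = W * P + X * (N * P)" by (subst W) (simp add: algebra_simps)
    with S(1) have "X = W + W * (S + P) + X * (N * P)" by (simp add: distrib_left add.assoc)
    moreover have "opb (1 - (1/2)^Suc j) (S + P)"
      by (rule opb_mono[OF opb_add[OF S(2,3)]]) (simp add: field_simps)
    moreover have "opb ((1/2)^Suc (Suc j)) (N * P)"
      using opb_mult[OF 1(4) S(3)] by simp
    ultimately show ?case by blast
  qed
  moreover obtain j where j: "norm X * (1/2)^j < \<eta>"
  proof -
    have "(\<lambda>j. norm X * (1/2)^j) \<longlonglongrightarrow> norm X * 0"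
      by (intro tendsto_mult tendsto_const LIMSEQ_power_zero) auto
    then have "eventually (\<lambda>j. norm X * (1/2)^j < \<eta>) sequentially"
      using assms(4) by (auto dest: order_tendstoD)
    then show thesis using that by (auto simp: eventually_sequentially)
  qed
  ultimately obtain S P where S: "X = W + W * S + X * P" "opb (1 - (1/2)^j) S" "opb ((1/2)^Suc j) P"
    by blast
  have S1: "opb 1 S" by (rule opb_mono[OF S(2)]) simp
  have XP: "opb \<eta> (X * P)"
  proof (rule opb_mono[OF opb_mult[OF opb_norm[OF order_refl] S(3)]])
    have "norm X * (1/2)^Suc j \<le> norm X * (1/2)^j"
      by (intro mult_left_mono power_decreasing) auto
    then show "norm X * (1/2)^Suc j \<le> \<eta>" using j by linarith
  qed
  \<comment> \<open>The low-rank part of \<open>W\<close>. It may be huge, since it contains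
    \<open>X\<close>, but its rank does not depend on \<open>X\<close>.\<close>
  let ?L = "L' + X * L"
  have lr: "lr (l + k) (?L + ?L * S)"
    by (intro lr_add_mult_right lr_add lr_mult_left 1 2)
  \<comment> \<open>The factor 2 in the bound is that of \<open>1 + S\<close> with \<open>S\<close>
    bounded by 1.\<close>
  have "opb (M + M * 1) (N' + N' * S)" by (intro opb_add opb_mult 2 S1)
  then have op: "opb (2 * M + \<eta>) (N' + N' * S + X * P)"
    using opb_add[OF _ XP] by fastforce
  have "X = (?L + ?L * S) + (N' + N' * S + X * P)"
    by (subst S(1)) (simp add: W_def 2(1) algebra_simps)
  then show ?thesis using lr op 1(3) 2(3) by (intro dcmpI) auto
qed

section \<open>Pseudoinverses of finitely supported matrices\<close>

definition penrose :: "'i fmat \<Rightarrow> 'i fmat \<Rightarrow> bool" where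
  "penrose A B \<longleftrightarrow> A * B * A = A \<and> B * A * B = B \<and> adj (A * B) = A * B \<and> adj (B * A) = B * A"

lemma penroseD:
  assumes "penrose A B"
  shows "A * B * A = A" "B * A * B = B" "adj B * adj A = A * B" "adj A * adj B = B * A"
  using assms unfolding penrose_def by simp_all

lemma penrose_adj:
  assumes "penrose A B"
  shows "penrose (adj A) (adj B)"
proof -
  note P = penroseD[OF assms]
  have "adj A * adj B * adj A = adj (A * B * A)" "adj B * adj A * adj B = adj (B * A * B)"
    by (simp_all add: mult.assoc)
  then have "adj A * adj B * adj A = adj A" "adj B * adj A * adj B = adj B"
    by (simp_all only: P)
  then show ?thesis unfolding penrose_def using P by simp
qed

text \<open>From \<open>X = adj A * adj X * X = X * adj X * adj A\<close> the pseudoinverse inherits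
  its rows and columns from \<open>adj A\<close>.\<close>

lemma penrose_support:
  assumes "penrose A X" "finite R" "finite S" "idm R * A = A" "A * idm S = A"
  shows "idm S * X = X" "X * idm R = X"
proof -
  note P = penroseD[OF assms(1)]
  have a: "idm S * adj A = adj A" "adj A * idm R = adj A"
    using arg_cong[OF assms(5), of adj] arg_cong[OF assms(4), of adj] assms(2,3) by simp_all
  have e: "adj A * adj X * X = X" "X * adj X * adj A = X"
    by (simp only: P, simp only: mult.assoc P(3), simp only: mult.assoc[symmetric] P(2))
  have "idm S * X = idm S * adj A * adj X * X"
    using arg_cong[OF e(1), of "\<lambda>Z. idm S * Z"] by (simp add: mult.assoc)
  then show "idm S * X = X" by (simp only: a e)
  have "X * idm R = X * adj X * (adj A * idm R)"
    using arg_cong[OF e(2), of "\<lambda>Z. Z * idm R"] by (simp add: mult.assoc)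
  then show "X * idm R = X" by (simp only: a e)
qed

text \<open>\<open>A * B\<close> and \<open>A * C\<close> are orthogonal projections onto the same
  range, that of \<open>A\<close>, hence equal; likewise \<open>B * A = C * A\<close>. Then
  \<open>B = B * A * B = C * A * C = C\<close>.\<close>

lemma penrose_unique:
  assumes "penrose A B" "penrose A C"
  shows "B = C"
proof -
  note B = penroseD[OF assms(1)] and C = penroseD[OF assms(2)]
  have "A * B = A * C"
  proof -
    have "A * B = adj (A * B)" using B by simp
    also have "\<dots> = adj ((A * C) * (A * B))" by (simp only: mult.assoc[symmetric] C(1))
    also have "\<dots> = (adj B * adj A) * (adj C * adj A)" by simp
    also have "\<dots> = (A * B * A) * C" by (simp only: B(3) C(3) mult.assoc)
    finally show ?thesis by (simp only: B(1))
  qed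
  moreover have "B * A = C * A"
  proof -
    have "B * A = adj (B * A)" using B by simp
    also have "\<dots> = adj ((B * A) * (C * A))" using C(1) by (simp only: mult.assoc)
    also have "\<dots> = (adj A * adj C) * (adj A * adj B)" by simp
    also have "\<dots> = C * (A * B * A)" by (simp only: B(4) C(4) mult.assoc)
    finally show ?thesis by (simp only: B(1))
  qed
  ultimately have "B * A * B = C * A * C" by (simp only: mult.assoc)
  then show ?thesis by (simp only: B(2) C(2))
qed

text \<open>
  Gaussian elimination with pivot \<open>entry X p q\<close>: for \<open>E = E\<^sub>q\<^sub>p / entry X p q\<close> the matrix
  \<open>X' = X - X E X\<close> has fewer nonzero rows, and an inner inverse \<open>G\<close> of \<open>X'\<close> yields the inner
  inverse \<open>E + (1 - E X) G (1 - X E)\<close> of \<open>X\<close>.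
\<close>

lemma inner_inverse_exists: "\<exists>G. X * G * X = (X :: 'i fmat)"
proof (induction "card {i. \<exists>j. entry X i j \<noteq> 0}" arbitrary: X rule: less_induct)
  case less
  show ?case
  proof (cases "X = 0")
    case False
    then obtain p q where pq: "entry X p q \<noteq> 0" by (metis entry_zero fmat_eqI)
    define E where "E = fmat_on {p, q} (\<lambda>i j. if i = q \<and> j = p then 1 / entry X p q else 0)"
    have E: "entry E i j = (if i = q \<and> j = p then 1 / entry X p q else 0)" for i j
      by (auto simp: E_def entry_fmat_on)
    have fE: "fsupp E \<subseteq> {p, q}" unfolding E_def by (rule fsupp_fmat_on) simp
    have XE: "entry (X * E) i j = (if j = p then entry X i q / entry X p q else 0)" for i j
    proof -
      have "entry (X * E) i j = (\<Sum>k\<in>{p, q}. entry X i k * entry E k j)"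
        by (rule entry_times) (use fE in auto)
      also have "\<dots> = (\<Sum>k\<in>{p, q}. if k = q then (if j = p then entry X i q / entry X p q else 0) else 0)"
        by (intro sum.cong) (auto simp: E)
      finally show ?thesis by simp
    qed
    have XEX: "entry (X * E * X) i j = entry X i q / entry X p q * entry X p j" for i j
    proof -
      have "entry (X * E * X) i j = (\<Sum>k\<in>insert p (fsupp X). entry (X * E) i k * entry X k j)"
        by (rule entry_times) auto
      also have "\<dots> = (\<Sum>k\<in>insert p (fsupp X). if k = p then entry X i q / entry X p q * entry X p j else 0)"
        by (intro sum.cong) (auto simp: XE)
      finally show ?thesis by simp
    qed
    define X' where "X' = X - X * E * X"
    have "{i. \<exists>j. entry X' i j \<noteq> 0} \<subset> {i. \<exists>j. entry X i j \<noteq> 0}"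
    proof
      show "{i. \<exists>j. entry X' i j \<noteq> 0} \<subseteq> {i. \<exists>j. entry X i j \<noteq> 0}"
      proof safe
        fix i j assume "entry X' i j \<noteq> 0"
        then have "entry X i j \<noteq> 0 \<or> entry X i q \<noteq> 0" by (auto simp: X'_def XEX)
        then show "\<exists>j. entry X i j \<noteq> 0" by blast
      qed
      have "p \<notin> {i. \<exists>j. entry X' i j \<noteq> 0}" "p \<in> {i. \<exists>j. entry X i j \<noteq> 0}"
        using pq by (auto simp: X'_def XEX)
      then show "{i. \<exists>j. entry X' i j \<noteq> 0} \<noteq> {i. \<exists>j. entry X i j \<noteq> 0}" by blast
    qed
    moreover have "finite {i. \<exists>j. entry X i j \<noteq> 0}"
      by (rule finite_subset[OF _ finite_fsupp[of X]]) (auto simp: fsupp_def)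
    ultimately have "card {i. \<exists>j. entry X' i j \<noteq> 0} < card {i. \<exists>j. entry X i j \<noteq> 0}"
      by (rule psubset_card_mono[rotated])
    from less(1)[OF this] obtain G where G: "X' * G * X' = X'" by blast
    \<comment> \<open>The inner inverse is written multiplied out, because the algebra has no
      unit.\<close>
    have "X * (E + G - E * X * G - G * X * E + E * X * G * X * E) * X = X * E * X + X' * G * X'"
      by (simp add: X'_def algebra_simps)
    also have "\<dots> = X" unfolding G by (simp add: X'_def)
    finally show ?thesis by blast
  qed simp
qed

text \<open>An inner inverse of the Gram matrix solves \<open>X * (A * adj A) = adj A\<close>, and
  similarly for \<open>Y\<close> on the other side. The first equation makes \<open>X * A\<close>
  selfadjoint, the second \<open>A * Y\<close>, and both give \<open>A X A = A Y A = A\<close>. Then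
  \<open>X * A * Y\<close> combines the two one-sided properties.\<close>

lemma penrose_exists: "\<exists>B. penrose A (B :: 'i fmat)"
proof -
  have left: "\<exists>X. X * (C * adj C) = adj C" for C :: "'i fmat"
  proof -
    let ?H = "C * adj C"
    obtain G where G: "?H * G * ?H = ?H" using inner_inverse_exists by blast
    \<comment> \<open>The defect of the desired equation satisfies \<open>C * W = 0\<close>, and its
      adjoint ends in the factor \<open>C\<close>; hence \<open>adj W * W = 0\<close>.\<close>
    define W where "W = adj C * G * ?H - adj C"
    have "C * W = 0" using G by (simp add: W_def algebra_simps)
    moreover have "adj W * W = (?H * adj G - idm (fsupp C)) * (C * W)"
    proof -
      have "idm (fsupp C) * C = C" by (simp add: mult_idm)
      then have "adj W = (?H * adj G - idm (fsupp C)) * C"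
        by (simp add: W_def left_diff_distrib mult.assoc)
      then show ?thesis by (simp add: mult.assoc)
    qed
    ultimately have "adj W * W = 0" by simp
    then have "W = 0" by (rule adj_mult_eq_0)
    then show ?thesis by (auto simp: W_def)
  qed
  obtain X where X: "X * (A * adj A) = adj A" using left by blast
  obtain Y' where Y': "Y' * (adj A * A) = A" using left[of "adj A"] by auto
  define Y where "Y = adj Y'"
  have Y: "adj A * A * Y = adj A"
    using arg_cong[OF Y', of adj] by (simp add: Y_def)
  have "adj A * adj X = X * A * (adj A * adj X)"
    using arg_cong[OF X, of "\<lambda>Z. Z * adj X"] by (simp add: mult.assoc)
  \<comment> \<open>The right-hand side is \<open>(X A) adj (X A)\<close>, hence selfadjoint;
    substituting the left-hand side back for it makes \<open>adj A * adj X\<close> selfadjoint, and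
    its adjoint is \<open>X * A\<close>.\<close>
  also have "adj \<dots> = \<dots>" by (simp add: mult.assoc)
  finally have hX: "adj A * adj X = X * A" by simp
  have "adj Y * adj A = adj Y * (adj A * A * Y)" by (simp only: Y)
  also have "adj \<dots> = \<dots>" by (simp add: mult.assoc)
  finally have hY: "adj Y * adj A = A * Y" by simp
  have AXA: "A * X * A = A"
    using arg_cong[OF X, of adj] hX by (simp add: mult.assoc)
  have AYA: "A * Y * A = A"
    using arg_cong[OF Y, of adj] hY by (simp add: mult.assoc)
  have 1: "A * (X * A * Y) = A * Y" "X * A * Y * A = X * A"
    using arg_cong[OF AXA, of "\<lambda>Z. Z * Y"] arg_cong[OF AYA, of "\<lambda>Z. X * Z"]
    by (simp_all add: mult.assoc)
  have "X * A * Y * A * (X * A * Y) = X * (A * (X * A * Y))"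
    by (simp only: 1(2)) (simp only: mult.assoc)
  also have "\<dots> = X * A * Y" unfolding 1(1) by (simp only: mult.assoc)
  finally have "X * A * Y * A * (X * A * Y) = X * A * Y" .
  then have "penrose A (X * A * Y)"
    unfolding penrose_def using 1 AYA hX hY by (simp add: mult.assoc)
  then show ?thesis by blast
qed

subsection \<open>Landweber iteration\<close>

text \<open>Gradient descent for the normal equation \<open>adj K * K * Y = adj K\<close>, started
  at 0. The step size stays below \<open>1 / |K|\<^sup>2\<close> and also makes sense for
  \<open>K = 0\<close>. The iterates are needed for the measurability of the pseudoinverse.\<close>

primrec landweber :: "'i fmat \<Rightarrow> nat \<Rightarrow> 'i fmat" where
  "landweber K 0 = 0"
| "landweber K (Suc j) = landweber K j +
     (1 / (1 + (norm K)\<^sup>2)) *\<^sub>R (adj K - adj K * K * landweber K j)"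

text \<open>
  The error \<open>Y\<close> of the iteration satisfies \<open>Y' = Y - H Y\<close> with \<open>0 \<le> H\<^sup>2 \<le> H\<close>, so \<open>\<langle>H Y, Y\<rangle>\<close> is at
  most the decrease of \<open>|Y|\<^sup>2\<close>; it tends to \<open>0\<close>, and it controls \<open>Y = B K Y\<close>.
\<close>

lemma landweber_tendsto:
  assumes "penrose K B"
  shows "landweber K \<longlonglongrightarrow> B"
proof -
  note P = penroseD[OF assms]
  define w where "w = 1 / (1 + (norm K)\<^sup>2)"
  define H where "H = w *\<^sub>R (adj K * K)"
  define Y where "Y j = B - landweber K j" for j
  have den: "0 < 1 + (norm K)\<^sup>2" by (simp add: add_pos_nonneg)
  have w: "0 < w" "w * (norm K)\<^sup>2 \<le> 1"
    using den by (simp_all add: w_def)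
  have KB: "adj K * K * B = adj K"
    using arg_cong[OF P(1), of adj] by (simp add: P(3) mult.assoc)
  have Y_Suc: "Y (Suc j) = Y j - H * Y j" for j
    by (simp add: Y_def H_def w_def[symmetric] KB[unfolded mult.assoc] algebra_simps)
  have BKH: "B * K * H = H"
  proof -
    have "B * K * adj K = adj K" using arg_cong[OF P(1), of adj] P(4) by (simp add: mult.assoc)
    then have "B * K * (adj K * K) = adj K * K" by (simp only: mult.assoc[symmetric])
    then show ?thesis by (simp add: H_def)
  qed
  \<comment> \<open>The errors stay in the range of the projection \<open>B * K\<close>, so that
    \<open>|Y| \<le> |B| |K Y|\<close>; this makes the decay of \<open>K Y\<close>
    sufficient.\<close>
  have BKY: "B * K * Y j = Y j" for j
  proof (induction j)
    case 0
    show ?case by (simp add: Y_def P(2))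
  next
    case (Suc j)
    have "B * K * (H * Y j) = H * Y j" by (simp only: mult.assoc[symmetric] BKH)
    with Suc show ?case by (simp add: Y_Suc right_diff_distrib)
  qed
  have HY: "inner (H * X) X = w * (norm (K * X))\<^sup>2" for X
    using inner_mult_left[of "adj K" "K * X" X]
    by (simp add: H_def power2_norm_eq_inner mult.assoc)
  have HH: "(norm (H * X))\<^sup>2 \<le> w * (norm (K * X))\<^sup>2" for X
  proof -
    have "norm (H * X) = w * norm (adj K * (K * X))"
      using w by (simp add: H_def mult.assoc)
    also have "\<dots> \<le> w * (norm K * norm (K * X))"
      using norm_mult_le[of "adj K" "K * X"] w by (intro mult_left_mono) auto
    finally have "(norm (H * X))\<^sup>2 \<le> (w * (norm K * norm (K * X)))\<^sup>2"
      by (rule power_mono) simp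
    also have "\<dots> = (w * (norm K)\<^sup>2) * (w * (norm (K * X))\<^sup>2)"
      by (simp add: power2_eq_square mult_ac)
    also have "\<dots> \<le> 1 * (w * (norm (K * X))\<^sup>2)"
      using w by (intro mult_right_mono) auto
    finally show ?thesis by simp
  qed
  have decr: "w * (norm (K * Y j))\<^sup>2 \<le> (norm (Y j))\<^sup>2 - (norm (Y (Suc j)))\<^sup>2" for j
  proof -
    have "(norm (Y (Suc j)))\<^sup>2 = (norm (Y j))\<^sup>2 - 2 * inner (H * Y j) (Y j) + (norm (H * Y j))\<^sup>2"
      by (simp add: Y_Suc power2_norm_eq_inner inner_diff_left inner_diff_right inner_commute)
    then show ?thesis using HY[of "Y j"] HH[of "Y j"] by simp
  qed
  have "convergent (\<lambda>j. (norm (Y j))\<^sup>2)"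
  proof (rule Bseq_monoseq_convergent)
    have "decseq (\<lambda>j. (norm (Y j))\<^sup>2)"
      using decr w by (intro decseq_SucI) (smt (verit) mult_nonneg_nonneg zero_le_power2)
    then show "monoseq (\<lambda>j. (norm (Y j))\<^sup>2)" "Bseq (\<lambda>j. (norm (Y j))\<^sup>2)"
      by (auto intro: decseq_bounded[where B = 0] simp: monoseq_iff)
  qed
  then obtain l where l: "(\<lambda>j. (norm (Y j))\<^sup>2) \<longlonglongrightarrow> l" by (auto simp: convergent_def)
  have "(\<lambda>j. (norm (Y j))\<^sup>2 - (norm (Y (Suc j)))\<^sup>2) \<longlonglongrightarrow> l - l"
    by (intro tendsto_diff l LIMSEQ_Suc)
  then have "(\<lambda>j. w * (norm (K * Y j))\<^sup>2) \<longlonglongrightarrow> 0"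
    using decr w by (intro tendsto_sandwich[OF _ _ tendsto_const, where g = "\<lambda>j. w * (norm (K * Y j))\<^sup>2"]) auto
  then have "(\<lambda>j. inverse w * (w * (norm (K * Y j))\<^sup>2)) \<longlonglongrightarrow> inverse w * 0"
    by (intro tendsto_mult tendsto_const)
  then have "(\<lambda>j. (norm (K * Y j))\<^sup>2) \<longlonglongrightarrow> 0" using w by simp
  then have "(\<lambda>j. sqrt ((norm (K * Y j))\<^sup>2)) \<longlonglongrightarrow> sqrt 0" by (intro tendsto_real_sqrt)
  then have "(\<lambda>j. norm B * norm (K * Y j)) \<longlonglongrightarrow> norm B * 0" by (intro tendsto_mult tendsto_const) simp
  then have lim: "(\<lambda>j. norm B * norm (K * Y j)) \<longlonglongrightarrow> 0" by simp
  have "norm (Y j) \<le> norm B * norm (K * Y j)" for j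
    using norm_mult_le[of B "K * Y j"] BKY[of j] by (simp add: mult.assoc)
  then have "Y \<longlonglongrightarrow> 0"
    by (intro Lim_null_comparison[OF _ lim] always_eventually allI)
  then have "(\<lambda>j. B - Y j) \<longlonglongrightarrow> B - 0" by (intro tendsto_diff tendsto_const)
  then show ?thesis by (simp add: Y_def[abs_def])
qed

section \<open>Matrices as finitely supported matrices\<close>

lemma mat_adjoint_carrier [simp]: "A \<in> carrier_mat r s \<Longrightarrow> mat_adjoint A \<in> carrier_mat s r"
  unfolding mat_adjoint_def by auto

lemma mat_adjoint_index:
  "A \<in> carrier_mat r s \<Longrightarrow> i < s \<Longrightarrow> j < r \<Longrightarrow> mat_adjoint A $$ (i, j) = cnj (A $$ (j, i))"
  unfolding mat_adjoint_def by (auto simp: mat_of_rows_index)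

text \<open>Rows and columns receive labels of one common type through \<open>b\<close> and
  \<open>c\<close>, which have to be injective only on the existing rows and columns. Rectangular
  matrices thereby enter the same algebra as square ones.\<close>

definition fmat_of :: "(nat \<Rightarrow> 'i) \<Rightarrow> (nat \<Rightarrow> 'i) \<Rightarrow> complex mat \<Rightarrow> 'i fmat" where
  "fmat_of b c M = fmat_on (b ` {..<dim_row M} \<union> c ` {..<dim_col M})
     (\<lambda>i j. if i \<in> b ` {..<dim_row M} \<and> j \<in> c ` {..<dim_col M}
            then M $$ (the_inv_into {..<dim_row M} b i, the_inv_into {..<dim_col M} c j) else 0)"

lemma entry_fmat_of:
  assumes "M \<in> carrier_mat r s" "inj_on b {..<r}" "inj_on c {..<s}" "p < r" "q < s"
  shows "entry (fmat_of b c M) (b p) (c q) = M $$ (p, q)"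
  using assms by (auto simp: fmat_of_def entry_fmat_on the_inv_into_f_f)

lemma entry_fmat_of_0:
  assumes "M \<in> carrier_mat r s" "i \<notin> b ` {..<r} \<or> j \<notin> c ` {..<s}"
  shows "entry (fmat_of b c M) i j = 0"
  using assms by (auto simp: fmat_of_def entry_fmat_on)

lemma fmat_of_eqI:
  assumes "M \<in> carrier_mat r s" "inj_on b {..<r}" "inj_on c {..<s}"
    and "\<And>p q. p < r \<Longrightarrow> q < s \<Longrightarrow> entry X (b p) (c q) = M $$ (p, q)"
    and "\<And>i j. i \<notin> b ` {..<r} \<or> j \<notin> c ` {..<s} \<Longrightarrow> entry X i j = 0"
  shows "fmat_of b c M = X"
proof (rule fmat_eqI)
  fix i j
  show "entry (fmat_of b c M) i j = entry X i j"
  proof (cases "i \<in> b ` {..<r} \<and> j \<in> c ` {..<s}")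
    case True
    then show ?thesis using assms by (auto simp: entry_fmat_of[OF assms(1-3)])
  qed (use assms(1,5) in \<open>simp add: entry_fmat_of_0\<close>)
qed

lemma fmat_of_inject:
  assumes "M \<in> carrier_mat r s" "M' \<in> carrier_mat r s" "inj_on b {..<r}" "inj_on c {..<s}"
    and "fmat_of b c M = fmat_of b c M'"
  shows "M = M'"
  by (rule eq_matI) (use assms entry_fmat_of[OF assms(1,3,4)] entry_fmat_of[OF assms(2,3,4)] in auto)

lemma fmat_of_mult:
  assumes "M \<in> carrier_mat r m" "M' \<in> carrier_mat m s"
    and "inj_on b {..<r}" "inj_on c {..<m}" "inj_on d {..<s}"
  shows "fmat_of b d (M * M') = fmat_of b c M * fmat_of c d M'"
proof (rule fmat_of_eqI[of _ r s])
  let ?S = "b ` {..<r} \<union> c ` {..<m}"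
  have prod: "entry (fmat_of b c M * fmat_of c d M') i j =
      (\<Sum>k<m. entry (fmat_of b c M) i (c k) * entry (fmat_of c d M') (c k) j)" for i j
  proof -
    have "entry (fmat_of b c M * fmat_of c d M') i j =
      (\<Sum>k\<in>?S. entry (fmat_of b c M) i k * entry (fmat_of c d M') k j)"
      by (rule entry_times) (use assms fsupp_fmat_on[of ?S] in \<open>auto simp: fmat_of_def\<close>)
    also have "\<dots> = (\<Sum>k\<in>c ` {..<m}. entry (fmat_of b c M) i k * entry (fmat_of c d M') k j)"
      by (rule sum.mono_neutral_right) (auto simp: entry_fmat_of_0[OF assms(1)])
    also have "\<dots> = (\<Sum>k<m. entry (fmat_of b c M) i (c k) * entry (fmat_of c d M') (c k) j)"
      by (subst sum.reindex[OF assms(4)]) simp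
    finally show ?thesis .
  qed
  show "entry (fmat_of b c M * fmat_of c d M') (b p) (d q) = (M * M') $$ (p, q)" if "p < r" "q < s" for p q
    using assms that
    by (auto simp: prod entry_fmat_of[OF assms(1,3,4)] entry_fmat_of[OF assms(2,4,5)]
        scalar_prod_def lessThan_atLeast0 intro!: sum.cong)
  show "entry (fmat_of b c M * fmat_of c d M') i j = 0" if "i \<notin> b ` {..<r} \<or> j \<notin> d ` {..<s}" for i j
    using that by (auto simp: prod entry_fmat_of_0[OF assms(1)] entry_fmat_of_0[OF assms(2)])
qed (use assms in auto)

lemma fmat_of_adjoint:
  assumes "M \<in> carrier_mat r s" "inj_on b {..<r}" "inj_on c {..<s}"
  shows "fmat_of c b (mat_adjoint M) = adj (fmat_of b c M)"
  by (rule fmat_of_eqI[of _ s r])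
    (use assms in \<open>auto simp: mat_adjoint_index entry_fmat_of entry_fmat_of_0\<close>)

lemma fmat_of_add:
  assumes "M \<in> carrier_mat r s" "M' \<in> carrier_mat r s" "inj_on b {..<r}" "inj_on c {..<s}"
  shows "fmat_of b c (M + M') = fmat_of b c M + fmat_of b c M'"
  by (rule fmat_of_eqI[of _ r s])
    (use assms in \<open>auto simp: entry_fmat_of[OF assms(1,3,4)] entry_fmat_of[OF assms(2,3,4)]
      entry_fmat_of_0[OF assms(1)] entry_fmat_of_0[OF assms(2)]\<close>)

lemma fmat_of_one:
  assumes "inj_on b {..<r}"
  shows "fmat_of b b (1\<^sub>m r) = idm (b ` {..<r})"
  by (rule fmat_of_eqI[of _ r r]) (use assms in \<open>auto simp: entry_idm dest: inj_onD\<close>)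

lemma idm_mult_fmat_of:
  assumes "M \<in> carrier_mat r s" "inj_on b {..<r}" "inj_on c {..<s}"
  shows "idm (b ` {..<r}) * fmat_of b c M = fmat_of b c M"
    and "fmat_of b c M * idm (c ` {..<s}) = fmat_of b c M"
  by (rule fmat_eqI; auto simp: entry_mult_idm entry_fmat_of_0[OF assms(1)])+

definition mat_of_fmat :: "(nat \<Rightarrow> 'i) \<Rightarrow> (nat \<Rightarrow> 'i) \<Rightarrow> nat \<Rightarrow> nat \<Rightarrow> 'i fmat \<Rightarrow> complex mat" where
  "mat_of_fmat b c r s X = Matrix.mat r s (\<lambda>(p, q). entry X (b p) (c q))"

lemma mat_of_fmat_carrier [simp]: "mat_of_fmat b c r s X \<in> carrier_mat r s"
  by (simp add: mat_of_fmat_def)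

lemma fmat_of_mat_of_fmat:
  assumes "inj_on b {..<r}" "inj_on c {..<s}"
  shows "fmat_of b c (mat_of_fmat b c r s X) = idm (b ` {..<r}) * X * idm (c ` {..<s})"
  by (rule fmat_of_eqI[of _ r s]) (use assms in \<open>auto simp: entry_mult_idm mat_of_fmat_def\<close>)

subsection \<open>The pseudoinverse\<close>

text \<open>The description by \<open>THE\<close> requires existence and uniqueness; both are pulled
  back along \<open>fmat_of id id\<close>, which is injective on matrices of a given size and
  respects products and adjoints.\<close>

lemma pinv_props:
  assumes M: "M \<in> carrier_mat r s"
  shows "pinv M \<in> carrier_mat s r" "M * pinv M * M = M" "pinv M * M * pinv M = pinv M"
    "mat_adjoint (M * pinv M) = M * pinv M" "mat_adjoint (pinv M * M) = pinv M * M"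
proof -
  let ?Q = "\<lambda>B. B \<in> carrier_mat (dim_col M) (dim_row M) \<and>
     M * B * M = M \<and> B * M * B = B \<and>
     mat_adjoint (M * B) = M * B \<and> mat_adjoint (B * M) = B * M"
  let ?F = "fmat_of id id :: complex mat \<Rightarrow> nat fmat"
  note mult = fmat_of_mult[where b = id and c = id and d = id, simplified]
  note adjoint = fmat_of_adjoint[where b = id and c = id, simplified]
  have inject_iff: "?F C = ?F C' \<longleftrightarrow> C = C'" if "C \<in> carrier_mat m n" "C' \<in> carrier_mat m n" for C C' m n
    using fmat_of_inject[OF that, of id id] by auto
  have penrose: "penrose (?F M) (?F B) \<longleftrightarrow> ?Q B" if B: "B \<in> carrier_mat s r" for B
  proof -
    have MB: "M * B \<in> carrier_mat r r" and BM: "B * M \<in> carrier_mat s s"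
      and MBM: "M * B * M \<in> carrier_mat r s" and BMB: "B * M * B \<in> carrier_mat s r"
      using M B by auto
    have "?F (M * B * M) = ?F M * ?F B * ?F M" "?F (B * M * B) = ?F B * ?F M * ?F B"
      "?F (mat_adjoint (M * B)) = adj (?F M * ?F B)" "?F (M * B) = ?F M * ?F B"
      "?F (mat_adjoint (B * M)) = adj (?F B * ?F M)" "?F (B * M) = ?F B * ?F M"
      by (simp_all only: mult[OF M B] mult[OF B M] mult[OF MB M] mult[OF BM B] adjoint[OF MB] adjoint[OF BM])
    moreover have "?F (M * B * M) = ?F M \<longleftrightarrow> M * B * M = M" "?F (B * M * B) = ?F B \<longleftrightarrow> B * M * B = B"
      "?F (mat_adjoint (M * B)) = ?F (M * B) \<longleftrightarrow> mat_adjoint (M * B) = M * B"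
      "?F (mat_adjoint (B * M)) = ?F (B * M) \<longleftrightarrow> mat_adjoint (B * M) = B * M"
      by (simp_all only: inject_iff[OF MBM M] inject_iff[OF BMB B]
        inject_iff[OF mat_adjoint_carrier[OF MB] MB] inject_iff[OF mat_adjoint_carrier[OF BM] BM])
    ultimately show ?thesis unfolding penrose_def using M B by auto
  qed
  have "\<exists>!B. ?Q B"
  proof (rule ex_ex1I)
    obtain X where X: "penrose (?F M) X" using penrose_exists by blast
    let ?Ir = "idm {..<r}" and ?Is = "idm {..<s}"
    define B where "B = mat_of_fmat id id s r X"
    have "?Ir * ?F M = ?F M" "?F M * ?Is = ?F M"
      using idm_mult_fmat_of[OF M, of id id] by simp_all
    \<comment> \<open>By \<open>penrose_support\<close>, \<open>X\<close> lives in the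
      \<open>s\<close> by \<open>r\<close> rectangle, so cutting it down to a matrix loses
      nothing.\<close>
    then have "?F B = X"
      using fmat_of_mat_of_fmat[of id s id r X] penrose_support[OF X, of "{..<r}" "{..<s}"]
      by (simp add: B_def)
    with X have "penrose (?F M) (?F B)" by simp
    then show "\<exists>B. ?Q B" using penrose[of B] by (auto simp: B_def)
  next
    fix B C assume "?Q B" "?Q C"
    then have c: "B \<in> carrier_mat s r" "C \<in> carrier_mat s r" using M by auto
    then have "penrose (?F M) (?F B)" "penrose (?F M) (?F C)"
      using penrose \<open>?Q B\<close> \<open>?Q C\<close> by blast+
    then have "?F B = ?F C" by (rule penrose_unique)
    then show "B = C" by (simp only: inject_iff[OF c])
  qed
  then have "?Q (pinv M)" unfolding pinv_def by (rule theI')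
  then show "pinv M \<in> carrier_mat s r" "M * pinv M * M = M" "pinv M * M * pinv M = pinv M"
    "mat_adjoint (M * pinv M) = M * pinv M" "mat_adjoint (pinv M * M) = pinv M * M"
    using M by auto
qed

lemma penrose_pinv:
  assumes M: "M \<in> carrier_mat r s" and b: "inj_on b {..<r}" and c: "inj_on c {..<s}"
  shows "penrose (fmat_of b c M) (fmat_of c b (pinv M))"
proof -
  note P = pinv_props[OF M]
  have MB: "M * pinv M \<in> carrier_mat r r" and BM: "pinv M * M \<in> carrier_mat s s" using M P(1) by auto
  let ?F = "fmat_of b c M" and ?G = "fmat_of c b (pinv M)"
  have FG: "fmat_of b b (M * pinv M) = ?F * ?G" and GF: "fmat_of c c (pinv M * M) = ?G * ?F"
    by (rule fmat_of_mult[OF M P(1) b c b], rule fmat_of_mult[OF P(1) M c b c])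
  show ?thesis
    unfolding penrose_def
    using fmat_of_mult[OF MB M b b c] fmat_of_mult[OF BM P(1) c c b]
      fmat_of_adjoint[OF MB b b] fmat_of_adjoint[OF BM c c] FG GF P by simp
qed

section \<open>Full rank and one-sided inverses\<close>

lemma (in vec_space) cols_basis_exists:
  assumes "A \<in> carrier_mat n nc"
  obtains S where "S \<subseteq> set (cols A)" "finite S" "S \<subseteq> carrier_vec n" "lin_indpt S" "card S = rank A"
    "set (cols A) \<subseteq> span S"
proof -
  have cols: "set (cols A) \<subseteq> carrier_vec n" using assms cols_dim by blast
  obtain S where S: "maximal S (\<lambda>T. T \<subseteq> set (cols A) \<and> lin_indpt T)"
    using maximal_exists[of "(\<lambda>T. T \<subseteq> set (cols A) \<and> lin_indpt T)" "card (set (cols A))" "{}"]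
    by (meson List.finite_set card_mono empty_iff empty_subsetI finite_lin_indpt2 rev_finite_subset)
  then have S': "S \<subseteq> set (cols A)" "lin_indpt S" by (auto simp: maximal_def)
  have finS: "finite S" and Sc: "S \<subseteq> carrier_vec n" using S' cols finite_subset by auto
  have "x \<in> span S" if x: "x \<in> set (cols A)" for x
  proof (rule ccontr)
    assume nx: "x \<notin> span S"
    then have "x \<notin> S" using Sc in_own_span by blast
    then have "lin_indpt (S \<union> {x})"
      using lin_dep_iff_in_span[of S x] nx Sc S'(2) cols x by auto
    then show False using S x \<open>x \<notin> S\<close> S'(1) unfolding maximal_def by blast
  qed
  then show thesis
    using that[OF S'(1) finS Sc S'(2) rank_card_indpt[OF assms S, symmetric]] by blast
qed

lemma mult_unit_vec_col:
  assumes "(A :: complex mat) \<in> carrier_mat r s" "q < s"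
  shows "A *\<^sub>v unit_vec s q = col A q"
  using col_mult2[OF assms(1) one_carrier_mat assms(2)] assms by simp

text \<open>The columns span the whole space, so every unit vector is some \<open>M x\<close>, and
  \<open>M * pinv M * M\<close> sends \<open>x\<close> to \<open>M x\<close>.\<close>

lemma mult_pinv_full_row_rank:
  assumes M: "M \<in> carrier_mat r s" and "mat_rank M = r"
  shows "M * pinv M = 1\<^sub>m r"
proof -
  interpret vec_space "TYPE(complex)" r .
  have rank: "rank M = r" using assms by auto
  have cols: "set (cols M) \<subseteq> carrier_vec r" using M cols_dim by blast
  obtain S where S: "S \<subseteq> set (cols M)" "finite S" "S \<subseteq> carrier_vec r" "lin_indpt S" "card S = rank M"
    by (rule cols_basis_exists[OF M])
  have "basis S"
    by (rule dim_li_is_basis[OF fin_dim S(2) _ S(4)])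
      (simp_all only: S(3,5) rank dim_is_n module_vec_simps order_refl)
  then have "span S = carrier_vec r" by (simp add: basis_def)
  then have span: "span (set (cols M)) = carrier_vec r"
    using span_is_monotone[OF S(1)] span_closed[OF cols] by blast
  note P = pinv_props[OF M]
  show ?thesis
  proof (rule mat_col_eqI)
    fix q assume "q < dim_col (1\<^sub>m r :: complex mat)"
    then have q: "q < r" by simp
    have "unit_vec r q \<in> col_space M" using span by (simp add: col_space_def)
    then obtain x where x: "x \<in> carrier_vec s" "M *\<^sub>v x = unit_vec r q"
      using col_space_eq[OF M] M by auto
    have "col (M * pinv M) q = (M * pinv M) *\<^sub>v unit_vec r q"
      using M P(1) q by (intro mult_unit_vec_col[symmetric]) auto
    also have "\<dots> = (M * pinv M * M) *\<^sub>v x"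
      using M P(1) x by (subst assoc_mult_mat_vec[of _ r r]) auto
    also have "\<dots> = col (1\<^sub>m r) q" using P(2) x(2) q by simp
    finally show "col (M * pinv M) q = col (1\<^sub>m r) q" .
  qed (use M P(1) in auto)
qed

text \<open>For a unit vector \<open>e\<close>, \<open>M\<close> annihilates
  \<open>pinv M * M e - e\<close>, and independent columns make \<open>M\<close> injective.\<close>

lemma pinv_mult_full_col_rank:
  assumes M: "M \<in> carrier_mat r s" and "mat_rank M = s"
  shows "pinv M * M = 1\<^sub>m s"
proof -
  interpret vec_space "TYPE(complex)" r .
  have rank: "rank M = s" using assms by auto
  note P = pinv_props[OF M]
  have cols: "set (cols M) \<subseteq> carrier_vec r" using M cols_dim by blast
  obtain S where S: "S \<subseteq> set (cols M)" "card S = rank M"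
    by (rule cols_basis_exists[OF M])
  \<comment> \<open>Linear independence is stated for the set of columns, so repeated columns have
    to be excluded: a basis taken from the columns has \<open>s\<close> elements.\<close>
  have "s \<le> card (set (cols M))"
    using S rank by (metis List.finite_set card_mono)
  then have dist: "distinct (cols M)"
    using M card_length[of "cols M"] by (intro card_distinct) auto
  show ?thesis
  proof (rule mat_col_eqI)
    fix q assume "q < dim_col (1\<^sub>m s :: complex mat)"
    then have q: "q < s" by simp
    have PM: "pinv M * M \<in> carrier_mat s s" using M P(1) by auto
    define w where "w = (pinv M * M) *\<^sub>v unit_vec s q"
    define v where "v = w - unit_vec s q"
    have w: "w \<in> carrier_vec s" using PM by (simp add: w_def)
    have v: "v \<in> carrier_vec s" using w by (simp add: v_def)
    have "M *\<^sub>v w = (M * (pinv M * M)) *\<^sub>v unit_vec s q"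
      unfolding w_def by (rule assoc_mult_mat_vec[OF M PM unit_vec_carrier, symmetric])
    also have "M * (pinv M * M) = M"
      using assoc_mult_mat[OF M P(1) M] P(2) by simp
    finally have Mw: "M *\<^sub>v w = M *\<^sub>v unit_vec s q" .
    have "M *\<^sub>v v = M *\<^sub>v w - M *\<^sub>v unit_vec s q"
      unfolding v_def by (rule mult_minus_distrib_mat_vec[OF M w unit_vec_carrier])
    also have "\<dots> = 0\<^sub>v r"
      unfolding Mw using M by (intro minus_cancel_vec) auto
    finally have Mv: "M *\<^sub>v v = 0\<^sub>v r" .
    have v0: "v = 0\<^sub>v s"
    proof (rule ccontr)
      assume "v \<noteq> 0\<^sub>v s"
      from lin_depI[OF M v this Mv dist] full_rank_lin_indpt[OF M rank dist] show False by simp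
    qed
    have "w = unit_vec s q"
    proof (rule eq_vecI)
      fix i assume "i < dim_vec (unit_vec s q :: complex Matrix.vec)"
      then have i: "i < s" by simp
      then have "vec_index v i = 0" by (simp add: v0)
      then show "vec_index w i = vec_index (unit_vec s q) i"
        using i w by (simp add: v_def)
    qed (use w in simp)
    then have "(pinv M * M) *\<^sub>v unit_vec s q = unit_vec s q" by (simp add: w_def)
    then show "col (pinv M * M) q = col (1\<^sub>m s) q"
      using PM q by (simp add: mult_unit_vec_col)
  qed (use M P(1) in auto)
qed

subsection \<open>Rank and spectral norm\<close>

lemma lr_outer_product:
  assumes "finite S"
  shows "lr 1 (fmat_on S (\<lambda>i j. u i * v j))"
proof -
  \<comment> \<open>Any label can be the single inner index of the factorisation, whether it lies in
    \<open>S\<close> or not.\<close>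
  obtain k :: 'a where True by simp
  define U where "U = fmat_on (insert k S) (\<lambda>i j. if i \<in> S \<and> j = k then u i else 0)"
  define V where "V = fmat_on (insert k S) (\<lambda>i j. if j \<in> S \<and> i = k then v j else 0)"
  have eU: "entry U i j = (if i \<in> S \<and> j = k then u i else 0)" for i j
    using assms by (auto simp: U_def entry_fmat_on)
  have eV: "entry V i j = (if j \<in> S \<and> i = k then v j else 0)" for i j
    using assms by (auto simp: V_def entry_fmat_on)
  have "entry (U * idm {k} * V) i j = (\<Sum>l\<in>insert k S. entry (U * idm {k}) i l * entry V l j)" for i j
    by (rule entry_times) (use assms fsupp_fmat_on[of "insert k S"] in \<open>auto simp: V_def\<close>)
  also have "\<dots> i j = (\<Sum>l\<in>insert k S. if l = k then (if i \<in> S \<and> j \<in> S then u i * v j else 0) else 0)" for i j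
    by (rule sum.cong) (auto simp: eU eV entry_mult_idm)
  finally have "U * idm {k} * V = fmat_on S (\<lambda>i j. u i * v j)"
    using assms by (intro fmat_eqI) (simp add: entry_fmat_on)
  then show ?thesis using lr_Suc[OF lr_0, of U k V] by simp
qed

lemma lr_sum:
  assumes "finite S" "\<And>x. x \<in> S \<Longrightarrow> lr 1 (f x)"
  shows "lr (card S) (\<Sum>x\<in>S. f x)"
  using assms
proof (induction S rule: finite_induct)
  case (insert x S)
  then show ?case using lr_add[of "card S" "sum f S" 1 "f x"] by (simp add: add.commute)
qed (simp add: lr_0)

text \<open>Expanding every column in a basis of the column space gives one outer product for each
  basis vector. Together with \<open>mat_rank_le_lr\<close> this translates between
  \<open>lr\<close> and the rank in both directions.\<close>

lemma lr_mat_rank: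
  assumes R: "R \<in> carrier_mat r s" and b: "inj_on b {..<r}" and c: "inj_on c {..<s}"
  shows "lr (mat_rank R) (fmat_of b c R)"
proof -
  interpret vec_space "TYPE(complex)" r .
  obtain S where S: "finite S" "S \<subseteq> carrier_vec r" "card S = rank R" "set (cols R) \<subseteq> span S"
    by (rule cols_basis_exists[OF R])
  note finS = S(1) and Sc = S(2)
  have rank: "mat_rank R = card S" using S R by simp
  have "\<forall>x\<in>set (cols R). x \<in> span S" using S by blast
  then have "\<forall>q<s. \<exists>a. col R q = lincomb a S"
    using finite_span[OF finS] Sc R by (fastforce simp: cols_def)
  then obtain a where a: "\<And>q. q < s \<Longrightarrow> col R q = lincomb (a q) S" by metis
  define T where "T = b ` {..<r} \<union> c ` {..<s}"
  have T: "finite T" by (simp add: T_def)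
  define u where "u x i = (if i \<in> b ` {..<r} then vec_index x (the_inv_into {..<r} b i) else 0)" for x :: "complex Matrix.vec" and i
  define v where "v x j = (if j \<in> c ` {..<s} then a (the_inv_into {..<s} c j) x else 0)" for x :: "complex Matrix.vec" and j
  have "fmat_of b c R = (\<Sum>x\<in>S. fmat_on T (\<lambda>i j. u x i * v x j))"
  proof (rule fmat_of_eqI[OF R b c])
    fix p q assume pq: "p < r" "q < s"
    have "R $$ (p, q) = vec_index (col R q) p" using R pq by auto
    also have "\<dots> = (\<Sum>x\<in>S. a q x * vec_index x p)"
      unfolding a[OF pq(2)] using pq(1) Sc by (rule lincomb_index)
    also have "\<dots> = entry (\<Sum>x\<in>S. fmat_on T (\<lambda>i j. u x i * v x j)) (b p) (c q)"
      using pq b c by (simp add: entry_fmat_on T) (auto simp: T_def u_def v_def the_inv_into_f_f mult.commute)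
    finally show "entry (\<Sum>x\<in>S. fmat_on T (\<lambda>i j. u x i * v x j)) (b p) (c q) = R $$ (p, q)" by simp
  next
    fix i j assume "i \<notin> b ` {..<r} \<or> j \<notin> c ` {..<s}"
    then show "entry (\<Sum>x\<in>S. fmat_on T (\<lambda>i j. u x i * v x j)) i j = 0"
      by (auto simp: entry_fmat_on T u_def v_def intro!: sum.neutral)
  qed
  also have "lr (card S) \<dots>" by (intro lr_sum lr_outer_product finS T)
  finally show ?thesis by (simp add: rank)
qed

lemma mat_rank_le_lr:
  assumes "lr k X"
  shows "mat_rank (mat_of_fmat b c r s X) \<le> k"
  using assms
proof (induction rule: lr.induct)
  case lr_0
  have "mat_of_fmat b c r s 0 = 0\<^sub>m r s" by (rule eq_matI) (auto simp: mat_of_fmat_def)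
  then show ?case using vec_space.rank_0I[of r s] by simp
next
  case (lr_Suc k X U i V)
  let ?m = "mat_of_fmat b c r s"
  have e: "entry (U * idm {i} * V) x y = entry U x i * entry V i y" for x y
  proof -
    have "entry (U * idm {i} * V) x y =
        (\<Sum>l\<in>insert i (fsupp U). entry U x l * (if l = i then entry V l y else 0))"
      unfolding mult.assoc by (subst entry_times[of "insert i (fsupp U)"]) (auto simp: entry_mult_idm)
    also have "\<dots> = (\<Sum>l\<in>insert i (fsupp U). if l = i then entry U x i * entry V i y else 0)"
      by (rule sum.cong) auto
    finally show ?thesis by simp
  qed
  have "?m (X + U * idm {i} * V) = ?m X + ?m (U * idm {i} * V)"
    by (rule eq_matI) (auto simp: mat_of_fmat_def)
  moreover have "vec_space.rank r (?m X + ?m (U * idm {i} * V)) \<le>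
      vec_space.rank r (?m X) + vec_space.rank r (?m (U * idm {i} * V))"
    by (rule vec_space.rank_subadditive[where nc = s]) (rule mat_of_fmat_carrier)+
  moreover have "vec_space.rank r (?m (U * idm {i} * V)) \<le> 1"
    by (rule vec_space.rank_le_1_product_entries[of _ _ s "\<lambda>p. entry U (b p) i" "\<lambda>q. entry V i (c q)"])
      (auto simp: mat_of_fmat_def e)
  moreover have "dim_row (?m Z) = r" for Z by (simp add: mat_of_fmat_def)
  ultimately show ?case using lr_Suc.IH by simp
qed

section \<open>Spectral norm and operator bounds\<close>

lemma l2_norm_vec_sq: "v \<in> carrier_vec n \<Longrightarrow> (l2_norm_vec v)\<^sup>2 = (\<Sum>i<n. (cmod (vec_index v i))\<^sup>2)"
  by (auto simp: l2_norm_vec_def L2_set_def sum_nonneg)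

lemma l2_norm_vec_nonneg [simp]: "0 \<le> l2_norm_vec v"
  by (simp add: l2_norm_vec_def)

lemma l2_norm_vec_smult: "l2_norm_vec (a \<cdot>\<^sub>v v) = cmod a * l2_norm_vec v"
proof -
  have "L2_set (\<lambda>i. cmod (vec_index (a \<cdot>\<^sub>v v) i)) {..<dim_vec v} =
      L2_set (\<lambda>i. cmod a * cmod (vec_index v i)) {..<dim_vec v}"
    by (rule L2_set_cong) (auto simp: norm_mult)
  then show ?thesis by (simp add: l2_norm_vec_def L2_set_right_distrib)
qed

lemma l2_norm_mult_le_opb:
  assumes N: "N \<in> carrier_mat r s" and b: "inj_on b {..<r}" and c: "inj_on c {..<s}"
    and "opb \<omega> (fmat_of b c N)" and v: "v \<in> carrier_vec s"
  shows "l2_norm_vec (N *\<^sub>v v) \<le> \<omega> * l2_norm_vec v"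
proof -
  \<comment> \<open>The vector becomes a matrix with one column under an arbitrary label
    \<open>d\<close>; its Frobenius norm is the Euclidean norm.\<close>
  define V where "V = Matrix.mat s 1 (\<lambda>(i, j). vec_index v i)"
  have V: "V \<in> carrier_mat s 1" by (simp add: V_def)
  obtain d :: "nat \<Rightarrow> 'a" where True by simp
  have d: "inj_on d {..<1}" by (auto intro: inj_onI)
  have norm_col: "norm (fmat_of e d W) = l2_norm_vec w"
    if W: "W \<in> carrier_mat m 1" and e: "inj_on e {..<m}" and w: "w \<in> carrier_vec m"
      and "\<And>i. i < m \<Longrightarrow> W $$ (i, 0) = vec_index w i" for W w m e
  proof -
    have "(norm (fmat_of e d W))\<^sup>2 = (\<Sum>i\<in>e ` {..<m}. \<Sum>j\<in>d ` {..<1}. (cmod (entry (fmat_of e d W) i j))\<^sup>2)"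
      by (rule norm_fmat_sq) (auto simp: entry_fmat_of_0[OF W])
    also have "\<dots> = (\<Sum>i<m. \<Sum>j<1. (cmod (entry (fmat_of e d W) (e i) (d j)))\<^sup>2)"
      by (simp add: sum.reindex[OF e] lessThan_Suc)
    also have "\<dots> = (\<Sum>i<m. (cmod (vec_index w i))\<^sup>2)"
      using that by (intro sum.cong) (auto simp: entry_fmat_of[OF W e d])
    also have "\<dots> = (l2_norm_vec w)\<^sup>2" by (rule l2_norm_vec_sq[OF w, symmetric])
    finally show ?thesis by simp
  qed
  have "norm (fmat_of b c N * fmat_of c d V) \<le> \<omega> * norm (fmat_of c d V)"
    using assms(4) by (rule opb_normD)
  moreover have "norm (fmat_of c d V) = l2_norm_vec v"
    by (rule norm_col[OF V c v]) (simp add: V_def)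
  moreover have "norm (fmat_of b d (N * V)) = l2_norm_vec (N *\<^sub>v v)"
    by (rule norm_col) (use N V v b in \<open>auto simp: scalar_prod_def V_def intro!: sum.cong\<close>)
  ultimately show ?thesis using fmat_of_mult[OF N V b c d] by simp
qed

lemma spectral_norm_le:
  assumes N: "N \<in> carrier_mat r s" and b: "inj_on b {..<r}" and c: "inj_on c {..<s}"
    and \<omega>: "opb \<omega> (fmat_of b c N)"
  shows "spectral_norm N \<le> \<omega>"
  unfolding spectral_norm_def
proof (rule cSup_least)
  have "l2_norm_vec (0\<^sub>v (dim_col N)) \<le> 1" by (simp add: l2_norm_vec_def L2_set_def)
  then show "{l2_norm_vec (N *\<^sub>v v) |v. v \<in> carrier_vec (dim_col N) \<and> l2_norm_vec v \<le> 1} \<noteq> {}"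
    by (auto intro: exI[of _ "0\<^sub>v (dim_col N)"])
next
  fix x assume "x \<in> {l2_norm_vec (N *\<^sub>v v) |v. v \<in> carrier_vec (dim_col N) \<and> l2_norm_vec v \<le> 1}"
  then obtain v where v: "x = l2_norm_vec (N *\<^sub>v v)" "v \<in> carrier_vec s" "l2_norm_vec v \<le> 1"
    using N by auto
  have "x \<le> \<omega> * l2_norm_vec v" unfolding v(1) by (rule l2_norm_mult_le_opb[OF N b c \<omega> v(2)])
  also have "\<dots> \<le> \<omega> * 1" by (intro mult_left_mono v opb_nonneg[OF \<omega>])
  finally show "x \<le> \<omega>" by simp
qed

lemma l2_norm_mult_le_spectral_norm:
  assumes N: "N \<in> carrier_mat r s" and v: "v \<in> carrier_vec s"
  shows "l2_norm_vec (N *\<^sub>v v) \<le> spectral_norm N * l2_norm_vec v"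
proof (cases "l2_norm_vec v = 0")
  case True
  then have "v = 0\<^sub>v s"
    using v by (intro eq_vecI) (auto simp: l2_norm_vec_def L2_set_eq_0_iff)
  then have "N *\<^sub>v v = 0\<^sub>v r" using N by (intro eq_vecI) auto
  with True show ?thesis by (simp add: l2_norm_vec_def L2_set_def)
next
  case False
  then have pos: "0 < l2_norm_vec v" using l2_norm_vec_nonneg[of v] by linarith
  let ?S = "{l2_norm_vec (N *\<^sub>v v) |v. v \<in> carrier_vec (dim_col N) \<and> l2_norm_vec v \<le> 1}"
  let ?M = "norm (fmat_of id id N :: nat fmat)"
  have bdd: "bdd_above ?S"
  proof (rule bdd_aboveI)
    fix x assume "x \<in> ?S"
    then obtain w where w: "x = l2_norm_vec (N *\<^sub>v w)" "w \<in> carrier_vec s" "l2_norm_vec w \<le> 1"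
      using N by auto
    have "x \<le> ?M * l2_norm_vec w"
      unfolding w(1) by (rule l2_norm_mult_le_opb[OF N _ _ opb_norm[OF order_refl] w(2)]) auto
    also have "\<dots> \<le> ?M * 1" by (intro mult_left_mono w) auto
    finally show "x \<le> ?M" by simp
  qed
  let ?a = "complex_of_real (inverse (l2_norm_vec v))"
  have 1: "l2_norm_vec (?a \<cdot>\<^sub>v v) = 1"
    using pos by (simp add: l2_norm_vec_smult norm_inverse)
  have "l2_norm_vec (N *\<^sub>v (?a \<cdot>\<^sub>v v)) \<le> spectral_norm N"
    unfolding spectral_norm_def
    by (rule cSup_upper[OF _ bdd]) (use 1 v N in auto)
  moreover have "N *\<^sub>v (?a \<cdot>\<^sub>v v) = ?a \<cdot>\<^sub>v (N *\<^sub>v v)"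
    using N v by (rule mult_mat_vec)
  ultimately have "inverse (l2_norm_vec v) * l2_norm_vec (N *\<^sub>v v) \<le> spectral_norm N"
    using pos by (simp add: l2_norm_vec_smult norm_inverse)
  then show ?thesis using pos by (simp add: field_simps)
qed

text \<open>On each column of \<open>Y\<close> the matrix acts as on a vector, rows of
  \<open>Y\<close> outside the labels of \<open>c\<close> being ignored; the squares add up over the
  columns.\<close>

lemma opb_fmat_of:
  assumes N: "N \<in> carrier_mat r s" and b: "inj_on b {..<r}" and c: "inj_on c {..<s}"
    and \<omega>: "spectral_norm N \<le> \<omega>"
  shows "opb \<omega> (fmat_of b c N)"
  unfolding opb_def
proof safe
  have "0 \<le> spectral_norm N"
  proof (cases "s = 0")
    case False
    have "1 = l2_norm_vec (unit_vec s 0 :: complex Matrix.vec)"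
    proof -
      have "(l2_norm_vec (unit_vec s 0 :: complex Matrix.vec))\<^sup>2 = (\<Sum>i<s. if i = 0 then 1 else 0)"
        by (rule trans[OF l2_norm_vec_sq sum.cong]) auto
      then show ?thesis using False l2_norm_vec_nonneg[of "unit_vec s 0"] by (simp add: power2_eq_1_iff)
    qed
    with l2_norm_mult_le_spectral_norm[OF N, of "unit_vec s 0"] show ?thesis
      by (metis l2_norm_vec_nonneg mult.right_neutral order_trans unit_vec_carrier)
  next
    \<comment> \<open>Without columns there is no unit vector to test with; the set under the
      supremum is then a singleton.\<close>
    case True
    have "\<exists>x. {l2_norm_vec (N *\<^sub>v v) |v. v \<in> carrier_vec (dim_col N) \<and> l2_norm_vec v \<le> 1} = {x} \<and> 0 \<le> x"
    proof (intro exI conjI)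
      show "{l2_norm_vec (N *\<^sub>v v) |v. v \<in> carrier_vec (dim_col N) \<and> l2_norm_vec v \<le> 1} = {l2_norm_vec (N *\<^sub>v 0\<^sub>v 0)}"
        using N True by (auto simp: l2_norm_vec_def L2_set_def scalar_prod_def intro!: exI[of _ "0\<^sub>v 0"])
    qed simp
    then show ?thesis unfolding spectral_norm_def by auto
  qed
  then show "0 \<le> \<omega>" using \<omega> by simp
  fix Y :: "'a fmat"
  let ?X = "fmat_of b c N" and ?T = "b ` {..<r} \<union> c ` {..<s} \<union> fsupp Y"
  have col: "(norm (?X * (Y * idm {j})))\<^sup>2 \<le> \<omega>\<^sup>2 * (norm (Y * idm {j}))\<^sup>2" for j
  proof -
    define v where "v = Matrix.vec s (\<lambda>q. entry Y (c q) j)"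
    have v: "v \<in> carrier_vec s" by (simp add: v_def)
    have prod: "entry (?X * Y) i j = (\<Sum>q<s. entry ?X i (c q) * entry Y (c q) j)" for i
    proof -
      have "entry (?X * Y) i j = (\<Sum>k\<in>?T. entry ?X i k * entry Y k j)"
        by (rule entry_times) auto
      also have "\<dots> = (\<Sum>k\<in>c ` {..<s}. entry ?X i k * entry Y k j)"
        by (rule sum.mono_neutral_right) (auto simp: entry_fmat_of_0[OF N])
      finally show ?thesis by (simp add: sum.reindex[OF c])
    qed
    have "(norm (?X * (Y * idm {j})))\<^sup>2 = (\<Sum>i\<in>b ` {..<r}. \<Sum>l\<in>{j}. (cmod (entry (?X * Y * idm {j}) i l))\<^sup>2)"
      unfolding mult.assoc[symmetric]
      by (rule norm_fmat_sq) (auto simp: entry_mult_idm prod entry_fmat_of_0[OF N])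
    also have "\<dots> = (\<Sum>p<r. (cmod (entry (?X * Y) (b p) j))\<^sup>2)"
      by (simp add: sum.reindex[OF b] entry_mult_idm)
    also have "\<dots> = (\<Sum>p<r. (cmod (vec_index (N *\<^sub>v v) p))\<^sup>2)"
      by (intro sum.cong refl)
        (use N v b c in \<open>simp add: prod entry_fmat_of[OF N b c] scalar_prod_def v_def lessThan_atLeast0\<close>)
    also have "\<dots> = (l2_norm_vec (N *\<^sub>v v))\<^sup>2"
      by (rule l2_norm_vec_sq[OF mult_mat_vec_carrier[OF N v], symmetric])
    also have "\<dots> \<le> (spectral_norm N * l2_norm_vec v)\<^sup>2"
      by (intro power_mono l2_norm_mult_le_spectral_norm[OF N v]) simp
    also have "\<dots> \<le> (\<omega> * l2_norm_vec v)\<^sup>2"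
      using \<open>0 \<le> spectral_norm N\<close> \<omega> by (intro power_mono mult_right_mono) auto
    also have "\<dots> = \<omega>\<^sup>2 * (\<Sum>q<s. (cmod (entry Y (c q) j))\<^sup>2)"
      by (simp add: power_mult_distrib l2_norm_vec_sq[OF v]) (simp add: v_def)
    also have "(\<Sum>q<s. (cmod (entry Y (c q) j))\<^sup>2) = (\<Sum>k\<in>c ` {..<s}. (cmod (entry Y k j))\<^sup>2)"
      by (simp add: sum.reindex[OF c])
    also have "\<dots> \<le> (\<Sum>k\<in>?T. (cmod (entry Y k j))\<^sup>2)"
      by (intro sum_mono2) auto
    also have "\<dots> = (norm (Y * idm {j}))\<^sup>2"
      by (subst norm_fmat_sq[of ?T "{j}"]) (auto simp: entry_mult_idm entry_nonzero_fsupp)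
    finally show ?thesis by (simp add: mult_left_mono)
  qed
  have "(norm (?X * Y))\<^sup>2 = (\<Sum>j\<in>?T. (norm (?X * (Y * idm {j})))\<^sup>2)"
    unfolding mult.assoc[symmetric]
    by (rule norm_sq_columns, simp, rule fsupp_mult)
      (use N fsupp_fmat_on[of "b ` {..<r} \<union> c ` {..<s}"] in \<open>auto simp: fmat_of_def\<close>)
  also have "\<dots> \<le> (\<Sum>j\<in>?T. \<omega>\<^sup>2 * (norm (Y * idm {j}))\<^sup>2)" by (intro sum_mono col)
  also have "\<dots> = \<omega>\<^sup>2 * (norm Y)\<^sup>2"
    unfolding sum_distrib_left[symmetric]
    by (rule arg_cong[of _ _ "\<lambda>x. \<omega>\<^sup>2 * x"], rule norm_sq_columns[symmetric]) auto
  also have "\<dots> = (\<omega> * norm Y)\<^sup>2" by (simp add: power_mult_distrib)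
  finally show "norm (?X * Y) \<le> \<omega> * norm Y"
    by (rule power2_le_imp_le) (simp add: \<open>0 \<le> \<omega>\<close>)
qed

section \<open>Enumeration of multi-indices\<close>

lemma bij_betw_dindex_range:
  "bij_betw vec_lambda (\<Pi>\<^sub>E k\<in>UNIV. {1..n $ k}) {1..n :: ('d::finite) dindex}"
  by (rule bij_betwI[where g = vec_nth]) (auto simp: Finite_Cartesian_Product.less_eq_vec_def PiE_iff)

lemma finite_dindex_range [simp]: "finite {1..n :: ('d::finite) dindex}"
  using bij_betw_finite[OF bij_betw_dindex_range[of n]] by (simp add: finite_PiE)

lemma card_dindex_range:
  assumes "1 \<le> (n :: ('d::finite) dindex)"
  shows "card {1..n} = level_size n"
proof -
  have pos: "0 \<le> n $ k" for k
    using assms by (auto simp: Finite_Cartesian_Product.less_eq_vec_def dest!: spec[of _ k])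
  have "card {1..n} = (\<Prod>k\<in>UNIV. card {1..n $ k})"
    using bij_betw_same_card[OF bij_betw_dindex_range[of n]] by (simp add: card_PiE)
  then have "int (card {1..n}) = (\<Prod>k\<in>UNIV. n $ k)"
    using pos by simp
  then show ?thesis by (simp add: level_size_def)
qed

lemma of_nat_level_size:
  assumes "1 \<le> (n :: ('d::finite) dindex)"
  shows "real (level_size n) = (\<Prod>k\<in>UNIV. real_of_int (n $ k))"
proof -
  have "0 \<le> n $ k" for k
    using assms by (auto simp: Finite_Cartesian_Product.less_eq_vec_def dest!: spec[of _ k])
  then have "int (level_size n) = (\<Prod>k\<in>UNIV. n $ k)"
    by (simp add: level_size_def prod_nonneg)
  then have "real_of_int (int (level_size n)) = real_of_int (\<Prod>k\<in>UNIV. n $ k)" by simp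
  then show ?thesis by simp
qed

lemma level_size_pos: "1 \<le> (n :: ('d::finite) dindex) \<Longrightarrow> 0 < level_size n"
  using card_dindex_range[of n] by (metis atLeastatMost_empty_iff2 card_gt_0_iff finite_dindex_range)

lemma lex_less_irrefl: "\<not> lex_less i i"
  by (auto simp: lex_less_def)

lemma lex_less_trans:
  assumes "lex_less i j" "lex_less j m"
  shows "lex_less i m"
proof -
  obtain k where k: "i $ k < j $ k" "\<forall>l<k. i $ l = j $ l" using assms(1) by (auto simp: lex_less_def)
  obtain k' where k': "j $ k' < m $ k'" "\<forall>l<k'. j $ l = m $ l" using assms(2) by (auto simp: lex_less_def)
  show ?thesis
  proof (cases k k' rule: linorder_cases)
    case less
    with k k' show ?thesis unfolding lex_less_def by (intro exI[of _ k]) auto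
  next
    case equal
    with k k' show ?thesis unfolding lex_less_def by (intro exI[of _ k]) auto
  next
    case greater
    with k k' show ?thesis unfolding lex_less_def by (intro exI[of _ k']) auto
  qed
qed

lemma lex_less_total:
  fixes i j :: "('d::{finite,linorder}) dindex"
  assumes "i \<noteq> j"
  shows "lex_less i j \<or> lex_less j i"
proof -
  let ?D = "{k. i $ k \<noteq> j $ k}"
  have ne: "?D \<noteq> {}" using assms by (auto simp: Finite_Cartesian_Product.vec_eq_iff)
  let ?k = "Min ?D"
  have "?k \<in> ?D" using ne by (intro Min_in) auto
  moreover have "i $ l = j $ l" if "l < ?k" for l
    using that ne by (metis (mono_tags, lifting) Min_le finite mem_Collect_eq not_le)
  ultimately show ?thesis unfolding lex_less_def by (metis (mono_tags, lifting) mem_Collect_eq linorder_less_linear)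
qed

text \<open>The number of predecessors is strictly increasing along a total order, hence injective,
  and a \<open>d\<close>-index does not precede itself, so the value stays below the cardinality.
  Counting gives surjectivity.\<close>

lemma bij_betw_lex_pos:
  assumes "1 \<le> (n :: ('d::{finite,linorder}) dindex)"
  shows "bij_betw (lex_pos n) {1..n} {..<level_size n}"
proof -
  have less: "lex_pos n i < lex_pos n j" if "i \<in> {1..n}" "lex_less i j" for i j
    unfolding lex_pos_def
  proof (rule psubset_card_mono)
    have "i \<in> {j' \<in> {1..n}. lex_less j' j}" "i \<notin> {j \<in> {1..n}. lex_less j i}"
      using that lex_less_irrefl by auto
    moreover have "{j \<in> {1..n}. lex_less j i} \<subseteq> {j' \<in> {1..n}. lex_less j' j}"
      using lex_less_trans[OF _ that(2)] by auto
    ultimately show "{j \<in> {1..n}. lex_less j i} \<subset> {j' \<in> {1..n}. lex_less j' j}" by blast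
  qed (rule finite_subset[OF _ finite_dindex_range], blast)
  have inj: "inj_on (lex_pos n) {1..n}"
    using less lex_less_total by (metis inj_onI less_irrefl)
  have "lex_pos n ` {1..n} \<subseteq> {..<level_size n}"
  proof safe
    fix i assume i: "i \<in> {1..n}"
    have "lex_pos n i < card {1..n}"
      unfolding lex_pos_def
      by (rule psubset_card_mono[OF finite_dindex_range]) (use i lex_less_irrefl[of i] in blast)
    then show "lex_pos n i < level_size n" by (simp add: card_dindex_range assms)
  qed
  moreover have "card (lex_pos n ` {1..n}) = card {..<level_size n}"
    using card_image[OF inj] by (simp add: card_dindex_range assms)
  ultimately have "lex_pos n ` {1..n} = {..<level_size n}"
    by (intro card_subset_eq) auto
  with inj show ?thesis by (simp add: bij_betw_def)
qed

text \<open>The label of row \<open>p\<close> consists of the \<open>d\<close>-index of its block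
  and its position inside the block. Enlarging the blocks changes row numbers but not
  labels.\<close>

definition block_enum :: "('d::{finite,linorder}) dindex \<Rightarrow> nat \<Rightarrow> nat \<Rightarrow> 'd dindex \<times> nat" where
  "block_enum n r p = (lex_index n (p div r), p mod r)"

context
  fixes n :: "('d::{finite,linorder}) dindex"
  assumes n: "1 \<le> n"
begin

lemma lex_index_lex_pos: "i \<in> {1..n} \<Longrightarrow> lex_index n (lex_pos n i) = i"
  using bij_betw_lex_pos[OF n] unfolding lex_index_def bij_betw_def
  by (simp add: the_inv_into_f_f)

lemma lex_pos_less: "i \<in> {1..n} \<Longrightarrow> lex_pos n i < level_size n"
  using bij_betw_lex_pos[OF n] by (auto simp: bij_betw_def)

lemma lex_index_props:
  assumes "p < level_size n"
  shows "lex_index n p \<in> {1..n}" "lex_pos n (lex_index n p) = p"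
proof -
  have "p \<in> lex_pos n ` {1..n}" using assms bij_betw_lex_pos[OF n] by (auto simp: bij_betw_def)
  then obtain i where "i \<in> {1..n}" "p = lex_pos n i" by auto
  then show "lex_index n p \<in> {1..n}" "lex_pos n (lex_index n p) = p"
    by (simp_all only: lex_index_lex_pos)
qed

lemma block_pos_less: "i \<in> {1..n} \<Longrightarrow> \<alpha> < r \<Longrightarrow> lex_pos n i * r + \<alpha> < level_size n * r"
proof -
  assume "i \<in> {1..n}" "\<alpha> < r"
  then have "lex_pos n i * r + \<alpha> < Suc (lex_pos n i) * r" by simp
  also have "\<dots> \<le> level_size n * r"
    using lex_pos_less[OF \<open>i \<in> {1..n}\<close>] by (intro mult_le_mono1) simp
  finally show ?thesis .
qed

lemma block_enum_pos: "i \<in> {1..n} \<Longrightarrow> \<alpha> < r \<Longrightarrow> block_enum n r (lex_pos n i * r + \<alpha>) = (i, \<alpha>)"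
  by (simp add: block_enum_def lex_index_lex_pos)

lemma div_less_level_size: "p < level_size n * r \<Longrightarrow> p div r < level_size n"
  by (simp add: less_mult_imp_div_less)

lemma inj_block_enum: "inj_on (block_enum n r) {..<level_size n * r}"
proof (rule inj_onI)
  fix p q assume pq: "p \<in> {..<level_size n * r}" "q \<in> {..<level_size n * r}"
    and eq: "block_enum n r p = block_enum n r q"
  then have "p div r = q div r"
    using lex_index_props(2)[OF div_less_level_size] unfolding block_enum_def by (metis lessThan_iff fst_conv)
  with eq show "p = q" unfolding block_enum_def by (metis div_mult_mod_eq snd_conv)
qed

lemma block_enum_image: "block_enum n r ` {..<level_size n * r} = {1..n} \<times> {..<r}"
proof (intro equalityI subsetI)
  fix x assume "x \<in> block_enum n r ` {..<level_size n * r}"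
  then obtain p where p: "p < level_size n * r" "x = block_enum n r p" by auto
  then have "0 < r" by (cases r) auto
  with p show "x \<in> {1..n} \<times> {..<r}"
    using lex_index_props(1)[OF div_less_level_size[OF p(1)]] by (simp add: block_enum_def)
next
  fix x assume "x \<in> {1..n} \<times> {..<r}"
  then obtain i \<alpha> where x: "x = (i, \<alpha>)" "i \<in> {1..n}" "\<alpha> < r" by auto
  with block_enum_pos[of i \<alpha> r] block_pos_less[of i \<alpha> r]
  show "x \<in> block_enum n r ` {..<level_size n * r}" by (metis imageI lessThan_iff)
qed

end

abbreviation block_fmat :: "('d::{finite,linorder}) dindex \<Rightarrow> nat \<Rightarrow> nat \<Rightarrow> complex mat \<Rightarrow> ('d dindex \<times> nat) fmat" where
  "block_fmat n r s \<equiv> fmat_of (block_enum n r) (block_enum n s)"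

lemma entry_block_fmat:
  assumes n: "1 \<le> n" and X: "X \<in> carrier_mat (level_size n * r) (level_size n * s)"
  shows "entry (block_fmat n r s X) (i, \<alpha>) (k, \<beta>) =
    (if i \<in> {1..n} \<and> k \<in> {1..n} \<and> \<alpha> < r \<and> \<beta> < s
     then X $$ (lex_pos n i * r + \<alpha>, lex_pos n k * s + \<beta>) else 0)"
proof (cases "i \<in> {1..n} \<and> k \<in> {1..n} \<and> \<alpha> < r \<and> \<beta> < s")
  case True
  then show ?thesis
    using entry_fmat_of[OF X inj_block_enum[OF n] inj_block_enum[OF n],
        of "lex_pos n i * r + \<alpha>" "lex_pos n k * s + \<beta>"] n
    by (simp add: block_enum_pos block_pos_less)
next
  case False
  then have "entry (block_fmat n r s X) (i, \<alpha>) (k, \<beta>) = 0"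
    by (intro entry_fmat_of_0[OF X]) (auto simp: block_enum_image[OF n])
  with False show ?thesis by auto
qed

lemma block_mat_carrier: "block_mat n r s x \<in> carrier_mat (level_size n * r) (level_size n * s)"
  by (simp add: block_mat_def)

lemma entry_block_fmat_block_mat:
  assumes n: "1 \<le> n"
  shows "entry (block_fmat n r s (block_mat n r s x)) (i, \<alpha>) (k, \<beta>) =
    (if i \<in> {1..n} \<and> k \<in> {1..n} \<and> \<alpha> < r \<and> \<beta> < s then x i k $$ (\<alpha>, \<beta>) else 0)"
  unfolding entry_block_fmat[OF n block_mat_carrier]
  using block_pos_less[OF n] lex_index_lex_pos[OF n]
  by (auto simp: block_mat_def)

text \<open>Old entries keep their labels and the added ones vanish. This makes the extension
  operator invisible in the algebra and unifies rectangular with square sequences.\<close>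

lemma block_fmat_ext_block_mat:
  assumes n: "1 \<le> n" and X: "X \<in> carrier_mat (level_size n * r) (level_size n * s)" and t: "max r s \<le> t"
  shows "block_fmat n t t (ext_block_mat n r s t X) = block_fmat n r s X"
proof (rule fmat_eqI)
  fix x y :: "'a dindex \<times> nat"
  obtain i \<alpha> k \<beta> where xy: "x = (i, \<alpha>)" "y = (k, \<beta>)" by (metis surj_pair)
  show "entry (block_fmat n t t (ext_block_mat n r s t X)) x y = entry (block_fmat n r s X) x y"
    unfolding xy ext_block_mat_def entry_block_fmat_block_mat[OF n] entry_block_fmat[OF n X]
    using t by (auto simp: ext_mat_def block_of_def)
qed

section \<open>Generating sequences\<close>

text \<open>
  The list element \<open>(a, j, \<alpha>, \<beta>)\<close> stands for the matrices \<open>D\<^sub>n(a I) T\<^sub>n(exp (\<i> j \<cdot> \<theta>) E\<^sub>\<alpha>\<^sub>\<beta>)\<close>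
  and for their symbol \<open>a(x) exp (\<i> j \<cdot> \<theta>) E\<^sub>\<alpha>\<^sub>\<beta>\<close>; a list stands for the sum.
\<close>

type_synonym 'd term4 = "('d point \<Rightarrow> complex) \<times> 'd dindex \<times> nat \<times> nat"

definition grid :: "('d::finite) dindex \<Rightarrow> 'd dindex \<Rightarrow> 'd point" where
  "grid n i = (\<chi> k. of_int (i $ k) / of_int (n $ k))"

text \<open>The product of the two matrices in closed form: the diagonal matrix scales block rows,
  so \<open>a\<close> is sampled at the row index \<open>fst x\<close>.\<close>

definition gen_mat :: "('d::finite) dindex \<Rightarrow> 'd term4 \<Rightarrow> ('d dindex \<times> nat) fmat" where
  "gen_mat n = (\<lambda>(a, j, \<alpha>, \<beta>). fmat_on ({1..n} \<times> {\<alpha>, \<beta>})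
     (\<lambda>x y. if snd x = \<alpha> \<and> snd y = \<beta> \<and> fst x - fst y = j then a (grid n (fst x)) else 0))"

definition gen_sym :: "('d::finite) term4 \<Rightarrow> 'd point \<times> 'd point \<Rightarrow> nat fmat" where
  "gen_sym = (\<lambda>(a, j, \<alpha>, \<beta>) z. fmat_on {\<alpha>, \<beta>}
     (\<lambda>p q. if p = \<alpha> \<and> q = \<beta> then a (fst z) * cis (phase j (snd z)) else 0))"

definition seq_mat :: "('d::finite) term4 list \<Rightarrow> 'd dindex \<Rightarrow> ('d dindex \<times> nat) fmat" where
  "seq_mat ts n = (\<Sum>\<tau>\<leftarrow>ts. gen_mat n \<tau>)"

definition seq_sym :: "('d::finite) term4 list \<Rightarrow> 'd point \<times> 'd point \<Rightarrow> nat fmat" where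
  "seq_sym ts z = (\<Sum>\<tau>\<leftarrow>ts. gen_sym \<tau> z)"

definition term_mult :: "('d::finite) term4 \<Rightarrow> 'd term4 \<Rightarrow> 'd term4 list" where
  "term_mult = (\<lambda>(a, j, \<alpha>, \<beta>) (b, k, \<gamma>, \<delta>). if \<beta> = \<gamma> then [(\<lambda>x. a x * b x, j + k, \<alpha>, \<delta>)] else [])"

definition seq_mult :: "('d::finite) term4 list \<Rightarrow> 'd term4 list \<Rightarrow> 'd term4 list" where
  "seq_mult ts ss = concat (map (\<lambda>\<tau>. concat (map (term_mult \<tau>) ss)) ts)"

definition seq_adj :: "('d::finite) term4 list \<Rightarrow> 'd term4 list" where
  "seq_adj = map (\<lambda>(a, j, \<alpha>, \<beta>). (\<lambda>x. cnj (a x), - j, \<beta>, \<alpha>))"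

definition seq_smult :: "complex \<Rightarrow> ('d::finite) term4 list \<Rightarrow> 'd term4 list" where
  "seq_smult c = map (\<lambda>(a, j, \<alpha>, \<beta>). (\<lambda>x. c * a x, j, \<alpha>, \<beta>))"

definition seq_idm :: "nat \<Rightarrow> ('d::finite) term4 list" where
  "seq_idm t = map (\<lambda>\<alpha>. (\<lambda>_. 1, 0, \<alpha>, \<alpha>)) [0..<t]"

text \<open>Continuity is all that the estimates use; smoothness is tracked separately by
  \<open>seq_smooth\<close>, for the sums that \<open>glt_square\<close> asks for.\<close>

definition seq_ok :: "nat \<Rightarrow> ('d::finite) term4 list \<Rightarrow> bool" where
  "seq_ok t ts \<longleftrightarrow> (\<forall>(a, j, \<alpha>, \<beta>) \<in> set ts. continuous_on (cbox 0 1) a \<and> \<alpha> < t \<and> \<beta> < t)"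

lemma seq_ok_simps [simp]:
  "seq_ok t []"
  "seq_ok t ((a, j, \<alpha>, \<beta>) # ts) \<longleftrightarrow> continuous_on (cbox 0 1) a \<and> \<alpha> < t \<and> \<beta> < t \<and> seq_ok t ts"
  "seq_ok t (ts @ ss) \<longleftrightarrow> seq_ok t ts \<and> seq_ok t ss"
  unfolding seq_ok_def by (simp_all add: ball_Un)

lemma seq_ok_mult: "seq_ok t ts \<Longrightarrow> seq_ok t ss \<Longrightarrow> seq_ok t (seq_mult ts ss)"
  unfolding seq_ok_def seq_mult_def term_mult_def
  by (fastforce split: if_splits prod.splits intro!: continuous_intros)

lemma seq_ok_adj: "seq_ok t ts \<Longrightarrow> seq_ok t (seq_adj ts)"
  unfolding seq_ok_def seq_adj_def by (fastforce intro!: continuous_intros)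

lemma seq_ok_smult: "seq_ok t ts \<Longrightarrow> seq_ok t (seq_smult c ts)"
  unfolding seq_ok_def seq_smult_def by (fastforce intro!: continuous_intros)

lemma seq_ok_idm: "seq_ok t (seq_idm t)"
  unfolding seq_ok_def seq_idm_def by auto

lemma seq_simps [simp]:
  "seq_mat [] n = 0" "seq_mat (\<tau> # ts) n = gen_mat n \<tau> + seq_mat ts n"
  "seq_mat (ts @ ss) n = seq_mat ts n + seq_mat ss n"
  "seq_sym [] z = 0" "seq_sym (\<tau> # ts) z = gen_sym \<tau> z + seq_sym ts z"
  "seq_sym (ts @ ss) z = seq_sym ts z + seq_sym ss z"
  by (simp_all add: seq_mat_def seq_sym_def)

lemma entry_gen_mat:
  "entry (gen_mat n (a, j, \<alpha>, \<beta>)) (i, \<alpha>') (k, \<beta>') =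
    (if i \<in> {1..n} \<and> k \<in> {1..n} \<and> \<alpha>' = \<alpha> \<and> \<beta>' = \<beta> \<and> i - k = j then a (grid n i) else 0)"
  by (auto simp: gen_mat_def entry_fmat_on)

lemma entry_gen_sym:
  "entry (gen_sym (a, j, \<alpha>, \<beta>) z) p q = (if p = \<alpha> \<and> q = \<beta> then a (fst z) * cis (phase j (snd z)) else 0)"
  by (auto simp: gen_sym_def entry_fmat_on)

lemma phase_add: "phase (j + k) \<theta> = phase j \<theta> + phase k \<theta>"
  by (simp add: phase_def sum.distrib algebra_simps)

lemma phase_uminus: "phase (- j) \<theta> = - phase j \<theta>"
  by (simp add: phase_def sum_negf)

lemma phase_0 [simp]: "phase 0 \<theta> = 0"
  by (simp add: phase_def)

lemma gen_sym_mult: "gen_sym \<tau> z * gen_sym \<sigma> z = seq_sym (term_mult \<tau> \<sigma>) z"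
proof -
  obtain a j \<alpha> \<beta> where \<tau>: "\<tau> = (a, j, \<alpha>, \<beta>)" by (metis prod_cases4)
  obtain b k \<gamma> \<delta> where \<sigma>: "\<sigma> = (b, k, \<gamma>, \<delta>)" by (metis prod_cases4)
  have "entry (gen_sym \<tau> z * gen_sym \<sigma> z) p q =
      (if p = \<alpha> \<and> q = \<delta> \<and> \<beta> = \<gamma> then a (fst z) * b (fst z) * cis (phase (j + k) (snd z)) else 0)" for p q
  proof -
    have "entry (gen_sym \<tau> z * gen_sym \<sigma> z) p q =
        (\<Sum>l\<in>{\<alpha>, \<beta>}. entry (gen_sym \<tau> z) p l * entry (gen_sym \<sigma> z) l q)"
      by (rule entry_times) (auto simp: \<tau> gen_sym_def dest!: subsetD[OF fsupp_fmat_on, rotated])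
    also have "\<dots> = (\<Sum>l\<in>{\<alpha>, \<beta>}. if l = \<beta> then
        (if p = \<alpha> \<and> q = \<delta> \<and> \<beta> = \<gamma> then a (fst z) * b (fst z) * cis (phase (j + k) (snd z)) else 0) else 0)"
      by (intro sum.cong) (auto simp: \<tau> \<sigma> entry_gen_sym phase_add cis_mult[symmetric])
    finally show ?thesis by simp
  qed
  then show ?thesis
    by (intro fmat_eqI) (simp add: \<tau> \<sigma> term_mult_def entry_gen_sym)
qed

lemma seq_sym_concat: "seq_sym (concat tss) z = (\<Sum>ts\<leftarrow>tss. seq_sym ts z)"
  by (induction tss) auto

lemma seq_sym_mult: "seq_sym (seq_mult ts ss) z = seq_sym ts z * seq_sym ss z"
proof -
  have 1: "seq_sym (concat (map (term_mult \<tau>) ss)) z = gen_sym \<tau> z * seq_sym ss z" for \<tau>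
    by (induction ss) (auto simp: gen_sym_mult distrib_left)
  show ?thesis
    unfolding seq_mult_def by (induction ts) (auto simp: 1 distrib_right)
qed

lemma seq_sym_adj: "seq_sym (seq_adj ts) z = adj (seq_sym ts z)"
proof (induction ts)
  case (Cons \<tau> ts)
  obtain a j \<alpha> \<beta> where \<tau>: "\<tau> = (a, j, \<alpha>, \<beta>)" by (metis prod_cases4)
  have "gen_sym (\<lambda>x. cnj (a x), - j, \<beta>, \<alpha>) z = adj (gen_sym \<tau> z)"
    by (rule fmat_eqI) (auto simp: \<tau> entry_gen_sym phase_uminus cis_cnj)
  with Cons show ?case by (simp add: seq_adj_def \<tau>)
qed (simp add: seq_adj_def)

lemma entry_seq_sym_smult: "entry (seq_sym (seq_smult c ts) z) p q = c * entry (seq_sym ts z) p q"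
proof (induction ts)
  case (Cons \<tau> ts)
  then show ?case
    by (cases \<tau>) (auto simp: seq_smult_def entry_gen_sym algebra_simps)
qed (simp add: seq_smult_def)

lemma seq_sym_smult_of_real: "seq_sym (seq_smult (complex_of_real c) ts) z = c *\<^sub>R seq_sym ts z"
  by (rule fmat_eqI) (simp add: entry_seq_sym_smult)

lemma entry_seq_mat_smult: "entry (seq_mat (seq_smult c ts) n) x y = c * entry (seq_mat ts n) x y"
proof (induction ts)
  case (Cons \<tau> ts)
  then show ?case
    by (cases \<tau>; cases x; cases y) (auto simp: seq_smult_def entry_gen_mat algebra_simps)
qed (simp add: seq_smult_def)

lemma seq_mat_smult_of_real: "seq_mat (seq_smult (complex_of_real c) ts) n = c *\<^sub>R seq_mat ts n"
  by (rule fmat_eqI) (simp add: entry_seq_mat_smult)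

lemma seq_idm_Suc: "seq_idm (Suc t) = seq_idm t @ [(\<lambda>_. 1, 0, t, t)]"
  by (simp add: seq_idm_def)

lemma seq_sym_idm: "seq_sym (seq_idm t) z = idm {..<t}"
proof (induction t)
  case 0
  show ?case by (rule fmat_eqI) (simp add: seq_idm_def entry_idm)
next
  case (Suc t)
  then show ?case
    by (intro fmat_eqI) (auto simp: seq_idm_Suc entry_idm entry_gen_sym)
qed

lemma seq_mat_idm: "seq_mat (seq_idm t) n = idm ({1..n} \<times> {..<t})"
proof (induction t)
  case 0
  show ?case by (rule fmat_eqI) (simp add: seq_idm_def entry_idm)
next
  case (Suc t)
  show ?case
  proof (rule fmat_eqI)
    fix x y :: "'a dindex \<times> nat"
    show "entry (seq_mat (seq_idm (Suc t)) n) x y = entry (idm ({1..n} \<times> {..<Suc t})) x y"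
      by (cases x; cases y) (auto simp: Suc seq_idm_Suc entry_idm entry_gen_mat)
  qed
qed

lemma fsupp_seq_mat: "seq_ok t ts \<Longrightarrow> fsupp (seq_mat ts n) \<subseteq> {1..n} \<times> {..<t}"
proof (induction ts)
  case (Cons \<tau> ts)
  obtain a j \<alpha> \<beta> where \<tau>: "\<tau> = (a, j, \<alpha>, \<beta>)" by (metis prod_cases4)
  have "fsupp (seq_mat (\<tau> # ts) n) \<subseteq> fsupp (gen_mat n \<tau>) \<union> fsupp (seq_mat ts n)"
    unfolding fsupp_def by fastforce
  moreover have "fsupp (gen_mat n \<tau>) \<subseteq> {1..n} \<times> {\<alpha>, \<beta>}"
    unfolding \<tau> gen_mat_def by (simp add: fsupp_fmat_on)
  ultimately show ?case using Cons by (auto simp: \<tau>)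
qed (simp add: fsupp_def)

lemma fsupp_seq_sym: "seq_ok t ts \<Longrightarrow> fsupp (seq_sym ts z) \<subseteq> {..<t}"
proof (induction ts)
  case (Cons \<tau> ts)
  obtain a j \<alpha> \<beta> where \<tau>: "\<tau> = (a, j, \<alpha>, \<beta>)" by (metis prod_cases4)
  have "fsupp (seq_sym (\<tau> # ts) z) \<subseteq> fsupp (gen_sym \<tau> z) \<union> fsupp (seq_sym ts z)"
    by (auto simp: fsupp_def)
  moreover have "fsupp (gen_sym \<tau> z) \<subseteq> {\<alpha>, \<beta>}"
    unfolding \<tau> gen_sym_def by (simp add: fsupp_fmat_on)
  ultimately show ?case using Cons by (auto simp: \<tau>)
qed (simp add: fsupp_def)

section \<open>Asymptotics of generating sequences\<close>

definition at_top_dindex :: "('d::finite) dindex filter" where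
  "at_top_dindex = (INF K. principal {n. \<forall>k. K \<le> n $ k})"

lemma eventually_at_top_dindex:
  "eventually P (at_top_dindex :: ('d::finite) dindex filter) \<longleftrightarrow> (\<exists>K. \<forall>n. (\<forall>k. K \<le> n $ k) \<longrightarrow> P n)"
  unfolding at_top_dindex_def
proof (subst eventually_INF_base)
  fix K L :: int
  show "\<exists>M\<in>UNIV. principal {n :: 'd dindex. \<forall>k. M \<le> n $ k} \<le>
      inf (principal {n. \<forall>k. K \<le> n $ k}) (principal {n. \<forall>k. L \<le> n $ k})"
    by (rule bexI[of _ "max K L"]) auto
qed (auto simp: eventually_principal)

lemma eventually_dindex_ge: "\<forall>\<^sub>F n :: ('d::finite) dindex in at_top_dindex. \<forall>k. K \<le> n $ k"
  unfolding eventually_at_top_dindex by blast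

lemma eventually_dindex_ge_1: "\<forall>\<^sub>F n :: ('d::finite) dindex in at_top_dindex. 1 \<le> n"
  using eventually_dindex_ge[of 1] by (auto simp: Finite_Cartesian_Product.less_eq_vec_def elim: eventually_mono)

text \<open>The squared norm is \<open>o(N)\<close> for \<open>N\<close> the number of grid points.
  By \<open>dcmp_frobenius\<close> this implies negligibility, and it can be checked by adding up
  entries.\<close>

definition frob_small :: "(('d::finite) dindex \<Rightarrow> 'i fmat) \<Rightarrow> bool" where
  "frob_small X \<longleftrightarrow> (\<forall>\<eta>>0. \<forall>\<^sub>F n in at_top_dindex. (norm (X n))\<^sup>2 \<le> \<eta> * real (level_size n))"

lemma norm_add_sq_le: "(norm (x + y))\<^sup>2 \<le> 2 * ((norm x)\<^sup>2 + (norm y)\<^sup>2)" for x y :: "'a::real_inner"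
proof -
  have "(norm (x + y))\<^sup>2 \<le> (norm (x + y))\<^sup>2 + (norm (x - y))\<^sup>2" by simp
  also have "\<dots> = 2 * ((norm x)\<^sup>2 + (norm y)\<^sup>2)"
    by (simp add: power2_norm_eq_inner inner_add_left inner_add_right inner_diff_left inner_diff_right inner_commute)
  finally show ?thesis .
qed

lemma frob_small_0 [simp]: "frob_small (\<lambda>n. 0)"
  by (simp add: frob_small_def)

lemma frob_small_add:
  assumes "frob_small X" "frob_small Y"
  shows "frob_small (\<lambda>n. X n + Y n)"
  unfolding frob_small_def
proof safe
  fix \<eta> :: real assume "0 < \<eta>"
  then have "0 < \<eta> / 4" by simp
  with assms have "\<forall>\<^sub>F n in at_top_dindex. (norm (X n))\<^sup>2 \<le> \<eta> / 4 * real (level_size n)"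
    "\<forall>\<^sub>F n in at_top_dindex. (norm (Y n))\<^sup>2 \<le> \<eta> / 4 * real (level_size n)"
    unfolding frob_small_def by blast+
  then show "\<forall>\<^sub>F n in at_top_dindex. (norm (X n + Y n))\<^sup>2 \<le> \<eta> * real (level_size n)"
  proof eventually_elim
    case (elim n)
    have "(norm (X n + Y n))\<^sup>2 \<le> 2 * ((norm (X n))\<^sup>2 + (norm (Y n))\<^sup>2)" by (rule norm_add_sq_le)
    also have "\<dots> \<le> 2 * (\<eta> / 4 * real (level_size n) + \<eta> / 4 * real (level_size n))"
      by (intro mult_left_mono add_mono elim) simp
    finally show ?case by simp
  qed
qed

lemma frob_small_sum_list:
  "(\<And>x. x \<in> set xs \<Longrightarrow> frob_small (X x)) \<Longrightarrow> frob_small (\<lambda>n. \<Sum>x\<leftarrow>xs. X x n)"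
  by (induction xs) (auto intro!: frob_small_add)

text \<open>A matrix on a single shifted diagonal has at most one nonzero entry in each row, so the
  double sum collapses.\<close>

lemma norm_sq_shift:
  fixes R :: "('d::finite) dindex set"
  assumes "finite R"
    and "\<And>x y. entry X x y \<noteq> 0 \<Longrightarrow> \<exists>i\<in>R. x = (i, \<alpha>) \<and> y = (i - m, \<beta>)"
  shows "(norm X)\<^sup>2 = (\<Sum>i\<in>R. (cmod (entry X (i, \<alpha>) (i - m, \<beta>)))\<^sup>2)"
proof -
  let ?f = "\<lambda>i. (i, \<alpha>)" and ?g = "\<lambda>i. (i - m, \<beta>)"
  have inj: "inj_on ?f R" "inj_on ?g R" by (auto intro: inj_onI)
  have "(norm X)\<^sup>2 = (\<Sum>x\<in>?f ` R. \<Sum>y\<in>?g ` R. (cmod (entry X x y))\<^sup>2)"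
    by (rule norm_fmat_sq) (use assms in fastforce)+
  also have "\<dots> = (\<Sum>i\<in>R. \<Sum>k\<in>R. (cmod (entry X (i, \<alpha>) (k - m, \<beta>)))\<^sup>2)"
    by (simp add: sum.reindex[OF inj(1)] sum.reindex[OF inj(2)])
  also have "\<dots> = (\<Sum>i\<in>R. \<Sum>k\<in>R. if k = i then (cmod (entry X (i, \<alpha>) (i - m, \<beta>)))\<^sup>2 else 0)"
  proof (intro sum.cong refl)
    fix i k
    show "(cmod (entry X (i, \<alpha>) (k - m, \<beta>)))\<^sup>2 = (if k = i then (cmod (entry X (i, \<alpha>) (i - m, \<beta>)))\<^sup>2 else 0)"
      using assms(2)[of "(i, \<alpha>)" "(k - m, \<beta>)"] by auto
  qed
  also have "\<dots> = (\<Sum>i\<in>R. (cmod (entry X (i, \<alpha>) (i - m, \<beta>)))\<^sup>2)"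
    using assms(1) by simp
  finally show ?thesis .
qed

text \<open>If the shift by \<open>j\<close> leaves the box, it does so in some coordinate
  \<open>k\<close>. Such points lie in a product set whose \<open>k\<close>-th side has at most
  \<open>\<bar>j $ k\<bar>\<close> elements instead of \<open>n $ k\<close>.\<close>

lemma card_dindex_boundary:
  fixes n j :: "('d::finite) dindex"
  assumes n: "1 \<le> n"
  shows "real (card {i \<in> {1..n}. i - j \<notin> {1..n}}) \<le>
    (\<Sum>k\<in>UNIV. real_of_int \<bar>j $ k\<bar> / real_of_int (n $ k)) * real (level_size n)"
proof -
  have n1: "1 \<le> n $ k" for k
    using n by (auto simp: Finite_Cartesian_Product.less_eq_vec_def dest!: spec[of _ k])
  then have n0: "0 \<le> n $ k" for k by (rule order_trans[rotated]) simp
  define B where "B k = {i \<in> {1..n}. i $ k - j $ k \<notin> {1..n $ k}}" for k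
  have card_B: "real (card (B k)) \<le> real_of_int \<bar>j $ k\<bar> / real_of_int (n $ k) * real (level_size n)" for k
  proof -
    define C where "C l = (if l = k then {a \<in> {1..n $ k}. a - j $ k \<notin> {1..n $ k}} else {1..n $ l})" for l
    have "B k \<subseteq> vec_lambda ` (\<Pi>\<^sub>E l\<in>UNIV. C l)"
    proof
      fix i assume i: "i \<in> B k"
      have "vec_nth i \<in> (\<Pi>\<^sub>E l\<in>UNIV. C l)"
        using i by (auto simp: B_def C_def Finite_Cartesian_Product.less_eq_vec_def)
      then show "i \<in> vec_lambda ` (\<Pi>\<^sub>E l\<in>UNIV. C l)"
        by (intro image_eqI[of _ _ "vec_nth i"]) simp_all
    qed
    moreover have finC: "finite (C l)" for l
      unfolding C_def by (auto intro: finite_subset[of _ "{1..n $ k}"])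
    then have finP: "finite (\<Pi>\<^sub>E l\<in>UNIV. C l)" by (intro finite_PiE) simp
    ultimately have "card (B k) \<le> card (vec_lambda ` (\<Pi>\<^sub>E l\<in>UNIV. C l))"
      by (intro card_mono finite_imageI)
    also have "\<dots> \<le> card (\<Pi>\<^sub>E l\<in>UNIV. C l)" by (rule card_image_le[OF finP])
    also have "\<dots> = (\<Prod>l\<in>UNIV. card (C l))" by (simp add: card_PiE)
    finally have "real (card (B k)) \<le> real (\<Prod>l\<in>UNIV. card (C l))" by (simp only: of_nat_le_iff)
    then have 1: "real (card (B k)) \<le> (\<Prod>l\<in>UNIV. real (card (C l)))" by simp
    have Ck: "real (card (C k)) \<le> real_of_int \<bar>j $ k\<bar>"
    proof -
      have "C k \<subseteq> (if 0 \<le> j $ k then {1..j $ k} else {n $ k + j $ k + 1..n $ k})"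
        by (auto simp: C_def)
      then have "card (C k) \<le> card (if 0 \<le> j $ k then {1..j $ k} else {n $ k + j $ k + 1..n $ k})"
        by (intro card_mono) auto
      then have "card (C k) \<le> nat \<bar>j $ k\<bar>" by (auto split: if_splits)
      then show ?thesis by linarith
    qed
    have "(\<Prod>l\<in>UNIV. real (card (C l))) = real (card (C k)) * (\<Prod>l\<in>UNIV - {k}. real (card (C l)))"
      by (rule prod.remove) auto
    also have "(\<Prod>l\<in>UNIV - {k}. real (card (C l))) = (\<Prod>l\<in>UNIV - {k}. real_of_int (n $ l))"
      using n0 by (intro prod.cong) (auto simp: C_def)
    also have "real (card (C k)) * \<dots> \<le> real_of_int \<bar>j $ k\<bar> * (\<Prod>l\<in>UNIV - {k}. real_of_int (n $ l))"
      using n0 by (intro mult_right_mono Ck prod_nonneg) auto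
    also have "\<dots> = real_of_int \<bar>j $ k\<bar> / real_of_int (n $ k) * real (level_size n)"
    proof -
      have "real (level_size n) = real_of_int (n $ k) * (\<Prod>l\<in>UNIV - {k}. real_of_int (n $ l))"
        unfolding of_nat_level_size[OF n] by (rule prod.remove) auto
      then show ?thesis using n1[of k] by simp
    qed
    finally show ?thesis using 1 by linarith
  qed
  have "{i \<in> {1..n}. i - j \<notin> {1..n}} \<subseteq> (\<Union>k. B k)"
    by (auto simp: B_def Finite_Cartesian_Product.less_eq_vec_def)
  then have "card {i \<in> {1..n}. i - j \<notin> {1..n}} \<le> card (\<Union>k. B k)"
    by (intro card_mono) (auto simp: B_def intro: finite_subset[OF _ finite_dindex_range])
  also have "\<dots> \<le> (\<Sum>k\<in>UNIV. card (B k))" by (rule card_UN_le) simp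
  finally have "real (card {i \<in> {1..n}. i - j \<notin> {1..n}}) \<le> real (\<Sum>k\<in>UNIV. card (B k))"
    by (simp only: of_nat_le_iff)
  also have "\<dots> = (\<Sum>k\<in>UNIV. real (card (B k)))" by simp
  also have "\<dots> \<le> (\<Sum>k\<in>UNIV. real_of_int \<bar>j $ k\<bar> / real_of_int (n $ k) * real (level_size n))"
    by (intro sum_mono card_B)
  finally show ?thesis by (simp add: sum_distrib_right)
qed

lemma eventually_ratio_small:
  assumes "0 < \<eta>"
  shows "\<forall>\<^sub>F n :: ('d::finite) dindex in at_top_dindex.
    (\<Sum>k\<in>UNIV. real_of_int \<bar>j $ k\<bar> / real_of_int (n $ k)) \<le> \<eta>"
proof -
  define S where "S = (\<Sum>k\<in>UNIV. real_of_int \<bar>j $ k\<bar>)"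
  have S: "0 \<le> S" by (simp add: S_def sum_nonneg)
  define K where "K = \<lceil>S / \<eta>\<rceil> + 1"
  have K: "0 < real_of_int K" "S \<le> \<eta> * real_of_int K"
  proof -
    have "S / \<eta> \<le> real_of_int K" unfolding K_def by linarith
    then show "S \<le> \<eta> * real_of_int K" using assms by (simp add: field_simps)
    have "0 \<le> S / \<eta>" using S assms by simp
    then show "0 < real_of_int K" unfolding K_def by linarith
  qed
  show ?thesis using eventually_dindex_ge[of K]
  proof eventually_elim
    case (elim n)
    have "(\<Sum>k\<in>UNIV. real_of_int \<bar>j $ k\<bar> / real_of_int (n $ k)) \<le> (\<Sum>k\<in>UNIV. real_of_int \<bar>j $ k\<bar> / real_of_int K)"
    proof (rule sum_mono)
      fix k
      have "real_of_int K \<le> real_of_int (n $ k)" using elim by simp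
      then show "real_of_int \<bar>j $ k\<bar> / real_of_int (n $ k) \<le> real_of_int \<bar>j $ k\<bar> / real_of_int K"
        using K by (intro divide_left_mono) auto
    qed
    also have "\<dots> = S / real_of_int K" by (simp add: S_def sum_divide_distrib)
    also have "\<dots> \<le> \<eta>" using K by (simp add: field_simps)
    finally show ?case .
  qed
qed

lemma grid_in_cube:
  assumes "1 \<le> n" "i \<in> {1..n}"
  shows "grid n i \<in> cbox 0 1"
proof -
  have "0 \<le> real_of_int (i $ k) / real_of_int (n $ k) \<and> real_of_int (i $ k) / real_of_int (n $ k) \<le> 1" for k
    using assms by (auto simp: Finite_Cartesian_Product.less_eq_vec_def divide_le_eq_1 dest!: spec[of _ k])
  then show ?thesis by (simp add: grid_def mem_box_cart)
qed

lemma dist_grid_le: "dist (grid n i) (grid n (i - j)) \<le> (\<Sum>k\<in>UNIV. \<bar>real_of_int (j $ k) / real_of_int (n $ k)\<bar>)"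
proof -
  have "dist (grid n i) (grid n (i - j)) \<le> (\<Sum>k\<in>UNIV. \<bar>(grid n i - grid n (i - j)) $ k\<bar>)"
    unfolding dist_norm by (rule norm_le_l1_cart)
  also have "\<dots> = (\<Sum>k\<in>UNIV. \<bar>real_of_int (j $ k) / real_of_int (n $ k)\<bar>)"
    by (intro sum.cong refl) (simp add: grid_def diff_divide_distrib)
  finally show ?thesis .
qed

text \<open>If the shifted index stays in the box, the two grid points are close and uniform
  continuity applies; the other indices are few, and there boundedness is enough. The errors of
  products and adjoints both reduce to this sum.\<close>

lemma shift_sum_small:
  fixes a :: "('d::finite) point \<Rightarrow> complex"
  assumes a: "continuous_on (cbox 0 1) a" and "0 < \<eta>"
  shows "\<forall>\<^sub>F n in at_top_dindex.
    (\<Sum>i\<in>{1..n}. (cmod ((if i - j \<in> {1..n} then a (grid n (i - j)) else 0) - a (grid n i)))\<^sup>2)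
      \<le> \<eta> * real (level_size n)"
proof -
  have "compact (a ` cbox 0 1)" by (rule compact_continuous_image[OF a compact_cbox])
  then have "bounded (a ` cbox 0 1)" by (rule compact_imp_bounded)
  then obtain M where M: "0 < M" "\<And>x. x \<in> cbox 0 1 \<Longrightarrow> cmod (a x) \<le> M"
    by (auto simp: bounded_pos)
  define e where "e = sqrt (\<eta> / 2)"
  have e: "0 < e" "e\<^sup>2 = \<eta> / 2" using assms(2) by (auto simp: e_def)
  have "uniformly_continuous_on (cbox 0 1) a"
    by (rule compact_uniformly_continuous[OF a compact_cbox])
  then obtain d where d: "0 < d" "\<And>x y. x \<in> cbox 0 1 \<Longrightarrow> y \<in> cbox 0 1 \<Longrightarrow> dist y x < d \<Longrightarrow> dist (a y) (a x) < e"
    using e(1) unfolding uniformly_continuous_on_def by metis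
  \<comment> \<open>Halving \<open>d\<close> turns the weak inequality of
    \<open>eventually_ratio_small\<close> into the strict one needed for continuity; the second
    bound limits the boundary points to half of the budget \<open>\<eta> N\<close>.\<close>
  have "0 < min (d / 2) (\<eta> / (2 * M\<^sup>2))" using d M assms(2) by simp
  from eventually_ratio_small[OF this, of j] eventually_dindex_ge_1
  show ?thesis
  proof eventually_elim
    case (elim n)
    define B where "B = {i \<in> {1..n}. i - j \<notin> {1..n}}"
    have fin: "finite B" unfolding B_def by (rule finite_subset[OF _ finite_dindex_range]) blast
    let ?f = "\<lambda>i. (cmod ((if i - j \<in> {1..n} then a (grid n (i - j)) else 0) - a (grid n i)))\<^sup>2"
    have f: "?f i \<le> \<eta> / 2 + (if i \<in> B then M\<^sup>2 else 0)" if i: "i \<in> {1..n}" for i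
    proof (cases "i \<in> B")
      case True
      then have "?f i = (cmod (a (grid n i)))\<^sup>2" by (auto simp: B_def)
      also have "\<dots> \<le> M\<^sup>2" by (intro power_mono M grid_in_cube elim i) simp
      finally show ?thesis using True assms(2) by simp
    next
      case False
      then have ij: "i - j \<in> {1..n}" using i by (auto simp: B_def)
      have "dist (grid n (i - j)) (grid n i) \<le> (\<Sum>k\<in>UNIV. \<bar>real_of_int (j $ k) / real_of_int (n $ k)\<bar>)"
        by (subst dist_commute) (rule dist_grid_le)
      also have "\<dots> = (\<Sum>k\<in>UNIV. real_of_int \<bar>j $ k\<bar> / real_of_int (n $ k))"
      proof (intro sum.cong refl)
        fix k
        have "1 \<le> n $ k" using elim(2) by (auto simp: Finite_Cartesian_Product.less_eq_vec_def dest!: spec[of _ k])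
        then show "\<bar>real_of_int (j $ k) / real_of_int (n $ k)\<bar> = real_of_int \<bar>j $ k\<bar> / real_of_int (n $ k)"
          by (simp add: abs_divide)
      qed
      also have "\<dots> < d" using elim(1) d(1) by linarith
      finally have "dist (a (grid n (i - j))) (a (grid n i)) < e"
        by (intro d(2) grid_in_cube elim i ij)
      then have "(cmod (a (grid n (i - j)) - a (grid n i)))\<^sup>2 \<le> e\<^sup>2"
        by (intro power_mono) (auto simp: dist_norm)
      then show ?thesis using ij False e(2) by (simp add: if_P)
    qed
    have "(\<Sum>i\<in>{1..n}. ?f i) \<le> (\<Sum>i\<in>{1..n}. \<eta> / 2 + (if i \<in> B then M\<^sup>2 else 0))"
      by (intro sum_mono f)
    also have "\<dots> = \<eta> / 2 * real (level_size n) + M\<^sup>2 * real (card B)"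
    proof -
      have "(\<Sum>i\<in>{1..n}. if i \<in> B then M\<^sup>2 else 0) = (\<Sum>i\<in>B. M\<^sup>2)"
        by (rule sum.mono_neutral_cong_right) (auto simp: B_def)
      then show ?thesis by (simp add: sum.distrib card_dindex_range[OF elim(2)])
    qed
    also have "M\<^sup>2 * real (card B) \<le> M\<^sup>2 * (\<eta> / (2 * M\<^sup>2) * real (level_size n))"
    proof (rule mult_left_mono)
      have "real (card B) \<le> (\<Sum>k\<in>UNIV. real_of_int \<bar>j $ k\<bar> / real_of_int (n $ k)) * real (level_size n)"
        unfolding B_def by (rule card_dindex_boundary[OF elim(2)])
      also have "\<dots> \<le> \<eta> / (2 * M\<^sup>2) * real (level_size n)"
        using elim(1) by (intro mult_right_mono) auto
      finally show "real (card B) \<le> \<eta> / (2 * M\<^sup>2) * real (level_size n)" .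
    qed simp
    also have "M\<^sup>2 * (\<eta> / (2 * M\<^sup>2) * real (level_size n)) = \<eta> / 2 * real (level_size n)"
      using M(1) by (simp add: field_simps)
    finally show ?case by simp
  qed
qed

section \<open>Products and adjoints of generating matrices\<close>

lemma entry_gen_mat_mult:
  "entry (gen_mat n (a, j, \<alpha>, \<beta>) * gen_mat n (b, k, \<gamma>, \<delta>)) (i, \<alpha>') (l, \<delta>') =
    (if \<beta> = \<gamma> \<and> i \<in> {1..n} \<and> l \<in> {1..n} \<and> \<alpha>' = \<alpha> \<and> \<delta>' = \<delta> \<and> i - l = j + k \<and> i - j \<in> {1..n}
     then a (grid n i) * b (grid n (i - j)) else 0)"
proof -
  \<comment> \<open>The only possible inner label is \<open>(i - j, \<beta>)\<close>. It is added to
    the summation set so that the sum collapses even when \<open>i - j\<close> lies outside the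
    box.\<close>
  let ?S = "{1..n} \<times> {\<alpha>, \<beta>} \<union> {(i - j, \<beta>)}"
  have "entry (gen_mat n (a, j, \<alpha>, \<beta>) * gen_mat n (b, k, \<gamma>, \<delta>)) (i, \<alpha>') (l, \<delta>') =
    (\<Sum>y\<in>?S. entry (gen_mat n (a, j, \<alpha>, \<beta>)) (i, \<alpha>') y * entry (gen_mat n (b, k, \<gamma>, \<delta>)) y (l, \<delta>'))"
    by (rule entry_times) (use fsupp_fmat_on[of "{1..n} \<times> {\<alpha>, \<beta>}"] in \<open>auto simp: gen_mat_def\<close>)
  also have "\<dots> = (\<Sum>y\<in>?S. if y = (i - j, \<beta>) then
    (if \<beta> = \<gamma> \<and> i \<in> {1..n} \<and> l \<in> {1..n} \<and> \<alpha>' = \<alpha> \<and> \<delta>' = \<delta> \<and> i - l = j + k \<and> i - j \<in> {1..n}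
     then a (grid n i) * b (grid n (i - j)) else 0) else 0)"
  proof (rule sum.cong[OF refl])
    fix y :: "'a dindex \<times> nat"
    obtain m \<beta>' where y: "y = (m, \<beta>')" by (metis surj_pair)
    have eq: "i - m = j \<longleftrightarrow> m = i - j" "i - l = j + k \<longleftrightarrow> i - j - l = k" by (auto simp: algebra_simps)
    show "entry (gen_mat n (a, j, \<alpha>, \<beta>)) (i, \<alpha>') y * entry (gen_mat n (b, k, \<gamma>, \<delta>)) y (l, \<delta>') =
      (if y = (i - j, \<beta>) then
        (if \<beta> = \<gamma> \<and> i \<in> {1..n} \<and> l \<in> {1..n} \<and> \<alpha>' = \<alpha> \<and> \<delta>' = \<delta> \<and> i - l = j + k \<and> i - j \<in> {1..n}
         then a (grid n i) * b (grid n (i - j)) else 0) else 0)"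
      unfolding y entry_gen_mat eq
      by (cases "m = i - j \<and> \<beta>' = \<beta>") (auto simp del: atLeastAtMost_iff)
  qed
  also have "\<dots> = (if \<beta> = \<gamma> \<and> i \<in> {1..n} \<and> l \<in> {1..n} \<and> \<alpha>' = \<alpha> \<and> \<delta>' = \<delta> \<and> i - l = j + k \<and> i - j \<in> {1..n}
     then a (grid n i) * b (grid n (i - j)) else 0)"
    by (subst sum.delta) auto
  finally show ?thesis .
qed

text \<open>Both matrices sit on the same shifted diagonal. They differ in that the product samples
  \<open>b\<close> at the grid point of \<open>i - j\<close> instead of \<open>i\<close>, or has no
  entry at all when \<open>i - j\<close> is outside the box.\<close>

lemma frob_small_gen_mult:
  assumes a: "continuous_on (cbox 0 1) a" and b: "continuous_on (cbox 0 1) b"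
  shows "frob_small (\<lambda>n. gen_mat n (a, j, \<alpha>, \<beta>) * gen_mat n (b, k, \<gamma>, \<delta>)
    - seq_mat (term_mult (a, j, \<alpha>, \<beta>) (b, k, \<gamma>, \<delta>)) n)"
proof (cases "\<beta> = \<gamma>")
  case False
  have "gen_mat n (a, j, \<alpha>, \<beta>) * gen_mat n (b, k, \<gamma>, \<delta>)
    - seq_mat (term_mult (a, j, \<alpha>, \<beta>) (b, k, \<gamma>, \<delta>)) n = 0" for n
  proof (rule fmat_eqI)
    fix x y :: "'a dindex \<times> nat"
    show "entry (gen_mat n (a, j, \<alpha>, \<beta>) * gen_mat n (b, k, \<gamma>, \<delta>)
      - seq_mat (term_mult (a, j, \<alpha>, \<beta>) (b, k, \<gamma>, \<delta>)) n) x y = entry 0 x y"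
      using False by (cases x; cases y) (simp add: entry_gen_mat_mult term_mult_def)
  qed
  then show ?thesis by simp
next
  case True
  define X where "X n = gen_mat n (a, j, \<alpha>, \<beta>) * gen_mat n (b, k, \<gamma>, \<delta>)
    - seq_mat (term_mult (a, j, \<alpha>, \<beta>) (b, k, \<gamma>, \<delta>)) n" for n
  have eX: "entry (X n) (i, \<alpha>') (l, \<delta>') = (if i \<in> {1..n} \<and> l \<in> {1..n} \<and> \<alpha>' = \<alpha> \<and> \<delta>' = \<delta> \<and> i - l = j + k
     then a (grid n i) * ((if i - j \<in> {1..n} then b (grid n (i - j)) else 0) - b (grid n i)) else 0)" for n i l \<alpha>' \<delta>'
    using True
    by (simp add: X_def entry_gen_mat_mult term_mult_def entry_gen_mat right_diff_distrib del: atLeastAtMost_iff)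
  have "compact (a ` cbox 0 1)" by (rule compact_continuous_image[OF a compact_cbox])
  then have "bounded (a ` cbox 0 1)" by (rule compact_imp_bounded)
  then obtain M where M: "0 < M" "\<And>x. x \<in> cbox 0 1 \<Longrightarrow> cmod (a x) \<le> M"
    by (auto simp: bounded_pos)
  have "frob_small X"
    unfolding frob_small_def
  proof safe
    fix \<eta> :: real assume \<eta>: "0 < \<eta>"
    then have "0 < \<eta> / M\<^sup>2" using M by simp
    from shift_sum_small[OF b this, of j] eventually_dindex_ge_1
    show "\<forall>\<^sub>F n in at_top_dindex. (norm (X n))\<^sup>2 \<le> \<eta> * real (level_size n)"
    proof eventually_elim
      case (elim n)
      let ?g = "\<lambda>i. (cmod ((if i - j \<in> {1..n} then b (grid n (i - j)) else 0) - b (grid n i)))\<^sup>2"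
      have "(norm (X n))\<^sup>2 = (\<Sum>i\<in>{1..n}. (cmod (entry (X n) (i, \<alpha>) (i - (j + k), \<delta>)))\<^sup>2)"
      proof (rule norm_sq_shift)
        fix x y :: "'a dindex \<times> nat" assume "entry (X n) x y \<noteq> 0"
        then show "\<exists>i\<in>{1..n}. x = (i, \<alpha>) \<and> y = (i - (j + k), \<delta>)"
          by (cases x; cases y) (auto simp: eX algebra_simps split: if_splits)
      qed simp
      also have "\<dots> \<le> (\<Sum>i\<in>{1..n}. M\<^sup>2 * ?g i)"
      proof (rule sum_mono)
        fix i assume i: "i \<in> {1..n}"
        have "cmod (entry (X n) (i, \<alpha>) (i - (j + k), \<delta>)) \<le>
            cmod (a (grid n i)) * cmod ((if i - j \<in> {1..n} then b (grid n (i - j)) else 0) - b (grid n i))"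
          unfolding eX by (simp add: norm_mult del: atLeastAtMost_iff)
        also have "\<dots> \<le> M * cmod ((if i - j \<in> {1..n} then b (grid n (i - j)) else 0) - b (grid n i))"
          by (intro mult_right_mono M grid_in_cube elim i) simp
        finally have "(cmod (entry (X n) (i, \<alpha>) (i - (j + k), \<delta>)))\<^sup>2 \<le>
            (M * cmod ((if i - j \<in> {1..n} then b (grid n (i - j)) else 0) - b (grid n i)))\<^sup>2"
          by (rule power_mono) simp
        then show "(cmod (entry (X n) (i, \<alpha>) (i - (j + k), \<delta>)))\<^sup>2 \<le> M\<^sup>2 * ?g i"
          by (simp only: power_mult_distrib)
      qed
      also have "\<dots> = M\<^sup>2 * (\<Sum>i\<in>{1..n}. ?g i)" by (simp only: sum_distrib_left)
      also have "\<dots> \<le> M\<^sup>2 * (\<eta> / M\<^sup>2 * real (level_size n))"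
        using elim(1) by (rule mult_left_mono) simp
      also have "\<dots> = \<eta> * real (level_size n)" using M by simp
      finally show ?case .
    qed
  qed
  then show ?thesis by (simp add: X_def[abs_def])
qed

lemma frob_small_seq_mult:
  assumes "seq_ok t ts" "seq_ok t ss"
  shows "frob_small (\<lambda>n. seq_mat ts n * seq_mat ss n - seq_mat (seq_mult ts ss) n)"
proof -
  let ?D = "\<lambda>\<tau> \<sigma> n. gen_mat n \<tau> * gen_mat n \<sigma> - seq_mat (term_mult \<tau> \<sigma>) n"
  have 1: "gen_mat n \<tau> * seq_mat ss n - seq_mat (concat (map (term_mult \<tau>) ss)) n = (\<Sum>\<sigma>\<leftarrow>ss. ?D \<tau> \<sigma> n)" for \<tau> n
    by (induction ss) (auto simp: algebra_simps)
  have eq: "seq_mat ts n * seq_mat ss n - seq_mat (seq_mult ts ss) n = (\<Sum>\<tau>\<leftarrow>ts. \<Sum>\<sigma>\<leftarrow>ss. ?D \<tau> \<sigma> n)" for n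
    unfolding seq_mult_def
    by (induction ts) (auto simp: 1[symmetric] algebra_simps)
  have "frob_small (?D \<tau> \<sigma>)" if "\<tau> \<in> set ts" "\<sigma> \<in> set ss" for \<tau> \<sigma>
    using assms that frob_small_gen_mult by (cases \<tau>; cases \<sigma>) (fastforce simp: seq_ok_def)
  then show ?thesis unfolding eq by (intro frob_small_sum_list)
qed

text \<open>Taking adjoints moves the sampling point from the row index to the column index, which
  is a fixed number of grid steps away.\<close>

lemma frob_small_gen_adj:
  assumes a: "continuous_on (cbox 0 1) a"
  shows "frob_small (\<lambda>n. adj (gen_mat n (a, j, \<alpha>, \<beta>)) - gen_mat n (\<lambda>x. cnj (a x), - j, \<beta>, \<alpha>))"
proof -
  define X where "X n = adj (gen_mat n (a, j, \<alpha>, \<beta>)) - gen_mat n (\<lambda>x. cnj (a x), - j, \<beta>, \<alpha>)" for n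
  have eX: "entry (X n) (i, \<beta>') (k, \<alpha>') = (if i \<in> {1..n} \<and> k \<in> {1..n} \<and> \<alpha>' = \<alpha> \<and> \<beta>' = \<beta> \<and> k - i = j
     then cnj (a (grid n k) - a (grid n i)) else 0)" for n i k \<alpha>' \<beta>'
  proof -
    have "i - k = - j \<longleftrightarrow> k - i = j" by (auto simp: algebra_simps)
    then show ?thesis by (auto simp: X_def entry_gen_mat)
  qed
  have "frob_small X"
    unfolding frob_small_def
  proof safe
    fix \<eta> :: real assume "0 < \<eta>"
    from shift_sum_small[OF a this, of "- j"]
    show "\<forall>\<^sub>F n in at_top_dindex. (norm (X n))\<^sup>2 \<le> \<eta> * real (level_size n)"
    proof eventually_elim
      case (elim n)
      have "(norm (X n))\<^sup>2 = (\<Sum>i\<in>{1..n}. (cmod (entry (X n) (i, \<beta>) (i - - j, \<alpha>)))\<^sup>2)"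
      proof (rule norm_sq_shift)
        fix x y :: "'a dindex \<times> nat" assume "entry (X n) x y \<noteq> 0"
        then show "\<exists>i\<in>{1..n}. x = (i, \<beta>) \<and> y = (i - - j, \<alpha>)"
          by (cases x; cases y) (auto simp: eX algebra_simps split: if_splits)
      qed simp
      also have "\<dots> \<le> (\<Sum>i\<in>{1..n}. (cmod ((if i - - j \<in> {1..n} then a (grid n (i - - j)) else 0) - a (grid n i)))\<^sup>2)"
        by (intro sum_mono power_mono)
          (auto simp: eX complex_mod_cnj simp del: complex_cnj_diff)
      finally show ?case using elim by linarith
    qed
  qed
  then show ?thesis by (simp add: X_def[abs_def])
qed

lemma frob_small_seq_adj:
  assumes "seq_ok t ts"
  shows "frob_small (\<lambda>n. adj (seq_mat ts n) - seq_mat (seq_adj ts) n)"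
  using assms
proof (induction ts)
  case (Cons \<tau> ts)
  obtain a j \<alpha> \<beta> where \<tau>: "\<tau> = (a, j, \<alpha>, \<beta>)" by (metis prod_cases4)
  have "frob_small (\<lambda>n. adj (gen_mat n \<tau>) - gen_mat n (\<lambda>x. cnj (a x), - j, \<beta>, \<alpha>))"
    unfolding \<tau> using Cons.prems by (intro frob_small_gen_adj) (simp add: \<tau>)
  moreover have "frob_small (\<lambda>n. adj (seq_mat ts n) - seq_mat (seq_adj ts) n)"
    using Cons by (simp add: \<tau>)
  ultimately have "frob_small (\<lambda>n. (adj (gen_mat n \<tau>) - gen_mat n (\<lambda>x. cnj (a x), - j, \<beta>, \<alpha>))
      + (adj (seq_mat ts n) - seq_mat (seq_adj ts) n))"
    by (rule frob_small_add)
  then show ?case by (simp add: seq_adj_def \<tau> algebra_simps)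
qed (simp add: seq_adj_def)

subsection \<open>Riemann sums\<close>

lemma measure_cube [simp]: "measure lborel (cbox 0 1 :: ('d::finite) point set) = 1"
proof -
  have "0 \<in> cbox (0 :: 'd point) 1" by (simp add: mem_box_cart)
  then have "cbox (0 :: 'd point) 1 \<noteq> {}" by blast
  from content_cbox_cart[OF this] show ?thesis by simp
qed

lemma cube_integrable:
  fixes f :: "('d::finite) point \<Rightarrow> 'b::{banach, second_countable_topology}"
  shows "continuous_on (cbox 0 1) f \<Longrightarrow> integrable lborel (\<lambda>x. indicator (cbox 0 1) x *\<^sub>R f x)"
  by (rule borel_integrable_compact[OF compact_cbox])

text \<open>The open grid cells are disjoint but miss the hyperplanes between them. There the step
  function is 0, and \<open>0 \<le> g\<close> keeps the pointwise comparison with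
  \<open>g + \<eta>\<close> valid.\<close>

lemma riemann_sum_upper_nonneg:
  fixes g :: "('d::finite) point \<Rightarrow> real"
  assumes g: "continuous_on (cbox 0 1) g" and g0: "\<And>x. x \<in> cbox 0 1 \<Longrightarrow> 0 \<le> g x" and "0 < \<eta>"
  shows "\<forall>\<^sub>F n in at_top_dindex. (\<Sum>i\<in>{1..n}. g (grid n i)) \<le>
    real (level_size n) * ((\<integral>x. indicator (cbox 0 1) x *\<^sub>R g x \<partial>lborel) + \<eta>)"
proof -
  have "uniformly_continuous_on (cbox 0 1) g"
    by (rule compact_uniformly_continuous[OF g compact_cbox])
  then obtain d where d: "0 < d" "\<And>x y. x \<in> cbox 0 1 \<Longrightarrow> y \<in> cbox 0 1 \<Longrightarrow> dist y x < d \<Longrightarrow> dist (g y) (g x) < \<eta>"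
    using assms(3) unfolding uniformly_continuous_on_def by metis
  have "0 < d / 2" using d(1) by simp
  from eventually_ratio_small[OF this, of "1 :: 'd dindex"] eventually_dindex_ge_1
  show ?thesis
  proof eventually_elim
    case (elim n)
    have n1: "1 \<le> n $ k" for k
      using elim(2) by (auto simp: Finite_Cartesian_Product.less_eq_vec_def dest!: spec[of _ k])
    have npos: "0 < real_of_int (n $ k)" for k
      using n1[of k] by linarith
    define C where "C i = box (grid n (i - 1)) (grid n i)" for i
    have C: "x \<in> C i \<longleftrightarrow> (\<forall>k. real_of_int (i $ k) - 1 < x $ k * real_of_int (n $ k) \<and>
        x $ k * real_of_int (n $ k) < real_of_int (i $ k))" for x i
      using npos by (simp add: C_def mem_box_cart grid_def pos_divide_less_eq pos_less_divide_eq)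
    have sub: "C i \<subseteq> cbox 0 1" if i: "i \<in> {1..n}" for i
    proof
      fix x assume x: "x \<in> C i"
      have "0 \<le> x $ k \<and> x $ k \<le> 1" for k
      proof -
        have ik: "1 \<le> i $ k" "i $ k \<le> n $ k"
          using i by (auto simp: Finite_Cartesian_Product.less_eq_vec_def dest!: spec[of _ k])
        have xk: "real_of_int (i $ k) - 1 < x $ k * real_of_int (n $ k)" "x $ k * real_of_int (n $ k) < real_of_int (i $ k)"
          using x by (auto simp: C)
        have "0 < x $ k * real_of_int (n $ k)" using xk(1) ik(1) by linarith
        moreover have "x $ k * real_of_int (n $ k) < 1 * real_of_int (n $ k)" using xk(2) ik(2) by linarith
        ultimately show ?thesis using npos[of k] by (simp add: zero_less_mult_iff mult_less_cancel_right)
      qed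
      then show "x \<in> cbox 0 1" by (simp add: mem_box_cart)
    qed
    have disj: "i = j" if x: "x \<in> C i" "x \<in> C j" for x i j
    proof -
      have "i $ k = j $ k" for k
      proof -
        have "real_of_int (i $ k) - 1 < x $ k * real_of_int (n $ k)" "x $ k * real_of_int (n $ k) < real_of_int (i $ k)"
          "real_of_int (j $ k) - 1 < x $ k * real_of_int (n $ k)" "x $ k * real_of_int (n $ k) < real_of_int (j $ k)"
          using x by (auto simp: C)
        then show ?thesis by linarith
      qed
      then show ?thesis by (simp add: Finite_Cartesian_Product.vec_eq_iff)
    qed
    have near: "g (grid n i) \<le> g x + \<eta>" if i: "i \<in> {1..n}" and x: "x \<in> C i" for i x
    proof -
      have "dist x (grid n i) \<le> (\<Sum>k\<in>UNIV. \<bar>(x - grid n i) $ k\<bar>)"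
        unfolding dist_norm by (rule norm_le_l1_cart)
      also have "\<dots> \<le> (\<Sum>k\<in>UNIV. 1 / real_of_int (n $ k))"
      proof (rule sum_mono)
        fix k
        have "real_of_int (i $ k) - 1 < x $ k * real_of_int (n $ k)" "x $ k * real_of_int (n $ k) < real_of_int (i $ k)"
          using x by (auto simp: C)
        then have "\<bar>x $ k * real_of_int (n $ k) - real_of_int (i $ k)\<bar> \<le> 1" by linarith
        moreover have "x $ k * real_of_int (n $ k) - real_of_int (i $ k) = (x - grid n i) $ k * real_of_int (n $ k)"
          using npos[of k] by (simp add: grid_def left_diff_distrib)
        ultimately show "\<bar>(x - grid n i) $ k\<bar> \<le> 1 / real_of_int (n $ k)"
          using npos[of k] by (simp add: abs_mult pos_le_divide_eq)
      qed
      also have "\<dots> < d" using elim(1) d(1) by simp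
      finally have "dist (g (grid n i)) (g x) < \<eta>"
        using d(2)[of x "grid n i"] sub[OF i] x grid_in_cube[OF elim(2) i] by (auto simp: dist_commute)
      then show ?thesis by (simp add: dist_real_def)
    qed
    have measC: "measure lborel (C i) = 1 / real (level_size n)" for i
    proof -
      have "grid n (i - 1) \<in> cbox (grid n (i - 1)) (grid n i)"
        using npos by (auto simp: mem_box_cart grid_def divide_right_mono less_imp_le)
      then have ne: "cbox (grid n (i - 1)) (grid n i) \<noteq> {}" by blast
      have "measure lborel (C i) = measure lborel (cbox (grid n (i - 1)) (grid n i))"
        unfolding C_def measure_lborel_box_eq measure_lborel_cbox_eq ..
      also have "\<dots> = (\<Prod>k\<in>UNIV. grid n i $ k - grid n (i - 1) $ k)"
        by (rule content_cbox_cart[OF ne])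
      also have "\<dots> = (\<Prod>k\<in>UNIV. 1 / real_of_int (n $ k))"
        by (intro prod.cong refl) (simp add: grid_def diff_divide_distrib[symmetric])
      finally show ?thesis by (simp add: of_nat_level_size[OF elim(2)] prod_dividef)
    qed
    let ?I = "\<lambda>x. indicator (cbox 0 1) x *\<^sub>R (g x + \<eta>)"
    have int1: "integrable lborel (\<lambda>x. indicator (C i) x *\<^sub>R g (grid n i))" for i
      by (intro integrable_scaleR_left integrable_real_indicator)
        (auto simp: C_def emeasure_lborel_box_eq)
    have "(\<Sum>i\<in>{1..n}. g (grid n i)) / real (level_size n) =
        (\<Sum>i\<in>{1..n}. \<integral>x. indicator (C i) x *\<^sub>R g (grid n i) \<partial>lborel)"
      unfolding sum_divide_distrib
    proof (intro sum.cong refl)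
      fix i
      have "(\<integral>x. indicator (C i) x *\<^sub>R g (grid n i) \<partial>lborel) = measure lborel (C i) * g (grid n i)"
        by (simp add: C_def)
      then show "g (grid n i) / real (level_size n) = (\<integral>x. indicator (C i) x *\<^sub>R g (grid n i) \<partial>lborel)"
        by (simp add: measC)
    qed
    also have "\<dots> = (\<integral>x. (\<Sum>i\<in>{1..n}. indicator (C i) x *\<^sub>R g (grid n i)) \<partial>lborel)"
      using int1 by (simp only: Bochner_Integration.integral_sum)
    also have "\<dots> \<le> (\<integral>x. ?I x \<partial>lborel)"
    proof (rule integral_mono)
      show "integrable lborel (\<lambda>x. \<Sum>i\<in>{1..n}. indicator (C i) x *\<^sub>R g (grid n i))"
        using int1 by (intro Bochner_Integration.integrable_sum)
      show "integrable lborel ?I" by (intro cube_integrable continuous_intros g)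
      fix x
      show "(\<Sum>i\<in>{1..n}. indicator (C i) x *\<^sub>R g (grid n i)) \<le> ?I x"
      proof (cases "\<exists>i\<in>{1..n}. x \<in> C i")
        case True
        then obtain i where i: "i \<in> {1..n}" "x \<in> C i" by blast
        have "(\<Sum>j\<in>{1..n}. indicator (C j) x *\<^sub>R g (grid n j)) = (\<Sum>j\<in>{1..n}. if j = i then g (grid n i) else 0)"
          by (intro sum.cong refl) (use i disj in \<open>auto simp: indicator_def\<close>)
        also have "\<dots> = g (grid n i)" using i by simp
        also have "\<dots> \<le> ?I x" using near[OF i] sub[OF i(1)] i(2) by auto
        finally show ?thesis .
      next
        case False
        then have "(\<Sum>j\<in>{1..n}. indicator (C j) x *\<^sub>R g (grid n j)) = 0"
          by (intro sum.neutral) (auto simp: indicator_def)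
        also have "0 \<le> ?I x" using g0[of x] assms(3) by (auto simp: indicator_def)
        finally show ?thesis .
      qed
    qed
    also have "\<dots> = (\<integral>x. indicator (cbox 0 1) x *\<^sub>R g x + indicator (cbox 0 1) x *\<^sub>R \<eta> \<partial>lborel)"
      by (simp only: scaleR_add_right)
    also have "\<dots> = (\<integral>x. indicator (cbox 0 1) x *\<^sub>R g x \<partial>lborel) + (\<integral>x. indicator (cbox 0 1) x *\<^sub>R \<eta> \<partial>(lborel :: 'd point measure))"
      by (intro Bochner_Integration.integral_add cube_integrable g continuous_on_const)
    also have "(\<integral>x. indicator (cbox 0 1) x *\<^sub>R \<eta> \<partial>(lborel :: 'd point measure)) = \<eta>" by simp
    finally show ?case using level_size_pos[OF elim(2)] by (simp add: field_simps)
  qed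
qed

text \<open>Adding a constant \<open>M\<close> with \<open>\<bar>g\<bar> \<le> M\<close> makes
  \<open>g\<close> nonnegative and shifts both sides by the same amount.\<close>

lemma riemann_sum_upper:
  fixes g :: "('d::finite) point \<Rightarrow> real"
  assumes g: "continuous_on (cbox 0 1) g" and "0 < \<eta>"
  shows "\<forall>\<^sub>F n in at_top_dindex. (\<Sum>i\<in>{1..n}. g (grid n i)) \<le>
    real (level_size n) * ((\<integral>x. indicator (cbox 0 1) x *\<^sub>R g x \<partial>lborel) + \<eta>)"
proof -
  have "compact (g ` cbox 0 1)" by (rule compact_continuous_image[OF g compact_cbox])
  then have "bounded (g ` cbox 0 1)" by (rule compact_imp_bounded)
  then obtain M where M: "\<And>x. x \<in> cbox 0 1 \<Longrightarrow> \<bar>g x\<bar> \<le> M"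
    by (auto simp: bounded_iff)
  have int: "(\<integral>x. indicator (cbox 0 1) x *\<^sub>R (g x + M) \<partial>lborel) = (\<integral>x. indicator (cbox 0 1) x *\<^sub>R g x \<partial>lborel) + M"
  proof -
    have "(\<integral>x. indicator (cbox 0 1) x *\<^sub>R (g x + M) \<partial>lborel) = (\<integral>x. indicator (cbox 0 1) x *\<^sub>R g x + indicator (cbox 0 1) x *\<^sub>R M \<partial>lborel)"
      by (simp only: scaleR_add_right)
    also have "\<dots> = (\<integral>x. indicator (cbox 0 1) x *\<^sub>R g x \<partial>lborel) + (\<integral>x. indicator (cbox 0 1) x *\<^sub>R M \<partial>(lborel :: 'd point measure))"
      by (intro Bochner_Integration.integral_add cube_integrable g continuous_on_const)
    finally show ?thesis by simp
  qed
  have "\<forall>\<^sub>F n in at_top_dindex. (\<Sum>i\<in>{1..n}. g (grid n i) + M) \<le>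
    real (level_size n) * ((\<integral>x. indicator (cbox 0 1) x *\<^sub>R (g x + M) \<partial>lborel) + \<eta>)"
    by (intro riemann_sum_upper_nonneg assms continuous_intros) (use M in \<open>force simp: abs_le_iff\<close>)
  then have "\<forall>\<^sub>F n in at_top_dindex. (\<Sum>i\<in>{1..n}. g (grid n i) + M) \<le>
    real (level_size n) * ((\<integral>x. indicator (cbox 0 1) x *\<^sub>R g x \<partial>lborel) + M + \<eta>)"
    unfolding int .
  with eventually_dindex_ge_1 show ?thesis
    by eventually_elim (simp add: sum.distrib card_dindex_range distrib_left)
qed

subsection \<open>Orthogonality of the trigonometric monomials\<close>

lemma integral_lborel_prod_cart:
  fixes f :: "'d::finite \<Rightarrow> real \<Rightarrow> complex"
  assumes "\<And>k. integrable lborel (f k)"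
  shows "(\<integral>x. (\<Prod>k\<in>UNIV. f k (x $ k)) \<partial>(lborel :: 'd point measure)) = (\<Prod>k\<in>UNIV. \<integral>x. f k x \<partial>lborel)"
proof -
  interpret product_sigma_finite "\<lambda>_ :: 'd point. lborel :: real measure" ..
  \<comment> \<open>Lebesgue measure is a product over \<open>Basis\<close>, so the factor
    \<open>f k\<close> has to be attached to the basis vector \<open>axis k 1\<close>.\<close>
  define F where "F b = f (THE k. b = axis k 1)" for b :: "'d point"
  have F: "F (axis k 1) = f k" for k by (simp add: F_def axis_eq_axis)
  have meas: "f k \<in> borel_measurable borel" for k
    using borel_measurable_integrable[OF assms[of k]] by simp
  have Basis: "bij_betw (\<lambda>k. axis k (1 :: real)) UNIV (Basis :: 'd point set)"
    by (auto simp: bij_betw_def inj_on_def axis_eq_axis Basis_vec_def)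
  have reindex: "(\<Prod>b\<in>Basis. G b) = (\<Prod>k\<in>UNIV. G (axis k 1))" for G :: "'d point \<Rightarrow> complex"
    by (rule prod.reindex_bij_betw[OF Basis, symmetric])
  have "(\<integral>x. (\<Prod>k\<in>UNIV. f k (x $ k)) \<partial>(lborel :: 'd point measure)) =
      (\<integral>x. (\<Prod>b\<in>Basis. F b (x \<bullet> b)) \<partial>(lborel :: 'd point measure))"
    by (simp add: reindex F inner_axis)
  also have "\<dots> = (\<integral>x. (\<Prod>b\<in>Basis. F b ((\<Sum>b'\<in>Basis. x b' *\<^sub>R b') \<bullet> b)) \<partial>(\<Pi>\<^sub>M b\<in>(Basis :: 'd point set). lborel))"
    by (subst lborel_eq, subst integral_distr)
      (auto simp: reindex F inner_axis intro!: borel_measurable_prod measurable_compose[OF _ meas])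
  also have "\<dots> = (\<integral>x. (\<Prod>b\<in>Basis. F b (x b)) \<partial>(\<Pi>\<^sub>M b\<in>(Basis :: 'd point set). lborel))"
    by (intro Bochner_Integration.integral_cong prod.cong refl) simp
  also have "\<dots> = (\<Prod>b\<in>Basis. \<integral>x. F b x \<partial>lborel)"
    by (rule product_integral_prod) (use assms in \<open>auto simp: F_def\<close>)
  finally show ?thesis by (simp add: reindex F)
qed

lemma integral_cis_period:
  "(\<integral>x. indicator {-pi..pi} x *\<^sub>R cis (real_of_int m * x) \<partial>lborel) = (if m = 0 then complex_of_real (2 * pi) else 0)"
proof (cases "m = 0")
  case True
  then show ?thesis by (simp add: scaleR_conv_of_real)
next
  case False
  define G where "G z = exp (\<i> * complex_of_int m * z) / (\<i> * complex_of_int m)" for z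
  define F where "F x = G (complex_of_real x)" for x
  have cis_eq: "cis (real_of_int m * x) = exp (\<i> * complex_of_int m * complex_of_real x)" for x
    by (simp add: cis_conv_exp mult.assoc)
  have deriv: "(F has_vector_derivative cis (real_of_int m * x)) (at x within {-pi..pi})" for x
  proof -
    have "(G has_field_derivative exp (\<i> * complex_of_int m * complex_of_real x)) (at (complex_of_real x))"
      unfolding G_def using False by (auto intro!: derivative_eq_intros)
    then show ?thesis unfolding F_def cis_eq by (rule has_vector_derivative_real_field)
  qed
  have "(\<integral>x. indicator {-pi..pi} x *\<^sub>R cis (real_of_int m * x) \<partial>lborel) = F pi - F (- pi)"
    by (rule integral_FTC_Icc[OF _ deriv]) (auto intro!: continuous_intros)
  also have "\<dots> = 0"
  proof -
    have F: "F x = cis (real_of_int m * x) / (\<i> * complex_of_int m)" for x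
      by (simp only: F_def G_def cis_eq)
    have "cis (real_of_int m * pi) = cis (- (real_of_int m * pi)) * cis (2 * pi * real_of_int m)"
      unfolding cis_mult by (simp add: algebra_simps)
    also have "cis (2 * pi * real_of_int m) = 1" by (rule cis_multiple_2pi) simp
    finally show ?thesis by (simp add: F)
  qed
  finally show ?thesis using False by simp
qed

lemma integral_torus_cis:
  "(\<integral>\<theta>. indicator torus \<theta> *\<^sub>R cis (phase j \<theta>) \<partial>(lborel :: ('d::finite) point measure)) =
    (if j = 0 then complex_of_real ((2 * pi) ^ CARD('d)) else 0)"
proof -
  let ?f = "\<lambda>k x. indicator {-pi..pi} x *\<^sub>R cis (real_of_int (j $ k) * x)"
  have "indicator torus \<theta> *\<^sub>R cis (phase j \<theta>) = (\<Prod>k\<in>UNIV. ?f k (\<theta> $ k))" for \<theta>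
  proof (cases "\<theta> \<in> torus")
    case True
    then have "\<theta> $ k \<in> {-pi..pi}" for k by (auto simp: torus_def mem_box_cart)
    then show ?thesis using True
      by (simp add: phase_def cis_conv_exp exp_sum[symmetric] sum_distrib_left)
  next
    case False
    then obtain k where "\<theta> $ k \<notin> {-pi..pi}" by (auto simp: torus_def mem_box_cart)
    then have "?f k (\<theta> $ k) = 0" by (simp add: indicator_def)
    then have "(\<Prod>k\<in>UNIV. ?f k (\<theta> $ k)) = 0" by (intro prod_zero) auto
    with False show ?thesis by simp
  qed
  then have "(\<integral>\<theta>. indicator torus \<theta> *\<^sub>R cis (phase j \<theta>) \<partial>lborel) =
      (\<integral>\<theta>. (\<Prod>k\<in>UNIV. ?f k (\<theta> $ k)) \<partial>(lborel :: 'd point measure))" by simp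
  also have "\<dots> = (\<Prod>k\<in>UNIV. \<integral>x. ?f k x \<partial>lborel)"
    by (intro integral_lborel_prod_cart borel_integrable_compact continuous_intros) simp
  also have "\<dots> = (\<Prod>k\<in>UNIV. if j $ k = 0 then complex_of_real (2 * pi) else 0)"
    by (simp only: integral_cis_period)
  also have "\<dots> = (if j = 0 then complex_of_real ((2 * pi) ^ CARD('d)) else 0)"
  proof (cases "j = 0")
    case False
    then obtain k where "j $ k \<noteq> 0" by (auto simp: Finite_Cartesian_Product.vec_eq_iff)
    then have "(\<Prod>k\<in>UNIV. if j $ k = 0 then complex_of_real (2 * pi) else 0) = 0"
      by (intro prod_zero) auto
    with False show ?thesis by simp
  qed simp
  finally show ?thesis .
qed

lemma glt_domain_eq: "glt_domain = cbox (0, \<chi> k. - pi) (1, \<chi> k. pi)"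
  by (simp add: glt_domain_def torus_def cbox_Pair_eq)

lemma domain_integrable:
  fixes f :: "('d::finite) point \<times> 'd point \<Rightarrow> 'b::{banach, second_countable_topology}"
  shows "continuous_on glt_domain f \<Longrightarrow> integrable lborel (\<lambda>z. indicator glt_domain z *\<^sub>R f z)"
  unfolding glt_domain_eq by (rule borel_integrable_compact[OF compact_cbox])

lemma continuous_on_phase [continuous_intros]:
  "continuous_on S f \<Longrightarrow> continuous_on S (\<lambda>z. phase j (f z))"
  unfolding phase_def by (intro continuous_intros)

lemma integral_domain_product:
  fixes c :: "('d::finite) point \<Rightarrow> complex"
  assumes c: "continuous_on (cbox 0 1) c"
  shows "(\<integral>z. indicator glt_domain z *\<^sub>R (c (fst z) * cis (phase j (snd z))) \<partial>lborel) =
    (\<integral>x. indicator (cbox 0 1) x *\<^sub>R c x \<partial>lborel) * (if j = 0 then complex_of_real ((2 * pi) ^ CARD('d)) else 0)"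
proof -
  let ?f = "\<lambda>z :: 'd point \<times> 'd point. indicator glt_domain z *\<^sub>R (c (fst z) * cis (phase j (snd z)))"
  have cont: "continuous_on glt_domain (\<lambda>z :: 'd point \<times> 'd point. c (fst z) * cis (phase j (snd z)))"
    by (intro continuous_intros continuous_on_compose2[OF c]) (auto simp: glt_domain_def)
  have "integrable lborel ?f" by (rule domain_integrable[OF cont])
  then have int: "integrable (lborel \<Otimes>\<^sub>M lborel) ?f" by (simp only: lborel_prod)
  have "(\<integral>z. ?f z \<partial>lborel) = (\<integral>z. ?f z \<partial>(lborel \<Otimes>\<^sub>M lborel))" by (simp only: lborel_prod)
  also have "\<dots> = (\<integral>x. (\<integral>\<theta>. ?f (x, \<theta>) \<partial>lborel) \<partial>lborel)"
    by (rule lborel_pair.integral_fst'[OF int, symmetric])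
  also have "\<dots> = (\<integral>x. (indicator (cbox 0 1) x *\<^sub>R c x) * (\<integral>\<theta>. indicator torus \<theta> *\<^sub>R cis (phase j \<theta>) \<partial>lborel) \<partial>lborel)"
  proof (rule Bochner_Integration.integral_cong[OF refl])
    fix x :: "'d point"
    have "indicat_real glt_domain (x, \<theta>) = indicator (cbox 0 1) x * indicator torus \<theta>" for \<theta> :: "'d point"
      by (auto simp: glt_domain_def indicator_def)
    then have "?f (x, \<theta>) = (indicator (cbox 0 1) x *\<^sub>R c x) * (indicator torus \<theta> *\<^sub>R cis (phase j \<theta>))" for \<theta>
      by simp
    then show "(\<integral>\<theta>. ?f (x, \<theta>) \<partial>lborel) =
        (indicator (cbox 0 1) x *\<^sub>R c x) * (\<integral>\<theta>. indicator torus \<theta> *\<^sub>R cis (phase j \<theta>) \<partial>lborel)"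
      by (simp only: integral_mult_right_zero)
  qed
  finally show ?thesis by (simp only: integral_torus_cis integral_mult_left_zero)
qed

subsection \<open>The Frobenius norm of a generating sequence\<close>

text \<open>Up to the factor \<open>(2 * pi) ^ CARD('d)\<close>, this is what remains of the inner
  product of two symbols after integration over \<open>\<theta>\<close>: different frequencies or
  matrix units are orthogonal. The same function, summed over grid points, is the inner product of
  the two matrices.\<close>

definition gen_corr :: "('d::finite) term4 \<Rightarrow> 'd term4 \<Rightarrow> 'd point \<Rightarrow> real" where
  "gen_corr = (\<lambda>(a, j, \<alpha>, \<beta>) (b, k, \<gamma>, \<delta>) x. if j = k \<and> \<alpha> = \<gamma> \<and> \<beta> = \<delta> then a x \<bullet> b x else 0)"

lemma inner_gen_sym:
  "inner (gen_sym (a, j, \<alpha>, \<beta>) z) (gen_sym (b, k, \<gamma>, \<delta>) z) =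
    (if \<alpha> = \<gamma> \<and> \<beta> = \<delta> then Re (cnj (a (fst z)) * b (fst z) * cis (phase (k - j) (snd z))) else 0)"
proof -
  have "inner (gen_sym (a, j, \<alpha>, \<beta>) z) (gen_sym (b, k, \<gamma>, \<delta>) z) =
    (\<Sum>p\<in>{\<alpha>}. \<Sum>q\<in>{\<beta>}. entry (gen_sym (a, j, \<alpha>, \<beta>) z) p q \<bullet> entry (gen_sym (b, k, \<gamma>, \<delta>) z) p q)"
    by (rule inner_fmat_eq) (auto simp: entry_gen_sym)
  also have "\<dots> = (if \<alpha> = \<gamma> \<and> \<beta> = \<delta> then
      (a (fst z) * cis (phase j (snd z))) \<bullet> (b (fst z) * cis (phase k (snd z))) else 0)"
    by (auto simp: entry_gen_sym)
  also have "(a (fst z) * cis (phase j (snd z))) \<bullet> (b (fst z) * cis (phase k (snd z))) =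
      Re (cnj (a (fst z) * cis (phase j (snd z))) * (b (fst z) * cis (phase k (snd z))))"
    by (simp add: inner_complex_def algebra_simps)
  also have "cnj (a (fst z) * cis (phase j (snd z))) * (b (fst z) * cis (phase k (snd z))) =
      cnj (a (fst z)) * b (fst z) * (cis (- phase j (snd z)) * cis (phase k (snd z)))"
    by (simp add: cis_cnj)
  also have "cis (- phase j (snd z)) * cis (phase k (snd z)) = cis (phase (k - j) (snd z))"
    using phase_add[of k "- j" "snd z"] by (simp add: cis_mult phase_uminus)
  finally show ?thesis .
qed

lemma continuous_on_gen_corr:
  assumes "continuous_on S a" "continuous_on S b"
  shows "continuous_on S (gen_corr (a, j, \<alpha>, \<beta>) (b, k, \<gamma>, \<delta>))"
  unfolding gen_corr_def using assms
  by (cases "j = k \<and> \<alpha> = \<gamma> \<and> \<beta> = \<delta>") (auto intro!: continuous_intros)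

lemma integral_inner_gen_sym:
  fixes a b :: "('d::finite) point \<Rightarrow> complex"
  assumes a: "continuous_on (cbox 0 1) a" and b: "continuous_on (cbox 0 1) b"
  shows "(\<integral>z. indicator glt_domain z *\<^sub>R inner (gen_sym (a, j, \<alpha>, \<beta>) z) (gen_sym (b, k, \<gamma>, \<delta>) z) \<partial>lborel) =
    (2 * pi) ^ CARD('d) * (\<integral>x. indicator (cbox 0 1) x *\<^sub>R gen_corr (a, j, \<alpha>, \<beta>) (b, k, \<gamma>, \<delta>) x \<partial>lborel)"
    and "integrable lborel (\<lambda>z. indicator glt_domain z *\<^sub>R inner (gen_sym (a, j, \<alpha>, \<beta>) z) (gen_sym (b, k, \<gamma>, \<delta>) z))"
proof -
  define c where "c x = cnj (a x) * b x" for x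
  have c: "continuous_on (cbox 0 1) c" unfolding c_def by (intro continuous_intros a b)
  let ?f = "\<lambda>z :: 'd point \<times> 'd point. indicator glt_domain z *\<^sub>R (c (fst z) * cis (phase (k - j) (snd z)))"
  have "continuous_on glt_domain (\<lambda>z :: 'd point \<times> 'd point. c (fst z) * cis (phase (k - j) (snd z)))"
    by (intro continuous_intros continuous_on_compose2[OF c]) (auto simp: glt_domain_def)
  then have int: "integrable lborel ?f" by (rule domain_integrable)
  define h where "h z = Re (?f z)" for z
  have eq: "indicator glt_domain z *\<^sub>R inner (gen_sym (a, j, \<alpha>, \<beta>) z) (gen_sym (b, k, \<gamma>, \<delta>) z) =
    (if \<alpha> = \<gamma> \<and> \<beta> = \<delta> then h z else 0)" for z
    by (simp add: inner_gen_sym c_def h_def)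
  show "integrable lborel (\<lambda>z. indicator glt_domain z *\<^sub>R inner (gen_sym (a, j, \<alpha>, \<beta>) z) (gen_sym (b, k, \<gamma>, \<delta>) z))"
    unfolding eq using integrable_Re[OF int, folded h_def] by (cases "\<alpha> = \<gamma> \<and> \<beta> = \<delta>") auto
  have "(\<integral>z. h z \<partial>lborel) = Re ((\<integral>x. indicator (cbox 0 1) x *\<^sub>R c x \<partial>lborel) *
      (if k - j = 0 then complex_of_real ((2 * pi) ^ CARD('d)) else 0))"
    unfolding h_def integral_Re[OF int] by (simp only: integral_domain_product[OF c])
  also have "\<dots> = (if k = j then (2 * pi) ^ CARD('d) * (\<integral>x. indicator (cbox 0 1) x *\<^sub>R (a x \<bullet> b x) \<partial>lborel) else 0)"
  proof -
    have "Re (\<integral>x. indicator (cbox 0 1) x *\<^sub>R c x \<partial>lborel) = (\<integral>x. Re (indicator (cbox 0 1) x *\<^sub>R c x) \<partial>lborel)"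
      by (rule integral_Re[symmetric, OF cube_integrable[OF c]])
    also have "\<dots> = (\<integral>x. indicator (cbox 0 1) x *\<^sub>R (a x \<bullet> b x) \<partial>lborel)"
      by (simp add: c_def inner_complex_def)
    finally show ?thesis by (simp del: of_real_power of_real_mult)
  qed
  finally show "(\<integral>z. indicator glt_domain z *\<^sub>R inner (gen_sym (a, j, \<alpha>, \<beta>) z) (gen_sym (b, k, \<gamma>, \<delta>) z) \<partial>lborel) =
    (2 * pi) ^ CARD('d) * (\<integral>x. indicator (cbox 0 1) x *\<^sub>R gen_corr (a, j, \<alpha>, \<beta>) (b, k, \<gamma>, \<delta>) x \<partial>lborel)"
    unfolding eq
    by (cases "\<alpha> = \<gamma> \<and> \<beta> = \<delta>"; cases "k = j") (auto simp: gen_corr_def)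
qed

lemma inner_gen_mat:
  "inner (gen_mat n (a, j, \<alpha>, \<beta>)) (gen_mat n (b, k, \<gamma>, \<delta>)) =
    (\<Sum>i\<in>{i \<in> {1..n}. i - j \<in> {1..n}}. gen_corr (a, j, \<alpha>, \<beta>) (b, k, \<gamma>, \<delta>) (grid n i))"
proof -
  let ?X = "gen_mat n (a, j, \<alpha>, \<beta>)" and ?Y = "gen_mat n (b, k, \<gamma>, \<delta>)"
  let ?R = "{1..n}"
  let ?G = "\<lambda>i. gen_corr (a, j, \<alpha>, \<beta>) (b, k, \<gamma>, \<delta>) (grid n i)"
  have "inner ?X ?Y = (\<Sum>x\<in>?R \<times> {\<alpha>}. \<Sum>y\<in>?R \<times> {\<beta>}. entry ?X x y \<bullet> entry ?Y x y)"
    by (rule inner_fmat_eq) (auto simp: entry_gen_mat split: if_split_asm)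
  also have "\<dots> = (\<Sum>i\<in>?R. \<Sum>l\<in>?R. entry ?X (i, \<alpha>) (l, \<beta>) \<bullet> entry ?Y (i, \<alpha>) (l, \<beta>))"
    by (simp add: sum.cartesian_product')
  also have "\<dots> = (\<Sum>i\<in>?R. \<Sum>l\<in>?R. if l = i - j then ?G i else 0)"
  proof (intro sum.cong refl)
    fix i l assume il: "i \<in> ?R" "l \<in> ?R"
    have eq: "i - l = j \<longleftrightarrow> l = i - j" by (auto simp: algebra_simps)
    show "entry ?X (i, \<alpha>) (l, \<beta>) \<bullet> entry ?Y (i, \<alpha>) (l, \<beta>) = (if l = i - j then ?G i else 0)"
      unfolding entry_gen_mat eq using il by (auto simp: gen_corr_def simp del: atLeastAtMost_iff)
  qed
  also have "\<dots> = (\<Sum>i\<in>?R. if i - j \<in> ?R then ?G i else 0)"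
    by (simp add: sum.delta del: atLeastAtMost_iff)
  also have "\<dots> = (\<Sum>i\<in>{i \<in> ?R. i - j \<in> ?R}. ?G i)"
    by (subst sum.inter_filter) auto
  finally show ?thesis .
qed

text \<open>The inner product is a Riemann sum without the indices whose shift leaves the box.
  Restoring them costs at most \<open>M\<close> times their number, which is half of the allowed
  error.\<close>

lemma inner_gen_mat_upper:
  fixes a b :: "('d::finite) point \<Rightarrow> complex"
  assumes a: "continuous_on (cbox 0 1) a" and b: "continuous_on (cbox 0 1) b" and "0 < \<eta>"
  shows "\<forall>\<^sub>F n in at_top_dindex. inner (gen_mat n (a, j, \<alpha>, \<beta>)) (gen_mat n (b, k, \<gamma>, \<delta>)) \<le>
    real (level_size n) * ((\<integral>x. indicator (cbox 0 1) x *\<^sub>R gen_corr (a, j, \<alpha>, \<beta>) (b, k, \<gamma>, \<delta>) x \<partial>lborel) + \<eta>)"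
proof -
  let ?G = "gen_corr (a, j, \<alpha>, \<beta>) (b, k, \<gamma>, \<delta>)"
  have G: "continuous_on (cbox 0 1) ?G" by (rule continuous_on_gen_corr[OF a b])
  have "compact (?G ` cbox 0 1)" by (rule compact_continuous_image[OF G compact_cbox])
  then have "bounded (?G ` cbox 0 1)" by (rule compact_imp_bounded)
  then obtain M where M: "0 < M" "\<And>x. x \<in> cbox 0 1 \<Longrightarrow> \<bar>?G x\<bar> \<le> M"
    by (auto simp: bounded_pos)
  have "0 < \<eta> / (2 * M)" "0 < \<eta> / 2" using M assms(3) by simp_all
  from eventually_ratio_small[OF this(1), of j] eventually_dindex_ge_1 riemann_sum_upper[OF G this(2)]
  show ?thesis
  proof eventually_elim
    case (elim n)
    let ?A = "{i \<in> {1..n}. i - j \<in> {1..n}}" and ?B = "{i \<in> {1..n}. i - j \<notin> {1..n}}"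
    let ?N = "real (level_size n)"
    have fin: "finite ?A" "finite ?B" by (rule finite_subset[OF _ finite_dindex_range], blast)+
    have split: "(\<Sum>i\<in>{1..n}. ?G (grid n i)) = (\<Sum>i\<in>?A. ?G (grid n i)) + (\<Sum>i\<in>?B. ?G (grid n i))"
      by (subst sum.union_disjoint[symmetric, OF fin]) (auto intro!: sum.cong simp del: atLeastAtMost_iff)
    have "- (\<Sum>i\<in>?B. ?G (grid n i)) \<le> (\<Sum>i\<in>?B. \<bar>?G (grid n i)\<bar>)"
      by (simp add: sum_negf[symmetric] sum_mono del: atLeastAtMost_iff)
    also have "\<dots> \<le> (\<Sum>i\<in>?B. M)"
      by (intro sum_mono M grid_in_cube elim) simp
    also have "\<dots> = M * real (card ?B)" by simp
    also have "\<dots> \<le> M * (\<eta> / (2 * M) * ?N)"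
    proof (rule mult_left_mono)
      have "real (card ?B) \<le> (\<Sum>k\<in>UNIV. real_of_int \<bar>j $ k\<bar> / real_of_int (n $ k)) * ?N"
        by (rule card_dindex_boundary[OF elim(2)])
      also have "\<dots> \<le> \<eta> / (2 * M) * ?N" using elim(1) by (intro mult_right_mono) auto
      finally show "real (card ?B) \<le> \<eta> / (2 * M) * ?N" .
    qed (use M in simp)
    also have "\<dots> = ?N * (\<eta> / 2)" using M by simp
    finally have "(\<Sum>i\<in>?A. ?G (grid n i)) \<le> (\<Sum>i\<in>{1..n}. ?G (grid n i)) + ?N * (\<eta> / 2)"
      using split by linarith
    also have "\<dots> \<le> ?N * ((\<integral>x. indicator (cbox 0 1) x *\<^sub>R ?G x \<partial>lborel) + \<eta> / 2) + ?N * (\<eta> / 2)"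
      using elim(3) by linarith
    also have "\<dots> = ?N * ((\<integral>x. indicator (cbox 0 1) x *\<^sub>R ?G x \<partial>lborel) + \<eta>)"
      by (simp add: algebra_simps)
    finally show ?case unfolding inner_gen_mat .
  qed
qed

lemma norm_sq_sum_list:
  fixes f :: "'a \<Rightarrow> 'b::real_inner"
  shows "(norm (\<Sum>x\<leftarrow>xs. f x))\<^sup>2 = (\<Sum>(x, y)\<leftarrow>List.product xs xs. inner (f x) (f y))"
proof -
  have 1: "inner z (\<Sum>y\<leftarrow>ys. f y) = (\<Sum>y\<leftarrow>ys. inner z (f y))" for z ys
    by (induction ys) (auto simp: inner_add_right)
  have "inner (\<Sum>x\<leftarrow>xs. f x) (\<Sum>y\<leftarrow>ys. f y) = (\<Sum>(x, y)\<leftarrow>List.product xs ys. inner (f x) (f y))" for ys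
    by (induction xs) (auto simp: inner_add_left 1 o_def sum_list_addf)
  then show ?thesis by (simp add: power2_norm_eq_inner)
qed

lemma eventually_sum_list_le:
  fixes u :: "'a \<Rightarrow> 'b \<Rightarrow> real"
  assumes "\<And>x \<eta>. x \<in> set xs \<Longrightarrow> 0 < \<eta> \<Longrightarrow> \<forall>\<^sub>F n in F. u x n \<le> N n * (c x + \<eta>)"
    and "\<And>n. 0 \<le> N n" and "0 < \<eta>"
  shows "\<forall>\<^sub>F n in F. (\<Sum>x\<leftarrow>xs. u x n) \<le> N n * ((\<Sum>x\<leftarrow>xs. c x) + \<eta>)"
  using assms
proof (induction xs arbitrary: \<eta>)
  case (Cons x xs)
  have "0 < \<eta> / 2" using Cons.prems by simp
  then have "\<forall>\<^sub>F n in F. (\<Sum>x\<leftarrow>xs. u x n) \<le> N n * ((\<Sum>x\<leftarrow>xs. c x) + \<eta> / 2)"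
    "\<forall>\<^sub>F n in F. u x n \<le> N n * (c x + \<eta> / 2)"
    using Cons by auto
  then show ?case
  proof eventually_elim
    case (elim n)
    have "N n * (c x + \<eta> / 2) + N n * ((\<Sum>x\<leftarrow>xs. c x) + \<eta> / 2) = N n * ((\<Sum>x\<leftarrow>x # xs. c x) + \<eta>)"
      by (simp add: algebra_simps)
    with elim show ?case by simp
  qed
qed simp

lemma integrable_sum_list:
  fixes u :: "'a \<Rightarrow> 'b \<Rightarrow> real"
  assumes "\<And>x. x \<in> set xs \<Longrightarrow> integrable M (u x)"
  shows "integrable M (\<lambda>z. \<Sum>x\<leftarrow>xs. u x z)"
    and "(\<integral>z. (\<Sum>x\<leftarrow>xs. u x z) \<partial>M) = (\<Sum>x\<leftarrow>xs. \<integral>z. u x z \<partial>M)"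
  using assms by (induction xs) auto

text \<open>Both sides expand over pairs of terms, and pair by pair the inner products of the
  matrices are asymptotically at most those of the symbols, integrated and normalised. This upper
  bound for the second moment of the singular values is the analytic input on the matrices.\<close>

lemma norm_seq_mat_upper:
  fixes ts :: "('d::finite) term4 list"
  assumes "seq_ok t ts" "0 < \<eta>"
  shows "\<forall>\<^sub>F n in at_top_dindex. (norm (seq_mat ts n))\<^sup>2 \<le>
    real (level_size n) * ((\<integral>z. indicator glt_domain z *\<^sub>R (norm (seq_sym ts z))\<^sup>2 \<partial>lborel) / (2 * pi) ^ CARD('d) + \<eta>)"
proof -
  let ?P = "List.product ts ts" and ?c = "\<lambda>(\<tau>, \<sigma>). \<integral>x. indicator (cbox 0 1) x *\<^sub>R gen_corr \<tau> \<sigma> x \<partial>lborel"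
  have ev: "\<forall>\<^sub>F n in at_top_dindex. (case p of (\<tau>, \<sigma>) \<Rightarrow> inner (gen_mat n \<tau>) (gen_mat n \<sigma>)) \<le> real (level_size n) * (?c p + \<epsilon>)"
    if "p \<in> set ?P" "0 < \<epsilon>" for p \<epsilon>
  proof -
    obtain a j \<alpha> \<beta> b k \<gamma> \<delta> where p: "p = ((a, j, \<alpha>, \<beta>), (b, k, \<gamma>, \<delta>))" by (metis prod_cases4 surj_pair)
    then have "continuous_on (cbox 0 1) a" "continuous_on (cbox 0 1) b"
      using that assms(1) by (auto simp: seq_ok_def)
    then show ?thesis unfolding p prod.case using that(2) by (intro inner_gen_mat_upper)
  qed
  have "\<forall>\<^sub>F n in at_top_dindex. (\<Sum>p\<leftarrow>?P. case p of (\<tau>, \<sigma>) \<Rightarrow> inner (gen_mat n \<tau>) (gen_mat n \<sigma>))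
      \<le> real (level_size n) * ((\<Sum>p\<leftarrow>?P. ?c p) + \<eta>)"
    by (rule eventually_sum_list_le[OF ev]) (use assms(2) in auto)
  moreover have "(\<integral>z. indicator glt_domain z *\<^sub>R (norm (seq_sym ts z))\<^sup>2 \<partial>lborel) = (2 * pi) ^ CARD('d) * (\<Sum>p\<leftarrow>?P. ?c p)"
  proof -
    let ?u = "\<lambda>p z. case p of (\<tau>, \<sigma>) \<Rightarrow> indicator glt_domain z *\<^sub>R inner (gen_sym \<tau> z) (gen_sym \<sigma> z)"
    have u: "integrable lborel (?u p)" "(\<integral>z. ?u p z \<partial>lborel) = (2 * pi) ^ CARD('d) * ?c p" if "p \<in> set ?P" for p
    proof -
      obtain a j \<alpha> \<beta> b k \<gamma> \<delta> where p: "p = ((a, j, \<alpha>, \<beta>), (b, k, \<gamma>, \<delta>))" by (metis prod_cases4 surj_pair)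
      then have "continuous_on (cbox 0 1) a" "continuous_on (cbox 0 1) b"
        using that assms(1) by (auto simp: seq_ok_def)
      then show "integrable lborel (?u p)" "(\<integral>z. ?u p z \<partial>lborel) = (2 * pi) ^ CARD('d) * ?c p"
        unfolding p prod.case by (rule integral_inner_gen_sym)+
    qed
    have "indicator glt_domain z *\<^sub>R (norm (seq_sym ts z))\<^sup>2 = (\<Sum>p\<leftarrow>?P. ?u p z)" for z
      unfolding seq_sym_def norm_sq_sum_list
      by (simp add: sum_list_const_mult[symmetric] case_prod_unfold)
    then have "(\<integral>z. indicator glt_domain z *\<^sub>R (norm (seq_sym ts z))\<^sup>2 \<partial>lborel) = (\<Sum>p\<leftarrow>?P. \<integral>z. ?u p z \<partial>lborel)"
      using integrable_sum_list(2)[of ?P lborel ?u, OF u(1)] by simp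
    also have "\<dots> = (\<Sum>p\<leftarrow>?P. (2 * pi) ^ CARD('d) * ?c p)"
      using u(2) by (intro arg_cong[of _ _ sum_list] map_cong refl)
    finally show ?thesis by (simp add: sum_list_const_mult)
  qed
  ultimately show ?thesis
    unfolding seq_mat_def norm_sq_sum_list by simp
qed

section \<open>Smallness in measure of the symbol controls the matrices\<close>

text \<open>Replaces a symbol \<open>h\<close> by its trace times the identity; off-diagonal terms
  have no trace. Applied to \<open>adj p * p\<close> it yields \<open>|p|\<^sup>2 I\<close>, so that
  the cutoff is a power of a scalar.\<close>

definition seq_trace :: "nat \<Rightarrow> ('d::finite) term4 list \<Rightarrow> 'd term4 list" where
  "seq_trace t hs = concat (map (\<lambda>(a, j, \<alpha>, \<beta>). if \<alpha> = \<beta> then map (\<lambda>\<gamma>. (a, j, \<gamma>, \<gamma>)) [0..<t] else []) hs)"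

lemma seq_ok_trace: "seq_ok t hs \<Longrightarrow> seq_ok t (seq_trace t hs)"
  unfolding seq_ok_def seq_trace_def by (fastforce split: if_splits)

lemma entry_seq_sym_diag:
  "entry (seq_sym (map (\<lambda>\<gamma>. (a, j, \<gamma>, \<gamma>)) [0..<t]) z) p q =
    (if p = q \<and> p < t then a (fst z) * cis (phase j (snd z)) else 0)"
  by (induction t) (auto simp: entry_gen_sym)

lemma entry_seq_sym_trace:
  "seq_ok t hs \<Longrightarrow> entry (seq_sym (seq_trace t hs) z) p q =
    (if p = q \<and> p < t then \<Sum>\<alpha><t. entry (seq_sym hs z) \<alpha> \<alpha> else 0)"
proof (induction hs)
  case Nil
  then show ?case by (simp add: seq_trace_def)
next
  case (Cons h hs)
  obtain a j \<alpha> \<beta> where h: "h = (a, j, \<alpha>, \<beta>)" by (metis prod_cases4)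
  have \<alpha>: "\<alpha> < t" using Cons.prems by (simp add: h)
  have IH: "entry (seq_sym (seq_trace t hs) z) p q = (if p = q \<and> p < t then \<Sum>\<alpha><t. entry (seq_sym hs z) \<alpha> \<alpha> else 0)"
    using Cons by (simp add: h)
  have split: "seq_trace t (h # hs) = (if \<alpha> = \<beta> then map (\<lambda>\<gamma>. (a, j, \<gamma>, \<gamma>)) [0..<t] else []) @ seq_trace t hs"
    by (simp add: seq_trace_def h)
  have "(\<Sum>\<gamma><t. entry (gen_sym h z) \<gamma> \<gamma>) = (\<Sum>\<gamma><t. if \<gamma> = \<alpha> then (if \<alpha> = \<beta> then a (fst z) * cis (phase j (snd z)) else 0) else 0)"
    by (intro sum.cong) (auto simp: h entry_gen_sym)
  also have "\<dots> = (if \<alpha> = \<beta> then a (fst z) * cis (phase j (snd z)) else 0)" using \<alpha> by simp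
  finally have gen: "(\<Sum>\<gamma><t. entry (gen_sym h z) \<gamma> \<gamma>) = (if \<alpha> = \<beta> then a (fst z) * cis (phase j (snd z)) else 0)" .
  show ?case
    unfolding split by (simp add: IH entry_seq_sym_diag sum.distrib gen)
qed

lemma seq_sym_norm_sq:
  assumes "seq_ok t ts"
  shows "(norm (seq_sym ts z))\<^sup>2 = (\<Sum>p<t. \<Sum>q<t. (cmod (entry (seq_sym ts z) p q))\<^sup>2)"
  by (rule norm_fmat_sq) (use fsupp_seq_sym[OF assms, of z] in \<open>auto simp: subset_iff fsupp_def\<close>)

lemma seq_sym_abs_square:
  assumes "seq_ok t ts"
  shows "seq_sym (seq_trace t (seq_mult (seq_adj ts) ts)) z = (norm (seq_sym ts z))\<^sup>2 *\<^sub>R idm {..<t}"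
proof (rule fmat_eqI)
  fix p q
  have H: "entry (adj (seq_sym ts z) * seq_sym ts z) \<alpha> \<alpha> = complex_of_real (\<Sum>l<t. (cmod (entry (seq_sym ts z) l \<alpha>))\<^sup>2)" for \<alpha>
  proof -
    have "entry (adj (seq_sym ts z) * seq_sym ts z) \<alpha> \<alpha> = (\<Sum>l<t. cnj (entry (seq_sym ts z) l \<alpha>) * entry (seq_sym ts z) l \<alpha>)"
      using fsupp_seq_sym[OF assms, of z] by (subst entry_times[of "{..<t}"]) auto
    then show ?thesis by (simp only: of_real_sum complex_norm_square mult.commute)
  qed
  have "(\<Sum>\<alpha><t. \<Sum>l<t. (cmod (entry (seq_sym ts z) l \<alpha>))\<^sup>2) = (norm (seq_sym ts z))\<^sup>2"
    unfolding seq_sym_norm_sq[OF assms] by (rule sum.swap)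
  then have tr: "(\<Sum>\<alpha><t. entry (adj (seq_sym ts z) * seq_sym ts z) \<alpha> \<alpha>) = complex_of_real ((norm (seq_sym ts z))\<^sup>2)"
    by (simp only: H of_real_sum[symmetric])
  have ok: "seq_ok t (seq_mult (seq_adj ts) ts)" by (intro seq_ok_mult seq_ok_adj assms)
  show "entry (seq_sym (seq_trace t (seq_mult (seq_adj ts) ts)) z) p q = entry ((norm (seq_sym ts z))\<^sup>2 *\<^sub>R idm {..<t}) p q"
    unfolding entry_seq_sym_trace[OF ok] seq_sym_mult seq_sym_adj tr by (simp add: entry_idm)
qed

text \<open>The symbol of \<open>seq_cutoff t k c ts\<close> is \<open>(1 - |p|\<^sup>2 / c)^k I\<close> if \<open>p\<close> is the symbol of \<open>ts\<close>.\<close>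

primrec seq_cutoff :: "nat \<Rightarrow> nat \<Rightarrow> real \<Rightarrow> ('d::finite) term4 list \<Rightarrow> 'd term4 list" where
  "seq_cutoff t 0 c ts = seq_idm t"
| "seq_cutoff t (Suc k) c ts = seq_mult (seq_cutoff t k c ts)
     (seq_idm t @ seq_smult (complex_of_real (- 1 / c)) (seq_trace t (seq_mult (seq_adj ts) ts)))"

lemma seq_ok_cutoff: "seq_ok t ts \<Longrightarrow> seq_ok t (seq_cutoff t k c ts)"
  by (induction k) (auto intro!: seq_ok_mult seq_ok_idm seq_ok_smult seq_ok_trace seq_ok_adj)

lemma idm_idm: "finite S \<Longrightarrow> idm S * idm S = idm S"
  by (simp add: mult_idm fsupp_idm)

lemma seq_sym_cutoff:
  assumes "seq_ok t ts"
  shows "seq_sym (seq_cutoff t k c ts) z = (1 - (norm (seq_sym ts z))\<^sup>2 / c) ^ k *\<^sub>R idm {..<t}"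
proof (induction k)
  case 0
  show ?case by (simp add: seq_sym_idm)
next
  case (Suc k)
  have "seq_sym (seq_idm t @ seq_smult (complex_of_real (- 1 / c)) (seq_trace t (seq_mult (seq_adj ts) ts))) z =
      (1 - (norm (seq_sym ts z))\<^sup>2 / c) *\<^sub>R idm {..<t}"
    by (simp add: seq_sym_smult_of_real seq_sym_idm seq_sym_abs_square[OF assms] scaleR_left_diff_distrib
        del: of_real_minus of_real_divide)
  then show ?case by (simp add: seq_sym_mult Suc idm_idm)
qed

lemma continuous_on_seq_sym_entry:
  "seq_ok t ts \<Longrightarrow> continuous_on glt_domain (\<lambda>z. entry (seq_sym ts z) p q)"
proof (induction ts)
  case (Cons \<tau> ts)
  obtain a j \<alpha> \<beta> where \<tau>: "\<tau> = (a, j, \<alpha>, \<beta>)" by (metis prod_cases4)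
  have a: "continuous_on (cbox 0 1) a" using Cons.prems by (simp add: \<tau>)
  have "continuous_on glt_domain (\<lambda>z. a (fst z) * cis (phase j (snd z)))"
    by (intro continuous_intros continuous_on_compose2[OF a]) (auto simp: glt_domain_def)
  then have "continuous_on glt_domain (\<lambda>z. entry (gen_sym \<tau> z) p q)"
    unfolding \<tau> entry_gen_sym by (cases "p = \<alpha> \<and> q = \<beta>") auto
  with Cons show ?case by (simp add: \<tau> continuous_on_add)
qed simp

lemma continuous_on_norm_seq_sym:
  "seq_ok t ts \<Longrightarrow> continuous_on glt_domain (\<lambda>z. (norm (seq_sym ts z))\<^sup>2)"
  by (simp only: seq_sym_norm_sq) (intro continuous_intros continuous_on_seq_sym_entry)

section \<open>Integrals and superlevel sets on the domain of the symbols\<close>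

lemma measure_glt_domain: "measure lborel (glt_domain :: (('d::finite) point \<times> 'd point) set) = (2 * pi) ^ CARD('d)"
proof -
  let ?l = "(\<chi> k. - pi) :: 'd point" and ?u = "(\<chi> k. pi) :: 'd point"
  have "?l \<in> cbox ?l ?u" by (simp add: mem_box_cart)
  then have "cbox ?l ?u \<noteq> {}" by blast
  from content_cbox_cart[OF this] have "measure lborel (cbox ?l ?u) = (2 * pi) ^ CARD('d)" by simp
  then show ?thesis
    using content_Pair[of "0 :: 'd point" ?l 1 ?u] by (simp add: glt_domain_eq)
qed

lemma glt_domain_borel [measurable]: "glt_domain \<in> sets borel"
  unfolding glt_domain_eq by simp

lemma emeasure_glt_domain_finite: "emeasure lborel (glt_domain :: (('d::finite) point \<times> 'd point) set) < \<infinity>"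
  unfolding glt_domain_eq by (simp add: emeasure_lborel_cbox_eq)

lemma superlevel_borel:
  fixes u :: "('d::finite) point \<times> 'd point \<Rightarrow> real"
  assumes "continuous_on glt_domain u" "0 \<le> \<delta>"
  shows "{z \<in> glt_domain. \<delta> < u z} \<in> sets borel"
proof -
  have "(\<lambda>z. indicator glt_domain z *\<^sub>R u z) \<in> borel_measurable borel"
    using borel_measurable_integrable[OF domain_integrable[OF assms(1)]] by simp
  then have "{z \<in> space borel. \<delta> < indicator glt_domain z *\<^sub>R u z} \<in> sets borel"
    by (rule borel_measurable_less[OF borel_measurable_const])
  moreover have "{z \<in> space borel. \<delta> < indicator glt_domain z *\<^sub>R u z} = {z \<in> glt_domain. \<delta> < u z}"
    using assms(2) by (auto simp: indicator_def split: if_splits)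
  ultimately show ?thesis by simp
qed

lemma integral_domain_le:
  fixes f :: "('d::finite) point \<times> 'd point \<Rightarrow> real"
  assumes f: "continuous_on glt_domain f" and B: "B \<in> sets borel" "B \<subseteq> glt_domain"
    and "\<And>z. z \<in> glt_domain - B \<Longrightarrow> f z \<le> a" "\<And>z. z \<in> B \<Longrightarrow> f z \<le> a + b" and "0 \<le> a"
  shows "(\<integral>z. indicator glt_domain z *\<^sub>R f z \<partial>lborel) \<le> a * (2 * pi) ^ CARD('d) + b * measure lborel B"
proof -
  have fin: "emeasure lborel B < \<infinity>"
    by (rule order_le_less_trans[OF emeasure_mono emeasure_glt_domain_finite]) (use B(2) in auto)
  have int: "integrable lborel (\<lambda>z. indicator glt_domain z *\<^sub>R a)" "integrable lborel (\<lambda>z. indicator B z *\<^sub>R b)"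
    using fin emeasure_glt_domain_finite B(1)
    by (auto intro!: integrable_scaleR_left integrable_real_indicator)
  have "(\<integral>z. indicator glt_domain z *\<^sub>R f z \<partial>lborel) \<le> (\<integral>z. indicator glt_domain z *\<^sub>R a + indicator B z *\<^sub>R b \<partial>lborel)"
  proof (rule integral_mono)
    fix z
    show "indicator glt_domain z *\<^sub>R f z \<le> indicator glt_domain z *\<^sub>R a + indicator B z *\<^sub>R b"
      using assms(2-6) by (auto simp: indicator_def)
  qed (intro domain_integrable f Bochner_Integration.integrable_add int)+
  also have "\<dots> = (\<integral>z. indicator glt_domain z *\<^sub>R a \<partial>(lborel :: ('d point \<times> 'd point) measure)) + (\<integral>z. indicator B z *\<^sub>R b \<partial>lborel)"
    by (rule Bochner_Integration.integral_add[OF int])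
  also have "\<dots> = measure lborel (glt_domain :: ('d point \<times> 'd point) set) * a + measure lborel B * b"
    using B(1) by simp
  finally show ?thesis by (simp add: measure_glt_domain mult.commute)
qed

text \<open>For \<open>q = (1 - x) ^ k\<close>, Bernoulli's inequality keeps \<open>q\<close> near 1
  where \<open>x\<close> is small against \<open>1 / k\<close>. The bound on
  \<open>x * q\<^sup>2\<close> holds for every \<open>x\<close> in the unit interval, since it is
  one term of the binomial expansion of \<open>(x + (1 - x)) ^ (2 * k + 1) = 1\<close>.\<close>

lemma bernoulli_cutoff:
  fixes x :: real
  assumes "0 \<le> x" "x \<le> 1"
  shows "0 \<le> 1 - (1 - x) ^ k" "1 - (1 - x) ^ k \<le> 1" "1 - (1 - x) ^ k \<le> real k * x"
    "real (2 * k + 1) * (x * ((1 - x) ^ k)\<^sup>2) \<le> 1"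
proof -
  show "0 \<le> 1 - (1 - x) ^ k" "1 - (1 - x) ^ k \<le> 1"
    using assms by (auto simp: power_le_one)
  show "1 - (1 - x) ^ k \<le> real k * x"
    using Bernoulli_inequality[of "- x" k] assms by simp
  have "real (2 * k + 1) * (x * ((1 - x) ^ k)\<^sup>2) = real (2 * k + 1) * (x ^ 1 * (1 - x) ^ (2 * k))"
    by (simp add: power_mult[symmetric] mult.commute)
  also have "\<dots> = real ((2 * k + 1) choose 1) * x ^ 1 * (1 - x) ^ (2 * k + 1 - 1)" by simp
  also have "\<dots> \<le> (\<Sum>l\<le>2 * k + 1. real ((2 * k + 1) choose l) * x ^ l * (1 - x) ^ (2 * k + 1 - l))"
    by (rule member_le_sum[where f = "\<lambda>l. real ((2 * k + 1) choose l) * x ^ l * (1 - x) ^ (2 * k + 1 - l)"])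
      (use assms in auto)
  also have "\<dots> = (x + (1 - x)) ^ (2 * k + 1)"
    by (rule binomial_ring[symmetric])
  finally show "real (2 * k + 1) * (x * ((1 - x) ^ k)\<^sup>2) \<le> 1" by simp
qed

text \<open>
  If \<open>|p|\<^sup>2 \<le> \<delta>\<close> off a small set, the symbol \<open>q\<close> of a cutoff sequence is close to \<open>1\<close> in \<open>L\<^sup>2\<close>, so
  \<open>I - Q\<close> is of norm at most \<open>1/2\<close> up to low rank, and \<open>p q\<close> is uniformly small, so \<open>P Q\<close> is small.
  The equation \<open>P = P Q + P (I - Q)\<close> then yields the claim.
\<close>

lemma dcmp_seq_mat:
  assumes "0 < \<epsilon>" "1 \<le> t"
  obtains C where "0 < C"
    "\<And>(ts :: ('d::finite) term4 list) \<delta>. seq_ok t ts \<Longrightarrow> 0 < \<delta> \<Longrightarrow>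
      measure lborel {z \<in> glt_domain. \<delta> < (norm (seq_sym ts z))\<^sup>2} \<le> \<epsilon> * (2 * pi) ^ CARD('d) \<Longrightarrow>
      \<forall>\<^sub>F n in at_top_dindex. dcmp (13 * real t * \<epsilon> * real (level_size n)) (C * sqrt \<delta>) (seq_mat ts n)"
proof -
  \<comment> \<open>Off the exceptional set \<open>1 - q\<close> will be at most
    \<open>2 / K\<close>, and its square has to be at most \<open>\<epsilon>\<close>.\<close>
  define K where "K = 2 / sqrt \<epsilon>"
  have K: "0 < K" "(2 / K)\<^sup>2 = \<epsilon>" using assms(1) by (auto simp: K_def)
  \<comment> \<open>\<open>C * sqrt \<delta>\<close> will be \<open>3 * M\<close> for the
    \<open>M\<close> below. It is essential that \<open>C\<close> depends on
    \<open>\<epsilon>\<close> only, neither on \<open>\<delta>\<close> nor on the sequence.\<close>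
  define C where "C = 3 * sqrt (6 * K / \<epsilon>)"
  let ?D = "(2 * pi) ^ CARD('d)"
  have D: "0 < ?D" by simp
  have "0 < C" using K assms by (simp add: C_def)
  moreover have "\<forall>\<^sub>F n in at_top_dindex. dcmp (13 * real t * \<epsilon> * real (level_size n)) (C * sqrt \<delta>) (seq_mat ts n)"
    if ok: "seq_ok t ts" and \<delta>: "0 < \<delta>"
      and meas: "measure lborel {z \<in> glt_domain. \<delta> < (norm (seq_sym ts z))\<^sup>2} \<le> \<epsilon> * ?D"
    for ts :: "'d term4 list" and \<delta>
  proof -
    define u where "u z = (norm (seq_sym ts z))\<^sup>2" for z
    have u0: "0 \<le> u z" for z by (simp add: u_def)
    have u: "continuous_on glt_domain u" unfolding u_def by (rule continuous_on_norm_seq_sym[OF ok])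
    define B where "B = {z \<in> glt_domain. \<delta> < u z}"
    have B: "B \<in> sets borel" "B \<subseteq> glt_domain" "measure lborel B \<le> \<epsilon> * ?D"
      using superlevel_borel[OF u, of \<delta>] \<delta> meas by (simp_all add: B_def u_def)
    have "compact (glt_domain :: ('d point \<times> 'd point) set)" unfolding glt_domain_eq by (rule compact_cbox)
    then have "bounded (u ` glt_domain)" by (intro compact_imp_bounded compact_continuous_image u)
    then obtain b where b: "\<And>z. z \<in> glt_domain \<Longrightarrow> \<bar>u z\<bar> \<le> b" by (auto simp: bounded_iff)
    \<comment> \<open>\<open>c\<close> bounds \<open>|p|\<^sup>2\<close>, so that
      \<open>|p|\<^sup>2 / c\<close> lies in the unit interval; the maximum with
      \<open>K * \<delta>\<close> makes \<open>c / (K * \<delta>)\<close> at least 1, so rounding it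
      up at most doubles it.\<close>
    define c where "c = max b (K * \<delta>)"
    have "0 < K * \<delta>" using K \<delta> by simp
    moreover have c2: "K * \<delta> \<le> c" by (simp add: c_def)
    ultimately have c1: "0 < c" by linarith
    have c3: "u z \<le> c" if "z \<in> glt_domain" for z
      using b[OF that] by (simp add: c_def)
    note c = c1 c2 c3
    \<comment> \<open>The degree depends on the symbol through \<open>c\<close>, but
      \<open>c\<close> cancels from both estimates for the cutoff.\<close>
    define k where "k = nat \<lceil>c / (K * \<delta>)\<rceil>"
    define x where "x = c / (K * \<delta>)"
    have "1 \<le> x" using c2 \<open>0 < K * \<delta>\<close> by (simp add: x_def pos_le_divide_eq)
    then have k': "x \<le> real k" "real k \<le> 2 * x"
      unfolding k_def x_def[symmetric] by linarith+
    note k = k'[unfolded x_def]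
    define qs where "qs = seq_cutoff t k c ts"
    define v where "v z = (1 - u z / c) ^ k" for z
    have ok_q: "seq_ok t qs" unfolding qs_def by (rule seq_ok_cutoff[OF ok])
    have sym_q: "seq_sym qs z = v z *\<^sub>R idm {..<t}" for z
      unfolding qs_def v_def u_def by (rule seq_sym_cutoff[OF ok])
    have v: "0 \<le> 1 - v z" "1 - v z \<le> 1" "1 - v z \<le> real k * (u z / c)" "u z * (v z)\<^sup>2 \<le> K * \<delta>"
      if "z \<in> glt_domain" for z
    proof -
      have x: "0 \<le> u z / c" "u z / c \<le> 1" using u0[of z] c that by auto
      show "0 \<le> 1 - v z" "1 - v z \<le> 1" "1 - v z \<le> real k * (u z / c)"
        unfolding v_def by (rule bernoulli_cutoff[OF x])+
      have x0: "0 \<le> u z / c * (v z)\<^sup>2" using x by (intro mult_nonneg_nonneg) auto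
      have "c / (K * \<delta>) * (u z / c * (v z)\<^sup>2) \<le> real (2 * k + 1) * (u z / c * (v z)\<^sup>2)"
        using k(1) by (intro mult_right_mono x0) simp
      also have "\<dots> \<le> 1" unfolding v_def by (rule bernoulli_cutoff[OF x])
      finally have "(u z * (v z)\<^sup>2) / (K * \<delta>) \<le> 1" using c(1) by simp
      then show "u z * (v z)\<^sup>2 \<le> K * \<delta>" using K \<delta> by (simp add: pos_divide_le_eq)
    qed
    define ps where "ps = seq_mult ts qs"
    define zs where "zs = seq_idm t @ seq_smult (complex_of_real (- 1)) qs"
    have ok_ps: "seq_ok t ps" unfolding ps_def by (rule seq_ok_mult[OF ok ok_q])
    have ok_zs: "seq_ok t zs" unfolding zs_def by (simp add: seq_ok_idm seq_ok_smult[OF ok_q] del: of_real_minus)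
    have norm_ps: "(norm (seq_sym ps z))\<^sup>2 = u z * (v z)\<^sup>2" for z
    proof -
      have "seq_sym ps z = v z *\<^sub>R seq_sym ts z"
        unfolding ps_def seq_sym_mult sym_q using fsupp_seq_sym[OF ok] by (simp add: mult_idm)
      then show ?thesis by (simp add: u_def power_mult_distrib mult.commute)
    qed
    have norm_zs: "(norm (seq_sym zs z))\<^sup>2 = real t * (1 - v z)\<^sup>2" for z
    proof -
      have "seq_sym zs z = (1 - v z) *\<^sub>R idm {..<t}"
        unfolding zs_def by (simp add: seq_sym_smult_of_real seq_sym_idm sym_q scaleR_left_diff_distrib del: of_real_minus)
      moreover have "(norm (idm {..<t} :: nat fmat))\<^sup>2 = real t"
      proof -
        have "(norm (idm {..<t} :: nat fmat))\<^sup>2 = (\<Sum>i<t. \<Sum>j<t. (cmod (if i = j \<and> i \<in> {..<t} then 1 else 0))\<^sup>2)"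
          by (subst norm_fmat_sq[of "{..<t}" "{..<t}"]) (auto simp: entry_idm)
        also have "\<dots> = (\<Sum>i<t. \<Sum>j<t. if j = i then 1 else 0)"
          by (intro sum.cong) auto
        finally show ?thesis by simp
      qed
      ultimately show ?thesis by (simp add: power_mult_distrib mult.commute)
    qed
    have int_ps: "(\<integral>z. indicator glt_domain z *\<^sub>R (norm (seq_sym ps z))\<^sup>2 \<partial>lborel) \<le> K * \<delta> * ?D"
    proof -
      have "(\<integral>z. indicator glt_domain z *\<^sub>R (norm (seq_sym ps z))\<^sup>2 \<partial>lborel) \<le> K * \<delta> * ?D + 0 * measure lborel B"
        by (rule integral_domain_le[OF continuous_on_norm_seq_sym[OF ok_ps] B(1,2)])
          (use v(4) B(2) K \<delta> in \<open>auto simp: norm_ps\<close>)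
      then show ?thesis by simp
    qed
    have int_zs: "(\<integral>z. indicator glt_domain z *\<^sub>R (norm (seq_sym zs z))\<^sup>2 \<partial>lborel) \<le> 2 * real t * \<epsilon> * ?D"
    proof -
      have 1: "(1 - v z)\<^sup>2 \<le> 1" if "z \<in> glt_domain" for z
        using v(1,2)[OF that] by (simp add: power_le_one)
      have 2: "(1 - v z)\<^sup>2 \<le> \<epsilon>" if z: "z \<in> glt_domain - B" for z
      proof -
        have "u z \<le> \<delta>" using z by (auto simp: B_def)
        have "1 - v z \<le> real k * (u z / c)" using v(3) z by auto
        also have "\<dots> \<le> 2 * (c / (K * \<delta>)) * (\<delta> / c)"
          using k \<open>u z \<le> \<delta>\<close> u0[of z] c(1) K \<delta> by (intro mult_mono divide_right_mono) auto
        also have "\<dots> = 2 / K" using c(1) \<delta> by simp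
        finally have "(1 - v z)\<^sup>2 \<le> (2 / K)\<^sup>2" using v(1) z by (intro power_mono) auto
        then show ?thesis by (simp only: K(2))
      qed
      have "(\<integral>z. indicator glt_domain z *\<^sub>R (norm (seq_sym zs z))\<^sup>2 \<partial>lborel) \<le> real t * \<epsilon> * ?D + real t * measure lborel B"
      proof (rule integral_domain_le[OF continuous_on_norm_seq_sym[OF ok_zs] B(1,2)])
        fix z assume "z \<in> glt_domain - B"
        then show "(norm (seq_sym zs z))\<^sup>2 \<le> real t * \<epsilon>"
          unfolding norm_zs by (intro mult_left_mono 2) auto
      next
        fix z assume "z \<in> B"
        then have "real t * (1 - v z)\<^sup>2 \<le> real t * 1" using B(2) by (intro mult_left_mono 1) auto
        then show "(norm (seq_sym zs z))\<^sup>2 \<le> real t * \<epsilon> + real t"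
          unfolding norm_zs using mult_nonneg_nonneg[of "real t" \<epsilon>] assms(1) by linarith
      qed (use assms(1) in simp)
      also have "real t * measure lborel B \<le> real t * (\<epsilon> * ?D)" by (intro mult_left_mono B(3)) simp
      also have "real t * \<epsilon> * ?D + real t * (\<epsilon> * ?D) = 2 * real t * \<epsilon> * ?D" by simp
      finally show ?thesis by simp
    qed
    have "0 < K * \<delta>" "0 < real t * \<epsilon>" using K \<delta> assms by simp_all
    note ev = norm_seq_mat_upper[OF ok_ps this(1)] norm_seq_mat_upper[OF ok_zs this(2)]
      frob_small_seq_mult[OF ok ok_q, unfolded frob_small_def, rule_format, OF this(1)]
    \<comment> \<open>\<open>6 K \<delta> = 2 (K \<delta> + 2 K \<delta>)\<close> bounds
      \<open>|P Q|\<^sup>2 / N\<close>, by the error of the product formula and the norm of the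
      product sequence; with this \<open>M\<close> it costs rank
      \<open>\<epsilon> N\<close>.\<close>
    define M where "M = sqrt (6 * K * \<delta> / \<epsilon>)"
    have M: "0 < M" "M\<^sup>2 = 6 * K * \<delta> / \<epsilon>" using K \<delta> assms(1) by (auto simp: M_def)
    from ev show ?thesis
    proof eventually_elim
      case (elim n)
      let ?N = "real (level_size n)" and ?P = "seq_mat ts n" and ?Q = "seq_mat qs n" and ?Z = "seq_mat zs n"
      have 1: "(norm (seq_mat ps n))\<^sup>2 \<le> 2 * (K * \<delta>) * ?N"
      proof -
        have "?N * ((\<integral>z. indicator glt_domain z *\<^sub>R (norm (seq_sym ps z))\<^sup>2 \<partial>lborel) / ?D + K * \<delta>) \<le> ?N * (K * \<delta> + K * \<delta>)"
          using int_ps D by (intro mult_left_mono add_right_mono) (simp_all add: pos_divide_le_eq)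
        with elim(1) show ?thesis by (simp add: algebra_simps)
      qed
      \<comment> \<open>The integral gives \<open>2 t \<epsilon>\<close> and the asymptotic error
        another \<open>t \<epsilon>\<close>; \<open>3 = 12 * (1/2)^2\<close> turns this into the
        rank that buys the norm bound 1/2 for \<open>I - Q\<close>.\<close>
      have 2: "(norm ?Z)\<^sup>2 \<le> 12 * real t * \<epsilon> * ?N * (1/2)\<^sup>2"
      proof -
        have "?N * ((\<integral>z. indicator glt_domain z *\<^sub>R (norm (seq_sym zs z))\<^sup>2 \<partial>lborel) / ?D + real t * \<epsilon>) \<le> ?N * (2 * real t * \<epsilon> + real t * \<epsilon>)"
          using int_zs D by (intro mult_left_mono add_right_mono) (simp_all add: pos_divide_le_eq)
        with elim(2) show ?thesis by (simp add: power2_eq_square algebra_simps)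
      qed
      have "(norm (?P * ?Q))\<^sup>2 \<le> 2 * ((norm (?P * ?Q - seq_mat ps n))\<^sup>2 + (norm (seq_mat ps n))\<^sup>2)"
        using norm_add_sq_le[of "?P * ?Q - seq_mat ps n" "seq_mat ps n"] by simp
      also have "\<dots> \<le> 2 * (K * \<delta> * ?N + 2 * (K * \<delta>) * ?N)"
        using elim(3) 1 unfolding ps_def by (intro mult_left_mono add_mono) auto
      also have "\<dots> = \<epsilon> * ?N * M\<^sup>2" using assms(1) by (simp add: M(2))
      finally have Y: "dcmp (\<epsilon> * ?N) M (?P * ?Q)" by (rule dcmp_frobenius[OF M(1)])
      have Z: "dcmp (12 * real t * \<epsilon> * ?N) (1/2) ?Z"
        using 2 by (intro dcmp_frobenius) auto
      have Zeq: "?Z = idm ({1..n} \<times> {..<t}) - ?Q"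
        by (simp add: zs_def seq_mat_smult_of_real seq_mat_idm del: of_real_minus)
      have "?P * idm ({1..n} \<times> {..<t}) = ?P"
        using fsupp_seq_mat[OF ok] by (intro mult_idm) auto
      then have "?P = ?P * ?Q + ?P * ?Z" by (simp add: Zeq right_diff_distrib)
      from dcmp_neumann[OF this Y Z M(1)]
      have "dcmp (\<epsilon> * ?N + 12 * real t * \<epsilon> * ?N) (2 * M + M) ?P" .
      moreover have "\<epsilon> * ?N + 12 * real t * \<epsilon> * ?N \<le> 13 * real t * \<epsilon> * ?N"
      proof -
        have "1 * (\<epsilon> * ?N) \<le> real t * (\<epsilon> * ?N)" using assms by (intro mult_right_mono) auto
        then show ?thesis by (simp add: algebra_simps)
      qed
      moreover have "2 * M + M = C * sqrt \<delta>"
        by (simp add: M_def C_def real_sqrt_mult[symmetric])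
      ultimately show ?case by (auto intro: dcmp_mono)
    qed
  qed
  ultimately show thesis by (rule that)
qed

section \<open>From convergence almost everywhere to estimates in measure\<close>

lemma measure_superlevel_tendsto_0:
  fixes u :: "nat \<Rightarrow> ('d::finite) point \<times> 'd point \<Rightarrow> real"
  assumes u: "\<And>m. continuous_on glt_domain (u m)"
    and AE: "AE z in lborel. z \<in> glt_domain \<longrightarrow> (\<lambda>m. u m z) \<longlonglongrightarrow> 0" and "0 < \<delta>"
  shows "(\<lambda>m. measure lborel {z \<in> glt_domain. \<delta> < u m z}) \<longlonglongrightarrow> 0"
proof -
  let ?B = "\<lambda>m. {z \<in> glt_domain. \<delta> < u m z}"
  have B: "?B m \<in> sets borel" for m using superlevel_borel[OF u] assms(3) by simp
  have "(\<lambda>m. \<integral>z. indicat_real (?B m) z \<partial>lborel) \<longlonglongrightarrow> (\<integral>z. (0 :: real) \<partial>(lborel :: ('d point \<times> 'd point) measure))"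
  proof (rule integral_dominated_convergence[where w = "indicat_real glt_domain"])
    show "integrable lborel (indicat_real (glt_domain :: ('d point \<times> 'd point) set))"
      using emeasure_glt_domain_finite by (intro integrable_real_indicator) auto
    show "AE z in lborel. (\<lambda>m. indicat_real (?B m) z) \<longlonglongrightarrow> 0"
      using AE
    proof eventually_elim
      case (elim z)
      show ?case
      proof (cases "z \<in> glt_domain")
        case True
        then have "eventually (\<lambda>m. u m z < \<delta>) sequentially"
          using elim assms(3) by (auto dest: order_tendstoD)
        then have "eventually (\<lambda>m. indicat_real (?B m) z = 0) sequentially"
          by eventually_elim (auto simp: indicator_def)
        then show ?thesis by (rule tendsto_eventually)
      qed simp
    qed
    show "(\<lambda>z. indicat_real (?B m) z) \<in> borel_measurable lborel" for m
      using B[of m] by (intro borel_measurable_indicator) simp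
  qed (auto simp: indicator_def)
  then show ?thesis using B by simp
qed

text \<open>The sets where some \<open>u m\<close> exceeds \<open>K\<close> decrease to a null set
  as \<open>K\<close> grows, and the domain has finite measure. The union over \<open>m\<close> is
  what makes \<open>K\<close> independent of \<open>m\<close>.\<close>

lemma measure_superlevel_uniform:
  fixes u :: "nat \<Rightarrow> ('d::finite) point \<times> 'd point \<Rightarrow> real"
  assumes u: "\<And>m. continuous_on glt_domain (u m)"
    and AE: "AE z in lborel. z \<in> glt_domain \<longrightarrow> bdd_above (range (\<lambda>m. u m z))" and "0 < \<epsilon>"
  obtains K where "0 < K" "\<And>m. measure lborel {z \<in> glt_domain. K < u m z} \<le> \<epsilon>"
proof -
  define B where "B K = (\<Union>m. {z \<in> glt_domain. real K < u m z})" for K :: nat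
  have B': "{z \<in> glt_domain. real K < u m z} \<in> sets borel" for K m
    using superlevel_borel[OF u] by simp
  then have B: "B K \<in> sets borel" for K unfolding B_def by auto
  have fin: "emeasure lborel (B K) < \<infinity>" for K
    by (rule order_le_less_trans[OF emeasure_mono emeasure_glt_domain_finite]) (auto simp: B_def)
  have "(\<lambda>K. \<integral>z. indicat_real (B K) z \<partial>lborel) \<longlonglongrightarrow> (\<integral>z. (0 :: real) \<partial>(lborel :: ('d point \<times> 'd point) measure))"
  proof (rule integral_dominated_convergence[where w = "indicat_real glt_domain"])
    show "integrable lborel (indicat_real (glt_domain :: ('d point \<times> 'd point) set))"
      using emeasure_glt_domain_finite by (intro integrable_real_indicator) auto
    show "AE z in lborel. (\<lambda>K. indicat_real (B K) z) \<longlonglongrightarrow> 0"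
      using AE
    proof eventually_elim
      case (elim z)
      show ?case
      proof (cases "z \<in> glt_domain")
        case True
        then obtain b where b: "\<And>m. u m z \<le> b" using elim by (auto simp: bdd_above_def)
        have "eventually (\<lambda>K. b \<le> real K) sequentially"
          by (rule eventually_sequentiallyI[of "nat \<lceil>b\<rceil>"]) linarith
        then have "eventually (\<lambda>K. indicat_real (B K) z = 0) sequentially"
        proof eventually_elim
          case (elim K)
          then have "z \<notin> B K" using b by (auto simp: B_def not_less intro: order_trans)
          then show ?case by simp
        qed
        then show ?thesis by (rule tendsto_eventually)
      next
        case False
        then have "z \<notin> B K" for K by (auto simp: B_def)
        then show ?thesis by simp
      qed
    qed
    show "(\<lambda>z. indicat_real (B K) z) \<in> borel_measurable lborel" for K
      using B[of K] by (intro borel_measurable_indicator) simp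
  qed (auto simp: indicator_def B_def)
  then have "(\<lambda>K. measure lborel (B K)) \<longlonglongrightarrow> 0" using B by simp
  then have "eventually (\<lambda>K. measure lborel (B K) < \<epsilon>) sequentially"
    using assms(3) by (auto dest: order_tendstoD)
  then obtain K0 where K0: "\<And>K. K0 \<le> K \<Longrightarrow> measure lborel (B K) < \<epsilon>"
    by (auto simp: eventually_sequentially)
  define K where "K = Suc K0"
  have "measure lborel {z \<in> glt_domain. real K < u m z} \<le> \<epsilon>" for m
  proof -
    have "measure lborel {z \<in> glt_domain. real K < u m z} \<le> measure lborel (B K)"
    proof (rule measure_mono_fmeasurable)
      show "B K \<in> fmeasurable lborel" using B fin by (simp add: fmeasurable_def)
    qed (use B' in \<open>auto simp: B_def\<close>)
    also have "\<dots> \<le> \<epsilon>" using K0[of K] by (simp add: K_def)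
    finally show ?thesis .
  qed
  then show thesis using that[of "real K"] by (simp add: K_def)
qed

section \<open>Density of the smooth trigonometric symbols\<close>

lemma Ck_SucD: "Ck (Suc m) f \<Longrightarrow> Ck m f"
proof (induction m arbitrary: f)
  case 0
  then have "f differentiable (at x)" for x by simp
  then show ?case
    by (simp add: continuous_on_eq_continuous_at differentiable_imp_continuous_within)
next
  case (Suc m)
  then show ?case by simp
qed

lemma Ck_const: "Ck m (\<lambda>_. c)"
  by (induction m arbitrary: c) auto

lemma Ck_coord: "Ck m (\<lambda>x :: ('d::finite) point. complex_of_real (x $ k))"
proof (cases m)
  case 0
  then show ?thesis by (auto intro!: continuous_intros)
next
  case (Suc m')
  have D: "((\<lambda>x :: 'd point. complex_of_real (x $ k)) has_derivative (\<lambda>h. complex_of_real (h $ k))) (at x)" for x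
    by (intro bounded_linear_imp_has_derivative bounded_linear_compose[OF bounded_linear_of_real bounded_linear_vec_nth])
  then have "frechet_derivative (\<lambda>x :: 'd point. complex_of_real (x $ k)) (at x) = (\<lambda>h. complex_of_real (h $ k))" for x
    by (rule frechet_derivative_at[symmetric])
  with D show ?thesis unfolding Suc by (auto simp: differentiable_def Ck_const)
qed

lemma Ck_add: "Ck m f \<Longrightarrow> Ck m g \<Longrightarrow> Ck m (\<lambda>x. f x + g x)"
proof (induction m arbitrary: f g)
  case 0
  then show ?case by (auto intro!: continuous_intros)
next
  case (Suc m)
  have D: "((\<lambda>x. f x + g x) has_derivative (\<lambda>h. frechet_derivative f (at x) h + frechet_derivative g (at x) h)) (at x)" for x
    using Suc.prems by (intro has_derivative_add) (auto simp: frechet_derivative_works[symmetric])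
  then have "frechet_derivative (\<lambda>x. f x + g x) (at x) = (\<lambda>h. frechet_derivative f (at x) h + frechet_derivative g (at x) h)" for x
    by (rule frechet_derivative_at[symmetric])
  with D Suc show ?case by (auto simp: differentiable_def)
qed

lemma Ck_mult: "Ck m f \<Longrightarrow> Ck m g \<Longrightarrow> Ck m (\<lambda>x. f x * g x)"
proof (induction m arbitrary: f g)
  case 0
  then show ?case by (auto intro!: continuous_intros)
next
  case (Suc m)
  have D: "((\<lambda>x. f x * g x) has_derivative (\<lambda>h. f x * frechet_derivative g (at x) h + frechet_derivative f (at x) h * g x)) (at x)" for x
    using Suc.prems by (intro has_derivative_mult) (auto simp: frechet_derivative_works[symmetric])
  then have "frechet_derivative (\<lambda>x. f x * g x) (at x) = (\<lambda>h. f x * frechet_derivative g (at x) h + frechet_derivative f (at x) h * g x)" for x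
    by (rule frechet_derivative_at[symmetric])
  moreover have "Ck m f" "Ck m g" using Suc.prems by (auto intro: Ck_SucD)
  ultimately show ?case using D Suc by (auto simp: differentiable_def intro!: Ck_add)
qed

text \<open>Scalar symbols with coefficients smooth on the whole space. They form an algebra that
  contains all polynomials in the coordinates of \<open>circle_embed z\<close>.\<close>

definition trig_sum :: "(('d::finite) point \<times> 'd point \<Rightarrow> complex) \<Rightarrow> bool" where
  "trig_sum q \<longleftrightarrow> (\<exists>l. (\<forall>(a, j)\<in>set l. \<forall>m. Ck m a) \<and>
     (\<forall>z. q z = (\<Sum>(a, j)\<leftarrow>l. a (fst z) * cis (phase j (snd z)))))"

lemma trig_sum_gen: "(\<And>m. Ck m a) \<Longrightarrow> trig_sum (\<lambda>z. a (fst z) * cis (phase j (snd z)))"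
  unfolding trig_sum_def by (rule exI[of _ "[(a, j)]"]) auto

lemma trig_sum_const: "trig_sum (\<lambda>z. c)"
  using trig_sum_gen[OF Ck_const, of c 0] by simp

lemma trig_sum_add:
  assumes "trig_sum p" "trig_sum q"
  shows "trig_sum (\<lambda>z. p z + q z)"
proof -
  obtain l where l: "\<forall>(a, j)\<in>set l. \<forall>m. Ck m a" "\<forall>z. p z = (\<Sum>(a, j)\<leftarrow>l. a (fst z) * cis (phase j (snd z)))"
    using assms(1) unfolding trig_sum_def by blast
  obtain l' where l': "\<forall>(a, j)\<in>set l'. \<forall>m. Ck m a" "\<forall>z. q z = (\<Sum>(a, j)\<leftarrow>l'. a (fst z) * cis (phase j (snd z)))"
    using assms(2) unfolding trig_sum_def by blast
  show ?thesis unfolding trig_sum_def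
    by (rule exI[of _ "l @ l'"]) (use l l' in auto)
qed

lemma trig_sum_mult:
  assumes "trig_sum p" "trig_sum q"
  shows "trig_sum (\<lambda>z. p z * q z)"
proof -
  obtain l where l: "\<forall>(a, j)\<in>set l. \<forall>m. Ck m a" "\<forall>z. p z = (\<Sum>(a, j)\<leftarrow>l. a (fst z) * cis (phase j (snd z)))"
    using assms(1) unfolding trig_sum_def by blast
  obtain l' where l': "\<forall>(a, j)\<in>set l'. \<forall>m. Ck m a" "\<forall>z. q z = (\<Sum>(a, j)\<leftarrow>l'. a (fst z) * cis (phase j (snd z)))"
    using assms(2) unfolding trig_sum_def by blast
  have gen: "trig_sum (\<lambda>z. a (fst z) * cis (phase j (snd z)) * q z)" if a: "\<And>m. Ck m a" for a j
    unfolding trig_sum_def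
  proof (rule exI[of _ "map (\<lambda>(b, k). (\<lambda>x. a x * b x, j + k)) l'"], intro conjI allI)
    show "\<forall>(b, k)\<in>set (map (\<lambda>(b, k). (\<lambda>x. a x * b x, j + k)) l'). \<forall>m. Ck m b"
      using l'(1) a by (auto intro!: Ck_mult)
    fix z
    have "a (fst z) * cis (phase j (snd z)) * (\<Sum>(b, k)\<leftarrow>ks. b (fst z) * cis (phase k (snd z))) =
        (\<Sum>(b, k)\<leftarrow>map (\<lambda>(b, k). (\<lambda>x. a x * b x, j + k)) ks. b (fst z) * cis (phase k (snd z)))" for ks
      by (induction ks) (auto simp: phase_add cis_mult[symmetric] algebra_simps)
    then show "a (fst z) * cis (phase j (snd z)) * q z =
        (\<Sum>(b, k)\<leftarrow>map (\<lambda>(b, k). (\<lambda>x. a x * b x, j + k)) l'. b (fst z) * cis (phase k (snd z)))"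
      by (simp only: l'(2)[rule_format, of z])
  qed
  have "trig_sum (\<lambda>z. (\<Sum>(a, j)\<leftarrow>ks. a (fst z) * cis (phase j (snd z))) * q z)" if "set ks \<subseteq> set l" for ks
    using that
  proof (induction ks)
    case Nil
    show ?case using trig_sum_const[of 0] by simp
  next
    case (Cons k ks)
    then show ?case
      using trig_sum_add[OF gen[of "fst k" "snd k"]] l(1) by (force simp: case_prod_unfold distrib_right)
  qed
  from this[OF subset_refl] show ?thesis by (simp only: l(2)[rule_format])
qed

lemma trig_sum_sum:
  "finite A \<Longrightarrow> (\<And>x. x \<in> A \<Longrightarrow> trig_sum (f x)) \<Longrightarrow> trig_sum (\<lambda>z. \<Sum>x\<in>A. f x z)"
  by (induction A rule: finite_induct) (auto intro: trig_sum_const trig_sum_add)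

definition circle_embed :: "('d::finite) point \<times> 'd point \<Rightarrow> 'd point \<times> (complex, 'd) Finite_Cartesian_Product.vec" where
  "circle_embed z = (fst z, \<chi> k. cis (snd z $ k))"

lemma phase_axis: "phase (axis k m) \<theta> = real_of_int m * \<theta> $ k"
proof -
  have "phase (axis k m) \<theta> = (\<Sum>l\<in>UNIV. if l = k then real_of_int m * \<theta> $ k else 0)"
    unfolding phase_def by (intro sum.cong) (auto simp: axis_def)
  then show ?thesis by simp
qed

text \<open>Bounded linear functionals generate \<open>real_polynomial_function\<close>. On the
  embedded points they are real combinations of the coordinates of \<open>x\<close> and of the
  cosines and sines of \<open>\<theta>\<close>, and the latter are combinations of
  \<open>cis\<close> at frequencies 1 and -1.\<close>

lemma trig_sum_linear:
  assumes "bounded_linear (f :: ('d::finite) point \<times> (complex, 'd) Finite_Cartesian_Product.vec \<Rightarrow> real)"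
  shows "trig_sum (\<lambda>z. complex_of_real (f (circle_embed z)))"
proof -
  interpret bounded_linear f by fact
  have x: "x = (\<Sum>k\<in>UNIV. (x $ k) *\<^sub>R axis k 1)" for x :: "'d point"
    by (simp add: Finite_Cartesian_Product.vec_eq_iff axis_def if_distrib cong: if_cong)
  have w: "w = (\<Sum>k\<in>UNIV. Re (w $ k) *\<^sub>R axis k 1) + (\<Sum>k\<in>UNIV. Im (w $ k) *\<^sub>R axis k \<i>)"
    for w :: "(complex, 'd) Finite_Cartesian_Product.vec"
  proof -
    have "w $ l = Re (w $ l) *\<^sub>R 1 + Im (w $ l) *\<^sub>R \<i>" for l by (simp add: complex_eq_iff)
    moreover have "(\<Sum>k\<in>UNIV. c k *\<^sub>R axis k e) $ l = c l *\<^sub>R e" for c :: "'d \<Rightarrow> real" and e :: complex and l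
    proof -
      have "(\<Sum>k\<in>UNIV. c k *\<^sub>R axis k e) $ l = (\<Sum>k\<in>UNIV. if k = l then c l *\<^sub>R e else 0)"
        unfolding sum_component by (intro sum.cong) (auto simp: axis_def)
      then show ?thesis by simp
    qed
    ultimately show ?thesis by (simp add: Finite_Cartesian_Product.vec_eq_iff)
  qed
  have f: "f (x, w) = (\<Sum>k\<in>UNIV. x $ k * f (axis k 1, 0)) + (\<Sum>k\<in>UNIV. Re (w $ k) * f (0, axis k 1))
      + (\<Sum>k\<in>UNIV. Im (w $ k) * f (0, axis k \<i>))" for x w
  proof -
    have s: "f (\<Sum>k\<in>UNIV. c k *\<^sub>R v k) = (\<Sum>k\<in>UNIV. c k * f (v k))" for c :: "'d \<Rightarrow> real" and v
      by (simp add: sum scaleR)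
    have "(x, w) = (\<Sum>k\<in>UNIV. (x $ k) *\<^sub>R (axis k 1, 0)) + (\<Sum>k\<in>UNIV. Re (w $ k) *\<^sub>R (0, axis k 1))
      + (\<Sum>k\<in>UNIV. Im (w $ k) *\<^sub>R (0, axis k \<i>))"
      by (rule prod_eqI) (use x[of x] w[of w] in \<open>simp_all add: fst_sum snd_sum\<close>)
    then show ?thesis by (simp only: add s)
  qed
  have xk: "trig_sum (\<lambda>z :: 'd point \<times> 'd point. complex_of_real (fst z $ k))" for k
    using trig_sum_gen[OF Ck_coord, of k 0] by simp
  have e: "trig_sum (\<lambda>z :: 'd point \<times> 'd point. c * cis (real_of_int m * snd z $ k))" for c m k
    using trig_sum_gen[OF Ck_const, of c "axis k m"] by (simp add: phase_axis)
  have ck: "trig_sum (\<lambda>z :: 'd point \<times> 'd point. complex_of_real (cos (snd z $ k)))" for k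
  proof -
    have "complex_of_real (cos a) = 1/2 * cis (real_of_int 1 * a) + 1/2 * cis (real_of_int (-1) * a)" for a
      by (simp add: complex_eq_iff)
    then show ?thesis using trig_sum_add[OF e[of "1/2" 1 k] e[of "1/2" "-1" k]] by simp
  qed
  have sk: "trig_sum (\<lambda>z :: 'd point \<times> 'd point. complex_of_real (sin (snd z $ k)))" for k
  proof -
    have "complex_of_real (sin a) = (- \<i>/2) * cis (real_of_int 1 * a) + (\<i>/2) * cis (real_of_int (-1) * a)" for a
      by (simp add: complex_eq_iff)
    then show ?thesis using trig_sum_add[OF e[of "- \<i>/2" 1 k] e[of "\<i>/2" "-1" k]] by simp
  qed
  have "trig_sum (\<lambda>z. (\<Sum>k\<in>UNIV. complex_of_real (fst z $ k) * complex_of_real (f (axis k 1, 0)))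
      + (\<Sum>k\<in>UNIV. complex_of_real (cos (snd z $ k)) * complex_of_real (f (0, axis k 1)))
      + (\<Sum>k\<in>UNIV. complex_of_real (sin (snd z $ k)) * complex_of_real (f (0, axis k \<i>))))"
    by (intro trig_sum_add trig_sum_sum trig_sum_mult xk ck sk trig_sum_const finite)
  moreover have "complex_of_real (f (circle_embed z)) = (\<Sum>k\<in>UNIV. complex_of_real (fst z $ k) * complex_of_real (f (axis k 1, 0)))
      + (\<Sum>k\<in>UNIV. complex_of_real (cos (snd z $ k)) * complex_of_real (f (0, axis k 1)))
      + (\<Sum>k\<in>UNIV. complex_of_real (sin (snd z $ k)) * complex_of_real (f (0, axis k \<i>)))" for z
    unfolding circle_embed_def by (subst f) simp
  ultimately show ?thesis by simp
qed

lemma trig_sum_real_polynomial: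
  "real_polynomial_function f \<Longrightarrow> trig_sum (\<lambda>z. complex_of_real (f (circle_embed z)))"
  by (induction rule: real_polynomial_function.induct)
    (auto intro: trig_sum_linear trig_sum_const trig_sum_add trig_sum_mult)

text \<open>
  On a box that avoids the boundary of the torus the circle embedding is a homeomorphism, so
  Stone--Weierstrass applies there without any periodicity of the function.
\<close>

lemma trig_sum_approx:
  fixes g :: "('d::finite) point \<times> 'd point \<Rightarrow> complex"
  assumes g: "continuous_on UNIV g" and "0 < \<epsilon>" "0 < \<eta>"
  obtains q where "trig_sum q"
    "\<And>z. fst z \<in> cbox 0 1 \<Longrightarrow> (\<And>k. \<bar>snd z $ k\<bar> \<le> pi - \<eta>) \<Longrightarrow> cmod (g z - q z) < \<epsilon>"
proof -
  define S :: "('d point \<times> 'd point) set" where "S = cbox 0 1 \<times> cbox (\<chi> k. - (pi - \<eta>)) (\<chi> k. pi - \<eta>)"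
  have S: "z \<in> S \<longleftrightarrow> fst z \<in> cbox 0 1 \<and> (\<forall>k. \<bar>snd z $ k\<bar> \<le> pi - \<eta>)" for z :: "'d point \<times> 'd point"
  proof -
    have "\<bar>y\<bar> \<le> pi - \<eta> \<longleftrightarrow> - (pi - \<eta>) \<le> y \<and> y \<le> pi - \<eta>" for y by linarith
    then show ?thesis by (simp only: S_def mem_Times_iff mem_box_cart(2) vec_lambda_beta)
  qed
  have compact: "compact S" unfolding S_def by (intro compact_Times compact_cbox)
  define G :: "'d point \<times> (complex, 'd) Finite_Cartesian_Product.vec \<Rightarrow> 'd point \<times> 'd point"
    where "G y = (fst y, \<chi> k. Arg (snd y $ k))" for y
  have cont: "continuous_on S circle_embed"
    unfolding circle_embed_def by (intro continuous_intros continuous_on_vec_lambda)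
  have inv: "G (circle_embed z) = z" if "z \<in> S" for z
  proof -
    have "Arg (cis (snd z $ k)) = snd z $ k" for k
    proof (rule Arg_cis)
      have "\<bar>snd z $ k\<bar> \<le> pi - \<eta>" using that by (auto simp: S)
      then show "snd z $ k \<in> {-pi<..pi}" using assms(3) by (auto simp: abs_le_iff)
    qed
    then show ?thesis
      by (intro prod_eqI) (auto simp: G_def circle_embed_def Finite_Cartesian_Product.vec_eq_iff)
  qed
  have "continuous_on (circle_embed ` S) G"
    by (rule continuous_on_inv[OF cont compact]) (use inv in blast)
  then have h: "continuous_on (circle_embed ` S) (\<lambda>y. g (G y))"
    by (intro continuous_on_compose2[OF g]) auto
  have "compact (circle_embed ` S)" by (rule compact_continuous_image[OF cont compact])
  from Stone_Weierstrass_polynomial_function[OF this h assms(2)] obtain p where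
    p: "polynomial_function p" "\<And>y. y \<in> circle_embed ` S \<Longrightarrow> cmod (g (G y) - p y) < \<epsilon>" by blast
  have "real_polynomial_function (Re \<circ> p)" "real_polynomial_function (Im \<circ> p)"
    using p(1) bounded_linear_Re bounded_linear_Im unfolding polynomial_function_def by blast+
  from this[THEN trig_sum_real_polynomial]
  have "trig_sum (\<lambda>z. complex_of_real (Re (p (circle_embed z))) + \<i> * complex_of_real (Im (p (circle_embed z))))"
    by (intro trig_sum_add trig_sum_mult trig_sum_const) (simp_all add: o_def)
  then have "trig_sum (\<lambda>z. p (circle_embed z))" by (simp add: complex_eq[symmetric])
  then show thesis
  proof (rule that)
    fix z :: "'d point \<times> 'd point" assume "fst z \<in> cbox 0 1" "\<And>k. \<bar>snd z $ k\<bar> \<le> pi - \<eta>"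
    then have "z \<in> S" by (simp add: S)
    then show "cmod (g z - p (circle_embed z)) < \<epsilon>" using p(2)[of "circle_embed z"] inv by auto
  qed
qed

lemma AE_lebesgue_on_glt_domain:
  "(AE z in lebesgue_on glt_domain. P z) \<longleftrightarrow> (AE z in lborel. z \<in> (glt_domain :: (('d::finite) point \<times> 'd point) set) \<longrightarrow> P z)"
proof -
  have "(glt_domain :: ('d point \<times> 'd point) set) \<in> sets lebesgue"
    using glt_domain_borel by (simp add: sets_completionI_sets)
  then have "(AE z in lebesgue_on glt_domain. P z) \<longleftrightarrow> (AE z in lebesgue. z \<in> glt_domain \<longrightarrow> P z)"
    by (intro AE_restrict_space_iff) simp
  then show ?thesis by (simp only: AE_completion_iff)
qed

text \<open>A measurable function is an almost everywhere limit of continuous ones. The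
  \<open>m\<close>-th of these is approximated within \<open>1 / (m + 1)\<close> on a box whose
  distance from the boundary of the torus shrinks with \<open>m\<close>; every interior point is
  eventually inside, and the boundary is a null set.\<close>

lemma trig_sum_dense:
  fixes f :: "('d::finite) point \<times> 'd point \<Rightarrow> complex"
  assumes f: "f \<in> borel_measurable (lebesgue_on glt_domain)"
  obtains q where "\<And>m. trig_sum (q m)" "AE z in lborel. z \<in> glt_domain \<longrightarrow> (\<lambda>m. q m z) \<longlonglongrightarrow> f z"
proof -
  have dom: "(glt_domain :: ('d point \<times> 'd point) set) \<in> sets lebesgue"
    using glt_domain_borel by (simp add: sets_completionI_sets)
  obtain N g where N: "negligible N" and g: "\<And>m. continuous_on UNIV (g m)"
    and lim: "\<And>z. z \<notin> N \<Longrightarrow> (\<lambda>m. g m z) \<longlonglongrightarrow> (if z \<in> glt_domain then f z else 0)"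
    using measurable_on_iff_borel_measurable[OF dom, of f] f unfolding measurable_on_def by blast
  have "\<exists>q. trig_sum q \<and> (\<forall>z. fst z \<in> cbox 0 1 \<longrightarrow> (\<forall>k. \<bar>snd z $ k\<bar> \<le> pi - inverse (real (Suc m))) \<longrightarrow>
      cmod (g m z - q z) < inverse (real (Suc m)))" for m
    by (rule trig_sum_approx[OF g[of m], of "inverse (real (Suc m))" "inverse (real (Suc m))"]) auto
  then obtain q where q: "\<And>m. trig_sum (q m)" "\<And>m z. fst z \<in> cbox 0 1 \<Longrightarrow>
      (\<And>k. \<bar>snd z $ k\<bar> \<le> pi - inverse (real (Suc m))) \<Longrightarrow> cmod (g m z - q m z) < inverse (real (Suc m))"
    by metis
  let ?l = "(0, \<chi> k. - pi) :: 'd point \<times> 'd point" and ?u = "(1, \<chi> k. pi) :: 'd point \<times> 'd point"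
  have "negligible (N \<union> (cbox ?l ?u - box ?l ?u))"
    using N negligible_frontier_interval by (rule negligible_Un)
  then have "AE z in lebesgue. z \<notin> N \<union> (cbox ?l ?u - box ?l ?u)"
    by (intro AE_not_in) (simp add: negligible_iff_null_sets)
  then have "AE z in lborel. z \<notin> N \<union> (cbox ?l ?u - box ?l ?u)" by (simp only: AE_completion_iff)
  then have "AE z in lborel. z \<in> glt_domain \<longrightarrow> (\<lambda>m. q m z) \<longlonglongrightarrow> f z"
  proof eventually_elim
    case (elim z)
    show ?case
    proof
      assume z: "z \<in> glt_domain"
      then have "z \<in> box ?l ?u" using elim by (simp add: glt_domain_eq)
      then have "fst z \<in> box 0 1 \<and> snd z \<in> box (\<chi> k. - pi) (\<chi> k. pi)"
        by (simp add: box_prod mem_Times_iff)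
      then have int: "\<bar>snd z $ k\<bar> < pi" for k by (auto simp: mem_box_cart abs_less_iff minus_less_iff)
      have "\<forall>\<^sub>F m in sequentially. \<bar>snd z $ k\<bar> \<le> pi - inverse (real (Suc m))" for k
      proof -
        have "(\<lambda>m. pi - inverse (real (Suc m))) \<longlonglongrightarrow> pi - 0"
          by (intro tendsto_diff tendsto_const LIMSEQ_inverse_real_of_nat)
        then have "\<forall>\<^sub>F m in sequentially. \<bar>snd z $ k\<bar> < pi - inverse (real (Suc m))"
          using int[of k] by (intro order_tendstoD) auto
        then show ?thesis by eventually_elim simp
      qed
      then have "\<forall>\<^sub>F m in sequentially. \<forall>k\<in>UNIV. \<bar>snd z $ k\<bar> \<le> pi - inverse (real (Suc m))"
        by (intro eventually_ball_finite) auto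
      then have "\<forall>\<^sub>F m in sequentially. cmod (g m z - q m z) \<le> inverse (real (Suc m))"
        by eventually_elim (use q(2) z in \<open>fastforce simp: glt_domain_def intro!: less_imp_le\<close>)
      then have "(\<lambda>m. g m z - q m z) \<longlonglongrightarrow> 0"
        by (rule Lim_null_comparison[OF _ LIMSEQ_inverse_real_of_nat])
      moreover have "(\<lambda>m. g m z) \<longlonglongrightarrow> f z" using lim[of z] elim z by simp
      ultimately have "(\<lambda>m. g m z - (g m z - q m z)) \<longlonglongrightarrow> f z - 0" by (intro tendsto_diff)
      then show "(\<lambda>m. q m z) \<longlonglongrightarrow> f z" by simp
    qed
  qed
  with q(1) show thesis by (rule that)
qed

definition seq_smooth :: "nat \<Rightarrow> ('d::finite) term4 list \<Rightarrow> bool" where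
  "seq_smooth t ts \<longleftrightarrow> (\<forall>(a, j, \<alpha>, \<beta>)\<in>set ts. (\<forall>m. Ck m a) \<and> \<alpha> < t \<and> \<beta> < t)"

lemma seq_smooth_ok: "seq_smooth t ts \<Longrightarrow> seq_ok t ts"
proof -
  have "continuous_on (cbox 0 1) a" if "\<forall>m. Ck m a" for a :: "'a point \<Rightarrow> complex"
  proof -
    have "continuous_on UNIV a" using that[rule_format, of 0] by simp
    then show ?thesis by (rule continuous_on_subset) simp
  qed
  then show "seq_smooth t ts \<Longrightarrow> seq_ok t ts" unfolding seq_smooth_def seq_ok_def by fast
qed

lemma seq_sym_dense:
  fixes \<rho> :: "nat \<Rightarrow> nat \<Rightarrow> ('d::finite) point \<times> 'd point \<Rightarrow> complex"
  assumes "\<And>\<alpha> \<beta>. \<alpha> < t \<Longrightarrow> \<beta> < t \<Longrightarrow> \<rho> \<alpha> \<beta> \<in> borel_measurable (lebesgue_on glt_domain)"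
  obtains ts where "\<And>m. seq_smooth t (ts m)"
    "AE z in lborel. z \<in> glt_domain \<longrightarrow> (\<forall>\<alpha><t. \<forall>\<beta><t. (\<lambda>m. entry (seq_sym (ts m) z) \<alpha> \<beta>) \<longlonglongrightarrow> \<rho> \<alpha> \<beta> z)"
proof -
  let ?v = "\<lambda>ks z. \<Sum>(a, j)\<leftarrow>ks. a (fst z) * cis (phase j (snd z))"
  define P where "P \<alpha> \<beta> l \<longleftrightarrow> (\<forall>m. \<forall>(a, j)\<in>set (l m). \<forall>k. Ck k a) \<and>
      (AE z in lborel. z \<in> glt_domain \<longrightarrow> (\<lambda>m. ?v (l m) z) \<longlonglongrightarrow> \<rho> \<alpha> \<beta> z)" for \<alpha> \<beta> l
  \<comment> \<open>One choice for all entries at once; for \<open>\<alpha>\<close> or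
    \<open>\<beta>\<close> beyond \<open>t\<close> its value is arbitrary.\<close>
  define l where "l \<alpha> \<beta> = (SOME l. P \<alpha> \<beta> l)" for \<alpha> \<beta>
  have P: "P \<alpha> \<beta> (l \<alpha> \<beta>)" if \<alpha>\<beta>: "\<alpha> < t" "\<beta> < t" for \<alpha> \<beta>
  proof (rule trig_sum_dense[OF assms[OF \<alpha>\<beta>]])
    fix q :: "nat \<Rightarrow> 'd point \<times> 'd point \<Rightarrow> complex"
    assume q: "\<And>m. trig_sum (q m)" "AE z in lborel. z \<in> glt_domain \<longrightarrow> (\<lambda>m. q m z) \<longlonglongrightarrow> \<rho> \<alpha> \<beta> z"
    have "\<forall>m. \<exists>ks. (\<forall>(a, j)\<in>set ks. \<forall>k. Ck k a) \<and> (\<forall>z. q m z = ?v ks z)"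
      using q(1) unfolding trig_sum_def by (rule allI)
    from choice[OF this] obtain ks where ks: "\<forall>m. (\<forall>(a, j)\<in>set (ks m). \<forall>k. Ck k a) \<and> (\<forall>z. q m z = ?v (ks m) z)" ..
    then have "P \<alpha> \<beta> ks" using q(2) by (simp add: P_def del: split_paired_All)
    then show ?thesis unfolding l_def by (rule someI[of "P \<alpha> \<beta>" ks])
  qed
  define q where "q \<alpha> \<beta> m z = ?v (l \<alpha> \<beta> m) z" for \<alpha> \<beta> m z
  have l: "\<forall>(a, j)\<in>set (l \<alpha> \<beta> m). \<forall>k. Ck k a" if "\<alpha> < t" "\<beta> < t" for \<alpha> \<beta> m
    using P[OF that] by (simp add: P_def)
  have q: "AE z in lborel. z \<in> glt_domain \<longrightarrow> (\<lambda>m. q \<alpha> \<beta> m z) \<longlonglongrightarrow> \<rho> \<alpha> \<beta> z" if "\<alpha> < t" "\<beta> < t" for \<alpha> \<beta>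
    using P[OF that] by (simp add: P_def q_def)
  define ts where "ts m = concat (map (\<lambda>(\<alpha>, \<beta>). map (\<lambda>(a, j). (a, j, \<alpha>, \<beta>)) (l \<alpha> \<beta> m)) (List.product [0..<t] [0..<t]))" for m
  have smooth: "seq_smooth t (ts m)" for m
  proof -
    have "(\<forall>m. Ck m a) \<and> \<alpha> < t \<and> \<beta> < t" if "(a, j, \<alpha>, \<beta>) \<in> set (ts m)" for a j \<alpha> \<beta>
    proof -
      have "(a, j) \<in> set (l \<alpha> \<beta> m)" "\<alpha> < t" "\<beta> < t" using that by (auto simp: ts_def)
      with l[of \<alpha> \<beta> m] show ?thesis by auto
    qed
    then show ?thesis unfolding seq_smooth_def by fast
  qed
  have entry_map: "entry (seq_sym (map (\<lambda>(a, j). (a, j, \<alpha>, \<beta>)) ks) z) p r =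
      (if p = \<alpha> \<and> r = \<beta> then \<Sum>(a, j)\<leftarrow>ks. a (fst z) * cis (phase j (snd z)) else 0)" for ks \<alpha> \<beta> z p r
    by (induction ks) (auto simp: entry_gen_sym)
  have entry_ts: "entry (seq_sym (ts m) z) p r = q p r m z" if "p < t" "r < t" for m z p r
  proof -
    have "entry (seq_sym (ts m) z) p r = (\<Sum>(\<alpha>, \<beta>)\<leftarrow>List.product [0..<t] [0..<t].
        if p = \<alpha> \<and> r = \<beta> then q p r m z else 0)"
      unfolding ts_def seq_sym_concat entry_sum_list map_map
      by (intro arg_cong[of _ _ sum_list] map_cong) (use that in \<open>auto simp: entry_map q_def\<close>)
    also have "\<dots> = (\<Sum>(\<alpha>, \<beta>)\<in>{..<t} \<times> {..<t}. if p = \<alpha> \<and> r = \<beta> then q p r m z else 0)"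
      by (subst sum_list_distinct_conv_sum_set) (auto simp: distinct_product lessThan_atLeast0)
    also have "\<dots> = (\<Sum>x\<in>{..<t} \<times> {..<t}. if x = (p, r) then q p r m z else 0)"
      by (intro sum.cong) (auto split: if_splits)
    finally show ?thesis using that by simp
  qed
  have "AE z in lborel. \<forall>\<alpha>\<in>{..<t}. \<forall>\<beta>\<in>{..<t}. z \<in> glt_domain \<longrightarrow> (\<lambda>m. q \<alpha> \<beta> m z) \<longlonglongrightarrow> \<rho> \<alpha> \<beta> z"
    by (intro AE_finite_allI finite_lessThan q) auto
  then have "AE z in lborel. z \<in> glt_domain \<longrightarrow> (\<forall>\<alpha><t. \<forall>\<beta><t. (\<lambda>m. entry (seq_sym (ts m) z) \<alpha> \<beta>) \<longlonglongrightarrow> \<rho> \<alpha> \<beta> z)"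
    by eventually_elim (simp add: entry_ts)
  with smooth show thesis by (rule that)
qed

section \<open>Measurability of the pseudoinverse\<close>

lemma borel_measurable_entry_mult:
  assumes "finite S" "\<And>z. fsupp (X z) \<subseteq> S"
    and "\<And>i j. (\<lambda>z. entry (X z) i j) \<in> borel_measurable M" "\<And>i j. (\<lambda>z. entry (Y z) i j) \<in> borel_measurable M"
  shows "(\<lambda>z. entry (X z * Y z) i j) \<in> borel_measurable M"
proof -
  have "(\<lambda>z. entry (X z * Y z) i j) = (\<lambda>z. \<Sum>k\<in>S. entry (X z) i k * entry (Y z) k j)"
    by (rule ext) (rule entry_times[OF assms(1)], use assms(2) in blast)
  moreover have "(\<lambda>z. \<Sum>k\<in>S. entry (X z) i k * entry (Y z) k j) \<in> borel_measurable M"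
    by (intro borel_measurable_sum borel_measurable_times assms(3,4))
  ultimately show ?thesis by simp
qed

text \<open>The pseudoinverse is discontinuous where the rank drops. It is, however, the pointwise
  limit of the Landweber iterates, whose entries arise from those of \<open>X z\<close> by sums,
  products, conjugation and a division by \<open>1 + |X z|\<^sup>2\<close>.\<close>

lemma borel_measurable_entry_penrose:
  assumes "finite S" "\<And>z. fsupp (X z) \<subseteq> S" "\<And>i j. (\<lambda>z. entry (X z) i j) \<in> borel_measurable M"
    and "\<And>z. z \<in> space M \<Longrightarrow> penrose (X z) (Y z)"
  shows "(\<lambda>z. entry (Y z) i j) \<in> borel_measurable M"
proof (rule borel_measurable_LIMSEQ_metric)
  have "(\<lambda>z. entry (landweber (X z) m) i j) \<in> borel_measurable M" for m i j
  proof (induction m arbitrary: i j)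
    case (Suc m)
    have norm: "(\<lambda>z. (norm (X z))\<^sup>2) \<in> borel_measurable M"
    proof -
      have "(\<lambda>z. (norm (X z))\<^sup>2) = (\<lambda>z. \<Sum>i\<in>S. \<Sum>j\<in>S. (cmod (entry (X z) i j))\<^sup>2)"
      proof
        fix z
        have "i \<notin> S \<or> j \<notin> S \<Longrightarrow> entry (X z) i j = 0" for i j
          using assms(2)[of z] entry_nonzero_fsupp[of i "X z" j] entry_nonzero_fsupp(2)[of j "X z" i] by auto
        then show "(norm (X z))\<^sup>2 = (\<Sum>i\<in>S. \<Sum>j\<in>S. (cmod (entry (X z) i j))\<^sup>2)"
          by (rule norm_fmat_sq[OF assms(1) assms(1)])
      qed
      moreover have "(\<lambda>z. \<Sum>i\<in>S. \<Sum>j\<in>S. (cmod (entry (X z) i j))\<^sup>2) \<in> borel_measurable M"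
        by (intro borel_measurable_sum borel_measurable_power measurable_compose[OF assms(3) borel_measurable_norm])
      ultimately show ?thesis by simp
    qed
    have adjX: "(\<lambda>z. entry (adj (X z)) i j) \<in> borel_measurable M" "fsupp (adj (X z)) \<subseteq> S" for i j z
      using assms(2)[of z] borel_measurable_continuous_on[OF continuous_on_cnj[OF continuous_on_id] assms(3)[of j i]] by simp_all
    have H: "(\<lambda>z. entry (adj (X z) * X z) i j) \<in> borel_measurable M" for i j
      by (rule borel_measurable_entry_mult[OF assms(1) adjX(2) adjX(1) assms(3)])
    have HS: "fsupp (adj (X z) * X z) \<subseteq> S" for z
      by (rule fsupp_mult[OF adjX(2) assms(2)])
    have "(\<lambda>z. entry (adj (X z) * X z * landweber (X z) m) i j) \<in> borel_measurable M" for i j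
      by (rule borel_measurable_entry_mult[OF assms(1) HS H Suc])
    then have "(\<lambda>z. entry (landweber (X z) m) i j + (1 / (1 + (norm (X z))\<^sup>2)) *\<^sub>R
        (entry (adj (X z)) i j - entry (adj (X z) * X z * landweber (X z) m) i j)) \<in> borel_measurable M"
      by (intro borel_measurable_add borel_measurable_scaleR borel_measurable_diff borel_measurable_divide
          borel_measurable_const norm Suc adjX(1))
    then show ?case by (simp add: scaleR_conv_of_real)
  qed simp
  then show "(\<lambda>z. entry (landweber (X z) m) i j) \<in> borel_measurable M" for m .
  fix z assume "z \<in> space M"
  then have lim: "landweber (X z) \<longlonglongrightarrow> Y z" by (intro landweber_tendsto assms)
  show "(\<lambda>m. entry (landweber (X z) m) i j) \<longlonglongrightarrow> entry (Y z) i j"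
  proof (rule LIM_zero_cancel, rule Lim_null_comparison)
    show "\<forall>\<^sub>F m in sequentially. norm (entry (landweber (X z) m) i j - entry (Y z) i j) \<le> norm (landweber (X z) m - Y z)"
      using cmod_entry_le_norm[of "landweber (X z) _ - Y z" i j] by simp
    show "(\<lambda>m. norm (landweber (X z) m - Y z)) \<longlonglongrightarrow> 0"
      using tendsto_norm[OF LIM_zero[OF lim]] by simp
  qed
qed

lemma measurable_symbol_pinv:
  fixes \<kappa> :: "('d::finite) point \<times> 'd point \<Rightarrow> complex mat"
  assumes "measurable_symbol r s \<kappa>"
  shows "measurable_symbol s r (\<lambda>z. pinv (\<kappa> z))"
proof -
  let ?M = "lebesgue_on (glt_domain :: ('d point \<times> 'd point) set)"
  let ?F = "fmat_of id id :: complex mat \<Rightarrow> nat fmat"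
  have car: "\<kappa> z \<in> carrier_mat r s" if "z \<in> glt_domain" for z
    using assms that by (simp add: measurable_symbol_def)
  have meas: "(\<lambda>z. \<kappa> z $$ (\<alpha>, \<beta>)) \<in> borel_measurable ?M" if "\<alpha> < r" "\<beta> < s" for \<alpha> \<beta>
    using assms that by (simp add: measurable_symbol_def)
  \<comment> \<open>Off the domain nothing is known about the size of \<open>\<kappa> z\<close>; the
    value 0 makes the support bound hold for every \<open>z\<close>.\<close>
  define X where "X z = (if z \<in> glt_domain then ?F (\<kappa> z) else 0)" for z
  have eX: "entry (X z) i j = (if i < r \<and> j < s then \<kappa> z $$ (i, j) else 0)" if "z \<in> glt_domain" for z i j
    using entry_fmat_of[OF car[OF that], of id id i j] entry_fmat_of_0[OF car[OF that], of i id j id] that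
    by (auto simp: X_def)
  have supp: "fsupp (X z) \<subseteq> {..<r + s}" for z
  proof (cases "z \<in> glt_domain")
    case True
    then show ?thesis by (auto simp: fsupp_def eX split: if_splits)
  next
    case False
    then show ?thesis by (simp add: X_def fsupp_def)
  qed
  have mX: "(\<lambda>z. entry (X z) i j) \<in> borel_measurable ?M" for i j
  proof -
    have "(\<lambda>z. entry (X z) i j) \<in> borel_measurable ?M \<longleftrightarrow> (\<lambda>z. if i < r \<and> j < s then \<kappa> z $$ (i, j) else 0) \<in> borel_measurable ?M"
      by (rule measurable_cong) (simp add: eX)
    then show ?thesis using meas by (cases "i < r \<and> j < s") auto
  qed
  have "(\<lambda>z. entry (?F (pinv (\<kappa> z))) i j) \<in> borel_measurable ?M" for i j
  proof (rule borel_measurable_entry_penrose[OF _ supp mX])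
    fix z assume "z \<in> space ?M"
    then have z: "z \<in> glt_domain" by simp
    then show "penrose (X z) (?F (pinv (\<kappa> z)))"
      using penrose_pinv[OF car[OF z], of id id] by (simp add: X_def)
  qed simp
  moreover have "entry (?F (pinv (\<kappa> z))) i j = pinv (\<kappa> z) $$ (i, j)" if "z \<in> glt_domain" "i < s" "j < r" for z i j
    using entry_fmat_of[OF pinv_props(1)[OF car[OF that(1)]], of id id i j] that by simp
  ultimately have "(\<lambda>z. pinv (\<kappa> z) $$ (i, j)) \<in> borel_measurable ?M" if "i < s" "j < r" for i j
    using that measurable_cong[of ?M "\<lambda>z. entry (?F (pinv (\<kappa> z))) i j" "\<lambda>z. pinv (\<kappa> z) $$ (i, j)" borel] by simp
  then show ?thesis using pinv_props(1)[OF car] by (simp add: measurable_symbol_def)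
qed

section \<open>Sequences of matrices up to small rank plus small norm\<close>

text \<open>\<open>F\<close> will be the filter of large \<open>n\<close> in the index set of a
  matrix-sequence.\<close>

locale fmat_sequences =
  fixes F :: "nat filter" and \<nu> :: "nat \<Rightarrow> ('d::{finite,linorder}) dindex" and t :: nat
  assumes filterlim_\<nu>: "filterlim \<nu> at_top_dindex F" and t_pos: "1 \<le> t"
begin

text \<open>One tolerance bounds both the relative rank and the norm, and how large \<open>n\<close>
  has to be may depend on \<open>m\<close>. This is approximation in the a.c.s. sense with the rates
  \<open>c\<close> and \<open>\<omega>\<close> stripped off.\<close>

definition acs_null :: "(nat \<Rightarrow> nat \<Rightarrow> 'i fmat) \<Rightarrow> bool" where
  "acs_null X \<longleftrightarrow> (\<forall>\<epsilon>>0. \<forall>\<^sub>F m in sequentially. \<forall>\<^sub>F n in F. dcmp (\<epsilon> * real (level_size (\<nu> n))) \<epsilon> (X m n))"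

text \<open>\<open>M\<close> may grow as \<open>\<epsilon>\<close> shrinks, so large singular values
  are tolerated if there are few of them. It must not depend on \<open>m\<close>: in a product with
  a negligible family \<open>M\<close> is fixed first and the tolerance
  \<open>\<epsilon> / M\<close> afterwards.\<close>

definition acs_bounded :: "(nat \<Rightarrow> nat \<Rightarrow> 'i fmat) \<Rightarrow> bool" where
  "acs_bounded X \<longleftrightarrow> (\<forall>\<epsilon>>0. \<exists>M. \<forall>\<^sub>F m in sequentially. \<forall>\<^sub>F n in F. dcmp (\<epsilon> * real (level_size (\<nu> n))) M (X m n))"

lemma acs_nullD:
  "acs_null X \<Longrightarrow> 0 < \<epsilon> \<Longrightarrow> 0 < \<delta> \<Longrightarrow>
    \<forall>\<^sub>F m in sequentially. \<forall>\<^sub>F n in F. dcmp (\<epsilon> * real (level_size (\<nu> n))) \<delta> (X m n)"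
proof -
  assume "acs_null X" "0 < \<epsilon>" "0 < \<delta>"
  then have "\<forall>\<^sub>F m in sequentially. \<forall>\<^sub>F n in F. dcmp (min \<epsilon> \<delta> * real (level_size (\<nu> n))) (min \<epsilon> \<delta>) (X m n)"
    by (simp only: acs_null_def min_less_iff_conj)
  moreover have "dcmp (min \<epsilon> \<delta> * real (level_size (\<nu> n))) (min \<epsilon> \<delta>) (X m n) \<Longrightarrow> dcmp (\<epsilon> * real (level_size (\<nu> n))) \<delta> (X m n)" for m n
    by (erule dcmp_mono) (auto intro: mult_right_mono)
  ultimately show ?thesis by (auto elim!: eventually_mono)
qed

lemma acs_nullI:
  assumes "\<And>\<epsilon>. 0 < \<epsilon> \<Longrightarrow> \<exists>x\<ge>0. \<exists>M. x \<le> \<epsilon> \<and> M \<le> \<epsilon> \<and>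
    (\<forall>\<^sub>F m in sequentially. \<forall>\<^sub>F n in F. dcmp (x * real (level_size (\<nu> n))) M (X m n))"
  shows "acs_null X"
  unfolding acs_null_def
proof (intro allI impI)
  fix \<epsilon> :: real assume "0 < \<epsilon>"
  from assms[OF this] obtain x M where *: "x \<le> \<epsilon>" "M \<le> \<epsilon>"
    "\<forall>\<^sub>F m in sequentially. \<forall>\<^sub>F n in F. dcmp (x * real (level_size (\<nu> n))) M (X m n)" by blast
  have "dcmp (x * real (level_size (\<nu> n))) M (X m n) \<Longrightarrow> dcmp (\<epsilon> * real (level_size (\<nu> n))) \<epsilon> (X m n)" for m n
    by (erule dcmp_mono) (use * in \<open>auto intro: mult_right_mono\<close>)
  with *(3) show "\<forall>\<^sub>F m in sequentially. \<forall>\<^sub>F n in F. dcmp (\<epsilon> * real (level_size (\<nu> n))) \<epsilon> (X m n)"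
    by (auto elim!: eventually_mono)
qed

lemma eventually_dcmp_combine:
  assumes "\<forall>\<^sub>F m in sequentially. \<forall>\<^sub>F n in F. dcmp (x * real (level_size (\<nu> n))) M (X m n)"
    and "\<forall>\<^sub>F m in sequentially. \<forall>\<^sub>F n in F. dcmp (y * real (level_size (\<nu> n))) K (Y m n)"
    and "\<And>m n. dcmp (x * real (level_size (\<nu> n))) M (X m n) \<Longrightarrow> dcmp (y * real (level_size (\<nu> n))) K (Y m n) \<Longrightarrow>
      dcmp ((x + y) * real (level_size (\<nu> n))) L (Z m n)"
  shows "\<forall>\<^sub>F m in sequentially. \<forall>\<^sub>F n in F. dcmp ((x + y) * real (level_size (\<nu> n))) L (Z m n)"
  using assms(1,2)
proof eventually_elim
  case (elim m)
  then show ?case by eventually_elim (rule assms(3))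
qed

lemma acs_null_cong:
  assumes "acs_null X" "\<And>m. \<forall>\<^sub>F n in F. X m n = Y m n"
  shows "acs_null Y"
  unfolding acs_null_def
proof (intro allI impI)
  fix \<epsilon> :: real assume "0 < \<epsilon>"
  with assms(1) have "\<forall>\<^sub>F m in sequentially. \<forall>\<^sub>F n in F. dcmp (\<epsilon> * real (level_size (\<nu> n))) \<epsilon> (X m n)"
    by (simp add: acs_null_def)
  then show "\<forall>\<^sub>F m in sequentially. \<forall>\<^sub>F n in F. dcmp (\<epsilon> * real (level_size (\<nu> n))) \<epsilon> (Y m n)"
  proof eventually_elim
    case (elim m)
    with assms(2)[of m] show ?case by eventually_elim simp
  qed
qed

lemma acs_null_add:
  assumes "acs_null X" "acs_null Y"
  shows "acs_null (\<lambda>m n. X m n + Y m n)"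
proof (rule acs_nullI)
  fix \<epsilon> :: real assume \<epsilon>: "0 < \<epsilon>"
  then have "0 < \<epsilon> / 2" by simp
  note XY = acs_nullD[OF assms(1) this this] acs_nullD[OF assms(2) this this]
  have "\<forall>\<^sub>F m in sequentially. \<forall>\<^sub>F n in F. dcmp ((\<epsilon>/2 + \<epsilon>/2) * real (level_size (\<nu> n))) (\<epsilon>/2 + \<epsilon>/2) (X m n + Y m n)"
    by (rule eventually_dcmp_combine[OF XY]) (simp only: distrib_right dcmp_add)
  then show "\<exists>x\<ge>0. \<exists>M. x \<le> \<epsilon> \<and> M \<le> \<epsilon> \<and>
      (\<forall>\<^sub>F m in sequentially. \<forall>\<^sub>F n in F. dcmp (x * real (level_size (\<nu> n))) M (X m n + Y m n))"
    using \<epsilon> by (intro exI[of _ "\<epsilon>/2 + \<epsilon>/2"] conjI) auto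
qed

lemma acs_null_uminus: "acs_null X \<Longrightarrow> acs_null (\<lambda>m n. - X m n)"
  unfolding acs_null_def by (auto elim!: eventually_mono all_forward imp_forward intro: dcmp_uminus)

lemma acs_null_diff: "acs_null X \<Longrightarrow> acs_null Y \<Longrightarrow> acs_null (\<lambda>m n. X m n - Y m n)"
  using acs_null_add[OF _ acs_null_uminus] by simp

lemma acs_null_adj: "acs_null X \<Longrightarrow> acs_null (\<lambda>m n. adj (X m n))"
  unfolding acs_null_def by (auto elim!: eventually_mono all_forward imp_forward intro: dcmp_adj)

lemma acs_null_bounded: "acs_null X \<Longrightarrow> acs_bounded X"
  unfolding acs_null_def acs_bounded_def by blast

lemma acs_bounded_adj: "acs_bounded X \<Longrightarrow> acs_bounded (\<lambda>m n. adj (X m n))"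
  unfolding acs_bounded_def
  by (elim all_forward imp_forward ex_forward) (auto elim!: eventually_mono intro: dcmp_adj)

lemma acs_bounded_add:
  assumes "acs_bounded X" "acs_bounded Y"
  shows "acs_bounded (\<lambda>m n. X m n + Y m n)"
  unfolding acs_bounded_def
proof (intro allI impI)
  fix \<epsilon> :: real assume "0 < \<epsilon>"
  then have "0 < \<epsilon> / 2" by simp
  then obtain M K where XY: "\<forall>\<^sub>F m in sequentially. \<forall>\<^sub>F n in F. dcmp (\<epsilon>/2 * real (level_size (\<nu> n))) M (X m n)"
    "\<forall>\<^sub>F m in sequentially. \<forall>\<^sub>F n in F. dcmp (\<epsilon>/2 * real (level_size (\<nu> n))) K (Y m n)"
    using assms unfolding acs_bounded_def by meson
  have "\<forall>\<^sub>F m in sequentially. \<forall>\<^sub>F n in F. dcmp ((\<epsilon>/2 + \<epsilon>/2) * real (level_size (\<nu> n))) (M + K) (X m n + Y m n)"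
    by (rule eventually_dcmp_combine[OF XY]) (simp only: distrib_right dcmp_add)
  then show "\<exists>M. \<forall>\<^sub>F m in sequentially. \<forall>\<^sub>F n in F. dcmp (\<epsilon> * real (level_size (\<nu> n))) M (X m n + Y m n)"
    by (simp only: field_sum_of_halves) (rule exI)
qed

lemma acs_bounded_mult:
  assumes "acs_bounded X" "acs_bounded Y"
  shows "acs_bounded (\<lambda>m n. X m n * Y m n)"
  unfolding acs_bounded_def
proof (intro allI impI)
  fix \<epsilon> :: real assume "0 < \<epsilon>"
  then have "0 < \<epsilon> / 2" by simp
  then obtain M K where XY: "\<forall>\<^sub>F m in sequentially. \<forall>\<^sub>F n in F. dcmp (\<epsilon>/2 * real (level_size (\<nu> n))) M (X m n)"
    "\<forall>\<^sub>F m in sequentially. \<forall>\<^sub>F n in F. dcmp (\<epsilon>/2 * real (level_size (\<nu> n))) K (Y m n)"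
    using assms unfolding acs_bounded_def by meson
  have "\<forall>\<^sub>F m in sequentially. \<forall>\<^sub>F n in F. dcmp ((\<epsilon>/2 + \<epsilon>/2) * real (level_size (\<nu> n))) (M * K) (X m n * Y m n)"
    by (rule eventually_dcmp_combine[OF XY]) (simp only: distrib_right dcmp_mult)
  then show "\<exists>M. \<forall>\<^sub>F m in sequentially. \<forall>\<^sub>F n in F. dcmp (\<epsilon> * real (level_size (\<nu> n))) M (X m n * Y m n)"
    by (simp only: field_sum_of_halves) (rule exI)
qed

lemma acs_bounded_opb:
  assumes "\<And>m. \<forall>\<^sub>F n in F. opb M (X m n)"
  shows "acs_bounded X"
  unfolding acs_bounded_def
proof (intro allI impI, rule exI[of _ M], rule always_eventually, rule allI)
  fix \<epsilon> :: real and m assume \<epsilon>: "0 < \<epsilon>"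
  from assms[of m] show "\<forall>\<^sub>F n in F. dcmp (\<epsilon> * real (level_size (\<nu> n))) M (X m n)"
    by eventually_elim (rule dcmp_opb, use \<epsilon> in auto)
qed

lemma acs_null_mult_left:
  assumes "acs_bounded X" "acs_null Y"
  shows "acs_null (\<lambda>m n. X m n * Y m n)"
proof (rule acs_nullI)
  fix \<epsilon> :: real assume \<epsilon>: "0 < \<epsilon>"
  then have \<epsilon>2: "0 < \<epsilon> / 2" by simp
  then obtain M where M: "\<forall>\<^sub>F m in sequentially. \<forall>\<^sub>F n in F. dcmp (\<epsilon>/2 * real (level_size (\<nu> n))) M (X m n)"
    using assms unfolding acs_bounded_def by meson
  \<comment> \<open>Only a positive bound makes \<open>\<epsilon> / K\<close> an admissible
    tolerance.\<close>
  define K where "K = \<bar>M\<bar> + 1"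
  have K: "0 < K" "M \<le> K" by (simp_all add: K_def)
  have X: "\<forall>\<^sub>F m in sequentially. \<forall>\<^sub>F n in F. dcmp (\<epsilon>/2 * real (level_size (\<nu> n))) K (X m n)"
    using M by (rule eventually_mono) (erule eventually_mono, erule dcmp_mono, use K in auto)
  have "0 < \<epsilon> / K" using \<epsilon> K by simp
  note Y = acs_nullD[OF assms(2) \<epsilon>2 this]
  have "\<forall>\<^sub>F m in sequentially. \<forall>\<^sub>F n in F. dcmp ((\<epsilon>/2 + \<epsilon>/2) * real (level_size (\<nu> n))) (K * (\<epsilon> / K)) (X m n * Y m n)"
    by (rule eventually_dcmp_combine[OF X Y]) (simp only: distrib_right dcmp_mult)
  then show "\<exists>x\<ge>0. \<exists>M. x \<le> \<epsilon> \<and> M \<le> \<epsilon> \<and>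
      (\<forall>\<^sub>F m in sequentially. \<forall>\<^sub>F n in F. dcmp (x * real (level_size (\<nu> n))) M (X m n * Y m n))"
    using \<epsilon> K by (intro exI[of _ "\<epsilon>/2 + \<epsilon>/2"] conjI exI[of _ "K * (\<epsilon> / K)"]) auto
qed

lemma acs_null_mult_right:
  assumes "acs_null X" "acs_bounded Y"
  shows "acs_null (\<lambda>m n. X m n * Y m n)"
  using acs_null_adj[OF acs_null_mult_left[OF acs_bounded_adj[OF assms(2)] acs_null_adj[OF assms(1)]]] by simp

text \<open>The family \<open>X\<close> is bounded by an equation in which it occurs on the
  right-hand side as well, and nothing is known about it beforehand; \<open>dcmp_neumann\<close>
  only asks that \<open>Z\<close> be at most 1/2 up to small rank.\<close>

lemma acs_bounded_neumann:
  assumes X: "\<And>m. \<forall>\<^sub>F n in F. X m n = Y m n + X m n * Z m n" and Y: "acs_bounded Y" and Z: "acs_null Z"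
  shows "acs_bounded X"
  unfolding acs_bounded_def
proof (intro allI impI)
  fix \<epsilon> :: real assume "0 < \<epsilon>"
  then have \<epsilon>2: "0 < \<epsilon> / 2" by simp
  then obtain M where M: "\<forall>\<^sub>F m in sequentially. \<forall>\<^sub>F n in F. dcmp (\<epsilon>/2 * real (level_size (\<nu> n))) M (Y m n)"
    using Y unfolding acs_bounded_def by meson
  have "\<forall>\<^sub>F m in sequentially. \<forall>\<^sub>F n in F. dcmp (\<epsilon>/2 * real (level_size (\<nu> n))) (1/2) (Z m n)"
    by (rule acs_nullD[OF Z \<epsilon>2]) simp
  with M have "\<forall>\<^sub>F m in sequentially. \<forall>\<^sub>F n in F. dcmp (\<epsilon> * real (level_size (\<nu> n))) (2 * M + 1) (X m n)"
  proof eventually_elim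
    case (elim m)
    from elim(1,2) X[of m] show ?case
    proof eventually_elim
      case (elim n)
      have "dcmp (\<epsilon>/2 * real (level_size (\<nu> n)) + \<epsilon>/2 * real (level_size (\<nu> n))) (2 * M + 1) (X m n)"
        by (rule dcmp_neumann[OF elim(3,1,2)]) simp
      then show ?case by (simp only: distrib_right[symmetric] field_sum_of_halves)
    qed
  qed
  then show "\<exists>M. \<forall>\<^sub>F m in sequentially. \<forall>\<^sub>F n in F. dcmp (\<epsilon> * real (level_size (\<nu> n))) M (X m n)" ..
qed

lemma acs_null_frob_small:
  assumes "\<And>m. frob_small (X m)"
  shows "acs_null (\<lambda>m n. X m (\<nu> n))"
  unfolding acs_null_def
proof (intro allI impI, rule always_eventually, rule allI)
  fix \<epsilon> :: real and m assume \<epsilon>: "0 < \<epsilon>"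
  then have "\<forall>\<^sub>F n in at_top_dindex. (norm (X m n))\<^sup>2 \<le> \<epsilon> * \<epsilon>\<^sup>2 * real (level_size n)"
    using assms[of m] by (simp add: frob_small_def)
  then have "\<forall>\<^sub>F n in F. (norm (X m (\<nu> n)))\<^sup>2 \<le> \<epsilon> * \<epsilon>\<^sup>2 * real (level_size (\<nu> n))"
    by (rule eventually_compose_filterlim[OF _ filterlim_\<nu>])
  then show "\<forall>\<^sub>F n in F. dcmp (\<epsilon> * real (level_size (\<nu> n))) \<epsilon> (X m (\<nu> n))"
    by eventually_elim (rule dcmp_frobenius[OF \<epsilon>], simp add: algebra_simps)
qed

section \<open>Generating sequences with convergent symbols\<close>

lemma bdd_above_norm_sq_convergent:
  "x \<longlonglongrightarrow> (l :: 'a::real_normed_vector) \<Longrightarrow> bdd_above (range (\<lambda>m. (norm (x m))\<^sup>2))"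
  by (intro Bseq_bdd_above convergent_imp_Bseq convergentI[OF tendsto_power[OF tendsto_norm]])

lemma acs_bounded_seq_mat:
  assumes ok: "\<And>m. seq_ok t (ts m)"
    and AE: "AE z in lborel. z \<in> glt_domain \<longrightarrow> (\<lambda>m. seq_sym (ts m) z) \<longlonglongrightarrow> g z"
  shows "acs_bounded (\<lambda>m n. seq_mat (ts m) (\<nu> n))"
  unfolding acs_bounded_def
proof (intro allI impI)
  fix \<epsilon> :: real assume "0 < \<epsilon>"
  \<comment> \<open>The divisor cancels the rank factor \<open>13 * real t\<close> of
    \<open>dcmp_seq_mat\<close>.\<close>
  then have \<epsilon>': "0 < \<epsilon> / (13 * real t)" using t_pos by simp
  obtain C where C: "0 < C" "\<And>(ts :: 'd term4 list) \<delta>. seq_ok t ts \<Longrightarrow> 0 < \<delta> \<Longrightarrow>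
      measure lborel {z \<in> glt_domain. \<delta> < (norm (seq_sym ts z))\<^sup>2} \<le> \<epsilon> / (13 * real t) * (2 * pi) ^ CARD('d) \<Longrightarrow>
      \<forall>\<^sub>F n in at_top_dindex. dcmp (13 * real t * (\<epsilon> / (13 * real t)) * real (level_size n)) (C * sqrt \<delta>) (seq_mat ts n)"
    by (rule dcmp_seq_mat[OF \<epsilon>' t_pos]) blast
  have bdd: "AE z in lborel. z \<in> glt_domain \<longrightarrow> bdd_above (range (\<lambda>m. (norm (seq_sym (ts m) z))\<^sup>2))"
    using AE by eventually_elim (rule impI, rule bdd_above_norm_sq_convergent, erule (1) mp)
  have pos: "0 < \<epsilon> / (13 * real t) * (2 * pi) ^ CARD('d)" by (intro mult_pos_pos \<epsilon>') simp
  obtain K where K: "0 < K"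
    "\<And>m. measure lborel {z \<in> glt_domain. K < (norm (seq_sym (ts m) z))\<^sup>2} \<le> \<epsilon> / (13 * real t) * (2 * pi) ^ CARD('d)"
    by (rule measure_superlevel_uniform[OF continuous_on_norm_seq_sym[OF ok] bdd pos]) blast
  have "\<forall>\<^sub>F n in F. dcmp (\<epsilon> * real (level_size (\<nu> n))) (C * sqrt K) (seq_mat (ts m) (\<nu> n))" for m
  proof -
    have "\<forall>\<^sub>F n in F. dcmp (13 * real t * (\<epsilon> / (13 * real t)) * real (level_size (\<nu> n))) (C * sqrt K) (seq_mat (ts m) (\<nu> n))"
      using C(2)[OF ok K] filterlim_\<nu> unfolding filterlim_iff by blast
    then show ?thesis using t_pos by simp
  qed
  then show "\<exists>M. \<forall>\<^sub>F m in sequentially. \<forall>\<^sub>F n in F. dcmp (\<epsilon> * real (level_size (\<nu> n))) M (seq_mat (ts m) (\<nu> n))"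
    by (intro exI[of _ "C * sqrt K"]) simp
qed

text \<open>Since \<open>C\<close> is known before the threshold, \<open>\<delta>\<close> can be
  chosen with \<open>C * sqrt \<delta> = \<epsilon>\<close>; convergence in measure then makes the
  exceptional sets small for late \<open>m\<close>.\<close>

lemma acs_null_seq_mat:
  assumes ok: "\<And>m. seq_ok t (ts m)"
    and AE: "AE z in lborel. z \<in> glt_domain \<longrightarrow> (\<lambda>m. seq_sym (ts m) z) \<longlonglongrightarrow> 0"
  shows "acs_null (\<lambda>m n. seq_mat (ts m) (\<nu> n))"
  unfolding acs_null_def
proof (intro allI impI)
  fix \<epsilon> :: real assume \<epsilon>: "0 < \<epsilon>"
  then have \<epsilon>': "0 < \<epsilon> / (13 * real t)" using t_pos by simp
  obtain C where C: "0 < C" "\<And>(ts :: 'd term4 list) \<delta>. seq_ok t ts \<Longrightarrow> 0 < \<delta> \<Longrightarrow>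
      measure lborel {z \<in> glt_domain. \<delta> < (norm (seq_sym ts z))\<^sup>2} \<le> \<epsilon> / (13 * real t) * (2 * pi) ^ CARD('d) \<Longrightarrow>
      \<forall>\<^sub>F n in at_top_dindex. dcmp (13 * real t * (\<epsilon> / (13 * real t)) * real (level_size n)) (C * sqrt \<delta>) (seq_mat ts n)"
    by (rule dcmp_seq_mat[OF \<epsilon>' t_pos]) blast
  have "AE z in lborel. z \<in> glt_domain \<longrightarrow> (\<lambda>m. (norm (seq_sym (ts m) z))\<^sup>2) \<longlonglongrightarrow> 0"
    using AE by eventually_elim (use tendsto_power[OF tendsto_norm, of _ 0 sequentially 2] in fastforce)
  moreover define \<delta> where "\<delta> = (\<epsilon> / C)\<^sup>2"
  moreover have \<delta>: "0 < \<delta>" "C * sqrt \<delta> = \<epsilon>" using \<epsilon> C(1) by (simp_all add: \<delta>_def)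
  ultimately have "(\<lambda>m. measure lborel {z \<in> glt_domain. \<delta> < (norm (seq_sym (ts m) z))\<^sup>2}) \<longlonglongrightarrow> 0"
    by (intro measure_superlevel_tendsto_0 continuous_on_norm_seq_sym[OF ok])
  moreover have "0 < \<epsilon> / (13 * real t) * (2 * pi) ^ CARD('d)" by (intro mult_pos_pos \<epsilon>') simp
  ultimately have "\<forall>\<^sub>F m in sequentially.
      measure lborel {z \<in> glt_domain. \<delta> < (norm (seq_sym (ts m) z))\<^sup>2} < \<epsilon> / (13 * real t) * (2 * pi) ^ CARD('d)"
    by (rule order_tendstoD)
  then show "\<forall>\<^sub>F m in sequentially. \<forall>\<^sub>F n in F. dcmp (\<epsilon> * real (level_size (\<nu> n))) \<epsilon> (seq_mat (ts m) (\<nu> n))"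
  proof eventually_elim
    case (elim m)
    have "\<forall>\<^sub>F n in F. dcmp (13 * real t * (\<epsilon> / (13 * real t)) * real (level_size (\<nu> n))) (C * sqrt \<delta>) (seq_mat (ts m) (\<nu> n))"
      using C(2)[OF ok \<delta>(1) less_imp_le[OF elim]] filterlim_\<nu> unfolding filterlim_iff by blast
    then show ?case using t_pos by (simp only: \<delta>(2)) simp
  qed
qed

section \<open>The algebra of GLT sequences\<close>

text \<open>A relaxed form of the GLT relation: \<open>X\<close> may itself depend on
  \<open>m\<close>, and the coefficients need only be continuous. The approximants and the given
  sequence thus obey the same rules.\<close>

definition glt_rep :: "(nat \<Rightarrow> nat \<Rightarrow> ('d dindex \<times> nat) fmat) \<Rightarrow> ('d point \<times> 'd point \<Rightarrow> nat fmat) \<Rightarrow> bool" where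
  "glt_rep X g \<longleftrightarrow> (\<exists>ts. (\<forall>m. seq_ok t (ts m)) \<and>
     (AE z in lborel. z \<in> glt_domain \<longrightarrow> (\<lambda>m. seq_sym (ts m) z) \<longlonglongrightarrow> g z) \<and>
     acs_null (\<lambda>m n. X m n - seq_mat (ts m) (\<nu> n)))"

lemma glt_repI:
  "(\<And>m. seq_ok t (ts m)) \<Longrightarrow> (AE z in lborel. z \<in> glt_domain \<longrightarrow> (\<lambda>m. seq_sym (ts m) z) \<longlonglongrightarrow> g z) \<Longrightarrow>
    acs_null (\<lambda>m n. X m n - seq_mat (ts m) (\<nu> n)) \<Longrightarrow> glt_rep X g"
  unfolding glt_rep_def by blast

lemma glt_repE:
  assumes "glt_rep X g"
  obtains ts where "\<And>m. seq_ok t (ts m)"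
    "AE z in lborel. z \<in> glt_domain \<longrightarrow> (\<lambda>m. seq_sym (ts m) z) \<longlonglongrightarrow> g z"
    "acs_null (\<lambda>m n. X m n - seq_mat (ts m) (\<nu> n))"
  using assms unfolding glt_rep_def by blast

lemma acs_null_zero: "acs_null (\<lambda>m n. 0)"
  unfolding acs_null_def by (intro allI impI always_eventually dcmp_opb opb_zero) auto

lemma glt_rep_seq_mat:
  assumes "\<And>m. seq_ok t (ts m)" "AE z in lborel. z \<in> glt_domain \<longrightarrow> (\<lambda>m. seq_sym (ts m) z) \<longlonglongrightarrow> g z"
  shows "glt_rep (\<lambda>m n. seq_mat (ts m) (\<nu> n)) g"
  using assms by (rule glt_repI) (simp add: acs_null_zero)

lemma glt_rep_idm:
  assumes "r \<le> t"
  shows "glt_rep (\<lambda>m n. idm ({1..\<nu> n} \<times> {..<r})) (\<lambda>z. idm {..<r})"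
proof -
  have "seq_ok t (seq_idm r)"
    using seq_ok_idm[of r] assms unfolding seq_ok_def by (auto intro: less_le_trans)
  then have "glt_rep (\<lambda>m n. seq_mat (seq_idm r) (\<nu> n)) (\<lambda>z. idm {..<r})"
    by (intro glt_rep_seq_mat) (simp_all add: seq_sym_idm)
  then show ?thesis by (simp add: seq_mat_idm)
qed

lemma glt_rep_cong_AE:
  assumes "glt_rep X g" "AE z in lborel. z \<in> glt_domain \<longrightarrow> g z = h z"
  shows "glt_rep X h"
proof -
  obtain ts where ts: "\<And>m. seq_ok t (ts m)" "AE z in lborel. z \<in> glt_domain \<longrightarrow> (\<lambda>m. seq_sym (ts m) z) \<longlonglongrightarrow> g z"
    "acs_null (\<lambda>m n. X m n - seq_mat (ts m) (\<nu> n))" using assms(1) by (rule glt_repE) blast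
  have "AE z in lborel. z \<in> glt_domain \<longrightarrow> (\<lambda>m. seq_sym (ts m) z) \<longlonglongrightarrow> h z"
    using ts(2) assms(2) by eventually_elim simp
  with ts(1) show ?thesis using ts(3) by (rule glt_repI)
qed

lemma glt_rep_bounded: "glt_rep X g \<Longrightarrow> acs_bounded X"
proof (elim glt_repE)
  fix ts assume ts: "\<And>m. seq_ok t (ts m)" "AE z in lborel. z \<in> glt_domain \<longrightarrow> (\<lambda>m. seq_sym (ts m) z) \<longlonglongrightarrow> g z"
    "acs_null (\<lambda>m n. X m n - seq_mat (ts m) (\<nu> n))"
  have "acs_bounded (\<lambda>m n. X m n - seq_mat (ts m) (\<nu> n) + seq_mat (ts m) (\<nu> n))"
    by (intro acs_bounded_add acs_null_bounded ts(3) acs_bounded_seq_mat[OF ts(1,2)])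
  then show "acs_bounded X" by simp
qed

text \<open>This turns identities between symbols into identities between matrices up to negligible
  families.\<close>

lemma glt_rep_nullD:
  assumes "glt_rep X g" "AE z in lborel. z \<in> glt_domain \<longrightarrow> g z = 0"
  shows "acs_null X"
proof -
  have "glt_rep X (\<lambda>z. 0)" using assms by (rule glt_rep_cong_AE)
  then obtain ts where ts: "\<And>m. seq_ok t (ts m)" "AE z in lborel. z \<in> glt_domain \<longrightarrow> (\<lambda>m. seq_sym (ts m) z) \<longlonglongrightarrow> 0"
    "acs_null (\<lambda>m n. X m n - seq_mat (ts m) (\<nu> n))" by (rule glt_repE) blast
  have "acs_null (\<lambda>m n. X m n - seq_mat (ts m) (\<nu> n) + seq_mat (ts m) (\<nu> n))"
    by (intro acs_null_add ts(3) acs_null_seq_mat[OF ts(1,2)])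
  then show "acs_null X" by simp
qed

lemma glt_rep_diff:
  assumes "glt_rep X g" "glt_rep Y h"
  shows "glt_rep (\<lambda>m n. X m n - Y m n) (\<lambda>z. g z - h z)"
proof -
  obtain ts where ts: "\<And>m. seq_ok t (ts m)" "AE z in lborel. z \<in> glt_domain \<longrightarrow> (\<lambda>m. seq_sym (ts m) z) \<longlonglongrightarrow> g z"
    "acs_null (\<lambda>m n. X m n - seq_mat (ts m) (\<nu> n))" using assms(1) by (rule glt_repE) blast
  obtain ss where ss: "\<And>m. seq_ok t (ss m)" "AE z in lborel. z \<in> glt_domain \<longrightarrow> (\<lambda>m. seq_sym (ss m) z) \<longlonglongrightarrow> h z"
    "acs_null (\<lambda>m n. Y m n - seq_mat (ss m) (\<nu> n))" using assms(2) by (rule glt_repE) blast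
  let ?ds = "\<lambda>m. ts m @ seq_smult (complex_of_real (- 1)) (ss m)"
  show ?thesis
  proof (rule glt_repI[of ?ds])
    show "seq_ok t (?ds m)" for m using ts(1) ss(1) seq_ok_smult[of t "ss m" "- 1"] by simp
    show "AE z in lborel. z \<in> glt_domain \<longrightarrow> (\<lambda>m. seq_sym (?ds m) z) \<longlonglongrightarrow> g z - h z"
      using ts(2) ss(2)
    proof eventually_elim
      case (elim z)
      have "seq_sym (?ds m) z = seq_sym (ts m) z - seq_sym (ss m) z" for m
        unfolding seq_simps seq_sym_smult_of_real by simp
      with elim show ?case by (auto intro: tendsto_diff)
    qed
    have "X m n - Y m n - seq_mat (?ds m) (\<nu> n) = (X m n - seq_mat (ts m) (\<nu> n)) - (Y m n - seq_mat (ss m) (\<nu> n))" for m n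
      unfolding seq_simps seq_mat_smult_of_real by simp
    then show "acs_null (\<lambda>m n. X m n - Y m n - seq_mat (?ds m) (\<nu> n))"
      using acs_null_diff[OF ts(3) ss(3)] by (simp only:)
  qed
qed

text \<open>With approximants \<open>P\<close> and \<open>Q\<close>,
  \<open>X Y - P Q = (X - P) Y + P (Y - Q)\<close>, and the boundedness of \<open>Y\<close> and
  \<open>P\<close> makes both terms negligible; the error of replacing \<open>P Q\<close> by the
  sequence \<open>seq_mult\<close> is small in Frobenius norm.\<close>

lemma glt_rep_mult:
  assumes "glt_rep X g" "glt_rep Y h"
  shows "glt_rep (\<lambda>m n. X m n * Y m n) (\<lambda>z. g z * h z)"
proof -
  obtain ts where ts: "\<And>m. seq_ok t (ts m)" "AE z in lborel. z \<in> glt_domain \<longrightarrow> (\<lambda>m. seq_sym (ts m) z) \<longlonglongrightarrow> g z"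
    "acs_null (\<lambda>m n. X m n - seq_mat (ts m) (\<nu> n))" using assms(1) by (rule glt_repE) blast
  obtain ss where ss: "\<And>m. seq_ok t (ss m)" "AE z in lborel. z \<in> glt_domain \<longrightarrow> (\<lambda>m. seq_sym (ss m) z) \<longlonglongrightarrow> h z"
    "acs_null (\<lambda>m n. Y m n - seq_mat (ss m) (\<nu> n))" using assms(2) by (rule glt_repE) blast
  show ?thesis
  proof (rule glt_repI[of "\<lambda>m. seq_mult (ts m) (ss m)"])
    show "seq_ok t (seq_mult (ts m) (ss m))" for m using ts(1) ss(1) by (rule seq_ok_mult)
    show "AE z in lborel. z \<in> glt_domain \<longrightarrow> (\<lambda>m. seq_sym (seq_mult (ts m) (ss m)) z) \<longlonglongrightarrow> g z * h z"
      using ts(2) ss(2) unfolding seq_sym_mult by eventually_elim (simp add: tendsto_mult)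
    have "acs_null (\<lambda>m n. (X m n - seq_mat (ts m) (\<nu> n)) * Y m n
        + seq_mat (ts m) (\<nu> n) * (Y m n - seq_mat (ss m) (\<nu> n))
        + (seq_mat (ts m) (\<nu> n) * seq_mat (ss m) (\<nu> n) - seq_mat (seq_mult (ts m) (ss m)) (\<nu> n)))"
      by (intro acs_null_add acs_null_mult_right[OF ts(3) glt_rep_bounded[OF assms(2)]]
        acs_null_mult_left[OF acs_bounded_seq_mat[OF ts(1,2)] ss(3)]
        acs_null_frob_small[of "\<lambda>m n. seq_mat (ts m) n * seq_mat (ss m) n - seq_mat (seq_mult (ts m) (ss m)) n"]
        frob_small_seq_mult[OF ts(1) ss(1)])
    then show "acs_null (\<lambda>m n. X m n * Y m n - seq_mat (seq_mult (ts m) (ss m)) (\<nu> n))"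
      by (simp add: algebra_simps)
  qed
qed

lemma glt_rep_adj:
  assumes "glt_rep X g"
  shows "glt_rep (\<lambda>m n. adj (X m n)) (\<lambda>z. adj (g z))"
proof -
  obtain ts where ts: "\<And>m. seq_ok t (ts m)" "AE z in lborel. z \<in> glt_domain \<longrightarrow> (\<lambda>m. seq_sym (ts m) z) \<longlonglongrightarrow> g z"
    "acs_null (\<lambda>m n. X m n - seq_mat (ts m) (\<nu> n))" using assms(1) by (rule glt_repE) blast
  have adj: "x \<longlonglongrightarrow> l \<Longrightarrow> (\<lambda>m. adj (x m)) \<longlonglongrightarrow> adj l" for x and l :: "nat fmat"
    by (simp add: LIMSEQ_iff adj_simps(4)[symmetric] del: adj_simps(4))
  show ?thesis
  proof (rule glt_repI[of "\<lambda>m. seq_adj (ts m)"])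
    show "seq_ok t (seq_adj (ts m))" for m using ts(1) by (rule seq_ok_adj)
    show "AE z in lborel. z \<in> glt_domain \<longrightarrow> (\<lambda>m. seq_sym (seq_adj (ts m)) z) \<longlonglongrightarrow> adj (g z)"
      using ts(2) unfolding seq_sym_adj by eventually_elim (simp add: adj)
    have "acs_null (\<lambda>m n. adj (X m n - seq_mat (ts m) (\<nu> n)) + (adj (seq_mat (ts m) (\<nu> n)) - seq_mat (seq_adj (ts m)) (\<nu> n)))"
      by (intro acs_null_add acs_null_adj ts(3)
        acs_null_frob_small[of "\<lambda>m n. adj (seq_mat (ts m) n) - seq_mat (seq_adj (ts m)) n"]
        frob_small_seq_adj[OF ts(1)])
    then show "acs_null (\<lambda>m n. adj (X m n) - seq_mat (seq_adj (ts m)) (\<nu> n))" by simp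
  qed
qed

end

section \<open>Pseudoinverses of GLT sequences\<close>

lemma opb_projection:
  assumes "H * H = H" "adj H = H"
  shows "opb 1 H"
  unfolding opb_def
proof (intro conjI allI)
  fix Y
  have "(norm (H * Y))\<^sup>2 = inner Y (adj H * (H * Y))" by (simp only: power2_norm_eq_inner inner_mult_left)
  also have "\<dots> = inner Y (H * Y)" by (simp only: assms mult.assoc[symmetric])
  also have "\<dots> \<le> norm Y * norm (H * Y)" by (rule norm_cauchy_schwarz)
  finally show "norm (H * Y) \<le> 1 * norm Y"
    by (cases "H * Y = 0") (simp_all add: power2_eq_square)
qed simp

context fmat_sequences
begin

text \<open>
  If \<open>A Q\<close> is close to the unit \<open>\<Pi>\<close> of the row space, then \<open>B = B A Q + B (\<Pi> - A Q)\<close> makes \<open>B\<close>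
  bounded up to small rank. Since \<open>Q A\<close> is nearly selfadjoint, \<open>Q\<close> is nearly \<open>A\<^sup>* Q\<^sup>* Q\<close>, whose
  range lies in that of \<open>A\<^sup>*\<close>, so the projection \<open>B A\<close> nearly fixes \<open>Q\<close>.
\<close>

lemma acs_null_penrose_row:
  assumes r: "r \<le> t"
    and A: "glt_rep (\<lambda>m. A) \<kappa>" and Q: "glt_rep Q \<rho>"
    and pen: "\<forall>\<^sub>F n in F. penrose (A n) (B n)"
    and supp: "\<forall>\<^sub>F n in F. idm ({1..\<nu> n} \<times> {..<r}) * A n = A n"
    and sym: "AE z in lborel. z \<in> glt_domain \<longrightarrow> penrose (\<kappa> z) (\<rho> z) \<and> \<kappa> z * \<rho> z = idm {..<r}"
  shows "acs_null (\<lambda>m n. B n - Q m n)"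
proof -
  let ?I = "\<lambda>n. idm ({1..\<nu> n} \<times> {..<r}) :: ('d dindex \<times> nat) fmat"
  define D1 where "D1 m n = ?I n - A n * Q m n" for m n
  define D2 where "D2 m n = Q m n * A n - adj (Q m n * A n)" for m n
  define D3 where "D3 m n = Q m n - Q m n * ?I n" for m n
  \<comment> \<open>\<open>E\<close> is the error in \<open>Q \<approx> adj A * adj Q * Q\<close>:
    first \<open>Q\<close> is replaced by \<open>Q I\<close>, then \<open>I\<close> by
    \<open>A Q\<close>, then \<open>Q A\<close> by its adjoint, at the costs \<open>D3\<close>,
    \<open>Q D1\<close> and \<open>D2 Q\<close>.\<close>
  define E where "E m n = D3 m n + Q m n * D1 m n + D2 m n * Q m n" for m n
  note I = glt_rep_idm[OF r]
  have D1: "acs_null D1" unfolding D1_def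
    by (rule glt_rep_nullD[OF glt_rep_diff[OF I glt_rep_mult[OF A Q]]])
      (use sym in \<open>eventually_elim, simp\<close>)
  have D2: "acs_null D2" unfolding D2_def
    by (rule glt_rep_nullD[OF glt_rep_diff[OF glt_rep_mult[OF Q A] glt_rep_adj[OF glt_rep_mult[OF Q A]]]])
      (use sym in \<open>eventually_elim, simp add: penroseD(4)\<close>)
  have D3: "acs_null D3" unfolding D3_def
  proof (rule glt_rep_nullD[OF glt_rep_diff[OF Q glt_rep_mult[OF Q I]]])
    show "AE z in lborel. z \<in> glt_domain \<longrightarrow> \<rho> z - \<rho> z * idm {..<r} = 0"
      using sym
    proof eventually_elim
      case (elim z)
      show ?case
      proof
        assume "z \<in> glt_domain"
        with elim have z: "penrose (\<kappa> z) (\<rho> z)" "\<kappa> z * \<rho> z = idm {..<r}" by auto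
        have "\<rho> z * idm {..<r} = \<rho> z * \<kappa> z * \<rho> z" by (simp only: z(2)[symmetric] mult.assoc)
        also have "\<dots> = \<rho> z" by (rule penroseD(2)[OF z(1)])
        finally show "\<rho> z - \<rho> z * idm {..<r} = 0" by simp
      qed
    qed
  qed
  note Qb = glt_rep_bounded[OF Q]
  have E: "acs_null E" unfolding E_def
    by (intro acs_null_add D3 acs_null_mult_left[OF Qb D1] acs_null_mult_right[OF D2 Qb])
  \<comment> \<open>\<open>B A\<close> is an orthogonal projection, so it is bounded by 1 although
    nothing is known yet about \<open>B\<close>.\<close>
  have BAb: "acs_bounded (\<lambda>m n. B n * A n)"
    using pen by (intro acs_bounded_opb[of 1], elim eventually_mono)
      (simp add: opb_projection penrose_def mult.assoc[symmetric])
  have BI: "\<forall>\<^sub>F n in F. B n * ?I n = B n"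
    using pen supp
  proof eventually_elim
    case (elim n)
    show ?case
      by (rule penrose_support(2)[OF elim(1) _ finite_subset[OF subset_refl] elim(2) mult_idm(1)[of "fsupp (A n)"]]) simp_all
  qed
  have B_eq: "B n = B n * A n * Q m n + B n * D1 m n" if "B n * ?I n = B n" for m n
    using that by (simp add: D1_def algebra_simps)
  have Bb: "acs_bounded (\<lambda>m. B)"
  proof (rule acs_bounded_neumann)
    show "\<forall>\<^sub>F n in F. B n = B n * A n * Q m n + B n * D1 m n" for m
      using BI by eventually_elim (rule B_eq)
    show "acs_bounded (\<lambda>m n. B n * A n * Q m n)" by (rule acs_bounded_mult[OF BAb Qb])
  qed (rule D1)
  \<comment> \<open>The family is \<open>B - Q\<close>: insert \<open>B A Q = Q - E + B A E\<close>
    into \<open>B = B A Q + B D1\<close>.\<close>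
  have "acs_null (\<lambda>m n. B n * D1 m n + (B n * A n) * E m n - E m n)"
    by (intro acs_null_add acs_null_diff acs_null_mult_left[OF Bb D1] acs_null_mult_left[OF BAb E] E)
  then show ?thesis
  proof (rule acs_null_cong)
    fix m
    show "\<forall>\<^sub>F n in F. B n * D1 m n + (B n * A n) * E m n - E m n = B n - Q m n"
      using BI pen
    proof eventually_elim
      case (elim n)
      note P = penroseD[OF elim(2)]
      have Q_eq: "Q m n = adj (A n) * adj (Q m n) * Q m n + E m n"
        by (simp add: E_def D1_def D2_def D3_def algebra_simps)
      have "adj (A n) * adj (B n) * adj (A n) = adj (A n * B n * A n)"
        by (simp only: adj_mult mult.assoc)
      then have BA_adj: "B n * A n * adj (A n) = adj (A n)" by (simp only: P(1,4))
      have "B n * A n * Q m n = B n * A n * (adj (A n) * (adj (Q m n) * Q m n) + E m n)"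
        by (rule arg_cong[where f = "(*) (B n * A n)"]) (subst Q_eq, simp only: mult.assoc)
      also have "\<dots> = B n * A n * adj (A n) * (adj (Q m n) * Q m n) + B n * A n * E m n"
        by (simp only: distrib_left mult.assoc)
      also have "\<dots> = adj (A n) * adj (Q m n) * Q m n + B n * A n * E m n"
        by (simp only: BA_adj) (simp only: mult.assoc)
      also have "adj (A n) * adj (Q m n) * Q m n = Q m n - E m n"
        using Q_eq by (simp only: eq_diff_eq)
      finally have BAQ: "B n * A n * Q m n = Q m n - E m n + B n * A n * E m n" .
      have "B n = Q m n - E m n + B n * A n * E m n + B n * D1 m n"
        using B_eq[OF elim(1), of m] by (simp only: BAQ)
      then have "B n - Q m n = Q m n - E m n + B n * A n * E m n + B n * D1 m n - Q m n" by (rule arg_cong)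
      then show ?case by simp
    qed
  qed
qed

lemma acs_null_penrose_col:
  assumes s: "s \<le> t"
    and A: "glt_rep (\<lambda>m. A) \<kappa>" and Q: "glt_rep Q \<rho>"
    and pen: "\<forall>\<^sub>F n in F. penrose (A n) (B n)"
    and supp: "\<forall>\<^sub>F n in F. A n * idm ({1..\<nu> n} \<times> {..<s}) = A n"
    and sym: "AE z in lborel. z \<in> glt_domain \<longrightarrow> penrose (\<kappa> z) (\<rho> z) \<and> \<rho> z * \<kappa> z = idm {..<s}"
  shows "acs_null (\<lambda>m n. B n - Q m n)"
proof -
  have "acs_null (\<lambda>m n. adj (B n) - adj (Q m n))"
  proof (rule acs_null_penrose_row[OF s glt_rep_adj[OF A] glt_rep_adj[OF Q]])
    show "\<forall>\<^sub>F n in F. penrose (adj (A n)) (adj (B n))"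
      using pen by eventually_elim (rule penrose_adj)
    show "\<forall>\<^sub>F n in F. idm ({1..\<nu> n} \<times> {..<s}) * adj (A n) = adj (A n)"
      using supp
    proof eventually_elim
      case (elim n)
      have "adj (A n * idm ({1..\<nu> n} \<times> {..<s})) = adj (A n)" by (simp only: elim)
      then show ?case by simp
    qed
    show "AE z in lborel. z \<in> glt_domain \<longrightarrow> penrose (adj (\<kappa> z)) (adj (\<rho> z)) \<and> adj (\<kappa> z) * adj (\<rho> z) = idm {..<s}"
      using sym
    proof eventually_elim
      case (elim z)
      show ?case
      proof
        assume "z \<in> glt_domain"
        with elim have z: "penrose (\<kappa> z) (\<rho> z)" "\<rho> z * \<kappa> z = idm {..<s}" by auto
        have "adj (\<kappa> z) * adj (\<rho> z) = adj (idm {..<s})" by (simp only: z(2)[symmetric] adj_mult)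
        then show "penrose (adj (\<kappa> z)) (adj (\<rho> z)) \<and> adj (\<kappa> z) * adj (\<rho> z) = idm {..<s}"
          using penrose_adj[OF z(1)] by simp
      qed
    qed
  qed
  from acs_null_adj[OF this] show ?thesis by simp
qed

end

section \<open>Translation to block matrices\<close>

lemma tendsto_fmatI:
  assumes S: "finite S" "\<And>m. fsupp (x m) \<subseteq> S" "fsupp l \<subseteq> S"
    and lim: "\<And>i j. i \<in> S \<Longrightarrow> j \<in> S \<Longrightarrow> (\<lambda>m. entry (x m) i j) \<longlonglongrightarrow> entry l i j"
  shows "x \<longlonglongrightarrow> (l :: 'i fmat)"
proof -
  have "(norm (x m - l))\<^sup>2 = (\<Sum>i\<in>S. \<Sum>j\<in>S. (cmod (entry (x m) i j - entry l i j))\<^sup>2)" for m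
  proof -
    have "entry (x m - l) i j = 0" if "i \<notin> S \<or> j \<notin> S" for i j
    proof -
      have "i \<notin> fsupp (x m) \<and> i \<notin> fsupp l \<or> j \<notin> fsupp (x m) \<and> j \<notin> fsupp l" using that S(2)[of m] S(3) by blast
      then show ?thesis by (auto simp: entry_nonzero_fsupp)
    qed
    from norm_fmat_sq[OF S(1) S(1) this] show ?thesis by simp
  qed
  moreover have "(\<lambda>m. \<Sum>i\<in>S. \<Sum>j\<in>S. (cmod (entry (x m) i j - entry l i j))\<^sup>2) \<longlonglongrightarrow> (\<Sum>i\<in>S. \<Sum>j\<in>S. (cmod 0)\<^sup>2)"
    by (intro tendsto_sum tendsto_power tendsto_norm LIM_zero lim)
  ultimately have "(\<lambda>m. (norm (x m - l))\<^sup>2) \<longlonglongrightarrow> 0" by simp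
  from tendsto_real_sqrt[OF this] have "(\<lambda>m. norm (x m - l)) \<longlonglongrightarrow> 0" by simp
  then show ?thesis by (rule LIM_zero_cancel[OF tendsto_norm_zero_cancel])
qed

lemma entry_fmat_of_id:
  assumes "M \<in> carrier_mat r s"
  shows "entry (fmat_of id id M) p q = (if p < r \<and> q < s then M $$ (p, q) else 0)"
proof (cases "p < r \<and> q < s")
  case True
  then show ?thesis using entry_fmat_of[OF assms, of id id p q] by simp
next
  case False
  then show ?thesis using entry_fmat_of_0[OF assms, of p id q id] by auto
qed

lemma fsupp_fmat_of_id:
  assumes "M \<in> carrier_mat r s" "max r s \<le> t"
  shows "fsupp (fmat_of id id M) \<subseteq> {..<t}"
  using assms(2) by (auto simp: fsupp_def entry_fmat_of_id[OF assms(1)] split: if_splits)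

lemma ext_mat_carrier [simp]: "ext_mat t x \<in> carrier_mat t t"
  by (simp add: ext_mat_def)

lemma fmat_of_ext_mat:
  assumes "x \<in> carrier_mat r s" "max r s \<le> t"
  shows "fmat_of id id (ext_mat t x) = fmat_of id id x"
proof (rule fmat_eqI)
  fix p q
  show "entry (fmat_of id id (ext_mat t x)) p q = entry (fmat_of id id x) p q"
    unfolding entry_fmat_of_id[OF assms(1)] entry_fmat_of_id[OF ext_mat_carrier]
    using assms by (auto simp: ext_mat_def)
qed

lemma measurable_symbol_ext_mat:
  assumes "measurable_symbol r s \<kappa>" "max r s \<le> t"
  shows "measurable_symbol t t (\<lambda>z. ext_mat t (\<kappa> z))"
proof -
  have car: "\<kappa> z \<in> carrier_mat r s" if "z \<in> glt_domain" for z
    using assms that by (simp add: measurable_symbol_def)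
  have meas: "(\<lambda>z. \<kappa> z $$ (\<alpha>, \<beta>)) \<in> borel_measurable (lebesgue_on glt_domain)" if "\<alpha> < r" "\<beta> < s" for \<alpha> \<beta>
    using assms that by (simp add: measurable_symbol_def)
  have "(\<lambda>z. ext_mat t (\<kappa> z) $$ (\<alpha>, \<beta>)) \<in> borel_measurable (lebesgue_on glt_domain)" if "\<alpha> < t" "\<beta> < t" for \<alpha> \<beta>
  proof -
    have "(\<lambda>z. ext_mat t (\<kappa> z) $$ (\<alpha>, \<beta>)) \<in> borel_measurable (lebesgue_on glt_domain) \<longleftrightarrow>
        (\<lambda>z. if \<alpha> < r \<and> \<beta> < s then \<kappa> z $$ (\<alpha>, \<beta>) else 0) \<in> borel_measurable (lebesgue_on glt_domain)"
      by (rule measurable_cong) (use that in \<open>auto simp: ext_mat_def dest!: car\<close>)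
    then show ?thesis using meas by (cases "\<alpha> < r \<and> \<beta> < s") auto
  qed
  then show ?thesis by (simp add: measurable_symbol_def)
qed

lemma mat_sum_carrier [simp]: "mat_sum r s X N \<in> carrier_mat r s"
  by (simp add: mat_sum_def)

lemma block_fmat_mat_sum:
  assumes n: "1 \<le> n"
    and X: "\<And>i. i < N \<Longrightarrow> X i \<in> carrier_mat (level_size n * r) (level_size n * s)"
  shows "block_fmat n r s (mat_sum (level_size n * r) (level_size n * s) X N) = (\<Sum>i<N. block_fmat n r s (X i))"
proof (rule fmat_eqI)
  fix x y :: "'a dindex \<times> nat"
  obtain i \<alpha> k \<beta> where xy: "x = (i, \<alpha>)" "y = (k, \<beta>)" by (metis surj_pair)
  have "entry (\<Sum>i<N. block_fmat n r s (X i)) x y = (\<Sum>l<N. if i \<in> {1..n} \<and> k \<in> {1..n} \<and> \<alpha> < r \<and> \<beta> < s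
     then X l $$ (lex_pos n i * r + \<alpha>, lex_pos n k * s + \<beta>) else 0)"
    unfolding entry_sum xy by (intro sum.cong refl entry_block_fmat[OF n X]) simp
  also have "\<dots> = entry (block_fmat n r s (mat_sum (level_size n * r) (level_size n * s) X N)) x y"
    unfolding xy entry_block_fmat[OF n mat_sum_carrier]
    using block_pos_less[OF n, of i \<alpha> r] block_pos_less[OF n, of k \<beta> s] by (auto simp: mat_sum_def)
  finally show "entry (block_fmat n r s (mat_sum (level_size n * r) (level_size n * s) X N)) x y =
    entry (\<Sum>i<N. block_fmat n r s (X i)) x y" ..
qed

section \<open>Generating matrices as products of sampling and Toeplitz matrices\<close>

definition term_fun :: "nat \<Rightarrow> ('d::finite) term4 \<Rightarrow> 'd point \<Rightarrow> complex mat" where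
  "term_fun t = (\<lambda>(a, j, \<alpha>, \<beta>) \<theta>. exp (\<i> * complex_of_real (phase j \<theta>)) \<cdot>\<^sub>m unit_mat_entry t \<alpha> \<beta>)"

lemma fourier_coeff_term_fun:
  "fourier_coeff t t (term_fun t (a, j, \<alpha>, \<beta>)) (k :: ('d::finite) dindex) =
    (if k = j then unit_mat_entry t \<alpha> \<beta> else 0\<^sub>m t t)"
proof (rule eq_matI)
  fix p q assume "p < dim_row (if k = j then unit_mat_entry t \<alpha> \<beta> else 0\<^sub>m t t)"
    "q < dim_col (if k = j then unit_mat_entry t \<alpha> \<beta> else 0\<^sub>m t t)"
  then have pq: "p < t" "q < t" by (auto simp: unit_mat_entry_def split: if_splits)
  let ?u = "unit_mat_entry t \<alpha> \<beta> $$ (p, q)"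
  let ?g = "\<lambda>\<theta> :: 'd point. indicator torus \<theta> *\<^sub>R cis (phase (j - k) \<theta>)"
  have torus: "(torus :: 'd point set) \<in> sets borel" by (simp add: torus_def)
  have "term_fun t (a, j, \<alpha>, \<beta>) \<theta> $$ (p, q) * exp (- \<i> * complex_of_real (phase k \<theta>)) = ?u * cis (phase (j - k) \<theta>)" for \<theta> :: "'d point"
  proof -
    have "exp (\<i> * complex_of_real (phase j \<theta>)) * exp (- \<i> * complex_of_real (phase k \<theta>)) = cis (phase (j - k) \<theta>)"
      unfolding exp_add[symmetric] cis_conv_exp diff_conv_add_uminus phase_add phase_uminus
      by (simp add: algebra_simps)
    then show ?thesis using pq by (simp add: term_fun_def unit_mat_entry_def)
  qed
  then have "(LINT \<theta>|lebesgue_on torus. term_fun t (a, j, \<alpha>, \<beta>) \<theta> $$ (p, q) * exp (- \<i> * complex_of_real (phase k \<theta>)))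
      = (LINT \<theta>|lebesgue_on torus. ?u * cis (phase (j - k) \<theta>))" by simp
  also have "\<dots> = ?u * (LINT \<theta>|lebesgue_on torus. cis (phase (j - k) \<theta>))" by simp
  also have "(LINT \<theta>|lebesgue_on torus. cis (phase (j - k) \<theta>)) = (LINT \<theta>|lebesgue. ?g \<theta>)"
    using torus by (intro integral_restrict_space) (simp add: sets_completionI_sets)
  also have "\<dots> = (LINT \<theta>|lborel. ?g \<theta>)"
  proof (rule integral_completion)
    have "(\<lambda>\<theta> :: 'd point. cis (phase (j - k) \<theta>)) \<in> borel_measurable borel"
      by (intro borel_measurable_continuous_onI continuous_on_cis continuous_on_phase continuous_on_id)
    then show "?g \<in> borel_measurable lborel" using torus by simp
  qed
  also have "\<dots> = (if k = j then complex_of_real ((2 * pi) ^ CARD('d)) else 0)"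
    unfolding integral_torus_cis by auto
  finally show "fourier_coeff t t (term_fun t (a, j, \<alpha>, \<beta>)) k $$ (p, q) = (if k = j then unit_mat_entry t \<alpha> \<beta> else 0\<^sub>m t t) $$ (p, q)"
    using pq by (auto simp: fourier_coeff_def)
qed (auto simp: fourier_coeff_def unit_mat_entry_def)

text \<open>By orthogonality a trigonometric monomial has a single nonzero Fourier coefficient, so
  its Toeplitz matrix carries one matrix unit along one block diagonal, and the sampling matrix
  scales its rows.\<close>

lemma block_fmat_gen_mat:
  fixes n :: "('d::{finite,linorder}) dindex"
  assumes n: "1 \<le> n" and \<tau>: "\<tau> = (a, j, \<alpha>, \<beta>)" "\<alpha> < t" "\<beta> < t"
  shows "block_fmat n t t (diag_sampling t t n (\<lambda>x. a x \<cdot>\<^sub>m 1\<^sub>m t) * toeplitz t t n (term_fun t \<tau>)) = gen_mat n \<tau>"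
    (is "block_fmat n t t (?D * ?T) = _")
proof (rule fmat_eqI)
  fix x z :: "'d dindex \<times> nat"
  obtain i \<gamma> k \<delta> where xz: "x = (i, \<gamma>)" "z = (k, \<delta>)" by (metis surj_pair)
  let ?S = "{1..n} \<times> {..<t}"
  have D: "entry (block_fmat n t t ?D) x y = (if x = y \<and> x \<in> ?S then a (grid n (fst x)) else 0)" for y
    unfolding diag_sampling_def xz
    by (cases y) (auto simp: entry_block_fmat_block_mat[OF n] grid_def)
  have T: "entry (block_fmat n t t ?T) x z = (if x \<in> ?S \<and> z \<in> ?S \<and> i - k = j \<and> \<gamma> = \<alpha> \<and> \<delta> = \<beta> then 1 else 0)"
    unfolding toeplitz_def xz \<tau>(1)
    by (auto simp: entry_block_fmat_block_mat[OF n] fourier_coeff_term_fun unit_mat_entry_def)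
  have "block_fmat n t t (?D * ?T) = block_fmat n t t ?D * block_fmat n t t ?T"
    unfolding diag_sampling_def toeplitz_def
    by (rule fmat_of_mult[OF block_mat_carrier block_mat_carrier]) (simp_all only: inj_block_enum[OF n])
  moreover have "fsupp (block_fmat n t t ?D) \<subseteq> ?S"
  proof -
    have "entry (block_fmat n t t ?D) u v = 0" if "u \<notin> ?S \<or> v \<notin> ?S" for u v
      using entry_fmat_of_0[OF block_mat_carrier, of u "block_enum n t" n t v "block_enum n t" t] that
      unfolding diag_sampling_def block_enum_image[OF n] by blast
    then show ?thesis unfolding fsupp_def by blast
  qed
  ultimately have "entry (block_fmat n t t (?D * ?T)) x z = (\<Sum>y\<in>?S. entry (block_fmat n t t ?D) x y * entry (block_fmat n t t ?T) y z)"
    by (simp only: entry_times[of ?S] finite_cartesian_product finite_dindex_range finite_lessThan simp_thms)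
  also have "\<dots> = (\<Sum>y\<in>?S. if x = y then a (grid n (fst x)) * entry (block_fmat n t t ?T) x z else 0)"
    unfolding D by (intro sum.cong refl) (auto simp del: atLeastAtMost_iff)
  also have "\<dots> = (if x \<in> ?S then a (grid n (fst x)) * entry (block_fmat n t t ?T) x z else 0)"
    by (subst sum.delta') (simp_all del: atLeastAtMost_iff)
  also have "\<dots> = entry (gen_mat n \<tau>) x z"
    unfolding T unfolding xz \<tau>(1) entry_gen_mat using \<tau>(2,3) by (auto simp del: atLeastAtMost_iff)
  finally show "entry (block_fmat n t t (?D * ?T)) x z = entry (gen_mat n \<tau>) x z" .
qed

lemma seq_mat_eq_mat_sum:
  fixes n :: "('d::{finite,linorder}) dindex"
  assumes n: "1 \<le> n" and ts: "seq_ok t ts"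
  shows "block_fmat n t t (mat_sum (level_size n * t) (level_size n * t)
      (\<lambda>i. diag_sampling t t n (\<lambda>x. fst (ts ! i) x \<cdot>\<^sub>m 1\<^sub>m t) * toeplitz t t n (term_fun t (ts ! i))) (length ts)) = seq_mat ts n"
proof -
  have "block_fmat n t t (diag_sampling t t n (\<lambda>x. fst (ts ! i) x \<cdot>\<^sub>m 1\<^sub>m t) * toeplitz t t n (term_fun t (ts ! i))) = gen_mat n (ts ! i)"
    if "i < length ts" for i
  proof -
    obtain a j \<alpha> \<beta> where \<tau>: "ts ! i = (a, j, \<alpha>, \<beta>)" by (metis prod_cases4)
    then have "\<alpha> < t" "\<beta> < t" using ts that unfolding seq_ok_def by (metis (mono_tags, lifting) nth_mem case_prod_conv)+
    from block_fmat_gen_mat[OF n \<tau> this] show ?thesis by (simp add: \<tau>)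
  qed
  then have "(\<Sum>i<length ts. block_fmat n t t (diag_sampling t t n (\<lambda>x. fst (ts ! i) x \<cdot>\<^sub>m 1\<^sub>m t) * toeplitz t t n (term_fun t (ts ! i)))) = seq_mat ts n"
    by (simp add: seq_mat_def sum_list_sum_nth atLeast0LessThan)
  moreover have "diag_sampling t t n (\<lambda>x. fst (ts ! i) x \<cdot>\<^sub>m 1\<^sub>m t) * toeplitz t t n (term_fun t (ts ! i))
      \<in> carrier_mat (level_size n * t) (level_size n * t)" for i
    unfolding diag_sampling_def toeplitz_def by (rule mult_carrier_mat[OF block_mat_carrier block_mat_carrier])
  ultimately show ?thesis by (subst block_fmat_mat_sum[OF n])
qed

lemma entry_seq_sym_eq_mat_sum:
  assumes "p < t" "q < t"
  shows "mat_sum t t (\<lambda>i. fst (ts ! i) (fst z) \<cdot>\<^sub>m term_fun t (ts ! i) (snd z)) (length ts) $$ (p, q) = entry (seq_sym ts z) p q"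
proof -
  have "(fst (ts ! i) (fst z) \<cdot>\<^sub>m term_fun t (ts ! i) (snd z)) $$ (p, q) = entry (gen_sym (ts ! i) z) p q" for i
    using assms by (cases "ts ! i" rule: prod_cases4)
      (auto simp: term_fun_def entry_gen_sym unit_mat_entry_def cis_conv_exp)
  then show ?thesis
    using assms by (simp add: mat_sum_def seq_sym_def entry_sum_list sum_list_sum_nth atLeast0LessThan)
qed

lemma mat_sum_cong: "(\<And>i. i < N \<Longrightarrow> X i = Y i) \<Longrightarrow> mat_sum r s X N = mat_sum r s Y N"
  by (simp add: mat_sum_def)

section \<open>The defining relations along an index set\<close>

locale block_mat_sequences = fmat_sequences "inf sequentially (principal J)" \<nu> t
  for J :: "nat set" and \<nu> :: "nat \<Rightarrow> ('d::{finite,linorder}) dindex" and t :: nat +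
  assumes ge_1: "\<And>n. n \<in> J \<Longrightarrow> 1 \<le> \<nu> n"

lemma block_mat_sequencesI:
  assumes "block_mat_seq J \<nu> r s A" "1 \<le> t"
  shows "block_mat_sequences J \<nu> t"
proof
  have "\<forall>\<^sub>F n in inf sequentially (principal J). P (\<nu> n)" if P: "eventually P at_top_dindex" for P
  proof -
    obtain K where K: "\<forall>n. (\<forall>k. K \<le> n $ k) \<longrightarrow> P n" using P unfolding eventually_at_top_dindex by blast
    obtain n0 where "\<forall>n\<in>J. n0 \<le> n \<longrightarrow> (\<forall>k. K \<le> \<nu> n $ k)"
      using assms(1) unfolding block_mat_seq_def by blast
    with K show ?thesis unfolding eventually_inf_principal eventually_sequentially by blast
  qed
  then show "filterlim \<nu> at_top_dindex (inf sequentially (principal J))" unfolding filterlim_iff by blast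
qed (use assms in \<open>simp_all add: block_mat_seq_def\<close>)

lemma eventually_seq_filter: "(\<And>n. n \<in> J \<Longrightarrow> P n) \<Longrightarrow> \<forall>\<^sub>F n in inf sequentially (principal J). P n"
  by (simp add: eventually_inf_principal)

context block_mat_sequences
begin

abbreviation "size_t n \<equiv> level_size (\<nu> n) * t"

lemma inj_enum: "n \<in> J \<Longrightarrow> inj_on (block_enum (\<nu> n) t) {..<size_t n}"
  by (rule inj_block_enum[OF ge_1])

lemma acs_convergentD:
  assumes acs: "acs_convergent J B A" and A: "\<And>n. n \<in> J \<Longrightarrow> A n \<in> carrier_mat (size_t n) (size_t n)"
  shows "acs_null (\<lambda>m n. block_fmat (\<nu> n) t t (A n) - block_fmat (\<nu> n) t t (B m n))"
  unfolding acs_null_def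
proof (intro allI impI)
  fix \<epsilon> :: real assume \<epsilon>: "0 < \<epsilon>"
  from acs obtain n0 c \<omega> where c: "c \<longlonglongrightarrow> 0" and \<omega>: "\<omega> \<longlonglongrightarrow> 0"
    and dec: "\<forall>m. \<forall>n\<in>J. n0 m \<le> n \<longrightarrow> B m n \<in> carrier_mat (dim_row (A n)) (dim_col (A n)) \<and>
          (\<exists>R N. R \<in> carrier_mat (dim_row (A n)) (dim_col (A n)) \<and>
                 N \<in> carrier_mat (dim_row (A n)) (dim_col (A n)) \<and> A n = B m n + R + N \<and>
                 real (mat_rank R) \<le> c m * real (min (dim_row (A n)) (dim_col (A n))) \<and>
                 spectral_norm N \<le> \<omega> m)"
    unfolding acs_convergent_def by blast
  \<comment> \<open>Ranks are measured against the matrix size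
    \<open>level_size (\<nu> n) * t\<close> in \<open>acs_convergent\<close>, but against
    \<open>level_size (\<nu> n)\<close> in \<open>acs_null\<close>.\<close>
  have "0 < \<epsilon> / real t" using \<epsilon> t_pos by simp
  then have "\<forall>\<^sub>F m in sequentially. c m < \<epsilon> / real t \<and> \<omega> m < \<epsilon>"
    using order_tendstoD(2)[OF c] order_tendstoD(2)[OF \<omega>] \<epsilon> by (simp add: eventually_conj)
  then show "\<forall>\<^sub>F m in sequentially. \<forall>\<^sub>F n in inf sequentially (principal J).
      dcmp (\<epsilon> * real (level_size (\<nu> n))) \<epsilon> (block_fmat (\<nu> n) t t (A n) - block_fmat (\<nu> n) t t (B m n))"
  proof eventually_elim
    case (elim m)
    have "dcmp (\<epsilon> * real (level_size (\<nu> n))) \<epsilon> (block_fmat (\<nu> n) t t (A n) - block_fmat (\<nu> n) t t (B m n))"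
      if n: "n \<in> J" "n0 m \<le> n" for n
    proof -
      note inj = inj_enum[OF n(1)]
      have dim: "dim_row (A n) = size_t n" "dim_col (A n) = size_t n" using A[OF n(1)] by auto
      obtain R N where B: "B m n \<in> carrier_mat (size_t n) (size_t n)" and R: "R \<in> carrier_mat (size_t n) (size_t n)"
        and N: "N \<in> carrier_mat (size_t n) (size_t n)" and eq: "A n = B m n + R + N"
        and rank: "real (mat_rank R) \<le> c m * real (min (size_t n) (size_t n))" and norm: "spectral_norm N \<le> \<omega> m"
        using dec[rule_format, OF n] unfolding dim by blast
      have "block_fmat (\<nu> n) t t (A n) = block_fmat (\<nu> n) t t (B m n) + block_fmat (\<nu> n) t t R + block_fmat (\<nu> n) t t N"
        unfolding eq by (simp only: fmat_of_add[OF add_carrier_mat[OF R] N inj inj] fmat_of_add[OF B R inj inj])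
      then have "block_fmat (\<nu> n) t t (A n) - block_fmat (\<nu> n) t t (B m n) = block_fmat (\<nu> n) t t R + block_fmat (\<nu> n) t t N"
        by simp
      then show ?thesis
      proof (rule dcmpI)
        show "lr (mat_rank R) (block_fmat (\<nu> n) t t R)" by (rule lr_mat_rank[OF R inj inj])
        show "opb \<epsilon> (block_fmat (\<nu> n) t t N)"
          by (rule opb_fmat_of[OF N inj inj]) (use norm elim in simp)
        have "c m * real (min (size_t n) (size_t n)) \<le> \<epsilon> / real t * real (size_t n)"
          using elim by (simp only: min.idem) (intro mult_right_mono, auto)
        also have "\<dots> = \<epsilon> * real (level_size (\<nu> n))" using t_pos by simp
        finally show "real (mat_rank R) \<le> \<epsilon> * real (level_size (\<nu> n))" using rank by linarith
      qed
    qed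
    then show ?case unfolding eventually_inf_principal eventually_sequentially by blast
  qed
qed

text \<open>
  The sequences \<open>c\<close> and \<open>\<omega>\<close> must be defined for all \<open>m\<close>: for small \<open>m\<close> the trivial splitting
  \<open>R = A - B\<close>, \<open>N = 0\<close> is used, later the best of the first \<open>m\<close> tolerances that is already reached.
\<close>

lemma acs_convergentI:
  assumes null: "acs_null (\<lambda>m n. block_fmat (\<nu> n) t t (A n) - block_fmat (\<nu> n) t t (B m n))"
    and A: "\<And>n. n \<in> J \<Longrightarrow> A n \<in> carrier_mat (size_t n) (size_t n)"
    and B: "\<And>m n. n \<in> J \<Longrightarrow> B m n \<in> carrier_mat (size_t n) (size_t n)"
  shows "acs_convergent J B A"
proof -
  let ?X = "\<lambda>m n. block_fmat (\<nu> n) t t (A n) - block_fmat (\<nu> n) t t (B m n)"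
  let ?e = "\<lambda>k. inverse (real (Suc k))"
  define G where "G k m \<longleftrightarrow> (\<forall>\<^sub>F n in inf sequentially (principal J). dcmp (?e k * real (size_t n)) (?e k) (?X m n))" for k m
  have supp: "idm ({1..\<nu> n} \<times> {..<t}) * ?X m n = ?X m n" "?X m n * idm ({1..\<nu> n} \<times> {..<t}) = ?X m n" if n: "n \<in> J" for m n
    using idm_mult_fmat_of[OF A[OF n] inj_enum[OF n] inj_enum[OF n]] idm_mult_fmat_of[OF B[OF n] inj_enum[OF n] inj_enum[OF n]]
    by (simp_all only: block_enum_image[OF ge_1[OF n]] right_diff_distrib left_diff_distrib)
  have G0: "G 0 m" for m
    unfolding G_def
  proof (rule eventually_seq_filter)
    fix n assume n: "n \<in> J"
    have "lr (card ({1..\<nu> n} \<times> {..<t})) (idm ({1..\<nu> n} \<times> {..<t}) * ?X m n)"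
      by (intro lr_mult_right lr_idm finite_cartesian_product finite_dindex_range finite_lessThan)
    then have "lr (size_t n) (?X m n)"
      by (simp only: supp(1)[OF n] card_cartesian_product card_dindex_range[OF ge_1[OF n]] card_lessThan)
    then have "dcmp (?e 0 * real (size_t n)) 0 (?X m n)" by (rule dcmp_lr) simp
    then show "dcmp (?e 0 * real (size_t n)) (?e 0) (?X m n)" by (rule dcmp_mono) simp_all
  qed
  have G: "\<forall>\<^sub>F m in sequentially. G k m" for k
  proof -
    have "0 < ?e k" by simp
    with null have "\<forall>\<^sub>F m in sequentially. \<forall>\<^sub>F n in inf sequentially (principal J).
        dcmp (?e k * real (level_size (\<nu> n))) (?e k) (?X m n)" unfolding acs_null_def by blast
    moreover have "?e k * real (level_size (\<nu> n)) \<le> ?e k * real (size_t n)" for n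
    proof (intro mult_left_mono of_nat_mono)
      show "level_size (\<nu> n) \<le> size_t n" using t_pos by simp
    qed simp
    ultimately show ?thesis unfolding G_def by (elim eventually_mono) (erule dcmp_mono, auto)
  qed
  define K where "K m = Max {k. k \<le> m \<and> G k m}" for m
  have fin: "finite {k. k \<le> m \<and> G k m}" "{k. k \<le> m \<and> G k m} \<noteq> {}" for m using G0 by auto
  have GK: "G (K m) m" for m using Max_in[OF fin] unfolding K_def by blast
  have "\<forall>\<^sub>F m in sequentially. k \<le> K m" for k
    using G[of k] eventually_ge_at_top[of k]
    by eventually_elim (unfold K_def, rule Max_ge[OF fin(1)], simp)
  then have "filterlim K at_top sequentially" unfolding filterlim_at_top by blast
  then have lim: "(\<lambda>m. ?e (K m)) \<longlonglongrightarrow> 0"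
    by (rule filterlim_compose[OF LIMSEQ_inverse_real_of_nat])
  have "\<forall>m. \<exists>n0. \<forall>n\<ge>n0. n \<in> J \<longrightarrow> dcmp (?e (K m) * real (size_t n)) (?e (K m)) (?X m n)"
    using GK unfolding G_def eventually_inf_principal eventually_sequentially by blast
  from choice[OF this] obtain n0 where
    n0: "\<forall>m. \<forall>n\<ge>n0 m. n \<in> J \<longrightarrow> dcmp (?e (K m) * real (size_t n)) (?e (K m)) (?X m n)" ..
  show ?thesis
    unfolding acs_convergent_def
  proof (intro exI[of _ n0] exI[of _ "\<lambda>m. ?e (K m)"] conjI allI ballI impI lim)
    fix m n assume n: "n \<in> J" "n0 m \<le> n"
    note inj = inj_enum[OF n(1)]
    have dim: "dim_row (A n) = size_t n" "dim_col (A n) = size_t n" using A[OF n(1)] by auto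
    show "B m n \<in> carrier_mat (dim_row (A n)) (dim_col (A n))" unfolding dim by (rule B[OF n(1)])
    from n0 n have "dcmp (?e (K m) * real (size_t n)) (?e (K m)) (?X m n)" by blast
    then obtain k L P where P: "?X m n = L + P" "lr k L" "real k \<le> ?e (K m) * real (size_t n)" "opb (?e (K m)) P"
      by (rule dcmpE)
    \<comment> \<open>\<open>L\<close> and \<open>P\<close> may have entries outside the labels of
      the matrix. Cutting both by the local unit raises neither rank nor norm and leaves their sum
      unchanged.\<close>
    let ?M = "mat_of_fmat (block_enum (\<nu> n) t) (block_enum (\<nu> n) t) (size_t n) (size_t n)"
    let ?I = "idm ({1..\<nu> n} \<times> {..<t})"
    have M: "block_fmat (\<nu> n) t t (?M Y) = ?I * Y * ?I" for Y
      by (simp only: fmat_of_mat_of_fmat[OF inj inj] block_enum_image[OF ge_1[OF n(1)]])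
    have "block_fmat (\<nu> n) t t (B m n + ?M L + ?M P) = block_fmat (\<nu> n) t t (B m n) + ?I * (L + P) * ?I"
      by (simp only: fmat_of_add[OF add_carrier_mat[OF mat_of_fmat_carrier] mat_of_fmat_carrier inj inj]
          fmat_of_add[OF B[OF n(1)] mat_of_fmat_carrier inj inj] M distrib_left distrib_right add.assoc)
    also have "\<dots> = block_fmat (\<nu> n) t t (A n)"
      unfolding P(1)[symmetric] supp[OF n(1)] by simp
    finally have eq: "A n = B m n + ?M L + ?M P"
      by (intro fmat_of_inject[OF A[OF n(1)] add_carrier_mat[OF mat_of_fmat_carrier] inj inj]) (rule sym)
    have "mat_rank (?M L) \<le> k" by (rule mat_rank_le_lr[OF P(2)])
    then have "real (mat_rank (?M L)) \<le> real k" by (rule of_nat_mono)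
    then have rank: "real (mat_rank (?M L)) \<le> ?e (K m) * real (min (dim_row (A n)) (dim_col (A n)))"
      using P(3) unfolding dim min.idem by (rule order_trans)
    have I: "opb 1 ?I"
      by (rule opb_projection) (simp_all add: mult_idm fsupp_idm)
    have "opb (1 * ?e (K m) * 1) (?I * P * ?I)" by (intro opb_mult I P(4))
    then have norm: "spectral_norm (?M P) \<le> ?e (K m)"
      by (intro spectral_norm_le[OF mat_of_fmat_carrier inj inj]) (simp only: M mult_1_left mult_1_right)
    show "\<exists>R N. R \<in> carrier_mat (dim_row (A n)) (dim_col (A n)) \<and> N \<in> carrier_mat (dim_row (A n)) (dim_col (A n)) \<and>
        A n = B m n + R + N \<and> real (mat_rank R) \<le> ?e (K m) * real (min (dim_row (A n)) (dim_col (A n))) \<and>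
        spectral_norm N \<le> ?e (K m)"
      by (intro exI[of _ "?M L"] exI[of _ "?M P"] conjI eq rank norm) (simp_all only: dim mat_of_fmat_carrier)
  qed
qed

lemma block_fmat_cong_acs_null:
  assumes "acs_null (\<lambda>m n. X n - Y m n)" "\<And>n. n \<in> J \<Longrightarrow> X n = X' n" "\<And>m n. n \<in> J \<Longrightarrow> Y m n = Y' m n"
  shows "acs_null (\<lambda>m n. X' n - Y' m n)"
  using assms(1) by (rule acs_null_cong) (rule eventually_seq_filter, simp add: assms(2,3))

lemma glt_square_rep:
  assumes "glt_square J \<nu> t A \<kappa>"
  shows "glt_rep (\<lambda>m n. block_fmat (\<nu> n) t t (A n)) (\<lambda>z. fmat_of id id (\<kappa> z))"
proof -
  have A: "A n \<in> carrier_mat (size_t n) (size_t n)" if "n \<in> J" for n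
    using assms that by (simp add: glt_square_def block_mat_seq_def)
  have \<kappa>: "\<kappa> z \<in> carrier_mat t t" if "z \<in> glt_domain" for z
    using assms that by (simp add: glt_square_def measurable_symbol_def)
  obtain N a f where af: "\<forall>m. \<forall>i<N m. smooth_on_unit_cube (a i m) \<and> f i m \<in> trig_monomials t"
    and lim: "AE z in lebesgue_on glt_domain. \<forall>\<alpha><t. \<forall>\<beta><t.
           (\<lambda>m. mat_sum t t (\<lambda>i. a i m (fst z) \<cdot>\<^sub>m f i m (snd z)) (N m) $$ (\<alpha>, \<beta>)) \<longlonglongrightarrow> \<kappa> z $$ (\<alpha>, \<beta>)"
    and acs: "acs_convergent J (\<lambda>m n. mat_sum (size_t n) (size_t n)
             (\<lambda>i. diag_sampling t t (\<nu> n) (\<lambda>x. a i m x \<cdot>\<^sub>m 1\<^sub>m t) * toeplitz t t (\<nu> n) (f i m)) (N m)) A"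
    using assms unfolding glt_square_def by (elim conjE exE) (rule that)
  have "\<exists>\<tau>. fst \<tau> = a i m \<and> term_fun t \<tau> = f i m \<and> seq_ok t [\<tau>]" if i: "i < N m" for i m
  proof -
    from af i have a: "smooth_on_unit_cube (a i m)" and f: "f i m \<in> trig_monomials t" by blast+
    from f obtain j \<alpha> \<beta> where f: "f i m = (\<lambda>\<theta>. exp (\<i> * complex_of_real (phase j \<theta>)) \<cdot>\<^sub>m unit_mat_entry t \<alpha> \<beta>)" "\<alpha> < t" "\<beta> < t"
      unfolding trig_monomials_def by blast
    from a obtain g where g: "\<forall>m. Ck m g" "\<forall>x\<in>cbox 0 1. a i m x = g x" unfolding smooth_on_unit_cube_def by blast
    have "continuous_on UNIV g" using g(1)[rule_format, of 0] by simp
    then have "continuous_on (cbox 0 1) g" by (rule continuous_on_subset) simp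
    then have "continuous_on (cbox 0 1) (a i m)" using g(2) by (simp cong: continuous_on_cong)
    with f show ?thesis by (intro exI[of _ "(a i m, j, \<alpha>, \<beta>)"]) (simp add: term_fun_def)
  qed
  then have "\<exists>\<tau>. i < N m \<longrightarrow> fst \<tau> = a i m \<and> term_fun t \<tau> = f i m \<and> seq_ok t [\<tau>]" for i m by blast
  then have "\<forall>m. \<exists>\<tau>. \<forall>i. i < N m \<longrightarrow> fst (\<tau> i) = a i m \<and> term_fun t (\<tau> i) = f i m \<and> seq_ok t [\<tau> i]"
    by (intro allI choice)
  from choice[OF this] obtain \<tau> where
    \<tau>: "\<forall>m i. i < N m \<longrightarrow> fst (\<tau> m i) = a i m \<and> term_fun t (\<tau> m i) = f i m \<and> seq_ok t [\<tau> m i]" ..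
  define ts where "ts m = map (\<tau> m) [0..<N m]" for m
  have ts: "length (ts m) = N m" "i < N m \<Longrightarrow> ts m ! i = \<tau> m i" for m i by (simp_all add: ts_def)
  have ok: "seq_ok t (ts m)" for m
    using \<tau> unfolding ts_def seq_ok_def by fastforce
  have sum: "mat_sum p p (\<lambda>i. X (a i m) (f i m)) (N m) = mat_sum p p (\<lambda>i. X (fst (ts m ! i)) (term_fun t (ts m ! i))) (length (ts m))" for p X m
    unfolding ts(1) by (rule mat_sum_cong) (use \<tau> in \<open>simp add: ts(2)\<close>)
  show ?thesis
  proof (rule glt_repI[OF ok])
    show "AE z in lborel. z \<in> glt_domain \<longrightarrow> (\<lambda>m. seq_sym (ts m) z) \<longlonglongrightarrow> fmat_of id id (\<kappa> z)"
      using lim unfolding AE_lebesgue_on_glt_domain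
    proof eventually_elim
      case (elim z)
      show ?case
      proof
        assume z: "z \<in> glt_domain"
        show "(\<lambda>m. seq_sym (ts m) z) \<longlonglongrightarrow> fmat_of id id (\<kappa> z)"
        proof (rule tendsto_fmatI[of "{..<t}"])
          show "fsupp (fmat_of id id (\<kappa> z)) \<subseteq> {..<t}" by (rule fsupp_fmat_of_id[OF \<kappa>[OF z]]) simp
          fix p q assume pq: "p \<in> {..<t}" "q \<in> {..<t}"
          then have "(\<lambda>m. mat_sum t t (\<lambda>i. a i m (fst z) \<cdot>\<^sub>m f i m (snd z)) (N m) $$ (p, q)) \<longlonglongrightarrow> \<kappa> z $$ (p, q)"
            using elim z by simp
          then have "(\<lambda>m. entry (seq_sym (ts m) z) p q) \<longlonglongrightarrow> \<kappa> z $$ (p, q)"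
            using pq unfolding sum[of t "\<lambda>a f. a (fst z) \<cdot>\<^sub>m f (snd z)"] by (simp add: entry_seq_sym_eq_mat_sum)
          then show "(\<lambda>m. entry (seq_sym (ts m) z) p q) \<longlonglongrightarrow> entry (fmat_of id id (\<kappa> z)) p q"
            using pq by (simp add: entry_fmat_of_id[OF \<kappa>[OF z]])
        qed (simp_all add: fsupp_seq_sym[OF ok])
      qed
    qed
    show "acs_null (\<lambda>m n. block_fmat (\<nu> n) t t (A n) - seq_mat (ts m) (\<nu> n))"
    proof (rule block_fmat_cong_acs_null[OF acs_convergentD[OF acs A]])
      fix m n assume "n \<in> J"
      show "block_fmat (\<nu> n) t t (mat_sum (size_t n) (size_t n)
             (\<lambda>i. diag_sampling t t (\<nu> n) (\<lambda>x. a i m x \<cdot>\<^sub>m 1\<^sub>m t) * toeplitz t t (\<nu> n) (f i m)) (N m)) = seq_mat (ts m) (\<nu> n)"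
        unfolding sum[of "size_t n" "\<lambda>a f. diag_sampling t t (\<nu> n) (\<lambda>x. a x \<cdot>\<^sub>m 1\<^sub>m t) * toeplitz t t (\<nu> n) f"]
        by (rule seq_mat_eq_mat_sum[OF ge_1[OF \<open>n \<in> J\<close>] ok])
    qed simp_all
  qed
qed

text \<open>In contrast to \<open>glt_square_rep\<close>, which only retains continuity, the
  approximating lists must be smooth here, because the definition asks for smooth
  coefficients.\<close>

lemma glt_squareI:
  assumes seq: "block_mat_seq J \<nu> t t A" and meas: "measurable_symbol t t \<kappa>"
    and ts: "\<And>m. seq_smooth t (ts m)"
    and lim: "AE z in lborel. z \<in> glt_domain \<longrightarrow> (\<forall>\<alpha><t. \<forall>\<beta><t. (\<lambda>m. entry (seq_sym (ts m) z) \<alpha> \<beta>) \<longlonglongrightarrow> \<kappa> z $$ (\<alpha>, \<beta>))"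
    and null: "acs_null (\<lambda>m n. block_fmat (\<nu> n) t t (A n) - seq_mat (ts m) (\<nu> n))"
  shows "glt_square J \<nu> t A \<kappa>"
proof -
  have A: "A n \<in> carrier_mat (size_t n) (size_t n)" if "n \<in> J" for n
    using seq that by (simp add: block_mat_seq_def)
  note ok = seq_smooth_ok[OF ts]
  show ?thesis
    unfolding glt_square_def
  proof (intro conjI exI[of _ "\<lambda>m. length (ts m)"] exI[of _ "\<lambda>i m. fst (ts m ! i)"] exI[of _ "\<lambda>i m. term_fun t (ts m ! i)"])
    show "\<forall>m. \<forall>i<length (ts m). smooth_on_unit_cube (fst (ts m ! i)) \<and> term_fun t (ts m ! i) \<in> trig_monomials t"
    proof (intro allI impI)
      fix m i assume i: "i < length (ts m)"
      obtain a j \<alpha> \<beta> where \<tau>: "ts m ! i = (a, j, \<alpha>, \<beta>)" by (metis prod_cases4)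
      have "(a, j, \<alpha>, \<beta>) \<in> set (ts m)" using i unfolding \<tau>[symmetric] by (rule nth_mem)
      then have s: "\<forall>m. Ck m a" "\<alpha> < t" "\<beta> < t" using ts[of m] unfolding seq_smooth_def by auto
      have "term_fun t (ts m ! i) \<in> trig_monomials t"
        unfolding trig_monomials_def \<tau> using s(2,3) by (auto simp: term_fun_def)
      moreover have "smooth_on_unit_cube (fst (ts m ! i))"
        unfolding smooth_on_unit_cube_def \<tau> using s(1) by auto
      ultimately show "smooth_on_unit_cube (fst (ts m ! i)) \<and> term_fun t (ts m ! i) \<in> trig_monomials t" by blast
    qed
    show "AE z in lebesgue_on glt_domain. \<forall>\<alpha><t. \<forall>\<beta><t.
        (\<lambda>m. mat_sum t t (\<lambda>i. fst (ts m ! i) (fst z) \<cdot>\<^sub>m term_fun t (ts m ! i) (snd z)) (length (ts m)) $$ (\<alpha>, \<beta>))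
          \<longlonglongrightarrow> \<kappa> z $$ (\<alpha>, \<beta>)"
      unfolding AE_lebesgue_on_glt_domain
      using lim by eventually_elim (simp add: entry_seq_sym_eq_mat_sum)
    show "acs_convergent J (\<lambda>m n. mat_sum (size_t n) (size_t n)
        (\<lambda>i. diag_sampling t t (\<nu> n) (\<lambda>x. fst (ts m ! i) x \<cdot>\<^sub>m 1\<^sub>m t) * toeplitz t t (\<nu> n) (term_fun t (ts m ! i))) (length (ts m))) A"
    proof (rule acs_convergentI)
      show "acs_null (\<lambda>m n. block_fmat (\<nu> n) t t (A n) - block_fmat (\<nu> n) t t (mat_sum (size_t n) (size_t n)
        (\<lambda>i. diag_sampling t t (\<nu> n) (\<lambda>x. fst (ts m ! i) x \<cdot>\<^sub>m 1\<^sub>m t) * toeplitz t t (\<nu> n) (term_fun t (ts m ! i))) (length (ts m))))"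
        by (rule block_fmat_cong_acs_null[OF null]) (simp_all add: seq_mat_eq_mat_sum[OF ge_1 ok])
    qed (simp_all add: A)
  qed (rule seq meas)+
qed

end

lemma block_mat_seq_pinv:
  assumes "block_mat_seq J \<nu> r s A"
  shows "block_mat_seq J \<nu> s r (\<lambda>n. pinv (A n))"
  using assms pinv_props(1) unfolding block_mat_seq_def by blast

lemma block_mat_seq_ext_block_mat:
  assumes "block_mat_seq J \<nu> r s A"
  shows "block_mat_seq J \<nu> t t (\<lambda>n. ext_block_mat (\<nu> n) r s t (A n))"
  using assms block_mat_carrier unfolding block_mat_seq_def ext_block_mat_def by blast

theorem theorem4p6:
  fixes J :: "nat set"
    and \<nu> :: "nat \<Rightarrow> ('d::{finite,linorder}) dindex"
    and r s :: nat
    and A :: "nat \<Rightarrow> complex mat"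
    and \<kappa> :: "'d point \<times> 'd point \<Rightarrow> complex mat"
  assumes "1 \<le> r" and "1 \<le> s"
    and "glt J \<nu> r s A \<kappa>"
    and "AE z in lebesgue_on glt_domain. mat_rank (\<kappa> z) = min r s"
  shows "glt J \<nu> s r (\<lambda>n. pinv (A n)) (\<lambda>z. pinv (\<kappa> z))"
proof -
  have seq: "block_mat_seq J \<nu> r s A" and \<kappa>: "measurable_symbol r s \<kappa>"
    and sq: "\<And>t. max r s \<le> t \<Longrightarrow> glt_square J \<nu> t (\<lambda>n. ext_block_mat (\<nu> n) r s t (A n)) (\<lambda>z. ext_mat t (\<kappa> z))"
    using assms(3) unfolding glt_def by blast+
  note seq' = block_mat_seq_pinv[OF seq] and \<kappa>' = measurable_symbol_pinv[OF \<kappa>]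
  have A: "A n \<in> carrier_mat (level_size (\<nu> n) * r) (level_size (\<nu> n) * s)" if "n \<in> J" for n
    using seq that by (simp add: block_mat_seq_def)
  have \<kappa>_car: "\<kappa> z \<in> carrier_mat r s" if "z \<in> glt_domain" for z
    using \<kappa> that by (simp add: measurable_symbol_def)
  have square: "glt_square J \<nu> t (\<lambda>n. ext_block_mat (\<nu> n) s r t (pinv (A n))) (\<lambda>z. ext_mat t (pinv (\<kappa> z)))"
    if "max s r \<le> t" for t
  proof -
    have t: "max r s \<le> t" "r \<le> t" "s \<le> t" "1 \<le> t" using that assms(1) by auto
    interpret block_mat_sequences J \<nu> t by (rule block_mat_sequencesI[OF seq t(4)])
    note inj = inj_block_enum[OF ge_1]
    \<comment> \<open>Both are formed from the rectangular matrices, and extension by zeros gives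
      the same elements. So the pseudoinverse of an extension never has to be compared with the
      extension of the pseudoinverse.\<close>
    define X where "X n = block_fmat (\<nu> n) r s (A n)" for n
    define Y where "Y n = block_fmat (\<nu> n) s r (pinv (A n))" for n
    have X: "glt_rep (\<lambda>m. X) (\<lambda>z. fmat_of id id (\<kappa> z))"
    proof (rule glt_rep_cong_AE)
      from glt_square_rep[OF sq[OF t(1)]] obtain ts where ts: "\<And>m. seq_ok t (ts m)"
        "AE z in lborel. z \<in> glt_domain \<longrightarrow> (\<lambda>m. seq_sym (ts m) z) \<longlonglongrightarrow> fmat_of id id (ext_mat t (\<kappa> z))"
        "acs_null (\<lambda>m n. block_fmat (\<nu> n) t t (ext_block_mat (\<nu> n) r s t (A n)) - seq_mat (ts m) (\<nu> n))"
        by (rule glt_repE) blast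
      from ts(1,2) show "glt_rep (\<lambda>m. X) (\<lambda>z. fmat_of id id (ext_mat t (\<kappa> z)))"
      proof (rule glt_repI)
        show "acs_null (\<lambda>m n. X n - seq_mat (ts m) (\<nu> n))"
          by (rule block_fmat_cong_acs_null[OF ts(3)]) (simp_all add: X_def block_fmat_ext_block_mat[OF ge_1 A t(1)])
      qed
      show "AE z in lborel. z \<in> glt_domain \<longrightarrow> fmat_of id id (ext_mat t (\<kappa> z)) = fmat_of id id (\<kappa> z)"
        by (intro AE_I2 impI fmat_of_ext_mat[OF \<kappa>_car t(1)])
    qed
    note \<rho> = measurable_symbol_ext_mat[OF \<kappa>' that]
    have meas: "(\<lambda>z. ext_mat t (pinv (\<kappa> z)) $$ (\<alpha>, \<beta>)) \<in> borel_measurable (lebesgue_on glt_domain)" if "\<alpha> < t" "\<beta> < t" for \<alpha> \<beta>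
      using \<rho> that by (simp add: measurable_symbol_def)
    \<comment> \<open>These lists approximate the desired symbol directly. They play the role of
      \<open>Q\<close> below and at the end witness the GLT relation for the pseudoinverses.\<close>
    obtain ts where ts: "\<And>m. seq_smooth t (ts m)"
      "AE z in lborel. z \<in> glt_domain \<longrightarrow> (\<forall>\<alpha><t. \<forall>\<beta><t.
         (\<lambda>m. entry (seq_sym (ts m) z) \<alpha> \<beta>) \<longlonglongrightarrow> ext_mat t (pinv (\<kappa> z)) $$ (\<alpha>, \<beta>))"
      by (rule seq_sym_dense[where \<rho> = "\<lambda>\<alpha> \<beta> z. ext_mat t (pinv (\<kappa> z)) $$ (\<alpha>, \<beta>)", OF meas]) blast+
    note ok = seq_smooth_ok[OF ts(1)]
    have Q: "glt_rep (\<lambda>m n. seq_mat (ts m) (\<nu> n)) (\<lambda>z. fmat_of id id (pinv (\<kappa> z)))"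
    proof (rule glt_rep_seq_mat[OF ok])
      show "AE z in lborel. z \<in> glt_domain \<longrightarrow> (\<lambda>m. seq_sym (ts m) z) \<longlonglongrightarrow> fmat_of id id (pinv (\<kappa> z))"
        using ts(2)
      proof eventually_elim
        case (elim z)
        show ?case
        proof
          assume z: "z \<in> glt_domain"
          note car = pinv_props(1)[OF \<kappa>_car[OF z]]
          show "(\<lambda>m. seq_sym (ts m) z) \<longlonglongrightarrow> fmat_of id id (pinv (\<kappa> z))"
          proof (rule tendsto_fmatI[of "{..<t}"])
            fix p q assume pq: "p \<in> {..<t}" "q \<in> {..<t}"
            then have "(\<lambda>m. entry (seq_sym (ts m) z) p q) \<longlonglongrightarrow> ext_mat t (pinv (\<kappa> z)) $$ (p, q)"
              using elim z by simp
            moreover have "ext_mat t (pinv (\<kappa> z)) $$ (p, q) = entry (fmat_of id id (pinv (\<kappa> z))) p q"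
              using pq car by (simp add: entry_fmat_of_id[OF car] ext_mat_def)
            ultimately show "(\<lambda>m. entry (seq_sym (ts m) z) p q) \<longlonglongrightarrow> entry (fmat_of id id (pinv (\<kappa> z))) p q" by simp
          qed (simp_all add: fsupp_seq_sym[OF ok] fsupp_fmat_of_id[OF car that])
        qed
      qed
    qed
    have pen: "\<forall>\<^sub>F n in inf sequentially (principal J). penrose (X n) (Y n)"
      unfolding X_def Y_def by (rule eventually_seq_filter) (rule penrose_pinv[OF A inj inj])
    have pen\<kappa>: "penrose (fmat_of id id (\<kappa> z)) (fmat_of id id (pinv (\<kappa> z)) :: nat fmat)" if "z \<in> glt_domain" for z
      by (rule penrose_pinv[OF \<kappa>_car[OF that]]) simp_all
    have rank: "AE z in lborel. z \<in> glt_domain \<longrightarrow> mat_rank (\<kappa> z) = min r s"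
      using assms(4) by (simp only: AE_lebesgue_on_glt_domain)
    \<comment> \<open>Rank \<open>min r s\<close> means full row rank for \<open>r \<le> s\<close>
      and full column rank otherwise; the unit has size \<open>r\<close> or \<open>s\<close>
      accordingly.\<close>
    have "acs_null (\<lambda>m n. Y n - seq_mat (ts m) (\<nu> n))"
    proof (cases "r \<le> s")
      case True
      show ?thesis
      proof (rule acs_null_penrose_row[OF t(2) X Q pen])
        show "\<forall>\<^sub>F n in inf sequentially (principal J). idm ({1..\<nu> n} \<times> {..<r}) * X n = X n"
        proof (rule eventually_seq_filter)
          fix n assume n: "n \<in> J"
          show "idm ({1..\<nu> n} \<times> {..<r}) * X n = X n"
            using idm_mult_fmat_of(1)[OF A[OF n] inj[OF n] inj[OF n]] by (simp only: X_def block_enum_image[OF ge_1[OF n]])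
        qed
        show "AE z in lborel. z \<in> glt_domain \<longrightarrow> penrose (fmat_of id id (\<kappa> z)) (fmat_of id id (pinv (\<kappa> z))) \<and>
            fmat_of id id (\<kappa> z) * fmat_of id id (pinv (\<kappa> z)) = (idm {..<r} :: nat fmat)"
          using rank
        proof eventually_elim
          case (elim z)
          show ?case
          proof (intro impI conjI pen\<kappa>)
            assume z: "z \<in> glt_domain"
            note car = \<kappa>_car[OF z]
            have "\<kappa> z * pinv (\<kappa> z) = 1\<^sub>m r" using elim z True by (intro mult_pinv_full_row_rank[OF car]) simp
            moreover have "fmat_of id id (\<kappa> z * pinv (\<kappa> z)) = fmat_of id id (\<kappa> z) * (fmat_of id id (pinv (\<kappa> z)) :: nat fmat)"
              by (rule fmat_of_mult[OF car pinv_props(1)[OF car]]) simp_all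
            ultimately show "fmat_of id id (\<kappa> z) * fmat_of id id (pinv (\<kappa> z)) = (idm {..<r} :: nat fmat)"
              using fmat_of_one[of id r] by simp
          qed
        qed
      qed
    next
      case False
      show ?thesis
      proof (rule acs_null_penrose_col[OF t(3) X Q pen])
        show "\<forall>\<^sub>F n in inf sequentially (principal J). X n * idm ({1..\<nu> n} \<times> {..<s}) = X n"
        proof (rule eventually_seq_filter)
          fix n assume n: "n \<in> J"
          show "X n * idm ({1..\<nu> n} \<times> {..<s}) = X n"
            using idm_mult_fmat_of(2)[OF A[OF n] inj[OF n] inj[OF n]] by (simp only: X_def block_enum_image[OF ge_1[OF n]])
        qed
        show "AE z in lborel. z \<in> glt_domain \<longrightarrow> penrose (fmat_of id id (\<kappa> z)) (fmat_of id id (pinv (\<kappa> z))) \<and>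
            fmat_of id id (pinv (\<kappa> z)) * fmat_of id id (\<kappa> z) = (idm {..<s} :: nat fmat)"
          using rank
        proof eventually_elim
          case (elim z)
          show ?case
          proof (intro impI conjI pen\<kappa>)
            assume z: "z \<in> glt_domain"
            note car = \<kappa>_car[OF z]
            have "pinv (\<kappa> z) * \<kappa> z = 1\<^sub>m s" using elim z False by (intro pinv_mult_full_col_rank[OF car]) simp
            moreover have "fmat_of id id (pinv (\<kappa> z) * \<kappa> z) = fmat_of id id (pinv (\<kappa> z)) * (fmat_of id id (\<kappa> z) :: nat fmat)"
              by (rule fmat_of_mult[OF pinv_props(1)[OF car] car]) simp_all
            ultimately show "fmat_of id id (pinv (\<kappa> z)) * fmat_of id id (\<kappa> z) = (idm {..<s} :: nat fmat)"
              using fmat_of_one[of id s] by simp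
          qed
        qed
      qed
    qed
    then have "acs_null (\<lambda>m n. block_fmat (\<nu> n) t t (ext_block_mat (\<nu> n) s r t (pinv (A n))) - seq_mat (ts m) (\<nu> n))"
      by (rule block_fmat_cong_acs_null)
        (simp_all add: Y_def block_fmat_ext_block_mat[OF ge_1 pinv_props(1)[OF A] that])
    then show ?thesis
      by (rule glt_squareI[OF block_mat_seq_ext_block_mat[OF seq'] \<rho> ts])
  qed
  show ?thesis unfolding glt_def using seq' \<kappa>' square by blast
qed

end
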